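(* Let $\mathsf{G}$ be an orbifold (a smooth étale proper groupoid representing an orbifold $X$). Then the groupoid $\mathsf{L}\mathsf{G}^{\mathbb R}$, the subgroupoid of the loop groupoid $\mathsf{L}\mathsf{G}$ fixed under the natural $\mathbb{R}$-action, is Morita equivalent to the twisted sectors $\widetilde{\Sigma_1\mathsf{G}}$ of $\mathsf{G}$.
   Context: **Groupoids.** A groupoid $\mathsf{G}$ has objects $\mathsf{G}_0$, arrows $\mathsf{G}_1$, source and target $s,t:\mathsf{G}_1\to\mathsf{G}_0$, composition $m$, inverse $i$, identities $e:\mathsf{G}_0\to\mathsf{G}_1$. Composition is written in diagrammatic order: $a\cdot b$ is defined when $t(a)=s(b)$. It is topological (smooth) if everything is in topological spaces (smooth manifolds, with $s,t$ submersions), étale if $s,t$ are local homeomorphisms (local diffeomorphisms), proper if $(s,t):\mathsf{G}_1\to\mathsf{G}_0\times\mathsf{G}_0$ is proper. A morphism $\Psi:\mathsf{H}\to\mathsf{G}$ is a pair of continuous maps $\Psi_0,\Psi_1$ commuting with the structure maps. It is Morita if the square formed by $\Psi_1$, $\Psi_0\times\Psi_0$ and the two maps $(s,t)$ is cartesian and $s\pi_2:\mathsf{H}_0\,{}_{\Psi_0}\!\times_t\mathsf{G}_1\to\mathsf{G}_0$ is an open surjection. $\mathsf{G},\mathsf{H}$ are Morita equivalent if there are a topological groupoid $\mathsf{K}$ and Morita morphisms $\mathsf{G}\leftarrow\mathsf{K}\to\mathsf{H}$. **Circle groupoids.** For a finite set $q_1<\dots<q_n<q_0$ in $(0,1]$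 (identified with points $e^{2\pi i q_k}$ of $S^1$) and $\epsilon>0$, consider the cover of $S^1$ by the (images of the) intervals $V_i=(q_i-\epsilon,q_{i+1}+\epsilon)$, indices cyclic (so $V_0=(q_0-\epsilon,q_1+1+\epsilon)$). It is admissible if all triple intersections of distinct members are empty; $\mathcal{W}$ is the set of admissible covers. A cover given by $(\{p_k\},\epsilon)$ refines one given by $(\{q_k\},\epsilon')$ if $\epsilon\le\epsilon'$ and $\{q_k\}\subset\{p_k\}$; each set of the finer cover then lies canonically in a set of the coarser. $\mathcal{W}$ is directed under refinement. For $W\in\mathcal{W}$ let $\{W_\beta\}$ be the intervals $V_i+k$ ($k\in\mathbb{Z}$) of $\mathbb{R}$, and $W_\beta^l:=W_\beta+l$. Put $\underline{\mathbb{R}^W}_0=\bigsqcup_\beta W_\beta$, $\underline{\mathbb{R}^W}_1=\bigsqcup_{(\beta,\gamma)}W_\beta\cap W_\gamma$. The groupoid $\mathsf{S}^1_W$ has objects $\underline{\mathbb{R}^W}_0$, arrows $\underline{\mathbb{R}^W}_1\times\mathbb{Z}$, $s((x,W_{\beta\gamma}),l)=(x,W_\beta)$, $t((x,W_{\beta\gamma}),l)=(x+l,W_\gamma^l)$, $e(x,W_\beta)=((x,W_{\beta\beta}),0)$, $((x,W_{\beta\gamma}),l)\cdot((x+l,W^l_{\gamma\sigma}),k)=((x,W_{\beta\sigma}),l+k)$. If $W'$ refines $W$ there is a natural morphism $\rho^{W'}_W:\mathsf{S}^1_{W'}\to\mathsf{S}^1_W$. **Loop groupoid.** $\mathsf{L}\mathsf{G}(W)$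 has as objects the morphisms $\mathsf{S}^1_W\to\mathsf{G}$; an arrow from $\Psi$ to $\Phi$ is a continuous $\Lambda:\underline{\mathbb{R}^W}_1\times\mathbb{Z}\to\mathsf{G}_1$ with $s\Lambda(r)=\Psi_0(s(r))$, $t\Lambda(r)=\Phi_0(t(r))$ and $\Lambda(r)=\Psi_1(r)\cdot\Lambda(et(r))=\Lambda(es(r))\cdot\Phi_1(r)$ for all $r$. Arrows $\Lambda:\Psi\to\Phi$, $\Omega:\Phi\to\Gamma$ compose by $(\Omega\circ\Lambda)(es(r))=\Lambda(es(r))\cdot\Omega(es(r))$, $(\Omega\circ\Lambda)(r)=(\Omega\circ\Lambda)(es(r))\cdot\Gamma_1(r)$. Objects carry the compact-open topology, and arrows the compact-open topology via $\Lambda\mapsto(\Psi_1,\Lambda\circ e)$. Precomposition with $\rho^{W'}_W$ gives monomorphisms $\mathsf{L}\mathsf{G}(W)\hookrightarrow\mathsf{L}\mathsf{G}(W')$, and $\mathsf{L}\mathsf{G}:=\varinjlim_{W\in\mathcal{W}}\mathsf{L}\mathsf{G}(W)$. **$\mathbb{R}$-action.** For $z\in\mathbb{R}$ let $W^z=\{V+z\}$ be the shifted cover; $z$ sends $\Psi:\mathsf{S}^1_W\to\mathsf{G}$ to $\Psi^z:\mathsf{S}^1_{W^z}\to\mathsf{G}$, $\Psi^z_1((x,V^z_{\alpha\beta}),l)=\Psi_1((x-z,V_{\alpha\beta}),l)$, $\Psi_0^z(x,V_\alpha^z)=\Psi_0(x-z,V_\alpha)$, and acts on arrows in the same way. **Twisted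 sectors.** Let $X$ be an orbifold with charts $\{(V_p,G_p,\pi_p)\}_{p\in X}$ ($G_p$ finite, acting on $V_p$ on the right, $V_p/G_p$ homeomorphic to a neighbourhood of $p$). The associated groupoid $\mathsf{X}$ has objects $\bigsqcup_p V_p$ and arrows $(x_1,V_1)\to(x_2,V_2)$ the classes $[\lambda_1,w,\lambda_2]$ where $w$ is a point of a chart $(W,H,\rho)$ and $\lambda_i:W\to V_i$ are equivariant embeddings of charts with $\lambda_i(w)=x_i$, modulo the relation generated by $[\lambda_1\gamma,w',\lambda_2\gamma]=[\lambda_1,\gamma(w'),\lambda_2]$ for embeddings of charts $\gamma$; $\mathsf{G}$ represents $X$ if it is Morita equivalent to $\mathsf{X}$. The twisted sectors $\widetilde{\Sigma_1X}=\widetilde{\Sigma_1\mathsf{G}}$ form the orbifold with underlying set $\{(p,(g)_{G_p}): p\in X,\ g\in G_p\}$ ($(g)_{G_p}$ the conjugacy class of $g$ in $G_p$), given over $V_p/G_p$ by $\bigsqcup_{(g)\subset G_p}V_p^g/C_{G_p}(g)$ with charts $(V_p^g,C_{G_p}(g))$, where $V_p^g$ is the fixed set and $C_{G_p}(g)$ the centralizer. As a groupoid: fix one representative $g$ in each conjugacy class of each $G_p$; the objects are $\bigsqcup_p\bigsqcup_{(g)\subset G_p}V_p^g\times\{g\}$ and arrows $(x,g)\to(y,h)$ are the arrows $r:x\to y$ of $\mathsf{X}$ with $g\cdot r=r\cdot h$ ($g$, $h$ regarded as arrows $x\to x$, $y\to y$), so that over one chart it is $\bigsqcup_{(g)\subset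 G_p}\big(V_p^g\times\{g\}\times C_{G_p}(g)\rightrightarrows V_p^g\times\{g\}\big)$.
   Formalization: Orbifold charts are assumed to have V_p connected and G_p acting effectively; otherwise (e.g. Z/3 acting trivially on a point) the groupoid of classes [λ1,w,λ2] loses group elements and the two descriptions of the twisted sectors disagree. *)

theory Defs
  imports "HOL-Analysis.Analysis" "HOL-Algebra.Group"
begin

section \<open>Topological preliminaries\<close>

definition quotient_top :: "'a topology \<Rightarrow> ('a \<Rightarrow> 'b) \<Rightarrow> 'b topology" where
  "quotient_top X f =
     topology (\<lambda>U. U \<subseteq> f ` topspace X \<and> openin X {x \<in> topspace X. f x \<in> U})"

lemma openin_quotient_top:
  "openin (quotient_top X f) U \<longleftrightarrow>
     U \<subseteq> f ` topspace X \<and> openin X {x \<in> topspace X. f x \<in> U}"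
proof -
  have "istopology (\<lambda>U. U \<subseteq> f ` topspace X \<and> openin X {x \<in> topspace X. f x \<in> U})"
    unfolding istopology_def
  proof (intro conjI allI impI)
    fix S T
    assume S: "S \<subseteq> f ` topspace X \<and> openin X {x \<in> topspace X. f x \<in> S}"
      and T: "T \<subseteq> f ` topspace X \<and> openin X {x \<in> topspace X. f x \<in> T}"
    then show "S \<inter> T \<subseteq> f ` topspace X" by blast
    have "{x \<in> topspace X. f x \<in> S \<inter> T} =
            {x \<in> topspace X. f x \<in> S} \<inter> {x \<in> topspace X. f x \<in> T}" by blast
    with S T show "openin X {x \<in> topspace X. f x \<in> S \<inter> T}" by auto
  next
    fix K
    assume K: "\<forall>S\<in>K. S \<subseteq> f ` topspace X \<and> openin X {x \<in> topspace X. f x \<in> S}"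
    then show "\<Union>K \<subseteq> f ` topspace X" by blast
    have "{x \<in> topspace X. f x \<in> \<Union>K} = (\<Union>S\<in>K. {x \<in> topspace X. f x \<in> S})" by blast
    with K show "openin X {x \<in> topspace X. f x \<in> \<Union>K}" by auto
  qed
  then show ?thesis
    by (simp add: quotient_top_def)
qed

text \<open>Continuous maps are made extensional, so that equality of functions is equality of maps.\<close>

definition cmaps :: "'a topology \<Rightarrow> 'b topology \<Rightarrow> ('a \<Rightarrow> 'b) set" where
  "cmaps X Y = {f \<in> extensional (topspace X). continuous_map X Y f}"

definition compact_open_topology :: "'a topology \<Rightarrow> 'b topology \<Rightarrow> ('a \<Rightarrow> 'b) topology" where
  "compact_open_topology X Y =
     topology_generated_by
       {{f \<in> cmaps X Y. f ` K \<subseteq> U} | K U. compactin X K \<and> openin Y U}"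


section \<open>Smooth manifolds\<close>

text \<open>
  The model space is a finite-dimensional normed space; unlike \<open>euclidean_space\<close>, this
  includes dimension 0.
\<close>

definition fin_dim :: "'e::real_vector itself \<Rightarrow> bool" where
  "fin_dim _ \<longleftrightarrow> (\<exists>B::'e set. finite B \<and> span B = UNIV)"

text \<open>The next two notions are used for open \<open>S\<close> only.\<close>

fun ck_on :: "nat \<Rightarrow> 'a::real_normed_vector set \<Rightarrow> ('a \<Rightarrow> 'b::real_normed_vector) \<Rightarrow> bool" where
  "ck_on 0 S f \<longleftrightarrow> continuous_on S f"
| "ck_on (Suc k) S f \<longleftrightarrow>
     (\<forall>x\<in>S. f differentiable at x) \<and> (\<forall>v. ck_on k S (\<lambda>x. frechet_derivative f (at x) v))"

definition smooth_on :: "'a::real_normed_vector set \<Rightarrow> ('a \<Rightarrow> 'b::real_normed_vector) \<Rightarrow> bool" where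
  "smooth_on S f \<longleftrightarrow> (\<forall>k. ck_on k S f)"

type_synonym ('p, 'm) atlas = "('p set \<times> ('p \<Rightarrow> 'm)) set"

text \<open>
  Manifolds are Hausdorff but not required to be second countable: the object space
  \<open>\<Squnion>\<^sub>p V\<^sub>p\<close> of the groupoid of an orbifold has uncountably many components in general.
\<close>

definition smooth_manifold :: "'p topology \<Rightarrow> ('p, 'm::real_normed_vector) atlas \<Rightarrow> bool" where
  "smooth_manifold T A \<longleftrightarrow>
     fin_dim TYPE('m) \<and> Hausdorff_space T \<and>
     (\<Union>(U, \<phi>)\<in>A. U) = topspace T \<and>
     (\<forall>(U, \<phi>)\<in>A. openin T U \<and> open (\<phi> ` U) \<and>
        homeomorphic_map (subtopology T U) (top_of_set (\<phi> ` U)) \<phi>) \<and>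
     (\<forall>(U, \<phi>)\<in>A. \<forall>(V, \<psi>)\<in>A. smooth_on (\<phi> ` (U \<inter> V)) (\<psi> \<circ> inv_into U \<phi>))"

definition prod_atlas :: "('p, 'm) atlas \<Rightarrow> ('q, 'n) atlas \<Rightarrow> ('p \<times> 'q, 'm \<times> 'n) atlas" where
  "prod_atlas A B = (\<lambda>((U, \<phi>), (V, \<psi>)). (U \<times> V, map_prod \<phi> \<psi>)) ` (A \<times> B)"

text \<open>
  Smoothness of a map defined on an arbitrary subset \<open>S\<close> of a manifold: locally it is the
  restriction of a smooth map defined on an open set. For an embedded submanifold \<open>S\<close> (such as
  the space of composable pairs of arrows inside the product) this is smoothness on \<open>S\<close>.
\<close>

definition smooth_map_on ::
  "('p, 'm::real_normed_vector) atlas \<Rightarrow> ('q, 'n::real_normed_vector) atlas \<Rightarrow> 'p set \<Rightarrow> ('p \<Rightarrow> 'q) \<Rightarrow> bool"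
  where
  "smooth_map_on A B S f \<longleftrightarrow>
     (\<forall>x\<in>S. \<exists>(U, \<phi>)\<in>A. \<exists>(V, \<psi>)\<in>B. x \<in> U \<and> f x \<in> V \<and>
        (\<exists>N F. open N \<and> \<phi> x \<in> N \<and> smooth_on N F \<and>
           (\<forall>y\<in>S \<inter> U. \<phi> y \<in> N \<longrightarrow> f y \<in> V \<and> \<psi> (f y) = F (\<phi> y))))"

definition local_diffeo ::
  "'p topology \<Rightarrow> ('p, 'm::real_normed_vector) atlas \<Rightarrow> 'q topology \<Rightarrow> ('q, 'n::real_normed_vector) atlas
     \<Rightarrow> ('p \<Rightarrow> 'q) \<Rightarrow> bool" where
  "local_diffeo T A T' B f \<longleftrightarrow>
     (\<forall>x\<in>topspace T. \<exists>N. openin T N \<and> x \<in> N \<and> openin T' (f ` N) \<and> inj_on f N \<and>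
        smooth_map_on A B N f \<and> smooth_map_on B A (f ` N) (inv_into N f))"


section \<open>Topological groupoids and Morita equivalence\<close>

text \<open>Composition is in diagrammatic order: \<open>gmul G a b\<close> is meaningful if \<open>gtgt G a = gsrc G b\<close>.\<close>

record ('o, 'a) tgroupoid =
  gobj :: "'o topology"
  garr :: "'a topology"
  gsrc :: "'a \<Rightarrow> 'o"
  gtgt :: "'a \<Rightarrow> 'o"
  gmul :: "'a \<Rightarrow> 'a \<Rightarrow> 'a"
  ginv :: "'a \<Rightarrow> 'a"
  gid :: "'o \<Rightarrow> 'a"

definition composable :: "('o, 'a) tgroupoid \<Rightarrow> ('a \<times> 'a) set" where
  "composable G =
     {(a, b). a \<in> topspace (garr G) \<and> b \<in> topspace (garr G) \<and> gtgt G a = gsrc G b}"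

definition topological_groupoid :: "('o, 'a) tgroupoid \<Rightarrow> bool" where
  "topological_groupoid G \<longleftrightarrow>
     continuous_map (garr G) (gobj G) (gsrc G) \<and>
     continuous_map (garr G) (gobj G) (gtgt G) \<and>
     continuous_map (gobj G) (garr G) (gid G) \<and>
     continuous_map (garr G) (garr G) (ginv G) \<and>
     continuous_map (subtopology (prod_topology (garr G) (garr G)) (composable G)) (garr G)
       (\<lambda>(a, b). gmul G a b) \<and>
     (\<forall>x\<in>topspace (gobj G). gsrc G (gid G x) = x \<and> gtgt G (gid G x) = x) \<and>
     (\<forall>(a, b)\<in>composable G. gsrc G (gmul G a b) = gsrc G a \<and> gtgt G (gmul G a b) = gtgt G b) \<and>
     (\<forall>(a, b)\<in>composable G. \<forall>c. (b, c) \<in> composable G \<longrightarrow>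
        gmul G (gmul G a b) c = gmul G a (gmul G b c)) \<and>
     (\<forall>a\<in>topspace (garr G).
        gmul G (gid G (gsrc G a)) a = a \<and> gmul G a (gid G (gtgt G a)) = a \<and>
        gsrc G (ginv G a) = gtgt G a \<and> gtgt G (ginv G a) = gsrc G a \<and>
        gmul G a (ginv G a) = gid G (gsrc G a) \<and> gmul G (ginv G a) a = gid G (gtgt G a))"

text \<open>Local diffeomorphisms are submersions, so this is a smooth groupoid which is etale.\<close>

definition smooth_etale_groupoid ::
  "('o, 'a) tgroupoid \<Rightarrow> ('o, 'm::real_normed_vector) atlas \<Rightarrow> ('a, 'm) atlas \<Rightarrow> bool" where
  "smooth_etale_groupoid G A0 A1 \<longleftrightarrow>
     topological_groupoid G \<and>
     smooth_manifold (gobj G) A0 \<and> smooth_manifold (garr G) A1 \<and>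
     local_diffeo (garr G) A1 (gobj G) A0 (gsrc G) \<and>
     local_diffeo (garr G) A1 (gobj G) A0 (gtgt G) \<and>
     smooth_map_on A0 A1 (topspace (gobj G)) (gid G) \<and>
     smooth_map_on A1 A1 (topspace (garr G)) (ginv G) \<and>
     smooth_map_on (prod_atlas A1 A1) A1 (composable G) (\<lambda>(a, b). gmul G a b)"

definition proper_groupoid :: "('o, 'a) tgroupoid \<Rightarrow> bool" where
  "proper_groupoid G \<longleftrightarrow>
     proper_map (garr G) (prod_topology (gobj G) (gobj G)) (\<lambda>a. (gsrc G a, gtgt G a))"

definition groupoid_morphism ::
  "('o, 'a) tgroupoid \<Rightarrow> ('p, 'b) tgroupoid \<Rightarrow> ('o \<Rightarrow> 'p) \<Rightarrow> ('a \<Rightarrow> 'b) \<Rightarrow> bool" where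
  "groupoid_morphism H G \<Psi>0 \<Psi>1 \<longleftrightarrow>
     continuous_map (gobj H) (gobj G) \<Psi>0 \<and> continuous_map (garr H) (garr G) \<Psi>1 \<and>
     (\<forall>a\<in>topspace (garr H).
        gsrc G (\<Psi>1 a) = \<Psi>0 (gsrc H a) \<and> gtgt G (\<Psi>1 a) = \<Psi>0 (gtgt H a) \<and>
        \<Psi>1 (ginv H a) = ginv G (\<Psi>1 a)) \<and>
     (\<forall>x\<in>topspace (gobj H). \<Psi>1 (gid H x) = gid G (\<Psi>0 x)) \<and>
     (\<forall>(a, b)\<in>composable H. \<Psi>1 (gmul H a b) = gmul G (\<Psi>1 a) (\<Psi>1 b))"

definition morita_morphism ::
  "('o, 'a) tgroupoid \<Rightarrow> ('p, 'b) tgroupoid \<Rightarrow> ('o \<Rightarrow> 'p) \<Rightarrow> ('a \<Rightarrow> 'b) \<Rightarrow> bool" where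
  "morita_morphism H G \<Psi>0 \<Psi>1 \<longleftrightarrow>
     groupoid_morphism H G \<Psi>0 \<Psi>1 \<and>
     homeomorphic_map (garr H)
       (subtopology (prod_topology (prod_topology (gobj H) (gobj H)) (garr G))
          {((x, y), g). gsrc G g = \<Psi>0 x \<and> gtgt G g = \<Psi>0 y})
       (\<lambda>a. ((gsrc H a, gtgt H a), \<Psi>1 a)) \<and>
     (let P = subtopology (prod_topology (gobj H) (garr G)) {(x, g). \<Psi>0 x = gtgt G g};
          f = (\<lambda>(x, g). gsrc G g)
      in open_map P (gobj G) f \<and> f ` topspace P = topspace (gobj G))"

text \<open>
  HOL does not quantify over types inside a formula, so the types on which the intermediate
  groupoid \<open>K\<close> lives are parameters. A hypothesis of Morita equivalence should be stated with
  type variables for \<open>'k0\<close> and \<open>'k1\<close>, which then allows arbitrary \<open>K\<close>; as a conclusion,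
  the statement for any particular types implies the unrestricted one.
\<close>

definition morita_equivalent ::
  "'k0 itself \<Rightarrow> 'k1 itself \<Rightarrow> ('o, 'a) tgroupoid \<Rightarrow> ('p, 'b) tgroupoid \<Rightarrow> bool" where
  "morita_equivalent _ _ G H \<longleftrightarrow>
     topological_groupoid G \<and> topological_groupoid H \<and>
     (\<exists>(K :: ('k0, 'k1) tgroupoid) \<Phi>0 \<Phi>1 \<Psi>0 \<Psi>1.
        topological_groupoid K \<and> morita_morphism K G \<Phi>0 \<Phi>1 \<and> morita_morphism K H \<Psi>0 \<Psi>1)"


section \<open>The circle groupoids\<close>

text \<open>
  A pair \<open>(Q, \<epsilon>)\<close> stands for the cover given by the points \<open>q\<^sub>k \<in> Q\<close> and \<open>\<epsilon>\<close>. The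
  intervals \<open>V\<^sub>i + k\<close> of the real line are indexed by \<open>\<beta> = q\<^sub>i + k\<close>, so that
  \<open>W\<^sub>\<beta>\<close> is the \<open>\<epsilon>\<close>-enlargement of the interval from \<open>\<beta>\<close> to the next
  point of \<open>Q + \<int>\<close>, and the index of \<open>W\<^sub>\<beta> + l\<close> is \<open>\<beta> + l\<close>.
\<close>

type_synonym cover = "real set \<times> real"
type_synonym circ_obj = "real \<times> real"
type_synonym circ_arr = "((real \<times> real) \<times> real) \<times> int"

definition cover_pts :: "cover \<Rightarrow> real set" where
  "cover_pts W = {q + of_int k | q k. q \<in> fst W}"

definition cover_next :: "cover \<Rightarrow> real \<Rightarrow> real" where
  "cover_next W \<beta> = Inf {\<gamma> \<in> cover_pts W. \<beta> < \<gamma>}"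

definition cover_int :: "cover \<Rightarrow> real \<Rightarrow> real set" where
  "cover_int W \<beta> = {\<beta> - snd W <..< cover_next W \<beta> + snd W}"

definition circle_map :: "real \<Rightarrow> complex" where
  "circle_map x = cis (2 * pi * x)"

definition circle_covers :: "cover set" where
  "circle_covers =
     {(Q, \<epsilon>). finite Q \<and> Q \<noteq> {} \<and> Q \<subseteq> {0<..1} \<and> 0 < \<epsilon> \<and>
        (\<forall>a\<in>Q. \<forall>b\<in>Q. \<forall>c\<in>Q. a \<noteq> b \<and> b \<noteq> c \<and> a \<noteq> c \<longrightarrow>
           circle_map ` cover_int (Q, \<epsilon>) a \<inter> circle_map ` cover_int (Q, \<epsilon>) b \<inter>
           circle_map ` cover_int (Q, \<epsilon>) c = {})}"

definition refines :: "cover \<Rightarrow> cover \<Rightarrow> bool" where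
  "refines W' W \<longleftrightarrow> snd W' \<le> snd W \<and> fst W \<subseteq> fst W'"

definition circle_groupoid :: "cover \<Rightarrow> (circ_obj, circ_arr) tgroupoid" where
  "circle_groupoid W = \<lparr>
     gobj = sum_topology (\<lambda>\<beta>. top_of_set (cover_int W \<beta>)) (cover_pts W),
     garr = prod_topology
              (sum_topology (\<lambda>(\<beta>, \<gamma>). top_of_set (cover_int W \<beta> \<inter> cover_int W \<gamma>))
                 (cover_pts W \<times> cover_pts W))
              (discrete_topology UNIV),
     gsrc = (\<lambda>(((\<beta>, \<gamma>), x), l). (\<beta>, x)),
     gtgt = (\<lambda>(((\<beta>, \<gamma>), x), l). (\<gamma> + of_int l, x + of_int l)),
     gmul = (\<lambda>(((\<beta>, \<gamma>), x), l) (((\<gamma>', \<sigma>'), x'), k). (((\<beta>, \<sigma>' - of_int l), x), l + k)),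
     ginv = (\<lambda>(((\<beta>, \<gamma>), x), l). (((\<gamma> + of_int l, \<beta> + of_int l), x + of_int l), - l)),
     gid = (\<lambda>(\<beta>, x). (((\<beta>, \<beta>), x), 0)) \<rparr>"

text \<open>If \<open>W'\<close> refines \<open>W\<close>, the interval of \<open>W'\<close> with index \<open>\<beta>\<close> lies canonically in the
  interval of \<open>W\<close> with index \<open>cover_floor W \<beta>\<close>.\<close>

definition cover_floor :: "cover \<Rightarrow> real \<Rightarrow> real" where
  "cover_floor W x = Sup {\<beta> \<in> cover_pts W. \<beta> \<le> x}"

definition refine_obj :: "cover \<Rightarrow> circ_obj \<Rightarrow> circ_obj" where
  "refine_obj W = (\<lambda>(\<beta>, x). (cover_floor W \<beta>, x))"

definition refine_arr :: "cover \<Rightarrow> circ_arr \<Rightarrow> circ_arr" where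
  "refine_arr W = (\<lambda>(((\<beta>, \<gamma>), x), l). (((cover_floor W \<beta>, cover_floor W \<gamma>), x), l))"


section \<open>The loop groupoid\<close>

type_synonym ('o, 'a) loop = "(circ_obj \<Rightarrow> 'o) \<times> (circ_arr \<Rightarrow> 'a)"

text \<open>An arrow \<open>\<Lambda>\<close> from \<open>\<Psi>\<close> to \<open>\<Phi>\<close> is the triple \<open>(\<Psi>, \<Lambda>, \<Phi>)\<close>.\<close>

type_synonym ('o, 'a) loop_arr = "('o, 'a) loop \<times> (circ_arr \<Rightarrow> 'a) \<times> ('o, 'a) loop"

definition loop_objs :: "('o, 'a) tgroupoid \<Rightarrow> cover \<Rightarrow> ('o, 'a) loop set" where
  "loop_objs G W =
     {(\<Psi>0, \<Psi>1). groupoid_morphism (circle_groupoid W) G \<Psi>0 \<Psi>1 \<and>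
        \<Psi>0 \<in> extensional (topspace (gobj (circle_groupoid W))) \<and>
        \<Psi>1 \<in> extensional (topspace (garr (circle_groupoid W)))}"

definition loop_arrs :: "('o, 'a) tgroupoid \<Rightarrow> cover \<Rightarrow> ('o, 'a) loop_arr set" where
  "loop_arrs G W = (let S = circle_groupoid W in
     {(\<Psi>, \<Lambda>, \<Phi>). \<Psi> \<in> loop_objs G W \<and> \<Phi> \<in> loop_objs G W \<and> \<Lambda> \<in> cmaps (garr S) (garr G) \<and>
        (\<forall>r\<in>topspace (garr S).
           gsrc G (\<Lambda> r) = fst \<Psi> (gsrc S r) \<and>
           gtgt G (\<Lambda> r) = fst \<Phi> (gtgt S r) \<and>
           \<Lambda> r = gmul G (snd \<Psi> r) (\<Lambda> (gid S (gtgt S r))) \<and>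
           \<Lambda> r = gmul G (\<Lambda> (gid S (gsrc S r))) (snd \<Phi> r))})"

definition loop_level ::
  "('o, 'a) tgroupoid \<Rightarrow> cover \<Rightarrow> (('o, 'a) loop, ('o, 'a) loop_arr) tgroupoid" where
  "loop_level G W = (let S = circle_groupoid W; es = (\<lambda>r. gid S (gsrc S r)) in \<lparr>
     gobj = subtopology
              (prod_topology (compact_open_topology (gobj S) (gobj G))
                 (compact_open_topology (garr S) (garr G)))
              (loop_objs G W),
     garr = pullback_topology (loop_arrs G W)
              (\<lambda>(\<Psi>, \<Lambda>, \<Phi>). (snd \<Psi>, restrict (\<Lambda> \<circ> gid S) (topspace (gobj S))))
              (prod_topology (compact_open_topology (garr S) (garr G))
                 (compact_open_topology (gobj S) (garr G))),
     gsrc = (\<lambda>(\<Psi>, \<Lambda>, \<Phi>). \<Psi>),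
     gtgt = (\<lambda>(\<Psi>, \<Lambda>, \<Phi>). \<Phi>),
     gmul = (\<lambda>(\<Psi>, \<Lambda>, \<Phi>) (\<Phi>', \<Omega>, \<Gamma>).
               (\<Psi>,
                restrict (\<lambda>r. gmul G (gmul G (\<Lambda> (es r)) (\<Omega> (es r))) (snd \<Gamma> r)) (topspace (garr S)),
                \<Gamma>)),
     ginv = (\<lambda>(\<Psi>, \<Lambda>, \<Phi>).
               (\<Phi>, restrict (\<lambda>r. gmul G (ginv G (\<Lambda> (es r))) (snd \<Psi> r)) (topspace (garr S)), \<Psi>)),
     gid = (\<lambda>\<Psi>. (\<Psi>, snd \<Psi>, \<Psi>)) \<rparr>)"

definition restrict_loop :: "cover \<Rightarrow> cover \<Rightarrow> ('o, 'a) loop \<Rightarrow> ('o, 'a) loop" where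
  "restrict_loop W W' = (\<lambda>(\<Psi>0, \<Psi>1).
     (restrict (\<Psi>0 \<circ> refine_obj W) (topspace (gobj (circle_groupoid W'))),
      restrict (\<Psi>1 \<circ> refine_arr W) (topspace (garr (circle_groupoid W')))))"

definition restrict_loop_arr :: "cover \<Rightarrow> cover \<Rightarrow> ('o, 'a) loop_arr \<Rightarrow> ('o, 'a) loop_arr" where
  "restrict_loop_arr W W' = (\<lambda>(\<Psi>, \<Lambda>, \<Phi>).
     (restrict_loop W W' \<Psi>,
      restrict (\<Lambda> \<circ> refine_arr W) (topspace (garr (circle_groupoid W'))),
      restrict_loop W W' \<Phi>))"

text \<open>
  Colimit of topological spaces \<open>X i\<close> over a directed index set \<open>I\<close>, where \<open>prec j i\<close>
  means that \<open>j\<close> is further along than \<open>i\<close>, in which case \<open>\<tau> i j\<close> is the transition map.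
\<close>

definition dirlim_class ::
  "'i set \<Rightarrow> ('i \<Rightarrow> 'i \<Rightarrow> bool) \<Rightarrow> ('i \<Rightarrow> 'i \<Rightarrow> 'x \<Rightarrow> 'x) \<Rightarrow> ('i \<Rightarrow> 'x topology)
     \<Rightarrow> 'i \<times> 'x \<Rightarrow> ('i \<times> 'x) set" where
  "dirlim_class I prec \<tau> X = (\<lambda>(i, x).
     {(j, y). j \<in> I \<and> y \<in> topspace (X j) \<and> (\<exists>k\<in>I. prec k i \<and> prec k j \<and> \<tau> i k x = \<tau> j k y)})"

definition dirlim_top ::
  "'i set \<Rightarrow> ('i \<Rightarrow> 'i \<Rightarrow> bool) \<Rightarrow> ('i \<Rightarrow> 'i \<Rightarrow> 'x \<Rightarrow> 'x) \<Rightarrow> ('i \<Rightarrow> 'x topology)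
     \<Rightarrow> ('i \<times> 'x) set topology" where
  "dirlim_top I prec \<tau> X = quotient_top (sum_topology X I) (dirlim_class I prec \<tau> X)"

definition dirlim_groupoid ::
  "'i set \<Rightarrow> ('i \<Rightarrow> 'i \<Rightarrow> bool) \<Rightarrow> ('i \<Rightarrow> 'i \<Rightarrow> 'o \<Rightarrow> 'o) \<Rightarrow> ('i \<Rightarrow> 'i \<Rightarrow> 'a \<Rightarrow> 'a)
     \<Rightarrow> ('i \<Rightarrow> ('o, 'a) tgroupoid) \<Rightarrow> (('i \<times> 'o) set, ('i \<times> 'a) set) tgroupoid" where
  "dirlim_groupoid I prec \<tau>0 \<tau>1 L = (
     let cl0 = dirlim_class I prec \<tau>0 (\<lambda>i. gobj (L i));
         cl1 = dirlim_class I prec \<tau>1 (\<lambda>i. garr (L i))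
     in \<lparr>
       gobj = dirlim_top I prec \<tau>0 (\<lambda>i. gobj (L i)),
       garr = dirlim_top I prec \<tau>1 (\<lambda>i. garr (L i)),
       gsrc = (\<lambda>a. THE c. \<exists>(i, x)\<in>a. c = cl0 (i, gsrc (L i) x)),
       gtgt = (\<lambda>a. THE c. \<exists>(i, x)\<in>a. c = cl0 (i, gtgt (L i) x)),
       gmul = (\<lambda>a b. THE c. \<exists>i x y. (i, x) \<in> a \<and> (i, y) \<in> b \<and> gtgt (L i) x = gsrc (L i) y \<and>
                  c = cl1 (i, gmul (L i) x y)),
       ginv = (\<lambda>a. THE c. \<exists>(i, x)\<in>a. c = cl1 (i, ginv (L i) x)),
       gid = (\<lambda>u. THE c. \<exists>(i, x)\<in>u. c = cl1 (i, gid (L i) x)) \<rparr>)"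

definition loop_groupoid ::
  "('o, 'a) tgroupoid \<Rightarrow>
     ((cover \<times> ('o, 'a) loop) set, (cover \<times> ('o, 'a) loop_arr) set) tgroupoid" where
  "loop_groupoid G =
     dirlim_groupoid circle_covers refines restrict_loop restrict_loop_arr (loop_level G)"


section \<open>The action of the real line\<close>

text \<open>The points of the shifted cover are again normalised to lie in \<open>(0, 1]\<close>.\<close>

definition shift_cover :: "real \<Rightarrow> cover \<Rightarrow> cover" where
  "shift_cover z W = ({x \<in> {0<..1}. x - z \<in> cover_pts W}, snd W)"

definition unshift_obj :: "real \<Rightarrow> circ_obj \<Rightarrow> circ_obj" where
  "unshift_obj z = (\<lambda>(\<beta>, x). (\<beta> - z, x - z))"

definition unshift_arr :: "real \<Rightarrow> circ_arr \<Rightarrow> circ_arr" where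
  "unshift_arr z = (\<lambda>(((\<beta>, \<gamma>), x), l). (((\<beta> - z, \<gamma> - z), x - z), l))"

definition shift_loop :: "real \<Rightarrow> cover \<Rightarrow> ('o, 'a) loop \<Rightarrow> ('o, 'a) loop" where
  "shift_loop z W = (\<lambda>(\<Psi>0, \<Psi>1).
     (restrict (\<Psi>0 \<circ> unshift_obj z) (topspace (gobj (circle_groupoid (shift_cover z W)))),
      restrict (\<Psi>1 \<circ> unshift_arr z) (topspace (garr (circle_groupoid (shift_cover z W))))))"

definition shift_loop_arr :: "real \<Rightarrow> cover \<Rightarrow> ('o, 'a) loop_arr \<Rightarrow> ('o, 'a) loop_arr" where
  "shift_loop_arr z W = (\<lambda>(\<Psi>, \<Lambda>, \<Phi>).
     (shift_loop z W \<Psi>,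
      restrict (\<Lambda> \<circ> unshift_arr z) (topspace (garr (circle_groupoid (shift_cover z W)))),
      shift_loop z W \<Phi>))"

definition act_obj ::
  "real \<Rightarrow> (cover \<times> ('o, 'a) loop) set \<Rightarrow> (cover \<times> ('o, 'a) loop) set" where
  "act_obj z u = (\<lambda>(W, \<Psi>). (shift_cover z W, shift_loop z W \<Psi>)) ` u"

definition act_arr ::
  "real \<Rightarrow> (cover \<times> ('o, 'a) loop_arr) set \<Rightarrow> (cover \<times> ('o, 'a) loop_arr) set" where
  "act_arr z a = (\<lambda>(W, \<Lambda>). (shift_cover z W, shift_loop_arr z W \<Lambda>)) ` a"

definition subgroupoid :: "('o, 'a) tgroupoid \<Rightarrow> 'o set \<Rightarrow> 'a set \<Rightarrow> ('o, 'a) tgroupoid" where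
  "subgroupoid G S R =
     G\<lparr>gobj := subtopology (gobj G) S, garr := subtopology (garr G) R\<rparr>"

definition fixed_loop_groupoid ::
  "('o, 'a) tgroupoid \<Rightarrow>
     ((cover \<times> ('o, 'a) loop) set, (cover \<times> ('o, 'a) loop_arr) set) tgroupoid" where
  "fixed_loop_groupoid G =
     subgroupoid (loop_groupoid G) {u. \<forall>z. act_obj z u = u} {a. \<forall>z. act_arr z a = a}"


section \<open>Orbifolds\<close>

record ('x, 'e, 'g) ochart =
  cdom :: "'e set"
  cgrp :: "'g monoid"
  cact :: "'e \<Rightarrow> 'g \<Rightarrow> 'e"
  cproj :: "'e \<Rightarrow> 'x"

definition orbifold_chart ::
  "'x topology \<Rightarrow> ('x, 'e::real_normed_vector, 'g) ochart \<Rightarrow> bool" where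
  "orbifold_chart X D \<longleftrightarrow>
     open (cdom D) \<and> connected (cdom D) \<and> cdom D \<noteq> {} \<and>
     group (cgrp D) \<and> finite (carrier (cgrp D)) \<and>
     (\<forall>g\<in>carrier (cgrp D). smooth_on (cdom D) (\<lambda>v. cact D v g)) \<and>
     (\<forall>v\<in>cdom D. \<forall>g\<in>carrier (cgrp D). cact D v g \<in> cdom D) \<and>
     (\<forall>v\<in>cdom D. cact D v \<one>\<^bsub>cgrp D\<^esub> = v) \<and>
     (\<forall>v\<in>cdom D. \<forall>g\<in>carrier (cgrp D). \<forall>h\<in>carrier (cgrp D).
        cact D v (g \<otimes>\<^bsub>cgrp D\<^esub> h) = cact D (cact D v g) h) \<and>
     (\<forall>g\<in>carrier (cgrp D). (\<forall>v\<in>cdom D. cact D v g = v) \<longrightarrow> g = \<one>\<^bsub>cgrp D\<^esub>) \<and>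
     openin X (cproj D ` cdom D) \<and>
     quotient_map (top_of_set (cdom D)) (subtopology X (cproj D ` cdom D)) (cproj D) \<and>
     (\<forall>v\<in>cdom D. \<forall>w\<in>cdom D.
        cproj D v = cproj D w \<longleftrightarrow> (\<exists>g\<in>carrier (cgrp D). w = cact D v g))"

definition chart_embedding ::
  "('x, 'e::real_normed_vector, 'g) ochart \<Rightarrow> ('x, 'e, 'g) ochart \<Rightarrow> ('e \<Rightarrow> 'e) \<Rightarrow> bool" where
  "chart_embedding D E \<phi> \<longleftrightarrow>
     \<phi> ` cdom D \<subseteq> cdom E \<and> open (\<phi> ` cdom D) \<and> inj_on \<phi> (cdom D) \<and>
     smooth_on (cdom D) \<phi> \<and> smooth_on (\<phi> ` cdom D) (inv_into (cdom D) \<phi>) \<and>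
     (\<forall>v\<in>cdom D. cproj E (\<phi> v) = cproj D v) \<and>
     (\<exists>\<eta>\<in>hom (cgrp D) (cgrp E). inj_on \<eta> (carrier (cgrp D)) \<and>
        (\<forall>v\<in>cdom D. \<forall>g\<in>carrier (cgrp D). \<phi> (cact D v g) = cact E (\<phi> v) (\<eta> g)))"

definition orbifold ::
  "'x topology \<Rightarrow> ('x \<Rightarrow> ('x, 'e::real_normed_vector, 'g) ochart) \<Rightarrow> bool" where
  "orbifold X C \<longleftrightarrow>
     fin_dim TYPE('e) \<and> Hausdorff_space X \<and>
     (\<forall>p\<in>topspace X. orbifold_chart X (C p) \<and> p \<in> cproj (C p) ` cdom (C p)) \<and>
     (\<forall>p\<in>topspace X. \<forall>q\<in>topspace X.
        \<forall>r\<in>cproj (C p) ` cdom (C p) \<inter> cproj (C q) ` cdom (C q).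
          \<exists>D \<phi> \<psi>. orbifold_chart X D \<and> r \<in> cproj D ` cdom D \<and>
            chart_embedding D (C p) \<phi> \<and> chart_embedding D (C q) \<psi>)"

text \<open>
  The data \<open>((p, \<phi>1, D, \<phi>2, q), w)\<close> represent \<open>[\<phi>1, w, \<phi>2]\<close> with \<open>\<phi>1\<close> and \<open>\<phi>2\<close> embeddings
  of \<open>D\<close> into the charts at \<open>p\<close> and \<open>q\<close>. The group of \<open>D\<close> embeds in that of the chart at \<open>p\<close>,
  so nothing is lost by taking it on the same type \<open>'g\<close>.
\<close>

type_synonym ('x, 'e, 'g) roof =
  "'x \<times> ('e \<Rightarrow> 'e) \<times> ('x, 'e, 'g) ochart \<times> ('e \<Rightarrow> 'e) \<times> 'x"

type_synonym ('x, 'e, 'g) orb_arr = "(('x, 'e, 'g) roof \<times> 'e) set"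

definition roofs ::
  "'x topology \<Rightarrow> ('x \<Rightarrow> ('x, 'e::real_normed_vector, 'g) ochart) \<Rightarrow> ('x, 'e, 'g) roof set" where
  "roofs X C = {(p, \<phi>1, D, \<phi>2, q). p \<in> topspace X \<and> q \<in> topspace X \<and> orbifold_chart X D \<and>
     chart_embedding D (C p) \<phi>1 \<and> chart_embedding D (C q) \<phi>2}"

text \<open>The functions \<open>\<phi>1\<close> and \<open>\<phi>2\<close> matter only on the domain of the chart.\<close>

definition roof_rel ::
  "'x topology \<Rightarrow> ('x \<Rightarrow> ('x, 'e::real_normed_vector, 'g) ochart)
     \<Rightarrow> ('x, 'e, 'g) roof \<times> 'e \<Rightarrow> ('x, 'e, 'g) roof \<times> 'e \<Rightarrow> bool" where
  "roof_rel X C = (\<lambda>((p', \<phi>1', D', \<phi>2', q'), w') ((p, \<phi>1, D, \<phi>2, q), w).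
     p' = p \<and> q' = q \<and>
     (p', \<phi>1', D', \<phi>2', q') \<in> roofs X C \<and> w' \<in> cdom D' \<and>
     (p, \<phi>1, D, \<phi>2, q) \<in> roofs X C \<and> w \<in> cdom D \<and>
     (\<exists>\<gamma>. chart_embedding D' D \<gamma> \<and> \<gamma> w' = w \<and>
        (\<forall>v\<in>cdom D'. \<phi>1' v = \<phi>1 (\<gamma> v) \<and> \<phi>2' v = \<phi>2 (\<gamma> v))))"

definition orb_class ::
  "'x topology \<Rightarrow> ('x \<Rightarrow> ('x, 'e::real_normed_vector, 'g) ochart)
     \<Rightarrow> ('x, 'e, 'g) roof \<times> 'e \<Rightarrow> ('x, 'e, 'g) orb_arr" where
  "orb_class X C t = {t'. equivclp (roof_rel X C) t t'}"

text \<open>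
  The arrow space has the finest topology making all the maps \<open>w \<mapsto> [\<phi>1, w, \<phi>2]\<close>
  continuous. The composition is \<open>[\<phi>1, w, \<phi>2] \<cdot> [\<phi>2, w, \<phi>3] = [\<phi>1, w, \<phi>3]\<close>.
\<close>

definition orbifold_groupoid ::
  "'x topology \<Rightarrow> ('x \<Rightarrow> ('x, 'e::real_normed_vector, 'g) ochart)
     \<Rightarrow> ('x \<times> 'e, ('x, 'e, 'g) orb_arr) tgroupoid" where
  "orbifold_groupoid X C = \<lparr>
     gobj = sum_topology (\<lambda>p. top_of_set (cdom (C p))) (topspace X),
     garr = quotient_top
              (sum_topology (\<lambda>(p, \<phi>1, D, \<phi>2, q). top_of_set (cdom D)) (roofs X C)) (orb_class X C),
     gsrc = (\<lambda>a. THE y. \<exists>((p, \<phi>1, D, \<phi>2, q), w)\<in>a. y = (p, \<phi>1 w)),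
     gtgt = (\<lambda>a. THE y. \<exists>((p, \<phi>1, D, \<phi>2, q), w)\<in>a. y = (q, \<phi>2 w)),
     gmul = (\<lambda>a b. THE c. \<exists>p \<phi>1 q \<phi>2 r \<phi>3 D w.
               ((p, \<phi>1, D, \<phi>2, q), w) \<in> a \<and> ((q, \<phi>2, D, \<phi>3, r), w) \<in> b \<and>
               c = orb_class X C ((p, \<phi>1, D, \<phi>3, r), w)),
     ginv = (\<lambda>a. (\<lambda>((p, \<phi>1, D, \<phi>2, q), w). ((q, \<phi>2, D, \<phi>1, p), w)) ` a),
     gid = (\<lambda>(p, x). orb_class X C ((p, id, C p, id, p), x)) \<rparr>"

text \<open>The element \<open>g\<close> of the group of the chart at \<open>p\<close>, as an arrow from \<open>x\<close> to \<open>x \<cdot> g\<close>.\<close>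

definition group_arrow ::
  "'x topology \<Rightarrow> ('x \<Rightarrow> ('x, 'e::real_normed_vector, 'g) ochart) \<Rightarrow> 'x \<times> 'e \<Rightarrow> 'g
     \<Rightarrow> ('x, 'e, 'g) orb_arr" where
  "group_arrow X C = (\<lambda>(p, x) g. orb_class X C ((p, id, C p, \<lambda>v. cact (C p) v g, p), x))"


section \<open>Twisted sectors\<close>

definition conj_reps :: "'g monoid \<Rightarrow> 'g set \<Rightarrow> bool" where
  "conj_reps H R \<longleftrightarrow> R \<subseteq> carrier H \<and>
     (\<forall>g\<in>carrier H. \<exists>!h. h \<in> R \<and> (\<exists>k\<in>carrier H. h = inv\<^bsub>H\<^esub> k \<otimes>\<^bsub>H\<^esub> g \<otimes>\<^bsub>H\<^esub> k))"

text \<open>The object \<open>((p, g), x)\<close> is the point \<open>(x, g)\<close> of \<open>V\<^sub>p\<^sup>g \<times> {g}\<close>, and the arrow \<open>(g, r, h)\<close>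
  is the arrow \<open>r\<close> of the orbifold groupoid viewed as an arrow from \<open>(x, g)\<close> to \<open>(y, h)\<close>.\<close>

type_synonym ('x, 'e, 'g) sector_obj = "('x \<times> 'g) \<times> 'e"
type_synonym ('x, 'e, 'g) sector_arr = "'g \<times> ('x, 'e, 'g) orb_arr \<times> 'g"

definition sector_obj_space ::
  "'x topology \<Rightarrow> ('x \<Rightarrow> ('x, 'e::real_normed_vector, 'g) ochart) \<Rightarrow> ('x \<Rightarrow> 'g set)
     \<Rightarrow> ('x, 'e, 'g) sector_obj topology" where
  "sector_obj_space X C R =
     sum_topology (\<lambda>(p, g). top_of_set {x \<in> cdom (C p). cact (C p) x g = x})
       {(p, g). p \<in> topspace X \<and> g \<in> R p}"

definition sector_groupoid ::
  "'x topology \<Rightarrow> ('x \<Rightarrow> ('x, 'e::real_normed_vector, 'g) ochart) \<Rightarrow> ('x \<Rightarrow> 'g set)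
     \<Rightarrow> (('x, 'e, 'g) sector_obj, ('x, 'e, 'g) sector_arr) tgroupoid" where
  "sector_groupoid X C R = (
     let XX = orbifold_groupoid X C;
         obj = (\<lambda>(p, x) g. ((p, g), x))
     in \<lparr>
       gobj = sector_obj_space X C R,
       garr = subtopology
                (prod_topology (discrete_topology UNIV)
                   (prod_topology (garr XX) (discrete_topology UNIV)))
                {(g, r, h). r \<in> topspace (garr XX) \<and>
                   obj (gsrc XX r) g \<in> topspace (sector_obj_space X C R) \<and>
                   obj (gtgt XX r) h \<in> topspace (sector_obj_space X C R) \<and>
                   gmul XX (group_arrow X C (gsrc XX r) g) r =
                   gmul XX r (group_arrow X C (gtgt XX r) h)},
       gsrc = (\<lambda>(g, r, h). obj (gsrc XX r) g),
       gtgt = (\<lambda>(g, r, h). obj (gtgt XX r) h),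
       gmul = (\<lambda>(g, r, h) (h', r', k). (g, gmul XX r r', k)),
       ginv = (\<lambda>(g, r, h). (h, ginv XX r, g)),
       gid = (\<lambda>((p, g), x). (g, gid XX (p, x), g)) \<rparr>)"

end

theory Submission
  imports Defs
begin

text \<open>
  If a class in the loop groupoid is fixed by all translations, then for each translation its
  representatives become invariant after a refinement of the cover; this forces the arrow map to
  depend only on the integer component \<open>l\<close> of the arrows of the circle groupoid, so the class is that
  of the constant loop \<open>h\<^sup>l\<close> of an automorphism \<open>h\<close>. In the same way a fixed arrow is given by
  an arrow conjugating \<open>h\<close> to another automorphism. Hence the fixed loop groupoid of \<open>G\<close> is
  isomorphic to the inertia groupoid of \<open>G\<close>, whose objects are the automorphisms. Morita
  morphisms induce Morita morphisms of inertia groupoids, so \<open>G\<close> may be replaced by the orbifold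
  groupoid. By rigidity of chart embeddings (two embeddings of a chart differ by a unique group
  element) the automorphisms there are exactly the group elements, and the twisted sectors are a
  full subgroupoid of the inertia groupoid that meets every isomorphism class.
\<close>

section \<open>Continuity and open maps\<close>

text \<open>Charts may contain reflections, so the points with trivial isotropy can fail to form a
  connected set, and two embeddings of a chart cannot be compared there alone. The comparison uses
  derivatives: at a limit of open sets on which two smooth maps agree, both values and derivatives
  agree. Finiteness of the group and connectedness of the chart do the rest.

  A fixed class gives, for each translation, a refinement that depends on the translation, and
  infinitely many of these need not have a common refinement. Therefore a loop at a point is
  compared with the origin through the translation by that very point, and the uniform statement is
  drawn from one further translation, by half a gap.

  Openness in the definition of Morita morphisms is mostly inherited: the space in question is the
  continuous image of a pullback of an open map. The groupoid that links both sides of the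
  conclusion is the weak pullback, over the inertia groupoid of the orbifold groupoid, of the
  twisted sectors and the inertia groupoid of the given \<open>K\<close>.\<close>

lemma cm_comp:
  assumes "continuous_map Y Y' g" "continuous_map X Y f"
  shows "continuous_map X Y' (\<lambda>z. g (f z))"
  using continuous_map_compose[OF assms(2,1)] by (simp add: o_def)

lemma cm_id: "continuous_map (subtopology X S) X (\<lambda>z. z)" "continuous_map X X (\<lambda>z. z)"
  by (auto simp: continuous_map_from_subtopology)

lemma cm_fst: "continuous_map Z (prod_topology X Y) f \<Longrightarrow> continuous_map Z X (\<lambda>z. fst (f z))"
  by (rule cm_comp[OF continuous_map_fst])

lemma cm_snd: "continuous_map Z (prod_topology X Y) f \<Longrightarrow> continuous_map Z Y (\<lambda>z. snd (f z))"
  by (rule cm_comp[OF continuous_map_snd])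

lemma cm_pair:
  "continuous_map Z X f \<Longrightarrow> continuous_map Z Y g \<Longrightarrow> continuous_map Z (prod_topology X Y) (\<lambda>z. (f z, g z))"
  by (simp add: continuous_map_pairwise o_def)

lemma cm_into_sub:
  "continuous_map Z Y f \<Longrightarrow> (\<And>z. z \<in> topspace Z \<Longrightarrow> f z \<in> S) \<Longrightarrow> continuous_map Z (subtopology Y S) f"
  by (auto simp: continuous_map_in_subtopology)

lemmas cm_intros = cm_id cm_into_sub cm_pair cm_fst cm_snd

text \<open>Merges nested subspaces of products into one subspace of one product. After that
  \<open>cm_id\<close> makes each coordinate continuous, and only membership conditions are
  left.\<close>

lemmas flatten_topology =
  prod_topology_subtopology subtopology_subtopology case_prod_unfold

lemma subtopology_eq:
  "topspace X \<inter> S = topspace X \<inter> T \<Longrightarrow> subtopology X S = subtopology X T"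
  by (metis subtopology_restrict)

lemma open_map_pullback:
  assumes f: "open_map A B f" and g: "continuous_map C B g"
  shows "open_map (subtopology (prod_topology A C) {(a, c). f a = g c}) C snd"
  unfolding open_map_def
proof (intro allI impI)
  fix W assume W: "openin (subtopology (prod_topology A C) {(a, c). f a = g c}) W"
  show "openin C (snd ` W)"
  proof (subst openin_subopen, intro ballI)
    fix c assume "c \<in> snd ` W"
    then obtain a where ac: "(a, c) \<in> W" by force
    from W obtain T where T: "openin (prod_topology A C) T" "W = T \<inter> {(a, c). f a = g c}"
      unfolding openin_subtopology by blast
    then obtain U V where UV: "openin A U" "openin C V" "a \<in> U" "c \<in> V" "U \<times> V \<subseteq> T"
      using ac unfolding openin_prod_topology_alt by (metis IntD1)
    let ?N = "V \<inter> {c \<in> topspace C. g c \<in> f ` U}"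
    have "openin C ?N"
      by (intro openin_Int openin_continuous_map_preimage[OF g]) (use UV f in \<open>auto simp: open_map_def\<close>)
    moreover have "g c = f a" using ac T(2) by auto
    then have "c \<in> ?N" using UV(3,4) openin_subset[OF UV(2)] by auto
    moreover have "?N \<subseteq> snd ` W"
    proof
      fix c' assume "c' \<in> ?N"
      then obtain a' where "a' \<in> U" "f a' = g c'" "c' \<in> V" by auto
      then have "(a', c') \<in> W" using UV(5) T(2) by auto
      then show "c' \<in> snd ` W" by force
    qed
    ultimately show "\<exists>N. openin C N \<and> c \<in> N \<and> N \<subseteq> snd ` W" by blast
  qed
qed

lemma open_map_cong_topspace:
  assumes "open_map X Y f" "\<And>x. x \<in> topspace X \<Longrightarrow> f x = g x"
  shows "open_map X Y g"
  unfolding open_map_def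
proof (intro allI impI)
  fix U assume U: "openin X U"
  then have "g ` U = f ` U"
    using openin_subset[OF U] assms(2) by (intro image_cong) auto
  with assms(1) U show "openin Y (g ` U)" by (simp add: open_map_def)
qed

text \<open>The image of an open set under \<open>f\<close> is the image under \<open>h\<close> of
  its preimage under \<open>q\<close>. In the applications \<open>Z\<close> is a space already known
  to map openly, often a pullback, and \<open>q\<close> parametrises \<open>X\<close> by it.\<close>

lemma open_map_factor:
  assumes "open_map Z Y h" "continuous_map Z X q"
    and "\<And>x. x \<in> topspace X \<Longrightarrow> \<exists>z\<in>topspace Z. q z = x"
    and "\<And>z. z \<in> topspace Z \<Longrightarrow> h z = f (q z)"
  shows "open_map X Y f"
proof (rule open_map_from_composition_left)
  show "open_map Z Y (f \<circ> q)" by (rule open_map_cong_topspace[OF assms(1)]) (simp add: assms(4))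
  show "continuous_map Z X q" by fact
  show "q ` topspace Z = topspace X"
    using assms(3) continuous_map_image_subset_topspace[OF assms(2)] by (fastforce simp: image_iff)
qed

lemma open_map_comp:
  "open_map Y Z g \<Longrightarrow> open_map X Y f \<Longrightarrow> open_map X Z (\<lambda>x. g (f x))"
  using open_map_compose[of X Y f Z g] by (simp add: o_def)

lemma topspace_quotient_top [simp]: "topspace (quotient_top X f) = f ` topspace X"
proof
  show "topspace (quotient_top X f) \<subseteq> f ` topspace X"
    using openin_topspace[of "quotient_top X f"] by (simp only: openin_quotient_top)
  have "{x \<in> topspace X. f x \<in> f ` topspace X} = topspace X" by auto
  then have "openin (quotient_top X f) (f ` topspace X)" by (simp add: openin_quotient_top)
  then show "f ` topspace X \<subseteq> topspace (quotient_top X f)" by (rule openin_subset)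
qed

lemma continuous_map_quotient_top: "continuous_map X (quotient_top X f) f"
  by (auto simp: continuous_map openin_quotient_top)

lemma continuous_map_from_quotient_top:
  assumes "continuous_map X Z (\<lambda>x. g (f x))"
  shows "continuous_map (quotient_top X f) Z g"
  unfolding continuous_map
proof (intro conjI allI impI)
  show "g ` topspace (quotient_top X f) \<subseteq> topspace Z"
    using assms by (auto simp: continuous_map)
  fix U assume "openin Z U"
  then have "openin X {x \<in> topspace X. g (f x) \<in> U}"
    using assms by (simp add: continuous_map)
  moreover have "{x \<in> topspace X. f x \<in> {y \<in> topspace (quotient_top X f). g y \<in> U}}
      = {x \<in> topspace X. g (f x) \<in> U}" by auto
  ultimately show "openin (quotient_top X f) {y \<in> topspace (quotient_top X f). g y \<in> U}"
    unfolding openin_quotient_top by auto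
qed

lemma continuous_map_from_sum_topology:
  assumes "\<And>i. i \<in> I \<Longrightarrow> continuous_map (X i) Y (\<lambda>x. f (i, x))"
  shows "continuous_map (sum_topology X I) Y f"
  unfolding continuous_map
proof (intro conjI allI impI)
  show "f ` topspace (sum_topology X I) \<subseteq> topspace Y"
    using continuous_map_image_subset_topspace[OF assms] by fastforce
  fix U assume "openin Y U"
  then have "openin (X i) {x \<in> topspace (X i). f (i, x) \<in> U}" if "i \<in> I" for i
    using assms[OF that] by (simp add: continuous_map)
  then show "openin (sum_topology X I) {x \<in> topspace (sum_topology X I). f x \<in> U}"
    by (auto simp: openin_sum_topology)
qed


section \<open>Formal properties of Morita morphisms, inertia groupoids and weak pullbacks\<close>

section \<open>Topological groupoids\<close>

locale topgpd =
  fixes G :: "('o, 'a) tgroupoid"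
  assumes tg: "topological_groupoid G"
begin

lemma structure_continuous:
  "continuous_map (garr G) (gobj G) (gsrc G)" "continuous_map (garr G) (gobj G) (gtgt G)"
  "continuous_map (gobj G) (garr G) (gid G)" "continuous_map (garr G) (garr G) (ginv G)"
  "continuous_map (subtopology (prod_topology (garr G) (garr G)) (composable G)) (garr G)
       (\<lambda>(a, b). gmul G a b)"
  using tg by (simp_all add: topological_groupoid_def)

lemma src_closed [simp]: "a \<in> topspace (garr G) \<Longrightarrow> gsrc G a \<in> topspace (gobj G)"
  and tgt_closed [simp]: "a \<in> topspace (garr G) \<Longrightarrow> gtgt G a \<in> topspace (gobj G)"
  and id_closed [simp]: "x \<in> topspace (gobj G) \<Longrightarrow> gid G x \<in> topspace (garr G)"
  and inv_closed [simp]: "a \<in> topspace (garr G) \<Longrightarrow> ginv G a \<in> topspace (garr G)"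
  using structure_continuous(1-4)[THEN continuous_map_image_subset_topspace] by auto

lemma cm_src: "continuous_map Z (garr G) f \<Longrightarrow> continuous_map Z (gobj G) (\<lambda>z. gsrc G (f z))"
  and cm_tgt: "continuous_map Z (garr G) f \<Longrightarrow> continuous_map Z (gobj G) (\<lambda>z. gtgt G (f z))"
  and cm_inv: "continuous_map Z (garr G) f \<Longrightarrow> continuous_map Z (garr G) (\<lambda>z. ginv G (f z))"
  and cm_gid: "continuous_map Z (gobj G) h \<Longrightarrow> continuous_map Z (garr G) (\<lambda>z. gid G (h z))"
  by (rule cm_comp[OF structure_continuous(1)] cm_comp[OF structure_continuous(2)]
      cm_comp[OF structure_continuous(3)] cm_comp[OF structure_continuous(4)], assumption)+

lemma cm_mul:
  assumes "continuous_map Z (garr G) f" "continuous_map Z (garr G) g"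
    and "\<And>z. z \<in> topspace Z \<Longrightarrow> gtgt G (f z) = gsrc G (g z)"
  shows "continuous_map Z (garr G) (\<lambda>z. gmul G (f z) (g z))"
proof -
  have "continuous_map Z (subtopology (prod_topology (garr G) (garr G)) (composable G)) (\<lambda>z. (f z, g z))"
    using assms continuous_map_image_subset_topspace[OF assms(1)]
      continuous_map_image_subset_topspace[OF assms(2)]
    by (intro cm_intros) (auto simp: composable_def)
  from cm_comp[OF structure_continuous(5) this] show ?thesis by simp
qed

lemma mul_closed [simp]:
  assumes "a \<in> topspace (garr G)" "b \<in> topspace (garr G)" "gtgt G a = gsrc G b"
  shows "gmul G a b \<in> topspace (garr G)"
proof -
  have "(\<lambda>(a, b). gmul G a b) ` topspace (subtopology (prod_topology (garr G) (garr G)) (composable G))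
      \<subseteq> topspace (garr G)"
    by (rule continuous_map_image_subset_topspace[OF structure_continuous(5)])
  then show ?thesis using assms by (force simp: composable_def)
qed

lemma src_id [simp]: "x \<in> topspace (gobj G) \<Longrightarrow> gsrc G (gid G x) = x"
  and tgt_id [simp]: "x \<in> topspace (gobj G) \<Longrightarrow> gtgt G (gid G x) = x"
  and src_inv [simp]: "a \<in> topspace (garr G) \<Longrightarrow> gsrc G (ginv G a) = gtgt G a"
  and tgt_inv [simp]: "a \<in> topspace (garr G) \<Longrightarrow> gtgt G (ginv G a) = gsrc G a"
  and mul_id_left [simp]: "a \<in> topspace (garr G) \<Longrightarrow> gmul G (gid G (gsrc G a)) a = a"
  and mul_id_right [simp]: "a \<in> topspace (garr G) \<Longrightarrow> gmul G a (gid G (gtgt G a)) = a"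
  and mul_inv_right [simp]: "a \<in> topspace (garr G) \<Longrightarrow> gmul G a (ginv G a) = gid G (gsrc G a)"
  and mul_inv_left [simp]: "a \<in> topspace (garr G) \<Longrightarrow> gmul G (ginv G a) a = gid G (gtgt G a)"
  using tg by (simp_all add: topological_groupoid_def)

lemma src_mul [simp]:
    "a \<in> topspace (garr G) \<Longrightarrow> b \<in> topspace (garr G) \<Longrightarrow> gtgt G a = gsrc G b \<Longrightarrow> gsrc G (gmul G a b) = gsrc G a"
  and tgt_mul [simp]:
    "a \<in> topspace (garr G) \<Longrightarrow> b \<in> topspace (garr G) \<Longrightarrow> gtgt G a = gsrc G b \<Longrightarrow> gtgt G (gmul G a b) = gtgt G b"
  using tg by (simp_all add: topological_groupoid_def composable_def Ball_def)

lemma mul_assoc [simp]: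
  assumes "a \<in> topspace (garr G)" "b \<in> topspace (garr G)" "c \<in> topspace (garr G)"
    "gtgt G a = gsrc G b" "gtgt G b = gsrc G c"
  shows "gmul G (gmul G a b) c = gmul G a (gmul G b c)"
proof -
  have "(a, b) \<in> composable G" "(b, c) \<in> composable G" using assms by (auto simp: composable_def)
  moreover have "\<forall>(a, b)\<in>composable G. \<forall>c. (b, c) \<in> composable G \<longrightarrow>
        gmul G (gmul G a b) c = gmul G a (gmul G b c)"
    using tg unfolding topological_groupoid_def by (elim conjE)
  ultimately show ?thesis by auto
qed

lemma mul_id_left' [simp]:
  "a \<in> topspace (garr G) \<Longrightarrow> gsrc G a = x \<Longrightarrow> gmul G (gid G x) a = a"
  and mul_id_right' [simp]:
  "a \<in> topspace (garr G) \<Longrightarrow> gtgt G a = x \<Longrightarrow> gmul G a (gid G x) = a"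
  by auto

lemma inv_mul_cancel [simp]:
  assumes "a \<in> topspace (garr G)" "b \<in> topspace (garr G)" "gtgt G a = gsrc G b"
  shows "gmul G (ginv G a) (gmul G a b) = b"
  using mul_assoc[of "ginv G a" a b] assms by simp

lemma mul_inv_cancel [simp]:
  assumes "a \<in> topspace (garr G)" "b \<in> topspace (garr G)" "gsrc G a = gsrc G b"
  shows "gmul G a (gmul G (ginv G a) b) = b"
  using mul_assoc[of a "ginv G a" b] assms by simp

lemma inv_unique:
  assumes "a \<in> topspace (garr G)" "b \<in> topspace (garr G)" "gtgt G a = gsrc G b"
    "gmul G a b = gid G (gsrc G a)"
  shows "b = ginv G a"
  using inv_mul_cancel[OF assms(1-3)] assms by simp

lemma mul_left_imp_eq:
  assumes "a \<in> topspace (garr G)" "b \<in> topspace (garr G)" "c \<in> topspace (garr G)"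
    "gtgt G a = gsrc G b" "gtgt G a = gsrc G c" "gmul G a b = gmul G a c"
  shows "b = c"
  using inv_mul_cancel[of a b] inv_mul_cancel[of a c] assms by simp

lemma inv_inv [simp]: "a \<in> topspace (garr G) \<Longrightarrow> ginv G (ginv G a) = a"
  using inv_unique[of "ginv G a" a] by simp

lemma inv_id [simp]: "x \<in> topspace (gobj G) \<Longrightarrow> ginv G (gid G x) = gid G x"
  using inv_unique[of "gid G x" "gid G x"] by simp

lemma inv_mul [simp]:
  assumes "a \<in> topspace (garr G)" "b \<in> topspace (garr G)" "gtgt G a = gsrc G b"
  shows "ginv G (gmul G a b) = gmul G (ginv G b) (ginv G a)"
proof (rule inv_unique[symmetric])
qed (use assms in simp_all)

lemmas cm_structure = cm_src cm_tgt cm_inv cm_gid cm_mul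

end

lemma topological_groupoidI:
  assumes "continuous_map (garr G) (gobj G) (gsrc G)" "continuous_map (garr G) (gobj G) (gtgt G)"
    "continuous_map (gobj G) (garr G) (gid G)" "continuous_map (garr G) (garr G) (ginv G)"
    "continuous_map (subtopology (prod_topology (garr G) (garr G))
       {z. gtgt G (fst z) = gsrc G (snd z)}) (garr G) (\<lambda>z. gmul G (fst z) (snd z))"
    and "\<And>x. x \<in> topspace (gobj G) \<Longrightarrow> gsrc G (gid G x) = x \<and> gtgt G (gid G x) = x"
    and "\<And>a b. a \<in> topspace (garr G) \<Longrightarrow> b \<in> topspace (garr G) \<Longrightarrow> gtgt G a = gsrc G b \<Longrightarrow>
       gsrc G (gmul G a b) = gsrc G a \<and> gtgt G (gmul G a b) = gtgt G b"
    and "\<And>a b c. a \<in> topspace (garr G) \<Longrightarrow> b \<in> topspace (garr G) \<Longrightarrow> c \<in> topspace (garr G) \<Longrightarrow>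
       gtgt G a = gsrc G b \<Longrightarrow> gtgt G b = gsrc G c \<Longrightarrow> gmul G (gmul G a b) c = gmul G a (gmul G b c)"
    and "\<And>a. a \<in> topspace (garr G) \<Longrightarrow> gmul G (gid G (gsrc G a)) a = a \<and> gmul G a (gid G (gtgt G a)) = a \<and>
        gsrc G (ginv G a) = gtgt G a \<and> gtgt G (ginv G a) = gsrc G a \<and>
        gmul G a (ginv G a) = gid G (gsrc G a) \<and> gmul G (ginv G a) a = gid G (gtgt G a)"
  shows "topological_groupoid G"
proof -
  have "subtopology (prod_topology (garr G) (garr G)) (composable G) =
      subtopology (prod_topology (garr G) (garr G)) {z. gtgt G (fst z) = gsrc G (snd z)}"
    by (rule subtopology_eq) (auto simp: composable_def)
  with assms show ?thesis
    unfolding topological_groupoid_def composable_def by (auto simp: case_prod_unfold)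
qed


section \<open>Morita morphisms\<close>

text \<open>Together with \<open>openly_surjective\<close> this splits
  \<open>morita_morphism\<close> into its cartesian half and its essential surjectivity. The halves
  are separated because they compose, and pass to inertia groupoids, for different reasons.\<close>

definition fully_faithful ::
  "('o, 'a) tgroupoid \<Rightarrow> ('p, 'b) tgroupoid \<Rightarrow> ('o \<Rightarrow> 'p) \<Rightarrow> ('a \<Rightarrow> 'b) \<Rightarrow> bool" where
  "fully_faithful H G \<Psi>0 \<Psi>1 \<longleftrightarrow>
     groupoid_morphism H G \<Psi>0 \<Psi>1 \<and>
     homeomorphic_map (garr H)
       (subtopology (prod_topology (prod_topology (gobj H) (gobj H)) (garr G))
          {((x, y), g). gsrc G g = \<Psi>0 x \<and> gtgt G g = \<Psi>0 y})
       (\<lambda>a. ((gsrc H a, gtgt H a), \<Psi>1 a))"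

definition openly_surjective ::
  "('o, 'a) tgroupoid \<Rightarrow> ('p, 'b) tgroupoid \<Rightarrow> ('o \<Rightarrow> 'p) \<Rightarrow> bool" where
  "openly_surjective H G \<Psi>0 \<longleftrightarrow>
     open_map (subtopology (prod_topology (gobj H) (garr G)) {(x, g). \<Psi>0 x = gtgt G g}) (gobj G)
       (\<lambda>z. gsrc G (snd z)) \<and>
     (\<forall>y\<in>topspace (gobj G). \<exists>x\<in>topspace (gobj H). \<exists>g\<in>topspace (garr G). \<Psi>0 x = gtgt G g \<and> gsrc G g = y)"

lemma morita_morphism_iff:
  assumes "topological_groupoid G"
  shows "morita_morphism H G \<Psi>0 \<Psi>1 \<longleftrightarrow> fully_faithful H G \<Psi>0 \<Psi>1 \<and> openly_surjective H G \<Psi>0"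
proof -
  interpret topgpd G by unfold_locales fact
  have "(\<lambda>z. gsrc G (snd z)) ` topspace (subtopology (prod_topology (gobj H) (garr G)) {(x, g). \<Psi>0 x = gtgt G g})
      = topspace (gobj G) \<longleftrightarrow>
     (\<forall>y\<in>topspace (gobj G). \<exists>x\<in>topspace (gobj H). \<exists>g\<in>topspace (garr G). \<Psi>0 x = gtgt G g \<and> gsrc G g = y)"
    (is "?l \<longleftrightarrow> ?r")
  proof
    assume ?l
    show ?r
    proof
      fix y assume "y \<in> topspace (gobj G)"
      with \<open>?l\<close> have "y \<in> (\<lambda>z. gsrc G (snd z)) ` topspace (subtopology (prod_topology (gobj H) (garr G)) {(x, g). \<Psi>0 x = gtgt G g})"
        by simp
      then show "\<exists>x\<in>topspace (gobj H). \<exists>g\<in>topspace (garr G). \<Psi>0 x = gtgt G g \<and> gsrc G g = y" by force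
    qed
  qed (force simp: image_iff)
  then show ?thesis
    by (auto simp: morita_morphism_def fully_faithful_def openly_surjective_def Let_def case_prod_unfold)
qed

locale gpd_hom = H: topgpd H + G: topgpd G
  for H :: "('o, 'a) tgroupoid" and G :: "('p, 'b) tgroupoid" +
  fixes \<Psi>0 :: "'o \<Rightarrow> 'p" and \<Psi>1 :: "'a \<Rightarrow> 'b"
  assumes hom: "groupoid_morphism H G \<Psi>0 \<Psi>1"
begin

lemma cm_hom0: "continuous_map Z (gobj H) u \<Longrightarrow> continuous_map Z (gobj G) (\<lambda>z. \<Psi>0 (u z))"
  and cm_hom1: "continuous_map Z (garr H) f \<Longrightarrow> continuous_map Z (garr G) (\<lambda>z. \<Psi>1 (f z))"
  using hom unfolding groupoid_morphism_def by (auto intro: cm_comp[of _ _ \<Psi>0] cm_comp[of _ _ \<Psi>1])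

lemma hom0_closed [simp]: "x \<in> topspace (gobj H) \<Longrightarrow> \<Psi>0 x \<in> topspace (gobj G)"
  and hom1_closed [simp]: "a \<in> topspace (garr H) \<Longrightarrow> \<Psi>1 a \<in> topspace (garr G)"
  using hom unfolding groupoid_morphism_def
  by (auto dest!: continuous_map_image_subset_topspace)

lemma src_hom [simp]: "a \<in> topspace (garr H) \<Longrightarrow> gsrc G (\<Psi>1 a) = \<Psi>0 (gsrc H a)"
  and tgt_hom [simp]: "a \<in> topspace (garr H) \<Longrightarrow> gtgt G (\<Psi>1 a) = \<Psi>0 (gtgt H a)"
  and hom_inv [simp]: "a \<in> topspace (garr H) \<Longrightarrow> \<Psi>1 (ginv H a) = ginv G (\<Psi>1 a)"
  and hom_id [simp]: "x \<in> topspace (gobj H) \<Longrightarrow> \<Psi>1 (gid H x) = gid G (\<Psi>0 x)"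
  using hom by (simp_all add: groupoid_morphism_def)

lemma hom_mul [simp]:
  "a \<in> topspace (garr H) \<Longrightarrow> b \<in> topspace (garr H) \<Longrightarrow> gtgt H a = gsrc H b \<Longrightarrow>
     \<Psi>1 (gmul H a b) = gmul G (\<Psi>1 a) (\<Psi>1 b)"
  using hom by (simp add: groupoid_morphism_def composable_def Ball_def)

lemmas cm_morphism = cm_hom0 cm_hom1

end

text \<open>For every functor below the inverse \<open>\<theta>\<close> on the fibre product has an
  explicit formula, so the homeomorphism reduces to the continuity of that formula and two
  identities.\<close>

lemma fully_faithfulI:
  assumes "topological_groupoid H" "topological_groupoid G" "groupoid_morphism H G \<Psi>0 \<Psi>1"
    and \<theta>: "continuous_map (subtopology (prod_topology (prod_topology (gobj H) (gobj H)) (garr G))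
          {((x, y), g). gsrc G g = \<Psi>0 x \<and> gtgt G g = \<Psi>0 y}) (garr H) \<theta>"
    and inv: "\<And>x y g. x \<in> topspace (gobj H) \<Longrightarrow> y \<in> topspace (gobj H) \<Longrightarrow> g \<in> topspace (garr G) \<Longrightarrow>
        gsrc G g = \<Psi>0 x \<Longrightarrow> gtgt G g = \<Psi>0 y \<Longrightarrow>
        gsrc H (\<theta> ((x, y), g)) = x \<and> gtgt H (\<theta> ((x, y), g)) = y \<and> \<Psi>1 (\<theta> ((x, y), g)) = g"
    and inv': "\<And>a. a \<in> topspace (garr H) \<Longrightarrow> \<theta> ((gsrc H a, gtgt H a), \<Psi>1 a) = a"
  shows "fully_faithful H G \<Psi>0 \<Psi>1"
proof -
  interpret gpd_hom H G \<Psi>0 \<Psi>1 by unfold_locales fact+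
  show ?thesis
    unfolding fully_faithful_def homeomorphic_map_maps homeomorphic_maps_def
  proof (intro conjI exI[of _ \<theta>] ballI)
    show "continuous_map (garr H) (subtopology (prod_topology (prod_topology (gobj H) (gobj H)) (garr G))
          {((x, y), g). gsrc G g = \<Psi>0 x \<and> gtgt G g = \<Psi>0 y}) (\<lambda>a. ((gsrc H a, gtgt H a), \<Psi>1 a))"
      by (intro cm_intros H.cm_structure cm_morphism) auto
  qed (use assms in auto)
qed

locale ff_hom = gpd_hom H G \<Psi>0 \<Psi>1
  for H :: "('o, 'a) tgroupoid" and G :: "('p, 'b) tgroupoid" and \<Psi>0 \<Psi>1 +
  assumes ff: "fully_faithful H G \<Psi>0 \<Psi>1"
begin

definition lift :: "('o \<times> 'o) \<times> 'b \<Rightarrow> 'a" where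
  "lift = (SOME \<theta>. homeomorphic_maps (garr H)
       (subtopology (prod_topology (prod_topology (gobj H) (gobj H)) (garr G))
          {((x, y), g). gsrc G g = \<Psi>0 x \<and> gtgt G g = \<Psi>0 y})
       (\<lambda>a. ((gsrc H a, gtgt H a), \<Psi>1 a)) \<theta>)"

lemma lift_maps: "homeomorphic_maps (garr H)
       (subtopology (prod_topology (prod_topology (gobj H) (gobj H)) (garr G))
          {((x, y), g). gsrc G g = \<Psi>0 x \<and> gtgt G g = \<Psi>0 y})
       (\<lambda>a. ((gsrc H a, gtgt H a), \<Psi>1 a)) lift"
  using ff unfolding fully_faithful_def homeomorphic_map_maps lift_def
  by (elim conjE) (erule someI_ex)

lemma
  assumes "x \<in> topspace (gobj H)" "y \<in> topspace (gobj H)" "g \<in> topspace (garr G)"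
    "gsrc G g = \<Psi>0 x" "gtgt G g = \<Psi>0 y"
  shows src_lift [simp]: "gsrc H (lift ((x, y), g)) = x"
    and tgt_lift [simp]: "gtgt H (lift ((x, y), g)) = y"
    and hom_lift [simp]: "\<Psi>1 (lift ((x, y), g)) = g"
    and lift_closed [simp]: "lift ((x, y), g) \<in> topspace (garr H)"
proof -
  have z: "((x, y), g) \<in> topspace (subtopology (prod_topology (prod_topology (gobj H) (gobj H)) (garr G))
          {((x, y), g). gsrc G g = \<Psi>0 x \<and> gtgt G g = \<Psi>0 y})"
    using assms by auto
  show "lift ((x, y), g) \<in> topspace (garr H)"
    using lift_maps z unfolding homeomorphic_maps_def continuous_map by blast
  show "gsrc H (lift ((x, y), g)) = x" "gtgt H (lift ((x, y), g)) = y" "\<Psi>1 (lift ((x, y), g)) = g"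
    using lift_maps z unfolding homeomorphic_maps_def by blast+
qed

lemma lift_hom [simp]: "a \<in> topspace (garr H) \<Longrightarrow> lift ((gsrc H a, gtgt H a), \<Psi>1 a) = a"
  using lift_maps unfolding homeomorphic_maps_def by blast

lemma lift_hom' [simp]:
  "a \<in> topspace (garr H) \<Longrightarrow> gsrc H a = x \<Longrightarrow> gtgt H a = y \<Longrightarrow> lift ((x, y), \<Psi>1 a) = a"
  by auto

lemma faithful:
  "a \<in> topspace (garr H) \<Longrightarrow> b \<in> topspace (garr H) \<Longrightarrow> gsrc H a = gsrc H b \<Longrightarrow> gtgt H a = gtgt H b \<Longrightarrow>
     \<Psi>1 a = \<Psi>1 b \<Longrightarrow> a = b"
  by (drule lift_hom, drule lift_hom) metis

lemma cm_lift:
  assumes "continuous_map Z (gobj H) x" "continuous_map Z (gobj H) y" "continuous_map Z (garr G) g"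
    "\<And>z. z \<in> topspace Z \<Longrightarrow> gsrc G (g z) = \<Psi>0 (x z)" "\<And>z. z \<in> topspace Z \<Longrightarrow> gtgt G (g z) = \<Psi>0 (y z)"
  shows "continuous_map Z (garr H) (\<lambda>z. lift ((x z, y z), g z))"
proof -
  have "continuous_map (subtopology (prod_topology (prod_topology (gobj H) (gobj H)) (garr G))
          {((x, y), g). gsrc G g = \<Psi>0 x \<and> gtgt G g = \<Psi>0 y}) (garr H) lift"
    using lift_maps unfolding homeomorphic_maps_def by blast
  then show ?thesis
    by (rule cm_comp) (rule cm_into_sub cm_pair assms | use assms in auto)+
qed

end

locale morita_hom = ff_hom +
  assumes os: "openly_surjective H G \<Psi>0"

lemma morita_homI:
  assumes "topological_groupoid H" "topological_groupoid G" "morita_morphism H G \<Psi>0 \<Psi>1"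
  shows "morita_hom H G \<Psi>0 \<Psi>1"
  using assms morita_morphism_iff[OF assms(2), of H \<Psi>0 \<Psi>1]
  by (auto simp: morita_hom_def ff_hom_def gpd_hom_def morita_hom_axioms_def ff_hom_axioms_def
      gpd_hom_axioms_def topgpd_def fully_faithful_def)

lemma morita_homD:
  assumes "morita_hom H G \<Psi>0 \<Psi>1"
  shows "morita_morphism H G \<Psi>0 \<Psi>1" "topological_groupoid H" "topological_groupoid G"
proof -
  interpret morita_hom H G \<Psi>0 \<Psi>1 by fact
  show "morita_morphism H G \<Psi>0 \<Psi>1" using ff os morita_morphism_iff[OF G.tg] by blast
  show "topological_groupoid H" "topological_groupoid G" by (rule H.tg G.tg)+
qed

lemma groupoid_morphismI:
  assumes "continuous_map (gobj H) (gobj G) \<Psi>0" "continuous_map (garr H) (garr G) \<Psi>1"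
    "\<And>a. a \<in> topspace (garr H) \<Longrightarrow> gsrc G (\<Psi>1 a) = \<Psi>0 (gsrc H a) \<and> gtgt G (\<Psi>1 a) = \<Psi>0 (gtgt H a) \<and>
        \<Psi>1 (ginv H a) = ginv G (\<Psi>1 a)"
    "\<And>x. x \<in> topspace (gobj H) \<Longrightarrow> \<Psi>1 (gid H x) = gid G (\<Psi>0 x)"
    "\<And>a b. a \<in> topspace (garr H) \<Longrightarrow> b \<in> topspace (garr H) \<Longrightarrow> gtgt H a = gsrc H b \<Longrightarrow>
        \<Psi>1 (gmul H a b) = gmul G (\<Psi>1 a) (\<Psi>1 b)"
  shows "groupoid_morphism H G \<Psi>0 \<Psi>1"
  using assms unfolding groupoid_morphism_def composable_def by auto

context morita_hom
begin

lemma hom_continuous: "continuous_map (gobj H) (gobj G) \<Psi>0" "continuous_map (garr H) (garr G) \<Psi>1"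
  using hom by (simp_all add: groupoid_morphism_def)

lemma os_open:
  "open_map (subtopology (prod_topology (gobj H) (garr G)) {(x, g). \<Psi>0 x = gtgt G g}) (gobj G)
     (\<lambda>z. gsrc G (snd z))"
  using os by (simp add: openly_surjective_def)

lemma os_surj:
  assumes "y \<in> topspace (gobj G)"
  obtains x g where "x \<in> topspace (gobj H)" "g \<in> topspace (garr G)" "\<Psi>0 x = gtgt G g" "gsrc G g = y"
  using os assms unfolding openly_surjective_def by auto

text \<open>
  The arrows of \<open>H\<close> are the triples \<open>((x, y), g)\<close> with \<open>g : \<Psi>0 x \<rightarrow> \<Psi>0 y\<close>, so the source
  map is a pullback of the open map \<open>(y, g) \<mapsto> gsrc g\<close>.
\<close>

lemma src_open: "open_map (garr H) (gobj H) (gsrc H)"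
proof -
  let ?P = "subtopology (prod_topology (gobj H) (garr G)) {(x, g). \<Psi>0 x = gtgt G g}"
  let ?Q = "subtopology (prod_topology ?P (gobj H)) {(a, x). gsrc G (snd a) = \<Psi>0 x}"
  have op: "open_map ?Q (gobj H) snd"
    by (rule open_map_pullback[OF os_open hom_continuous(1)])
  show ?thesis
  proof (rule open_map_factor[OF op, of _ "\<lambda>z. lift ((snd z, fst (fst z)), snd (fst z))"])
    show "continuous_map ?Q (garr H) (\<lambda>z. lift ((snd z, fst (fst z)), snd (fst z)))"
      unfolding flatten_topology by (intro cm_lift cm_intros) (rule cm_id | (auto; fail))+
    show "\<exists>z\<in>topspace ?Q. lift ((snd z, fst (fst z)), snd (fst z)) = a" if "a \<in> topspace (garr H)" for a
      using that by (intro bexI[of _ "((gtgt H a, \<Psi>1 a), gsrc H a)"]) auto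
  qed auto
qed

end

lemma fully_faithful_compose:
  assumes "ff_hom K H \<Phi>0 \<Phi>1" "ff_hom H G \<Psi>0 \<Psi>1"
  shows "ff_hom K G (\<lambda>x. \<Psi>0 (\<Phi>0 x)) (\<lambda>a. \<Psi>1 (\<Phi>1 a))"
proof -
  interpret A: ff_hom K H \<Phi>0 \<Phi>1 by fact
  interpret B: ff_hom H G \<Psi>0 \<Psi>1 by fact
  have hom: "groupoid_morphism K G (\<lambda>x. \<Psi>0 (\<Phi>0 x)) (\<lambda>a. \<Psi>1 (\<Phi>1 a))"
    by (intro groupoid_morphismI B.cm_morphism A.cm_morphism cm_id) auto
  have "fully_faithful K G (\<lambda>x. \<Psi>0 (\<Phi>0 x)) (\<lambda>a. \<Psi>1 (\<Phi>1 a))"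
  proof (rule fully_faithfulI[of _ _ _ _ "\<lambda>z. A.lift (fst z, B.lift ((\<Phi>0 (fst (fst z)), \<Phi>0 (snd (fst z))), snd z))"])
    show "continuous_map (subtopology (prod_topology (prod_topology (gobj K) (gobj K)) (garr G))
          {((x, y), g). gsrc G g = \<Psi>0 (\<Phi>0 x) \<and> gtgt G g = \<Psi>0 (\<Phi>0 y)}) (garr K)
        (\<lambda>z. A.lift (fst z, B.lift ((\<Phi>0 (fst (fst z)), \<Phi>0 (snd (fst z))), snd z)))"
      unfolding flatten_topology
      by (subst prod.collapse[symmetric], intro A.cm_lift B.cm_lift A.cm_hom0 cm_intros) (rule cm_id | (auto; fail))+
  qed (use hom A.H.tg B.G.tg in auto)
  then show ?thesis
    by unfold_locales (use hom in auto)
qed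

text \<open>An arrow \<open>g\<close> from \<open>y\<close> to \<open>\<Psi>0 x\<close> and an arrow
  \<open>h\<close> from \<open>x\<close> to \<open>\<Phi>0 k\<close> give the arrow
  \<open>g \<cdot> \<Psi>1 h\<close> from \<open>y\<close> to the image of \<open>k\<close>. The
  space of such pairs is a pullback, so its map to the objects of \<open>G\<close> is open. All test
  arrows of the composite arise in this way, with \<open>h\<close> an identity, and openness
  descends.\<close>

lemma morita_compose:
  assumes "morita_hom K H \<Phi>0 \<Phi>1" "morita_hom H G \<Psi>0 \<Psi>1"
  shows "morita_hom K G (\<lambda>x. \<Psi>0 (\<Phi>0 x)) (\<lambda>a. \<Psi>1 (\<Phi>1 a))"
proof -
  interpret A: morita_hom K H \<Phi>0 \<Phi>1 by fact
  interpret B: morita_hom H G \<Psi>0 \<Psi>1 by fact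
  interpret C: ff_hom K G "\<lambda>x. \<Psi>0 (\<Phi>0 x)" "\<lambda>a. \<Psi>1 (\<Phi>1 a)"
    by (rule fully_faithful_compose) unfold_locales
  let ?PA = "subtopology (prod_topology (gobj K) (garr H)) {(x, g). \<Phi>0 x = gtgt H g}"
  let ?PB = "subtopology (prod_topology (gobj H) (garr G)) {(x, g). \<Psi>0 x = gtgt G g}"
  let ?Z = "subtopology (prod_topology ?PA ?PB) {(a, b). gsrc H (snd a) = fst b}"
  have "continuous_map ?PB (gobj H) fst"
    by (intro continuous_map_from_subtopology continuous_map_fst)
  from open_map_comp[OF B.os_open open_map_pullback[OF A.os_open this]]
  have op: "open_map ?Z (gobj G) (\<lambda>z. gsrc G (snd (snd z)))" .
  have "openly_surjective K G (\<lambda>x. \<Psi>0 (\<Phi>0 x))"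
    unfolding openly_surjective_def
  proof (intro conjI ballI)
    show "open_map (subtopology (prod_topology (gobj K) (garr G)) {(x, g). \<Psi>0 (\<Phi>0 x) = gtgt G g}) (gobj G)
       (\<lambda>z. gsrc G (snd z))" (is "open_map ?P _ _")
    proof (rule open_map_factor[OF op, of _ "\<lambda>z. (fst (fst z), gmul G (snd (snd z)) (\<Psi>1 (snd (fst z))))"])
      show "continuous_map ?Z ?P (\<lambda>z. (fst (fst z), gmul G (snd (snd z)) (\<Psi>1 (snd (fst z)))))"
        unfolding flatten_topology by (intro cm_intros B.G.cm_mul B.cm_hom1) (rule cm_id | (auto; fail))+
      fix x assume "x \<in> topspace ?P"
      then show "\<exists>z\<in>topspace ?Z. (fst (fst z), gmul G (snd (snd z)) (\<Psi>1 (snd (fst z)))) = x"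
        by (intro bexI[of _ "((fst x, gid H (\<Phi>0 (fst x))), (\<Phi>0 (fst x), snd x))"]) auto
    qed auto
    fix y assume "y \<in> topspace (gobj G)"
    then obtain x g where 1: "x \<in> topspace (gobj H)" "g \<in> topspace (garr G)" "\<Psi>0 x = gtgt G g" "gsrc G g = y"
      by (rule B.os_surj)
    obtain k h where 2: "k \<in> topspace (gobj K)" "h \<in> topspace (garr H)" "\<Phi>0 k = gtgt H h" "gsrc H h = x"
      by (rule A.os_surj[OF 1(1)])
    show "\<exists>k\<in>topspace (gobj K). \<exists>g\<in>topspace (garr G). \<Psi>0 (\<Phi>0 k) = gtgt G g \<and> gsrc G g = y"
      using 1 2 by (intro bexI[of _ k] bexI[of _ "gmul G g (\<Psi>1 h)"]) auto
  qed
  then show ?thesis by unfold_locales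
qed

text \<open>The map \<open>(x, g) \<mapsto> gsrc g\<close> is the projection to \<open>g\<close>, a
  base change of \<open>\<Psi>0\<close>, followed by the source map. With both open, essential
  surjectivity only has to be checked point by point; the weak pullback and the twisted sectors are
  treated in this way.\<close>

lemma (in ff_hom) morita_homI_open:
  assumes "open_map (gobj H) (gobj G) \<Psi>0" "open_map (garr G) (gobj G) (gsrc G)"
    and "\<And>y. y \<in> topspace (gobj G) \<Longrightarrow>
      \<exists>x\<in>topspace (gobj H). \<exists>g\<in>topspace (garr G). \<Psi>0 x = gtgt G g \<and> gsrc G g = y"
  shows "morita_hom H G \<Psi>0 \<Psi>1"
proof unfold_locales
  have "open_map (subtopology (prod_topology (gobj H) (garr G)) {(x, g). \<Psi>0 x = gtgt G g}) (gobj G)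
     (\<lambda>z. gsrc G (snd z))"
    by (rule open_map_comp[OF assms(2) open_map_pullback[OF assms(1) G.structure_continuous(2)]])
  then show "openly_surjective H G \<Psi>0"
    using assms(3) by (simp add: openly_surjective_def)
qed


section \<open>Isomorphisms of topological groupoids\<close>

text \<open>Only \<open>H\<close> is assumed to be a topological groupoid; the axioms for
  \<open>G\<close> are transported. This suits the fixed loop groupoid, whose operations are
  definite descriptions over classes and whose axioms would be awkward to verify directly.\<close>

locale gpd_iso = H: topgpd H
  for H :: "('o, 'a) tgroupoid" +
  fixes G :: "('p, 'b) tgroupoid" and u :: "'o \<Rightarrow> 'p" and f :: "'a \<Rightarrow> 'b" and u' f'
  assumes u: "homeomorphic_maps (gobj H) (gobj G) u u'" and f: "homeomorphic_maps (garr H) (garr G) f f'"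
    and src: "\<And>a. a \<in> topspace (garr H) \<Longrightarrow> gsrc G (f a) = u (gsrc H a)"
    and tgt: "\<And>a. a \<in> topspace (garr H) \<Longrightarrow> gtgt G (f a) = u (gtgt H a)"
    and inv: "\<And>a. a \<in> topspace (garr H) \<Longrightarrow> ginv G (f a) = f (ginv H a)"
    and idt: "\<And>x. x \<in> topspace (gobj H) \<Longrightarrow> gid G (u x) = f (gid H x)"
    and mul: "\<And>a b. a \<in> topspace (garr H) \<Longrightarrow> b \<in> topspace (garr H) \<Longrightarrow> gtgt H a = gsrc H b \<Longrightarrow>
        gmul G (f a) (f b) = f (gmul H a b)"
begin

lemma
  shows cm_u: "continuous_map Z (gobj H) p \<Longrightarrow> continuous_map Z (gobj G) (\<lambda>z. u (p z))"
    and cm_u': "continuous_map Z (gobj G) q \<Longrightarrow> continuous_map Z (gobj H) (\<lambda>z. u' (q z))"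
    and cm_f: "continuous_map Z (garr H) r \<Longrightarrow> continuous_map Z (garr G) (\<lambda>z. f (r z))"
    and cm_f': "continuous_map Z (garr G) s \<Longrightarrow> continuous_map Z (garr H) (\<lambda>z. f' (s z))"
  using u f unfolding homeomorphic_maps_def
  by (auto intro: cm_comp[of _ _ u] cm_comp[of _ _ f] cm_comp[of _ _ u'] cm_comp[of _ _ f'])

lemma u'_u [simp]: "x \<in> topspace (gobj H) \<Longrightarrow> u' (u x) = x"
  and u_u' [simp]: "y \<in> topspace (gobj G) \<Longrightarrow> u (u' y) = y"
  and f'_f [simp]: "a \<in> topspace (garr H) \<Longrightarrow> f' (f a) = a"
  and f_f' [simp]: "b \<in> topspace (garr G) \<Longrightarrow> f (f' b) = b"
  using u f by (simp_all add: homeomorphic_maps_def)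

lemma u_closed [simp]: "x \<in> topspace (gobj H) \<Longrightarrow> u x \<in> topspace (gobj G)"
  and u'_closed [simp]: "y \<in> topspace (gobj G) \<Longrightarrow> u' y \<in> topspace (gobj H)"
  and f_closed [simp]: "a \<in> topspace (garr H) \<Longrightarrow> f a \<in> topspace (garr G)"
  and f'_closed [simp]: "b \<in> topspace (garr G) \<Longrightarrow> f' b \<in> topspace (garr H)"
  using u f unfolding homeomorphic_maps_def by (auto dest!: continuous_map_image_subset_topspace)

lemma arr_cases:
  assumes "b \<in> topspace (garr G)"
  obtains a where "a \<in> topspace (garr H)" "b = f a"
  using assms that[of "f' b"] by simp

lemma obj_cases:
  assumes "y \<in> topspace (gobj G)"
  obtains x where "x \<in> topspace (gobj H)" "y = u x"
  using assms that[of "u' y"] by simp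

lemma u_inj: "x \<in> topspace (gobj H) \<Longrightarrow> y \<in> topspace (gobj H) \<Longrightarrow> u x = u y \<longleftrightarrow> x = y"
  by (metis u'_u)

lemma groupoid: "topological_groupoid G"
proof (rule topological_groupoidI)
  have "continuous_map (garr G) (gobj G) (\<lambda>b. u (gsrc H (f' b)))"
    by (intro cm_u H.cm_src cm_f' cm_id)
  then show "continuous_map (garr G) (gobj G) (gsrc G)"
    by (rule continuous_map_eq) (use src in \<open>auto elim!: arr_cases\<close>)
  have "continuous_map (garr G) (gobj G) (\<lambda>b. u (gtgt H (f' b)))"
    by (intro cm_u H.cm_tgt cm_f' cm_id)
  then show "continuous_map (garr G) (gobj G) (gtgt G)"
    by (rule continuous_map_eq) (use tgt in \<open>auto elim!: arr_cases\<close>)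
  have "continuous_map (garr G) (garr G) (\<lambda>b. f (ginv H (f' b)))"
    by (intro cm_f H.cm_inv cm_f' cm_id)
  then show "continuous_map (garr G) (garr G) (ginv G)"
    by (rule continuous_map_eq) (use inv in \<open>auto elim!: arr_cases\<close>)
  have "continuous_map (gobj G) (garr G) (\<lambda>b. f (gid H (u' b)))"
    by (intro cm_f H.cm_gid cm_u' cm_id)
  then show "continuous_map (gobj G) (garr G) (gid G)"
    by (rule continuous_map_eq) (use idt in \<open>auto elim!: obj_cases\<close>)
  let ?Z = "subtopology (prod_topology (garr G) (garr G)) {z. gtgt G (fst z) = gsrc G (snd z)}"
  have comp: "gtgt H (f' a) = gsrc H (f' b)"
    if "a \<in> topspace (garr G)" "b \<in> topspace (garr G)" "gtgt G a = gsrc G b" for a b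
    using that tgt[of "f' a"] src[of "f' b"] u_inj[of "gtgt H (f' a)" "gsrc H (f' b)"] by simp
  have "continuous_map ?Z (garr G) (\<lambda>z. f (gmul H (f' (fst z)) (f' (snd z))))"
    by (intro cm_f H.cm_mul cm_f' cm_fst cm_snd) (rule cm_id | (use comp in \<open>auto; fail\<close>))+
  then show "continuous_map ?Z (garr G) (\<lambda>z. gmul G (fst z) (snd z))"
  proof (rule continuous_map_eq)
    fix z assume "z \<in> topspace ?Z"
    then have "fst z \<in> topspace (garr G)" "snd z \<in> topspace (garr G)" "gtgt G (fst z) = gsrc G (snd z)"
      by auto
    then show "f (gmul H (f' (fst z)) (f' (snd z))) = gmul G (fst z) (snd z)"
      using comp[of "fst z" "snd z"] mul[of "f' (fst z)" "f' (snd z)"] by simp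
  qed
  show "gsrc G (gid G x) = x \<and> gtgt G (gid G x) = x" if "x \<in> topspace (gobj G)" for x
    using that by (auto elim!: obj_cases simp: idt src tgt)
  show "gsrc G (gmul G a b) = gsrc G a \<and> gtgt G (gmul G a b) = gtgt G b"
    if "a \<in> topspace (garr G)" "b \<in> topspace (garr G)" "gtgt G a = gsrc G b" for a b
    using that by (auto elim!: arr_cases simp: mul src tgt u_inj)
  show "gmul G (gmul G a b) c = gmul G a (gmul G b c)"
    if "a \<in> topspace (garr G)" "b \<in> topspace (garr G)" "c \<in> topspace (garr G)"
      "gtgt G a = gsrc G b" "gtgt G b = gsrc G c" for a b c
    using that by (auto elim!: arr_cases simp: mul src tgt u_inj)
  show "gmul G (gid G (gsrc G a)) a = a \<and> gmul G a (gid G (gtgt G a)) = a \<and>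
        gsrc G (ginv G a) = gtgt G a \<and> gtgt G (ginv G a) = gsrc G a \<and>
        gmul G a (ginv G a) = gid G (gsrc G a) \<and> gmul G (ginv G a) a = gid G (gtgt G a)"
    if "a \<in> topspace (garr G)" for a
    using that by (auto elim!: arr_cases simp: mul src tgt inv idt u_inj)
qed

lemma ff: "ff_hom H G u f"
proof -
  interpret G: topgpd G by unfold_locales (rule groupoid)
  have hom: "groupoid_morphism H G u f"
    by (intro groupoid_morphismI cm_u cm_f cm_id) (auto simp: src tgt inv idt mul)
  have "fully_faithful H G u f"
  proof (rule fully_faithfulI[of _ _ _ _ "\<lambda>z. f' (snd z)"])
    show "continuous_map (subtopology (prod_topology (prod_topology (gobj H) (gobj H)) (garr G))
      {((x, y), g). gsrc G g = u x \<and> gtgt G g = u y}) (garr H) (\<lambda>z. f' (snd z))"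
      by (intro cm_f' cm_snd) (rule cm_id)
  qed (use hom groupoid H.tg in \<open>auto elim!: arr_cases simp: src tgt u_inj\<close>)
  with hom show ?thesis by unfold_locales
qed

end

text \<open>An isomorphism is itself a Morita morphism only if the source maps are open, which is
  not known here. A Morita morphism followed by an isomorphism is one nevertheless, since its open
  map is merely followed by the homeomorphism \<open>u\<close>.\<close>

lemma morita_compose_iso:
  assumes "morita_hom K H \<Phi>0 \<Phi>1" "gpd_iso H G u f u' f'"
  shows "morita_hom K G (\<lambda>x. u (\<Phi>0 x)) (\<lambda>a. f (\<Phi>1 a))"
proof -
  interpret A: morita_hom K H \<Phi>0 \<Phi>1 by fact
  interpret B: gpd_iso H G u f u' f' by fact
  interpret C: ff_hom K G "\<lambda>x. u (\<Phi>0 x)" "\<lambda>a. f (\<Phi>1 a)"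
    by (rule fully_faithful_compose[OF _ B.ff]) unfold_locales
  let ?PA = "subtopology (prod_topology (gobj K) (garr H)) {(x, g). \<Phi>0 x = gtgt H g}"
  have u: "open_map (gobj H) (gobj G) u"
    using B.u homeomorphic_maps_map homeomorphic_imp_open_map by metis
  have "openly_surjective K G (\<lambda>x. u (\<Phi>0 x))"
    unfolding openly_surjective_def
  proof (intro conjI ballI)
    show "open_map (subtopology (prod_topology (gobj K) (garr G)) {(x, g). u (\<Phi>0 x) = gtgt G g}) (gobj G)
       (\<lambda>z. gsrc G (snd z))" (is "open_map ?P _ _")
    proof (rule open_map_factor[OF open_map_comp[OF u A.os_open], of _ "\<lambda>z. (fst z, f (snd z))"])
      show "continuous_map ?PA ?P (\<lambda>z. (fst z, f (snd z)))"
        by (intro cm_intros B.cm_f) (rule cm_id | (auto simp: B.tgt; fail))+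
      fix x assume "x \<in> topspace ?P"
      then show "\<exists>z\<in>topspace ?PA. (fst z, f (snd z)) = x"
        by (intro bexI[of _ "(fst x, f' (snd x))"]) (auto elim!: B.arr_cases simp: B.tgt B.u_inj)
    qed (auto simp: B.src)
    fix y assume "y \<in> topspace (gobj G)"
    then obtain x where x: "x \<in> topspace (gobj H)" "y = u x" by (rule B.obj_cases)
    obtain k h where 2: "k \<in> topspace (gobj K)" "h \<in> topspace (garr H)" "\<Phi>0 k = gtgt H h" "gsrc H h = x"
      by (rule A.os_surj[OF x(1)])
    show "\<exists>k\<in>topspace (gobj K). \<exists>g\<in>topspace (garr G). u (\<Phi>0 k) = gtgt G g \<and> gsrc G g = y"
      using x 2 by (intro bexI[of _ k] bexI[of _ "f h"]) (auto simp: B.src B.tgt)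
  qed
  then show ?thesis by unfold_locales
qed

lemma ff_homI:
  "topological_groupoid H \<Longrightarrow> topological_groupoid G \<Longrightarrow> fully_faithful H G \<Psi>0 \<Psi>1 \<Longrightarrow> ff_hom H G \<Psi>0 \<Psi>1"
  by unfold_locales (auto simp: fully_faithful_def)

text \<open>With \<open>m = a \<cdot> b\<close> this reads
  \<open>m \<cdot> inv (inv f \<cdot> m) = f\<close>. In the weak pullback it recovers the
  \<open>A\<close>-component of an arrow from the middle arrows at its two ends and its
  \<open>C\<close>-component.\<close>

lemma (in topgpd) mul_inv_conj_cancel:
  assumes "a \<in> topspace (garr G)" "b \<in> topspace (garr G)" "f \<in> topspace (garr G)"
    "gtgt G a = gsrc G b" "gsrc G f = gsrc G a"
  shows "gmul G a (gmul G b (ginv G (gmul G (ginv G f) (gmul G a b)))) = f"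
proof -
  define m where "m = gmul G a b"
  have m: "m \<in> topspace (garr G)" "gsrc G m = gsrc G a" "gtgt G m = gtgt G b"
    using assms by (simp_all add: m_def)
  have "gmul G a (gmul G b (gmul G (ginv G m) f)) = gmul G m (gmul G (ginv G m) f)"
    unfolding m_def(1) by (rule mul_assoc[symmetric]) (use assms m in \<open>simp_all flip: m_def\<close>)
  also have "\<dots> = f" by (rule mul_inv_cancel) (use m assms in simp_all)
  finally show ?thesis using assms m by (simp flip: m_def)
qed

section \<open>The inertia groupoid\<close>

text \<open>An arrow \<open>(h, l)\<close> records its source \<open>h\<close> and an arrow
  \<open>l\<close> of \<open>G\<close> starting at the base point of \<open>h\<close>. Its target is
  the conjugate of \<open>h\<close> by \<open>l\<close>, so no equation between automorphisms has to
  be stored.\<close>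

definition inertia :: "('o, 'a) tgroupoid \<Rightarrow> ('a, 'a \<times> 'a) tgroupoid" where
  "inertia G = \<lparr>
     gobj = subtopology (garr G) {h. gsrc G h = gtgt G h},
     garr = subtopology (prod_topology (garr G) (garr G)) {(h, l). gsrc G h = gtgt G h \<and> gsrc G l = gsrc G h},
     gsrc = fst,
     gtgt = (\<lambda>a. gmul G (ginv G (snd a)) (gmul G (fst a) (snd a))),
     gmul = (\<lambda>a b. (fst a, gmul G (snd a) (snd b))),
     ginv = (\<lambda>a. (gmul G (ginv G (snd a)) (gmul G (fst a) (snd a)), ginv G (snd a))),
     gid = (\<lambda>h. (h, gid G (gsrc G h))) \<rparr>"

lemma inertia_simps [simp]:
  "gobj (inertia G) = subtopology (garr G) {h. gsrc G h = gtgt G h}"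
  "garr (inertia G) =
     subtopology (prod_topology (garr G) (garr G)) {(h, l). gsrc G h = gtgt G h \<and> gsrc G l = gsrc G h}"
  "gsrc (inertia G) = fst"
  "gtgt (inertia G) = (\<lambda>a. gmul G (ginv G (snd a)) (gmul G (fst a) (snd a)))"
  "gmul (inertia G) = (\<lambda>a b. (fst a, gmul G (snd a) (snd b)))"
  "ginv (inertia G) = (\<lambda>a. (gmul G (ginv G (snd a)) (gmul G (fst a) (snd a)), ginv G (snd a)))"
  "gid (inertia G) = (\<lambda>h. (h, gid G (gsrc G h)))"
  by (simp_all add: inertia_def)

lemma (in topgpd) inertia_groupoid: "topological_groupoid (inertia G)"
proof (rule topological_groupoidI)
  show "continuous_map (garr (inertia G)) (gobj (inertia G)) (gsrc (inertia G))"
    by (simp add: continuous_map_in_subtopology continuous_map_from_subtopology continuous_map_fst) auto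
  show "continuous_map (garr (inertia G)) (gobj (inertia G)) (gtgt (inertia G))"
    unfolding inertia_simps flatten_topology
    by (intro cm_intros cm_structure) (rule cm_id | (auto; fail))+
  show "continuous_map (garr (inertia G)) (garr (inertia G)) (ginv (inertia G))"
    unfolding inertia_simps flatten_topology
    by (intro cm_intros cm_structure) (rule cm_id | (auto; fail))+
  show "continuous_map (gobj (inertia G)) (garr (inertia G)) (gid (inertia G))"
    unfolding inertia_simps flatten_topology
    by (intro cm_intros cm_structure) (rule cm_id | (auto; fail))+
  show "continuous_map (subtopology (prod_topology (garr (inertia G)) (garr (inertia G)))
      {z. gtgt (inertia G) (fst z) = gsrc (inertia G) (snd z)}) (garr (inertia G))
      (\<lambda>z. gmul (inertia G) (fst z) (snd z))"
    unfolding inertia_simps flatten_topology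
    by (intro cm_intros cm_structure) (rule cm_id | (auto dest!: arg_cong[where f="gsrc G"]; fail))+
qed (auto, (metis mul_assoc mul_closed src_mul tgt_mul)?)

text \<open>If \<open>l\<close> conjugates \<open>\<Psi>1 h\<close> to \<open>\<Psi>1 h'\<close>,
  then \<open>l\<close> must end at the base point of \<open>\<Psi>1 h'\<close>, because the
  conjugate starts where \<open>l\<close> ends. Hence \<open>l\<close> lifts to an arrow between the
  base points of \<open>h\<close> and \<open>h'\<close>, and by faithfulness the lift conjugates
  \<open>h\<close> to \<open>h'\<close>.\<close>

lemma inertia_ff:
  assumes "ff_hom H G \<Psi>0 \<Psi>1"
  shows "ff_hom (inertia H) (inertia G) \<Psi>1 (\<lambda>a. (\<Psi>1 (fst a), \<Psi>1 (snd a)))"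
proof -
  interpret ff_hom H G \<Psi>0 \<Psi>1 by fact
  have hom: "groupoid_morphism (inertia H) (inertia G) \<Psi>1 (\<lambda>a. (\<Psi>1 (fst a), \<Psi>1 (snd a)))"
  proof (rule groupoid_morphismI)
    show "continuous_map (gobj (inertia H)) (gobj (inertia G)) \<Psi>1"
      unfolding inertia_simps by (rule cm_into_sub[OF cm_hom1[OF cm_id(1)]]) auto
    show "continuous_map (garr (inertia H)) (garr (inertia G)) (\<lambda>a. (\<Psi>1 (fst a), \<Psi>1 (snd a)))"
      unfolding inertia_simps flatten_topology
      by (rule cm_into_sub cm_pair cm_hom1 cm_fst cm_snd cm_id(1) | (auto; fail))+
  qed auto
  have "fully_faithful (inertia H) (inertia G) \<Psi>1 (\<lambda>a. (\<Psi>1 (fst a), \<Psi>1 (snd a)))"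
  proof (rule fully_faithfulI[of _ _ _ _
      "\<lambda>z. (fst (fst z), lift ((gsrc H (fst (fst z)), gsrc H (snd (fst z))), snd (snd z)))"])
    have eq: "gtgt G l = \<Psi>0 (gsrc H h')"
      if "h' \<in> topspace (garr H)" "h \<in> topspace (garr H)" "l \<in> topspace (garr G)" "gsrc H h = gtgt H h"
        "gsrc G l = \<Psi>0 (gtgt H h)" "gmul G (ginv G l) (gmul G (\<Psi>1 h) l) = \<Psi>1 h'" for h h' l
    proof -
      have "gsrc G (gmul G (ginv G l) (gmul G (\<Psi>1 h) l)) = gtgt G l" using that(1-5) by simp
      then show ?thesis unfolding that(6) using that(1) by simp
    qed
    let ?Z = "subtopology (prod_topology (prod_topology (gobj (inertia H)) (gobj (inertia H))) (garr (inertia G)))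
        {((x, y), g). gsrc (inertia G) g = \<Psi>1 x \<and> gtgt (inertia G) g = \<Psi>1 y}"
    have side: "gtgt G (snd (snd z)) = \<Psi>0 (gsrc H (snd (fst z)))" if "z \<in> topspace ?Z" for z
    proof (rule eq)
      show "gmul G (ginv G (snd (snd z))) (gmul G (\<Psi>1 (fst (fst z))) (snd (snd z))) = \<Psi>1 (snd (fst z))"
        using that by auto
    qed (use that in auto)
    show "continuous_map ?Z (garr (inertia H))
        (\<lambda>z. (fst (fst z), lift ((gsrc H (fst (fst z)), gsrc H (snd (fst z))), snd (snd z))))"
      unfolding inertia_simps
    proof (intro cm_into_sub cm_pair cm_lift H.cm_src)
      fix z assume "z \<in> topspace (subtopology (prod_topology (prod_topology
         (subtopology (garr H) {h. gsrc H h = gtgt H h}) (subtopology (garr H) {h. gsrc H h = gtgt H h}))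
         (subtopology (prod_topology (garr G) (garr G)) {(h, l). gsrc G h = gtgt G h \<and> gsrc G l = gsrc G h}))
         {((x, y), g). fst g = \<Psi>1 x \<and> gmul G (ginv G (snd g)) (gmul G (fst g) (snd g)) = \<Psi>1 y})"
      then have z: "z \<in> topspace ?Z" by simp
      show "gtgt G (snd (snd z)) = \<Psi>0 (gsrc H (snd (fst z)))" by (rule side[OF z])
      show "(fst (fst z), lift ((gsrc H (fst (fst z)), gsrc H (snd (fst z))), snd (snd z)))
          \<in> {(h, l). gsrc H h = gtgt H h \<and> gsrc H l = gsrc H h}"
        using side[OF z] z by auto
    qed (unfold flatten_topology, (rule cm_fst cm_snd cm_id | (auto; fail))+)
    fix h h' g assume "h \<in> topspace (gobj (inertia H))" "h' \<in> topspace (gobj (inertia H))"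
      "g \<in> topspace (garr (inertia G))" "gsrc (inertia G) g = \<Psi>1 h" "gtgt (inertia G) g = \<Psi>1 h'"
    then obtain l where *: "g = (\<Psi>1 h, l)" "h \<in> topspace (garr H)" "h' \<in> topspace (garr H)"
        "gsrc H h = gtgt H h" "gsrc H h' = gtgt H h'" "l \<in> topspace (garr G)" "gsrc G l = \<Psi>0 (gtgt H h)"
        "gmul G (ginv G l) (gmul G (\<Psi>1 h) l) = \<Psi>1 h'"
      by (cases g) auto
    let ?l = "lift ((gsrc H h, gsrc H h'), l)"
    have **: "gtgt G l = \<Psi>0 (gsrc H h')" using eq * by blast
    have "gmul H (ginv H ?l) (gmul H h ?l) = h'"
      by (rule faithful) (use * ** in auto)
    then show "gsrc (inertia H) (fst (fst ((h, h'), g)), lift ((gsrc H (fst (fst ((h, h'), g))), gsrc H (snd (fst ((h, h'), g)))), snd (snd ((h, h'), g)))) = h \<and>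
       gtgt (inertia H) (fst (fst ((h, h'), g)), lift ((gsrc H (fst (fst ((h, h'), g))), gsrc H (snd (fst ((h, h'), g)))), snd (snd ((h, h'), g)))) = h' \<and>
       (\<Psi>1 (fst (fst (fst ((h, h'), g)), lift ((gsrc H (fst (fst ((h, h'), g))), gsrc H (snd (fst ((h, h'), g)))), snd (snd ((h, h'), g))))),
        \<Psi>1 (snd (fst (fst ((h, h'), g)), lift ((gsrc H (fst (fst ((h, h'), g))), gsrc H (snd (fst ((h, h'), g)))), snd (snd ((h, h'), g)))))) = g"
      using * ** by simp
  qed (use hom H.inertia_groupoid G.inertia_groupoid in auto)
  then show ?thesis by (intro ff_homI H.inertia_groupoid G.inertia_groupoid)
qed

text \<open>The source map \<open>(h, l) \<mapsto> h\<close> is the base change of the source map of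
  \<open>G\<close> along the map that sends an automorphism to its base point.\<close>

lemma (in topgpd) inertia_src_open:
  assumes "open_map (garr G) (gobj G) (gsrc G)"
  shows "open_map (garr (inertia G)) (gobj (inertia G)) (gsrc (inertia G))"
proof -
  let ?L = "subtopology (garr G) {h. gsrc G h = gtgt G h}"
  let ?Q = "subtopology (prod_topology (garr G) ?L) {(a, h). gsrc G a = gsrc G h}"
  have "continuous_map ?L (gobj G) (gsrc G)"
    by (intro continuous_map_from_subtopology structure_continuous)
  from open_map_pullback[OF assms this] have op: "open_map ?Q (gobj (inertia G)) snd" by simp
  show ?thesis
  proof (rule open_map_factor[OF op, of _ "\<lambda>z. (snd z, fst z)"])
    show "continuous_map ?Q (garr (inertia G)) (\<lambda>z. (snd z, fst z))"
      unfolding inertia_simps flatten_topology by (intro cm_intros) (rule cm_id | (auto; fail))+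
    fix a assume "a \<in> topspace (garr (inertia G))"
    then show "\<exists>z\<in>topspace ?Q. (snd z, fst z) = a"
      by (intro bexI[of _ "(snd a, fst a)"]) auto
  qed auto
qed

text \<open>
  An automorphism \<open>g\<close> of \<open>z\<close> and an arrow \<open>m : z \<rightarrow> \<Psi>0 y\<close> determine the conjugate of
  \<open>g\<close> by \<open>m\<close>, which lifts uniquely to an automorphism of \<open>y\<close>.
\<close>

lemma inertia_morita:
  assumes "morita_hom H G \<Psi>0 \<Psi>1"
  shows "morita_hom (inertia H) (inertia G) \<Psi>1 (\<lambda>a. (\<Psi>1 (fst a), \<Psi>1 (snd a)))"
proof -
  interpret morita_hom H G \<Psi>0 \<Psi>1 by fact
  let ?L = "subtopology (garr G) {h. gsrc G h = gtgt G h}"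
  let ?P = "subtopology (prod_topology (gobj H) (garr G)) {(x, g). \<Psi>0 x = gtgt G g}"
  let ?Q = "subtopology (prod_topology ?P ?L) {(a, h). gsrc G (snd a) = gsrc G h}"
  have "continuous_map ?L (gobj G) (gsrc G)"
    by (intro continuous_map_from_subtopology G.structure_continuous)
  from open_map_pullback[OF os_open this] have op: "open_map ?Q (gobj (inertia G)) snd" by simp
  let ?q = "\<lambda>z. (lift ((fst (fst z), fst (fst z)), gmul G (ginv G (snd (fst z))) (gmul G (snd z) (snd (fst z)))),
      (snd z, snd (fst z)))"
  have "openly_surjective (inertia H) (inertia G) \<Psi>1"
    unfolding openly_surjective_def
  proof (intro conjI ballI)
    show "open_map (subtopology (prod_topology (gobj (inertia H)) (garr (inertia G)))
        {(x, g). \<Psi>1 x = gtgt (inertia G) g}) (gobj (inertia G)) (\<lambda>z. gsrc (inertia G) (snd z))"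
      (is "open_map ?PI _ _")
    proof (rule open_map_factor[OF op, of _ ?q])
      show "continuous_map ?Q ?PI ?q"
        unfolding inertia_simps flatten_topology
        by (intro cm_intros cm_lift G.cm_structure) (rule cm_id | (auto; fail))+
      fix z assume "z \<in> topspace ?PI"
      then obtain h g l where *: "z = (h, (g, l))" "h \<in> topspace (garr H)" "gsrc H h = gtgt H h"
        "g \<in> topspace (garr G)" "l \<in> topspace (garr G)" "gsrc G g = gtgt G g" "gsrc G l = gtgt G g"
        "\<Psi>1 h = gmul G (ginv G l) (gmul G g l)"
        by (cases z) auto
      have "gsrc G (gmul G (ginv G l) (gmul G g l)) = gtgt G l" using *(2-7) by simp
      then have "gtgt G l = \<Psi>0 (gsrc H h)" unfolding *(8)[symmetric] using *(2) by simp
      then show "\<exists>w\<in>topspace ?Q. ?q w = z"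
        using *(1-7) by (intro bexI[of _ "((gsrc H h, l), g)"]) (auto simp flip: *(8))
    qed auto
    fix g assume "g \<in> topspace (gobj (inertia G))"
    then have g: "g \<in> topspace (garr G)" "gsrc G g = gtgt G g" by auto
    from g have "gtgt G g \<in> topspace (gobj G)" by simp
    then obtain y m where "y \<in> topspace (gobj H)" "m \<in> topspace (garr G)" "\<Psi>0 y = gtgt G m" "gsrc G m = gtgt G g"
      by (rule os_surj)
    note y = this
    define k where "k = gmul G (ginv G m) (gmul G g m)"
    have k: "k \<in> topspace (garr G)" "gsrc G k = \<Psi>0 y" "gtgt G k = \<Psi>0 y"
      using y g by (simp_all add: k_def)
    have "lift ((y, y), k) \<in> topspace (gobj (inertia H))" "(g, m) \<in> topspace (garr (inertia G))"
      using k y g by simp_all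
    moreover have "\<Psi>1 (lift ((y, y), k)) = gtgt (inertia G) (g, m)"
      using k y by (simp add: k_def)
    ultimately show "\<exists>x\<in>topspace (gobj (inertia H)). \<exists>a\<in>topspace (garr (inertia G)).
        \<Psi>1 x = gtgt (inertia G) a \<and> gsrc (inertia G) a = g"
      by (metis fst_conv inertia_simps(3))
  qed
  then show ?thesis
    by (intro morita_hom.intro morita_hom_axioms.intro inertia_ff) unfold_locales
qed


section \<open>The weak pullback of two Morita morphisms\<close>

locale weak_pullback = A: morita_hom A B F0 F1 + C: morita_hom C B E0 E1
  for A :: "('o, 'a) tgroupoid" and B :: "('p, 'b) tgroupoid" and C :: "('q, 'c) tgroupoid"
    and F0 F1 E0 E1
begin

text \<open>In \<open>(x, g, y)\<close> the middle entry is an arrow from \<open>F0 x\<close> to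
  \<open>E0 y\<close>. An arrow \<open>(a, g, c)\<close> stores the middle entry of its source only:
  the one at its target is forced by commutativity of the square and equals
  \<open>inv (F1 a) \<cdot> g \<cdot> E1 c\<close>. The construction joins two Morita morphisms with
  common target into a span.\<close>

definition wpb :: "('o \<times> 'b \<times> 'q, 'a \<times> 'b \<times> 'c) tgroupoid" where
  "wpb = \<lparr>
     gobj = subtopology (prod_topology (gobj A) (prod_topology (garr B) (gobj C)))
       {(x, g, y). gsrc B g = F0 x \<and> gtgt B g = E0 y},
     garr = subtopology (prod_topology (garr A) (prod_topology (garr B) (garr C)))
       {(a, g, c). gsrc B g = F0 (gsrc A a) \<and> gtgt B g = E0 (gsrc C c)},
     gsrc = (\<lambda>(a, g, c). (gsrc A a, g, gsrc C c)),
     gtgt = (\<lambda>(a, g, c). (gtgt A a, gmul B (ginv B (F1 a)) (gmul B g (E1 c)), gtgt C c)),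
     gmul = (\<lambda>(a, g, c) (a', g', c'). (gmul A a a', g, gmul C c c')),
     ginv = (\<lambda>(a, g, c). (ginv A a, gmul B (ginv B (F1 a)) (gmul B g (E1 c)), ginv C c)),
     gid = (\<lambda>(x, g, y). (gid A x, g, gid C y)) \<rparr>"

lemma wpb_simps [simp]:
  "gobj wpb = subtopology (prod_topology (gobj A) (prod_topology (garr B) (gobj C)))
       {(x, g, y). gsrc B g = F0 x \<and> gtgt B g = E0 y}"
  "garr wpb = subtopology (prod_topology (garr A) (prod_topology (garr B) (garr C)))
       {(a, g, c). gsrc B g = F0 (gsrc A a) \<and> gtgt B g = E0 (gsrc C c)}"
  "gsrc wpb = (\<lambda>(a, g, c). (gsrc A a, g, gsrc C c))"
  "gtgt wpb = (\<lambda>(a, g, c). (gtgt A a, gmul B (ginv B (F1 a)) (gmul B g (E1 c)), gtgt C c))"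
  "gmul wpb = (\<lambda>(a, g, c) (a', g', c'). (gmul A a a', g, gmul C c c'))"
  "ginv wpb = (\<lambda>(a, g, c). (ginv A a, gmul B (ginv B (F1 a)) (gmul B g (E1 c)), ginv C c))"
  "gid wpb = (\<lambda>(x, g, y). (gid A x, g, gid C y))"
  by (simp_all add: wpb_def)

lemmas wpb_cm = A.H.cm_structure A.G.cm_structure C.H.cm_structure A.cm_morphism C.cm_morphism

lemma wpb_groupoid: "topological_groupoid wpb"
proof (rule topological_groupoidI)
  show "continuous_map (garr wpb) (gobj wpb) (gsrc wpb)"
    "continuous_map (garr wpb) (gobj wpb) (gtgt wpb)"
    "continuous_map (garr wpb) (garr wpb) (ginv wpb)"
    "continuous_map (gobj wpb) (garr wpb) (gid wpb)"
    unfolding wpb_simps flatten_topology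
    by (intro cm_intros wpb_cm; (rule cm_id | (auto; fail))+)+
  show "continuous_map (subtopology (prod_topology (garr wpb) (garr wpb))
      {z. gtgt wpb (fst z) = gsrc wpb (snd z)}) (garr wpb) (\<lambda>z. gmul wpb (fst z) (snd z))"
    unfolding wpb_simps flatten_topology
    by (intro cm_intros wpb_cm) (rule cm_id | (auto; fail))+
qed auto

text \<open>Given the ends and the arrow \<open>a\<close> of \<open>A\<close>, commutativity
  prescribes the image in \<open>B\<close> of the missing arrow of \<open>C\<close>, namely
  \<open>inv g \<cdot> F1 a \<cdot> g'\<close>, and full faithfulness of \<open>E\<close> lifts it.
  On objects the projection is a base change along \<open>F0\<close> of the open map belonging to
  \<open>E\<close>.\<close>

lemma wpb_left: "morita_hom wpb A fst fst"
proof -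
  have hom: "groupoid_morphism wpb A fst fst"
    by (rule groupoid_morphismI)
      (auto simp: continuous_map_from_subtopology continuous_map_fst)
  have "fully_faithful wpb A fst fst"
  proof (rule fully_faithfulI[of _ _ _ _ "\<lambda>(((x, g, y), (x', g', y')), a).
      (a, g, C.lift ((y, y'), gmul B (ginv B g) (gmul B (F1 a) g')))"])
    show "continuous_map (subtopology (prod_topology (prod_topology (gobj wpb) (gobj wpb)) (garr A))
        {((x, y), g). gsrc A g = fst x \<and> gtgt A g = fst y}) (garr wpb)
        (\<lambda>(((x, g, y), (x', g', y')), a). (a, g, C.lift ((y, y'), gmul B (ginv B g) (gmul B (F1 a) g'))))"
      unfolding wpb_simps flatten_topology
      by (intro cm_intros wpb_cm C.cm_lift) (rule cm_id | (auto; fail))+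
  qed (use hom wpb_groupoid A.H.tg in auto)
  then have "ff_hom wpb A fst fst" by (intro ff_homI wpb_groupoid A.H.tg)
  then show ?thesis
  proof (rule ff_hom.morita_homI_open)
    let ?P = "subtopology (prod_topology (gobj C) (garr B)) {(x, g). E0 x = gtgt B g}"
    let ?Q = "subtopology (prod_topology ?P (gobj A)) {(a, x). gsrc B (snd a) = F0 x}"
    have op: "open_map ?Q (gobj A) snd"
      by (rule open_map_pullback[OF C.os_open A.hom_continuous(1)])
    show "open_map (gobj wpb) (gobj A) fst"
    proof (rule open_map_factor[OF op, of _ "\<lambda>z. (snd z, snd (fst z), fst (fst z))"])
      show "continuous_map ?Q (gobj wpb) (\<lambda>z. (snd z, snd (fst z), fst (fst z)))"
        unfolding wpb_simps flatten_topology by (intro cm_intros) (rule cm_id | (auto; fail))+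
      fix w assume "w \<in> topspace (gobj wpb)"
      then show "\<exists>z\<in>topspace ?Q. (snd z, snd (fst z), fst (fst z)) = w"
        by (intro bexI[of _ "((snd (snd w), fst (snd w)), fst w)"]) auto
    qed auto
    show "open_map (garr A) (gobj A) (gsrc A)" by (rule A.src_open)
    fix x assume x: "x \<in> topspace (gobj A)"
    then have "F0 x \<in> topspace (gobj B)" by simp
    then obtain y g where "y \<in> topspace (gobj C)" "g \<in> topspace (garr B)" "E0 y = gtgt B g" "gsrc B g = F0 x"
      by (rule C.os_surj)
    with x show "\<exists>w\<in>topspace (gobj wpb). \<exists>a\<in>topspace (garr A). fst w = gtgt A a \<and> gsrc A a = x"
      by (intro bexI[of _ "(x, g, y)"] bexI[of _ "gid A x"]) auto
  qed
qed

text \<open>Here the missing arrow of \<open>A\<close> is the lift of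
  \<open>g \<cdot> E1 c \<cdot> inv g'\<close>. The test arrows of \<open>F\<close> end at
  \<open>F0 x\<close> whereas the middle arrows of the weak pullback start there, so an inversion
  enters the parametrisation of the objects.\<close>

lemma wpb_right: "morita_hom wpb C (\<lambda>x. snd (snd x)) (\<lambda>a. snd (snd a))"
proof -
  have hom: "groupoid_morphism wpb C (\<lambda>x. snd (snd x)) (\<lambda>a. snd (snd a))"
  proof (rule groupoid_morphismI)
    show "continuous_map (gobj wpb) (gobj C) (\<lambda>x. snd (snd x))"
      "continuous_map (garr wpb) (garr C) (\<lambda>x. snd (snd x))"
      unfolding wpb_simps by (rule cm_snd, rule cm_snd, rule cm_id)+
  qed auto
  have "fully_faithful wpb C (\<lambda>x. snd (snd x)) (\<lambda>a. snd (snd a))"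
  proof (rule fully_faithfulI[of _ _ _ _ "\<lambda>(((x, g, y), (x', g', y')), c).
      (A.lift ((x, x'), gmul B g (gmul B (E1 c) (ginv B g'))), g, c)"])
    show "continuous_map (subtopology (prod_topology (prod_topology (gobj wpb) (gobj wpb)) (garr C))
        {((x, y), g). gsrc C g = snd (snd x) \<and> gtgt C g = snd (snd y)}) (garr wpb)
        (\<lambda>(((x, g, y), (x', g', y')), c). (A.lift ((x, x'), gmul B g (gmul B (E1 c) (ginv B g'))), g, c))"
      unfolding wpb_simps flatten_topology
      by (intro cm_intros wpb_cm A.cm_lift) (rule cm_id | (auto; fail))+
    fix w w' c assume "w \<in> topspace (gobj wpb)" "w' \<in> topspace (gobj wpb)" "c \<in> topspace (garr C)"
      "gsrc C c = snd (snd w)" "gtgt C c = snd (snd w')"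
    then obtain x g x' g' where *: "w = (x, g, gsrc C c)" "w' = (x', g', gtgt C c)"
      "x \<in> topspace (gobj A)" "x' \<in> topspace (gobj A)" "g \<in> topspace (garr B)" "g' \<in> topspace (garr B)"
      "gsrc B g = F0 x" "gsrc B g' = F0 x'" "gtgt B g = E0 (gsrc C c)" "gtgt B g' = E0 (gtgt C c)"
      "c \<in> topspace (garr C)"
      by (cases w; cases w') auto
    define k where "k = gmul B g (gmul B (E1 c) (ginv B g'))"
    have k: "k \<in> topspace (garr B)" "gsrc B k = F0 x" "gtgt B k = F0 x'"
      using * by (simp_all add: k_def)
    have "gmul B k g' = gmul B g (E1 c)" using * by (simp add: k_def)
    moreover have "gmul B (ginv B k) (gmul B k g') = g'"
      using k * by (intro A.G.inv_mul_cancel) simp_all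
    ultimately have key: "gmul B (ginv B k) (gmul B g (E1 c)) = g'" by simp
    show "gsrc wpb ((\<lambda>(((x, g, y), (x', g', y')), c).
        (A.lift ((x, x'), gmul B g (gmul B (E1 c) (ginv B g'))), g, c)) ((w, w'), c)) = w \<and>
      gtgt wpb ((\<lambda>(((x, g, y), (x', g', y')), c).
        (A.lift ((x, x'), gmul B g (gmul B (E1 c) (ginv B g'))), g, c)) ((w, w'), c)) = w' \<and>
      snd (snd ((\<lambda>(((x, g, y), (x', g', y')), c).
        (A.lift ((x, x'), gmul B g (gmul B (E1 c) (ginv B g'))), g, c)) ((w, w'), c))) = c"
      unfolding *(1,2) prod.case fst_conv snd_conv k_def[symmetric] using * k key by simp
  next
    fix a assume "a \<in> topspace (garr wpb)"
    then obtain b g c where *: "a = (b, g, c)" "b \<in> topspace (garr A)" "g \<in> topspace (garr B)"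
      "c \<in> topspace (garr C)" "gsrc B g = F0 (gsrc A b)" "gtgt B g = E0 (gsrc C c)"
      by (cases a) auto
    define m where "m = gmul B g (E1 c)"
    have m: "m \<in> topspace (garr B)" "gsrc B m = F0 (gsrc A b)"
      using * by (simp_all add: m_def)
    have k: "gmul B g (gmul B (E1 c) (ginv B (gmul B (ginv B (F1 b)) m))) = F1 b"
      unfolding m_def by (rule A.G.mul_inv_conj_cancel) (use * in simp_all)
    show "(\<lambda>(((x, g, y), (x', g', y')), c).
        (A.lift ((x, x'), gmul B g (gmul B (E1 c) (ginv B g'))), g, c))
        ((gsrc wpb a, gtgt wpb a), snd (snd a)) = a"
      using * k by (simp flip: m_def)
  qed (use hom wpb_groupoid C.H.tg in \<open>simp_all\<close>)
  then have "ff_hom wpb C (\<lambda>x. snd (snd x)) (\<lambda>a. snd (snd a))"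
    by (intro ff_homI wpb_groupoid C.H.tg)
  then show ?thesis
  proof (rule ff_hom.morita_homI_open)
    let ?P = "subtopology (prod_topology (gobj A) (garr B)) {(x, g). F0 x = gtgt B g}"
    let ?Q = "subtopology (prod_topology ?P (gobj C)) {(a, x). gsrc B (snd a) = E0 x}"
    have op: "open_map ?Q (gobj C) snd"
      by (rule open_map_pullback[OF A.os_open C.hom_continuous(1)])
    show "open_map (gobj wpb) (gobj C) (\<lambda>x. snd (snd x))"
    proof (rule open_map_factor[OF op, of _ "\<lambda>z. (fst (fst z), ginv B (snd (fst z)), snd z)"])
      show "continuous_map ?Q (gobj wpb) (\<lambda>z. (fst (fst z), ginv B (snd (fst z)), snd z))"
        unfolding wpb_simps flatten_topology by (intro cm_intros wpb_cm) (rule cm_id | (auto; fail))+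
      fix w assume "w \<in> topspace (gobj wpb)"
      then show "\<exists>z\<in>topspace ?Q. (fst (fst z), ginv B (snd (fst z)), snd z) = w"
        by (intro bexI[of _ "((fst w, ginv B (fst (snd w))), snd (snd w))"]) auto
    qed auto
    show "open_map (garr C) (gobj C) (gsrc C)" by (rule C.src_open)
    fix y assume y: "y \<in> topspace (gobj C)"
    then have "E0 y \<in> topspace (gobj B)" by simp
    then obtain x g where "x \<in> topspace (gobj A)" "g \<in> topspace (garr B)" "F0 x = gtgt B g" "gsrc B g = E0 y"
      by (rule A.os_surj)
    with y show "\<exists>w\<in>topspace (gobj wpb). \<exists>a\<in>topspace (garr C). snd (snd w) = gtgt C a \<and> gsrc C a = y"
      by (intro bexI[of _ "(x, ginv B g, y)"] bexI[of _ "gid C y"]) auto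
  qed
qed

end

section \<open>Rigidity of chart embeddings, by differential calculus in finite-dimensional normed
  spaces\<close>

section \<open>Strict derivatives\<close>

text \<open>Strict differentiability: both points of the difference quotient vary. Unlike the
  derivative at \<open>x\<close> alone, this can be tested on open sets that merely accumulate at
  \<open>x\<close>, and an injective derivative yields local injectivity directly.\<close>

definition strict_deriv ::
  "('a::real_normed_vector \<Rightarrow> 'b::real_normed_vector) \<Rightarrow> ('a \<Rightarrow> 'b) \<Rightarrow> 'a \<Rightarrow> bool" where
  "strict_deriv f L x \<longleftrightarrow> bounded_linear L \<and>
     (\<forall>e>0. \<exists>d>0. \<forall>y\<in>ball x d. \<forall>z\<in>ball x d. norm (f y - f z - L (y - z)) \<le> e * norm (y - z))"

lemma strict_derivD:
  assumes "strict_deriv f L x" "e > 0"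
  obtains d where "d > 0"
    "\<And>y z. y \<in> ball x d \<Longrightarrow> z \<in> ball x d \<Longrightarrow> norm (f y - f z - L (y - z)) \<le> e * norm (y - z)"
  using assms unfolding strict_deriv_def by meson

lemma strict_deriv_imp_has_derivative:
  assumes "strict_deriv f L x"
  shows "(f has_derivative L) (at x)"
  unfolding has_derivative_at_alt
proof (intro conjI allI impI)
  show "bounded_linear L" using assms by (simp add: strict_deriv_def)
  fix e :: real assume "0 < e"
  from strict_derivD[OF assms this] obtain d where d: "d > 0"
    "\<And>y z. y \<in> ball x d \<Longrightarrow> z \<in> ball x d \<Longrightarrow> norm (f y - f z - L (y - z)) \<le> e * norm (y - z)" by metis
  show "\<exists>d>0. \<forall>y. norm (y - x) < d \<longrightarrow> norm (f y - f x - L (y - x)) \<le> e * norm (y - x)"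
    using d by (intro exI[of _ d]) (auto simp: dist_norm norm_minus_commute)
qed

lemma strict_deriv_isCont: "strict_deriv f L x \<Longrightarrow> isCont f x"
  by (rule has_derivative_continuous[OF strict_deriv_imp_has_derivative])

lemma strict_deriv_id: "strict_deriv (\<lambda>x. x) (\<lambda>v. v) x"
  unfolding strict_deriv_def by (auto intro!: exI[of _ 1] bounded_linear_ident)

lemma strict_deriv_zero: "strict_deriv (\<lambda>x. 0) (\<lambda>v. 0) x"
  unfolding strict_deriv_def by (auto intro!: exI[of _ 1] bounded_linear_zero)

lemma strict_deriv_add:
  assumes "strict_deriv f L x" "strict_deriv g M x"
  shows "strict_deriv (\<lambda>x. f x + g x) (\<lambda>v. L v + M v) x"
  unfolding strict_deriv_def
proof (intro conjI allI impI)
  show "bounded_linear (\<lambda>v. L v + M v)"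
    using assms by (simp add: strict_deriv_def bounded_linear_add)
  fix e :: real assume "0 < e"
  then have e: "e / 2 > 0" by simp
  from strict_derivD[OF assms(1) e] obtain d1 where d1: "d1 > 0"
    "\<And>y z. y \<in> ball x d1 \<Longrightarrow> z \<in> ball x d1 \<Longrightarrow> norm (f y - f z - L (y - z)) \<le> e/2 * norm (y - z)" by metis
  from strict_derivD[OF assms(2) e] obtain d2 where d2: "d2 > 0"
    "\<And>y z. y \<in> ball x d2 \<Longrightarrow> z \<in> ball x d2 \<Longrightarrow> norm (g y - g z - M (y - z)) \<le> e/2 * norm (y - z)" by metis
  show "\<exists>d>0. \<forall>y\<in>ball x d. \<forall>z\<in>ball x d.
      norm (f y + g y - (f z + g z) - (L (y - z) + M (y - z))) \<le> e * norm (y - z)"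
  proof (intro exI[of _ "min d1 d2"] conjI ballI)
    fix y z assume yz: "y \<in> ball x (min d1 d2)" "z \<in> ball x (min d1 d2)"
    have "f y + g y - (f z + g z) - (L (y - z) + M (y - z)) =
        (f y - f z - L (y - z)) + (g y - g z - M (y - z))" by simp
    also have "norm \<dots> \<le> e/2 * norm (y - z) + e/2 * norm (y - z)"
      by (intro norm_triangle_mono d1 d2) (use yz in auto)
    finally show "norm (f y + g y - (f z + g z) - (L (y - z) + M (y - z))) \<le> e * norm (y - z)" by simp
  qed (use d1 d2 in auto)
qed

lemma strict_deriv_sum:
  "finite I \<Longrightarrow> (\<And>i. i \<in> I \<Longrightarrow> strict_deriv (f i) (L i) x) \<Longrightarrow>
     strict_deriv (\<lambda>x. \<Sum>i\<in>I. f i x) (\<lambda>v. \<Sum>i\<in>I. L i v) x"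
  by (induction I rule: finite_induct) (simp_all add: strict_deriv_zero strict_deriv_add)

lemma strict_deriv_chain:
  fixes f :: "'a::real_normed_vector \<Rightarrow> 'b::real_normed_vector" and g :: "'b \<Rightarrow> 'c::real_normed_vector"
  assumes f: "strict_deriv f L x" and g: "strict_deriv g M (f x)"
  shows "strict_deriv (\<lambda>x. g (f x)) (\<lambda>v. M (L v)) x"
  unfolding strict_deriv_def
proof (intro conjI allI impI)
  have bl: "bounded_linear L" "bounded_linear M" using f g by (simp_all add: strict_deriv_def)
  show "bounded_linear (\<lambda>v. M (L v))" by (rule bounded_linear_compose[OF bl(2,1)])
  obtain K1 where K1: "K1 > 0" "\<And>v. norm (L v) \<le> norm v * K1" using bounded_linear.pos_bounded[OF bl(1)] by metis
  obtain K2 where K2: "K2 > 0" "\<And>v. norm (M v) \<le> norm v * K2" using bounded_linear.pos_bounded[OF bl(2)] by metis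
  fix e :: real assume e: "0 < e"
  \<comment> \<open>The bound \<open>e1 \<le> 1\<close> makes \<open>f\<close> Lipschitz near
    \<open>x\<close> with constant \<open>K1 + 1\<close>. The error of \<open>g\<close> then
    contributes \<open>e2 * (K1 + 1)\<close> and that of \<open>f\<close> at most
    \<open>K2 * e1\<close>, each bounded by \<open>e / 2\<close>.\<close>
  define e1 where "e1 = min 1 (e / (2 * K2))"
  define e2 where "e2 = e / 2 / (K1 + 1)"
  have e12: "e1 > 0" "e2 > 0" "e1 \<le> 1" using e K1 K2 by (auto simp: e1_def e2_def)
  have "K2 * e1 \<le> K2 * (e / (2 * K2))" using K2 by (intro mult_left_mono) (auto simp: e1_def)
  then have ee: "K2 * e1 \<le> e / 2" using K2 by simp
  have "a / b * b = a" if "b \<noteq> 0" for a b :: real using that by simp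
  from this[of "K1 + 1" "e / 2"] have ee': "e2 * (K1 + 1) = e / 2" using K1(1) by (simp only: e2_def)
  from strict_derivD[OF f e12(1)] obtain d1 where d1: "d1 > 0"
    "\<And>y z. y \<in> ball x d1 \<Longrightarrow> z \<in> ball x d1 \<Longrightarrow> norm (f y - f z - L (y - z)) \<le> e1 * norm (y - z)" by metis
  from strict_derivD[OF g e12(2)] obtain d2 where d2: "d2 > 0"
    "\<And>y z. y \<in> ball (f x) d2 \<Longrightarrow> z \<in> ball (f x) d2 \<Longrightarrow> norm (g y - g z - M (y - z)) \<le> e2 * norm (y - z)" by metis
  obtain d3 where d3: "d3 > 0" "\<And>y. y \<in> ball x d3 \<Longrightarrow> f y \<in> ball (f x) d2"
    using strict_deriv_isCont[OF f] d2(1) unfolding continuous_at_eps_delta by (auto simp: dist_commute)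
  show "\<exists>d>0. \<forall>y\<in>ball x d. \<forall>z\<in>ball x d. norm (g (f y) - g (f z) - M (L (y - z))) \<le> e * norm (y - z)"
  proof (intro exI[of _ "min d1 d3"] conjI ballI)
    fix y z assume yz: "y \<in> ball x (min d1 d3)" "z \<in> ball x (min d1 d3)"
    let ?r = "f y - f z - L (y - z)"
    have r: "norm ?r \<le> e1 * norm (y - z)" using d1 yz by auto
    have "norm (f y - f z) \<le> norm (L (y - z)) + norm ?r"
      using norm_triangle_ineq[of "L (y - z)" ?r] by simp
    also have "\<dots> \<le> norm (y - z) * K1 + 1 * norm (y - z)"
      using r K1(2) e12 by (intro add_mono order_trans[OF r] mult_right_mono) auto
    finally have fyz: "norm (f y - f z) \<le> (K1 + 1) * norm (y - z)" by (simp add: algebra_simps)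
    have "M (L (y - z)) = M (f y - f z) - M ?r"
      by (simp add: linear_diff[OF bounded_linear.linear[OF bl(2)]])
    moreover have "a - (b - c) = (a - b) + c" for a b c :: 'c by simp
    ultimately have "norm (g (f y) - g (f z) - M (L (y - z))) =
        norm ((g (f y) - g (f z) - M (f y - f z)) + M ?r)" by (simp only:)
    also have "\<dots> \<le> e2 * norm (f y - f z) + norm ?r * K2"
      using d2(2)[of "f y" "f z"] d3 yz K2(2)[of ?r] by (intro norm_triangle_mono) auto
    also have "\<dots> \<le> e2 * ((K1 + 1) * norm (y - z)) + (e1 * norm (y - z)) * K2"
      using fyz r e12 K2 by (intro add_mono mult_left_mono mult_right_mono) auto
    also have "\<dots> = (e2 * (K1 + 1) + K2 * e1) * norm (y - z)" by (simp add: algebra_simps)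
    also have "\<dots> \<le> e * norm (y - z)" using ee ee' by (intro mult_right_mono) auto
    finally show "norm (g (f y) - g (f z) - M (L (y - z))) \<le> e * norm (y - z)" .
  qed (use d1 d3 in auto)
qed

lemma strict_deriv_cong:
  assumes "strict_deriv f L x" "open S" "x \<in> S" "\<And>y. y \<in> S \<Longrightarrow> f y = g y"
  shows "strict_deriv g L x"
  unfolding strict_deriv_def
proof (intro conjI allI impI)
  show "bounded_linear L" using assms(1) by (simp add: strict_deriv_def)
  obtain d0 where d0: "d0 > 0" "ball x d0 \<subseteq> S" using assms(2,3) open_contains_ball by blast
  fix e :: real assume "0 < e"
  from strict_derivD[OF assms(1) this] obtain d where d: "d > 0"
    "\<And>y z. y \<in> ball x d \<Longrightarrow> z \<in> ball x d \<Longrightarrow> norm (f y - f z - L (y - z)) \<le> e * norm (y - z)" by metis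
  have "norm (g y - g z - L (y - z)) \<le> e * norm (y - z)"
    if "y \<in> ball x (min d d0)" "z \<in> ball x (min d d0)" for y z
  proof -
    have "y \<in> S" "z \<in> S" using that d0(2) by auto
    with that d(2)[of y z] show ?thesis by (simp flip: assms(4))
  qed
  then show "\<exists>d>0. \<forall>y\<in>ball x d. \<forall>z\<in>ball x d. norm (g y - g z - L (y - z)) \<le> e * norm (y - z)"
    using d(1) d0(1) by (intro exI[of _ "min d d0"]) auto
qed

text \<open>
  Strict derivatives see the values near \<open>x\<close> and not only at \<open>x\<close>.
\<close>

lemma strict_deriv_agree:
  assumes f: "strict_deriv f L x" and g: "strict_deriv g M x"
    and U: "\<And>d. d > 0 \<Longrightarrow> \<exists>U. open U \<and> U \<noteq> {} \<and> U \<subseteq> ball x d \<and> (\<forall>y\<in>U. f y = g y)"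
  shows "f x = g x" "L = M"
proof -
  show "L = M"
  proof (rule ext, rule ccontr)
    fix w assume w: "L w \<noteq> M w"
    have lin: "linear L" "linear M"
      using f g by (simp_all add: strict_deriv_def bounded_linear.linear)
    \<comment> \<open>With this \<open>e\<close> the estimates for \<open>f\<close> and
      \<open>g\<close> add up to at most half the norm of \<open>L w - M w\<close>, which is absurd;
      the summand 1 keeps the denominator positive.\<close>
    define e where "e = norm (L w - M w) / (4 * (norm w + 1))"
    have e: "e > 0" using w by (simp add: e_def add_nonneg_pos)
    from strict_derivD[OF f e] obtain d1 where d1: "d1 > 0"
      "\<And>y z. y \<in> ball x d1 \<Longrightarrow> z \<in> ball x d1 \<Longrightarrow> norm (f y - f z - L (y - z)) \<le> e * norm (y - z)" by metis
    from strict_derivD[OF g e] obtain d2 where d2: "d2 > 0"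
      "\<And>y z. y \<in> ball x d2 \<Longrightarrow> z \<in> ball x d2 \<Longrightarrow> norm (g y - g z - M (y - z)) \<le> e * norm (y - z)" by metis
    have "\<exists>U. open U \<and> U \<noteq> {} \<and> U \<subseteq> ball x (min d1 d2) \<and> (\<forall>y\<in>U. f y = g y)"
      using d1(1) d2(1) by (intro U) simp
    then obtain U where U': "open U" "U \<noteq> {}" "U \<subseteq> ball x (min d1 d2)" "\<And>y. y \<in> U \<Longrightarrow> f y = g y"
      by blast
    then obtain u r where u: "u \<in> U" "r > 0" "ball u r \<subseteq> U" using open_contains_ball by blast
    \<comment> \<open>Small enough for \<open>u + t *\<^sub>R w\<close> to remain in
      \<open>U\<close>. Both \<open>f\<close> and \<open>g\<close> then have the same increment
      along \<open>t *\<^sub>R w\<close>, whose linear approximations are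
      \<open>t *\<^sub>R L w\<close> and \<open>t *\<^sub>R M w\<close>.\<close>
    define t where "t = r / (2 * (norm w + 1))"
    have t: "t > 0" using u by (simp add: t_def add_nonneg_pos)
    have "norm (t *\<^sub>R w) = r * norm w / (2 * (norm w + 1))" using t u(2) by (simp add: t_def)
    also have "\<dots> \<le> r * (norm w + 1) / (2 * (norm w + 1))"
      using u by (intro divide_right_mono mult_left_mono) auto
    also have "\<dots> = r / 2"
    proof -
      have "norm w + 1 \<noteq> 0" using norm_ge_zero[of w] by linarith
      then show ?thesis by (rule nonzero_mult_divide_mult_cancel_right)
    qed
    also have "\<dots> < r" using u by simp
    finally have "u + t *\<^sub>R w \<in> ball u r" by (simp add: dist_norm)
    then have v: "u + t *\<^sub>R w \<in> U" using u by auto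
    have "u \<in> ball x d1" "u \<in> ball x d2" "u + t *\<^sub>R w \<in> ball x d1" "u + t *\<^sub>R w \<in> ball x d2"
      using u(1) v U'(3) by auto
    then have "norm (f (u + t *\<^sub>R w) - f u - L (t *\<^sub>R w)) \<le> e * norm (t *\<^sub>R w)"
      "norm (g (u + t *\<^sub>R w) - g u - M (t *\<^sub>R w)) \<le> e * norm (t *\<^sub>R w)"
      using d1(2)[of "u + t *\<^sub>R w" u] d2(2)[of "u + t *\<^sub>R w" u] by simp_all
    moreover have "f u = g u" "f (u + t *\<^sub>R w) = g (u + t *\<^sub>R w)" using u(1) v U'(4) by simp_all
    ultimately have "norm (L (t *\<^sub>R w) - M (t *\<^sub>R w)) \<le> e * norm (t *\<^sub>R w) + e * norm (t *\<^sub>R w)"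
      using norm_triangle_ineq4[of "f (u + t *\<^sub>R w) - f u - M (t *\<^sub>R w)" "f (u + t *\<^sub>R w) - f u - L (t *\<^sub>R w)"]
      by simp
    then have "t * norm (L w - M w) \<le> t * (2 * e * norm w)"
      using t by (simp add: linear_scale[OF lin(1)] linear_scale[OF lin(2)] flip: scaleR_diff_right)
    then have "norm (L w - M w) \<le> 2 * e * norm w" using t by simp
    also have "\<dots> \<le> 2 * e * (norm w + 1)" using e by simp
    also have "\<dots> = norm (L w - M w) / 2" by (simp add: e_def divide_simps add_nonneg_eq_0_iff)
    finally show False using w by simp
  qed
  show "f x = g x"
  proof (rule ccontr)
    assume "f x \<noteq> g x"
    then have "f x - g x \<in> - {0}" by simp
    moreover have "isCont (\<lambda>y. f y - g y) x"
      using strict_deriv_isCont[OF f] strict_deriv_isCont[OF g] by (intro continuous_intros)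
    then have "((\<lambda>y. f y - g y) \<longlongrightarrow> f x - g x) (nhds x)"
      unfolding isCont_def tendsto_at_iff_tendsto_nhds[of "\<lambda>y. f y - g y"] .
    ultimately have "eventually (\<lambda>y. f y - g y \<in> - {0}) (nhds x)"
      by (intro topological_tendstoD) auto
    then obtain d where "d > 0" "\<And>y. dist y x < d \<Longrightarrow> f y \<noteq> g y"
      unfolding eventually_nhds_metric by auto
    with U[of d] show False by (force simp: dist_commute)
  qed
qed

lemma strict_deriv_unique:
  assumes "strict_deriv f L x" "strict_deriv f M x"
  shows "L = M"
  using assms by (rule strict_deriv_agree) (auto intro!: exI[of _ "ball x _"])

text \<open>With error \<open>c / 2\<close>, equal values at \<open>y\<close> and \<open>z\<close>
  would give \<open>c * norm (y - z) \<le> c / 2 * norm (y - z)\<close>.\<close>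

lemma strict_deriv_scaleR_inj:
  assumes f: "strict_deriv f (\<lambda>v. c *\<^sub>R v) x" and c: "c > 0"
  obtains d where "d > 0" "inj_on f (ball x d)"
proof -
  from strict_derivD[OF f, of "c/2"] c obtain d where d: "d > 0"
    "\<And>y z. y \<in> ball x d \<Longrightarrow> z \<in> ball x d \<Longrightarrow> norm (f y - f z - c *\<^sub>R (y - z)) \<le> c/2 * norm (y - z)" by auto
  have "inj_on f (ball x d)"
  proof (rule inj_onI)
    fix y z assume yz: "y \<in> ball x d" "z \<in> ball x d" "f y = f z"
    have "c * norm (y - z) \<le> c/2 * norm (y - z)" using d(2)[OF yz(1,2)] yz(3) c by simp
    with c have "norm (y - z) \<le> 0" by (simp add: field_simps)
    then show "y = z" by simp
  qed
  with d that show thesis by blast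
qed


section \<open>Smooth maps in finite dimension\<close>

text \<open>In the induction step \<open>b0\<close> has positive distance from
  \<open>span B\<close>: if elements of the span converged to \<open>b0\<close>, their coefficients
  would be Cauchy by the induction hypothesis and the limit would lie in the span. This distance
  bounds the coefficient of \<open>b0\<close>, and subtracting its term leaves a vector to which the
  induction hypothesis applies.\<close>

lemma basis_coefficients_bounded:
  fixes B :: "'a::real_normed_vector set"
  shows "finite B \<Longrightarrow> independent B \<Longrightarrow> \<exists>C>0. \<forall>c. \<forall>b\<in>B. \<bar>c b\<bar> \<le> C * norm (\<Sum>b\<in>B. c b *\<^sub>R b)"
proof (induction B rule: finite_induct)
  case empty
  show ?case by (auto intro: exI[of _ 1])
next
  case (insert b0 B)
  then have ind: "independent B" "b0 \<notin> span B" by (auto simp: independent_insert)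
  with insert.IH obtain C where C: "C > 0" "\<And>c b. b \<in> B \<Longrightarrow> \<bar>c b\<bar> \<le> C * norm (\<Sum>b\<in>B. c b *\<^sub>R b)"
    by blast
  have "\<exists>\<delta>>0. \<forall>s\<in>span B. \<delta> \<le> norm (b0 - s)"
  proof (rule ccontr)
    assume "\<not> ?thesis"
    then have "\<forall>n. \<exists>s\<in>span B. norm (b0 - s) < inverse (real (Suc n))"
      by (meson inverse_positive_iff_positive of_nat_0_less_iff zero_less_Suc not_le)
    then obtain s where s: "\<And>n. s n \<in> span B" "\<And>n. norm (b0 - s n) < inverse (real (Suc n))"
      by metis
    have "\<forall>n. \<exists>c. s n = (\<Sum>b\<in>B. c b *\<^sub>R b)"
      using s(1) by (auto simp: span_finite[OF insert.hyps(1)])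
    then obtain c where c: "\<And>n. s n = (\<Sum>b\<in>B. c n b *\<^sub>R b)" by metis
    have lim: "s \<longlonglongrightarrow> b0"
    proof (rule LIM_zero_cancel, rule Lim_null_comparison[OF _ LIMSEQ_inverse_real_of_nat])
      show "\<forall>\<^sub>F n in sequentially. norm (s n - b0) \<le> inverse (real (Suc n))"
        using s(2) by (auto simp: norm_minus_commute intro!: always_eventually less_imp_le)
    qed
    then have cau: "Cauchy s" by (intro LIMSEQ_imp_Cauchy)
    have "convergent (\<lambda>n. c n b)" if b: "b \<in> B" for b
    proof (rule Cauchy_convergent, rule CauchyI)
      fix e :: real assume e: "0 < e"
      have "e / C > 0" using e C(1) by simp
      from CauchyD[OF cau this] obtain M where M: "\<forall>m\<ge>M. \<forall>n\<ge>M. norm (s m - s n) < e / C" ..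
      have "norm (c m b - c n b) < e" if "m \<ge> M" "n \<ge> M" for m n
      proof -
        have "\<bar>c m b - c n b\<bar> \<le> C * norm (\<Sum>b\<in>B. (c m b - c n b) *\<^sub>R b)"
          using C(2)[OF b, of "\<lambda>b. c m b - c n b"] .
        also have "\<dots> = C * norm (s m - s n)"
          by (simp add: c scaleR_diff_left sum_subtractf)
        also have "\<dots> < C * (e / C)" using M that C(1) by (intro mult_strict_left_mono) auto
        finally show ?thesis using C(1) by simp
      qed
      then show "\<exists>M. \<forall>m\<ge>M. \<forall>n\<ge>M. norm (c m b - c n b) < e" by blast
    qed
    then obtain c' where c': "\<And>b. b \<in> B \<Longrightarrow> (\<lambda>n. c n b) \<longlonglongrightarrow> c' b"
      unfolding convergent_def by metis
    have "(\<lambda>n. \<Sum>b\<in>B. c n b *\<^sub>R b) \<longlonglongrightarrow> (\<Sum>b\<in>B. c' b *\<^sub>R b)"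
      by (intro tendsto_sum tendsto_scaleR tendsto_const c')
    then have "s \<longlonglongrightarrow> (\<Sum>b\<in>B. c' b *\<^sub>R b)" by (simp flip: c)
    with lim have "b0 = (\<Sum>b\<in>B. c' b *\<^sub>R b)" by (rule LIMSEQ_unique)
    then have "b0 \<in> span B" by (simp add: span_sum span_scale span_base)
    with ind show False by simp
  qed
  then obtain \<delta> where \<delta>: "\<delta> > 0" "\<And>s. s \<in> span B \<Longrightarrow> \<delta> \<le> norm (b0 - s)" by blast
  \<comment> \<open>The first summand bounds the coefficient of \<open>b0\<close>. The second bounds
    the others, since removing the \<open>b0\<close> term from \<open>v\<close> leaves a vector of
    norm at most \<open>(1 + norm b0 / \<delta>) * norm v\<close>.\<close>
  define K where "K = 1 / \<delta> + C * (1 + norm b0 / \<delta>)"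
  have K: "K > 0" "1 / \<delta> \<le> K" "C * (1 + norm b0 / \<delta>) \<le> K"
    using \<delta>(1) C(1) by (auto simp: K_def intro!: add_pos_nonneg mult_nonneg_nonneg)
  show ?case
  proof (intro exI[of _ K] conjI allI ballI K(1))
    fix c b assume b: "b \<in> insert b0 B"
    define s where "s = (\<Sum>b\<in>B. c b *\<^sub>R b)"
    define v where "v = (\<Sum>b\<in>insert b0 B. c b *\<^sub>R b)"
    have v: "v = c b0 *\<^sub>R b0 + s" using insert.hyps by (simp add: v_def s_def)
    have sspan: "s \<in> span B" by (simp add: s_def span_sum span_scale span_base)
    have c0: "\<bar>c b0\<bar> * \<delta> \<le> norm v"
    proof (cases "c b0 = 0")
      case False
      have "\<delta> \<le> norm (b0 - (- inverse (c b0)) *\<^sub>R s)" by (intro \<delta>(2) span_scale sspan)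
      then have "\<bar>c b0\<bar> * \<delta> \<le> \<bar>c b0\<bar> * norm (b0 - (- inverse (c b0)) *\<^sub>R s)"
        by (intro mult_left_mono) auto
      also have "\<dots> = norm (c b0 *\<^sub>R (b0 - (- inverse (c b0)) *\<^sub>R s))" by simp
      also have "c b0 *\<^sub>R (b0 - (- inverse (c b0)) *\<^sub>R s) = v"
        using False by (simp add: v scaleR_add_right)
      finally show ?thesis .
    qed simp
    then have c0': "\<bar>c b0\<bar> \<le> 1 / \<delta> * norm v" using \<delta>(1) by (simp add: field_simps)
    show "\<bar>c b\<bar> \<le> K * norm (\<Sum>b\<in>insert b0 B. c b *\<^sub>R b)"
    proof (cases "b = b0")
      case True
      have "1 / \<delta> * norm v \<le> K * norm v" using K by (intro mult_right_mono) auto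
      with True c0' show ?thesis by (simp add: v_def)
    next
      case False
      have "norm s = norm (v - c b0 *\<^sub>R b0)" by (simp add: v)
      also have "\<dots> \<le> norm v + norm (c b0 *\<^sub>R b0)" by (rule norm_triangle_ineq4)
      also have "\<dots> \<le> norm v + (1 / \<delta> * norm v) * norm b0" using mult_right_mono[OF c0', of "norm b0"] by simp
      also have "\<dots> = (1 + norm b0 / \<delta>) * norm v" by (simp add: algebra_simps)
      finally have "C * norm s \<le> C * ((1 + norm b0 / \<delta>) * norm v)" using C(1) by simp
      also have "\<dots> = (C * (1 + norm b0 / \<delta>)) * norm v" by simp
      also have "\<dots> \<le> K * norm v" using K by (intro mult_right_mono) auto
      finally have "C * norm s \<le> K * norm v" .
      moreover have "\<bar>c b\<bar> \<le> C * norm s" using C(2)[of b c] False b by (simp add: s_def)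
      ultimately show ?thesis by (simp add: v_def)
    qed
  qed
qed

text \<open>The definition of smoothness gives continuity of the derivative in one direction at a
  time. A bound through finitely many directions turns this into continuity in the operator
  norm.\<close>

lemma linear_norm_bound_basis:
  assumes "fin_dim TYPE('a::real_normed_vector)"
  obtains B :: "'a::real_normed_vector set" and C where "finite B" "C > 0"
    "\<And>(L::'a::real_normed_vector \<Rightarrow> 'b::real_normed_vector) v. linear L \<Longrightarrow> norm (L v) \<le> C * (\<Sum>b\<in>B. norm (L b)) * norm v"
proof -
  obtain B0 :: "'a set" where B0: "finite B0" "span B0 = UNIV" using assms by (auto simp: fin_dim_def)
  obtain B where B: "B \<subseteq> B0" "independent B" "B0 \<subseteq> span B"
    using maximal_independent_subset[of B0] by blast
  have fin: "finite B" using B(1) B0(1) by (rule finite_subset)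
  have sp: "span B = UNIV" using B(3) B0(2) span_mono span_span by (metis top.extremum_uniqueI)
  obtain C where C: "C > 0" "\<And>c b. b \<in> B \<Longrightarrow> \<bar>c b\<bar> \<le> C * norm (\<Sum>b\<in>B. c b *\<^sub>R b)"
    using basis_coefficients_bounded[OF fin B(2)] by blast
  show thesis
  proof (rule that[OF fin C(1)])
    fix L :: "'a \<Rightarrow> 'b" and v assume L: "linear L"
    have "v \<in> span B" using sp by simp
    then obtain c where v: "v = (\<Sum>b\<in>B. c b *\<^sub>R b)" by (auto simp: span_finite[OF fin])
    have "L v = (\<Sum>b\<in>B. c b *\<^sub>R L b)" by (simp add: v linear_sum[OF L] linear_scale[OF L])
    then have "norm (L v) \<le> (\<Sum>b\<in>B. norm (c b *\<^sub>R L b))" by (simp add: sum_norm_le)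
    also have "\<dots> \<le> (\<Sum>b\<in>B. (C * norm v) * norm (L b))"
      using C(2)[of _ c] by (intro sum_mono) (simp add: mult_right_mono flip: v)
    also have "\<dots> = C * (\<Sum>b\<in>B. norm (L b)) * norm v"
      by (simp add: sum_distrib_left mult_ac flip: sum_distrib_left)
    finally show "norm (L v) \<le> C * (\<Sum>b\<in>B. norm (L b)) * norm v" .
  qed
qed

text \<open>Near \<open>x\<close> the map \<open>f - f' x\<close> has derivative
  \<open>f' y - f' x\<close>, which is small in operator norm, so the mean value inequality on a
  ball gives the two-point estimate.\<close>

lemma smooth_imp_strict_deriv:
  fixes f :: "'a::real_normed_vector \<Rightarrow> 'b::real_normed_vector"
  assumes fd: "fin_dim TYPE('a)" and sm: "smooth_on S f" and S: "open S" "x \<in> S"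
  shows "strict_deriv f (frechet_derivative f (at x)) x"
proof -
  define f' where "f' y = frechet_derivative f (at y)" for y
  have ck: "ck_on (Suc 0) S f" using sm unfolding smooth_on_def by (rule spec)
  have der: "(f has_derivative f' y) (at y)" if "y \<in> S" for y
    using ck that by (simp add: f'_def frechet_derivative_works)
  have cont: "continuous_on S (\<lambda>y. f' y v)" for v using ck by (simp add: f'_def)
  have bl: "bounded_linear (f' y)" if "y \<in> S" for y using der[OF that] by (rule has_derivative_bounded_linear)
  obtain B :: "'a set" and C where B: "finite B" "C > 0"
    "\<And>(L::'a \<Rightarrow> 'b) v. linear L \<Longrightarrow> norm (L v) \<le> C * (\<Sum>b\<in>B. norm (L b)) * norm v"
    using linear_norm_bound_basis[OF fd] by blast
  have "strict_deriv f (f' x) x"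
    unfolding strict_deriv_def
  proof (intro conjI allI impI)
    show "bounded_linear (f' x)" by (rule bl[OF S(2)])
    fix e :: real assume e: "e > 0"
    \<comment> \<open>The factor \<open>real (card B) + 1\<close> absorbs the sum over the basis and
      remains positive in dimension 0, where \<open>B\<close> is empty.\<close>
    define e' where "e' = e / (C * (real (card B) + 1))"
    have e': "e' > 0" using e B(2) by (simp add: e'_def)
    have "\<forall>b\<in>B. eventually (\<lambda>y. dist (f' y b) (f' x b) < e') (nhds x)"
    proof
      fix b
      have "isCont (\<lambda>y. f' y b) x"
        using cont[of b] S by (simp add: continuous_on_eq_continuous_at)
      then have "((\<lambda>y. f' y b) \<longlongrightarrow> f' x b) (nhds x)"
        unfolding isCont_def tendsto_at_iff_tendsto_nhds[of "\<lambda>y. f' y b"] .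
      then show "eventually (\<lambda>y. dist (f' y b) (f' x b) < e') (nhds x)"
        using e' by (rule tendstoD)
    qed
    then have "eventually (\<lambda>y. \<forall>b\<in>B. dist (f' y b) (f' x b) < e') (nhds x)"
      using B(1) by (simp add: eventually_ball_finite_distrib)
    moreover have "eventually (\<lambda>y. y \<in> S) (nhds x)" using S by (rule eventually_nhds_in_open)
    ultimately have "eventually (\<lambda>y. y \<in> S \<and> (\<forall>b\<in>B. dist (f' y b) (f' x b) < e')) (nhds x)"
      by eventually_elim simp
    then obtain d where d: "d > 0" "\<And>y. dist y x < d \<Longrightarrow> y \<in> S \<and> (\<forall>b\<in>B. dist (f' y b) (f' x b) < e')"
      unfolding eventually_nhds_metric by blast
    have on: "onorm (\<lambda>v. f' y v - f' x v) \<le> e" if y: "y \<in> ball x d" for y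
    proof (rule onorm_bound)
      show "0 \<le> e" using e by simp
      fix v :: 'a
      have yS: "y \<in> S" using d y by (auto simp: dist_commute)
      have lin: "linear (\<lambda>v. f' y v - f' x v)"
        using bl[OF yS] bl[OF S(2)] by (intro linear_compose_sub bounded_linear.linear)
      have "(\<Sum>b\<in>B. norm (f' y b - f' x b)) \<le> (\<Sum>b\<in>B. e')"
      proof (intro sum_mono)
        fix b assume "b \<in> B"
        moreover have "dist y x < d" using y by (simp add: dist_commute)
        ultimately have "dist (f' y b) (f' x b) < e'" using d(2)[of y] by blast
        then show "norm (f' y b - f' x b) \<le> e'" by (simp add: dist_norm)
      qed
      also have "\<dots> = real (card B) * e'" by simp
      also have "\<dots> \<le> (real (card B) + 1) * e'" using e' by (simp add: algebra_simps)
      finally have "C * (\<Sum>b\<in>B. norm (f' y b - f' x b)) \<le> C * ((real (card B) + 1) * e')"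
        using B(2) by (intro mult_left_mono) auto
      also have "\<dots> = e" using B(2) by (simp add: e'_def add_nonneg_eq_0_iff)
      finally have "C * (\<Sum>b\<in>B. norm (f' y b - f' x b)) * norm v \<le> e * norm v"
        by (rule mult_right_mono) simp
      with B(3)[OF lin, of v] show "norm (f' y v - f' x v) \<le> e * norm v" by linarith
    qed
    show "\<exists>d>0. \<forall>y\<in>ball x d. \<forall>z\<in>ball x d. norm (f y - f z - f' x (y - z)) \<le> e * norm (y - z)"
    proof (intro exI[of _ d] conjI ballI d(1))
      fix y z assume yz: "y \<in> ball x d" "z \<in> ball x d"
      have "norm ((f y - f' x y) - (f z - f' x z)) \<le> e * norm (y - z)"
      proof (rule differentiable_bound[where S = "ball x d" and f' = "\<lambda>y v. f' y v - f' x v"])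
        fix w assume w: "w \<in> ball x d"
        have "(f has_derivative f' w) (at w within ball x d)"
          using der[of w] d(2)[of w] w by (auto simp: dist_commute intro: has_derivative_at_withinI)
        then show "((\<lambda>y. f y - f' x y) has_derivative (\<lambda>v. f' w v - f' x v)) (at w within ball x d)"
          by (intro has_derivative_diff bounded_linear_imp_has_derivative bl S)
      qed (use on yz in auto)
      also have "(f y - f' x y) - (f z - f' x z) = f y - f z - f' x (y - z)"
        by (simp add: linear_diff[OF bounded_linear.linear[OF bl[OF S(2)]]])
      finally show "norm (f y - f z - f' x (y - z)) \<le> e * norm (y - z)" .
    qed
  qed
  then show ?thesis by (simp add: f'_def)
qed

lemma ck_on_cong:
  assumes "open S" "\<And>x. x \<in> S \<Longrightarrow> f x = g x" "ck_on k S f"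
  shows "ck_on k S g"
  using assms(2,3)
proof (induction k arbitrary: f g)
  case 0
  then show ?case by (simp cong: continuous_on_cong)
next
  case (Suc k)
  have d: "(g has_derivative frechet_derivative f (at x)) (at x)" if "x \<in> S" for x
  proof (rule has_derivative_transform_within_open[OF _ assms(1) that Suc.prems(1)])
    show "(f has_derivative frechet_derivative f (at x)) (at x)"
      using Suc.prems(2) that by (simp add: frechet_derivative_works)
  qed
  have eq: "frechet_derivative g (at x) = frechet_derivative f (at x)" if "x \<in> S" for x
    using frechet_derivative_at[OF d[OF that]] by simp
  have "ck_on k S (\<lambda>x. frechet_derivative g (at x) v)" for v
    by (rule Suc.IH[of "\<lambda>x. frechet_derivative f (at x) v"]) (use eq Suc.prems(2) in auto)
  then show ?case using d by (auto simp: differentiable_def)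
qed

lemma smooth_on_cong:
  "open S \<Longrightarrow> (\<And>x. x \<in> S \<Longrightarrow> f x = g x) \<Longrightarrow> smooth_on S f \<Longrightarrow> smooth_on S g"
  unfolding smooth_on_def using ck_on_cong by blast

lemma smooth_on_imp_continuous_on: "smooth_on S f \<Longrightarrow> continuous_on S f"
  unfolding smooth_on_def by (metis ck_on.simps(1))

text \<open>A finite form of the Baire property: if \<open>T i\<close> has empty interior, the
  complement of \<open>T i\<close> in \<open>W\<close> is open and non-empty and is covered by the
  remaining sets.\<close>

lemma finite_closed_cover_interior:
  assumes "finite I" "open W" "W \<noteq> {}" "\<And>i. i \<in> I \<Longrightarrow> closedin (top_of_set W) (T i)" "W \<subseteq> (\<Union>i\<in>I. T i)"
  shows "\<exists>i\<in>I. interior (T i) \<noteq> {}"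
  using assms
proof (induction I arbitrary: W T rule: finite_induct)
  case empty
  then show ?case by auto
next
  case (insert i I)
  show ?case
  proof (cases "interior (T i) = {}")
    case True
    have "openin (top_of_set W) (W - T i)" using insert.prems(3)[of i] by (auto simp: closedin_def)
    then have op: "open (W - T i)" using insert.prems(1) by (simp add: openin_open_eq)
    have ne: "W - T i \<noteq> {}"
    proof
      assume "W - T i = {}"
      then have "W \<subseteq> interior (T i)" using insert.prems(1) by (intro interior_maximal) auto
      with True insert.prems(2) show False by auto
    qed
    have "\<exists>j\<in>I. interior (T j \<inter> (W - T i)) \<noteq> {}"
    proof (rule insert.IH[OF op ne])
      show "closedin (top_of_set (W - T i)) (T j \<inter> (W - T i))" if j: "j \<in> I" for j
      proof -
        have "closedin (top_of_set W) (T j)" using insert.prems(3) j by simp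
        then obtain K where "closed K" "T j = W \<inter> K"
          unfolding closedin_closed by blast
        then show ?thesis by (auto simp: closedin_closed intro!: exI[of _ K])
      qed
    qed (use insert.prems(4) in auto)
    then show ?thesis by (metis Int_lower1 insertI2 interior_mono subset_empty)
  qed auto
qed

text \<open>Otherwise \<open>W - T j\<close> is open and non-empty, and one of the sets other than
  \<open>T j\<close> would have interior points in it.\<close>

lemma closed_cover_only_thick_member:
  assumes "finite I" "open W" "\<And>i. i \<in> I \<Longrightarrow> closedin (top_of_set W) (T i)" "W \<subseteq> (\<Union>i\<in>I. T i)"
    and "j \<in> I" "\<And>i. i \<in> I \<Longrightarrow> i \<noteq> j \<Longrightarrow> interior (T i) = {}"
  shows "W \<subseteq> T j"
proof (rule ccontr)
  assume "\<not> W \<subseteq> T j"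
  then have ne: "W - T j \<noteq> {}" by auto
  have "openin (top_of_set W) (W - T j)" using assms(3,5) by (auto simp: closedin_def)
  then have op: "open (W - T j)" using assms(2) by (simp add: openin_open_eq)
  have "\<exists>i\<in>I. interior (T i \<inter> (W - T j)) \<noteq> {}"
  proof (rule finite_closed_cover_interior[OF assms(1) op ne])
    show "closedin (top_of_set (W - T j)) (T i \<inter> (W - T j))" if i: "i \<in> I" for i
    proof -
      obtain K where "closed K" "T i = W \<inter> K"
        using assms(3)[OF i] unfolding closedin_closed by blast
      then show ?thesis by (auto simp: closedin_closed intro!: exI[of _ K])
    qed
  qed (use assms(4) in auto)
  then obtain i where i: "i \<in> I" "interior (T i \<inter> (W - T j)) \<noteq> {}" by blast
  have "i \<noteq> j"
  proof
    assume "i = j"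
    then have "T i \<inter> (W - T j) = {}" by auto
    with i(2) show False by simp
  qed
  with assms(6)[OF i(1)] i(2) show False by (metis Int_lower1 interior_mono subset_empty)
qed

section \<open>Charts and embeddings\<close>

locale chart =
  fixes X :: "'x topology" and D :: "('x, 'e::real_normed_vector, 'g) ochart"
  assumes chart: "orbifold_chart X D" and fd: "fin_dim TYPE('e)"
begin

lemma open_cdom: "open (cdom D)"
  and connected_cdom: "connected (cdom D)"
  and cdom_ne: "cdom D \<noteq> {}"
  and grp: "group (cgrp D)"
  and fin: "finite (carrier (cgrp D))"
  and smooth: "g \<in> carrier (cgrp D) \<Longrightarrow> smooth_on (cdom D) (\<lambda>v. cact D v g)"
  and act_closed [simp]: "v \<in> cdom D \<Longrightarrow> g \<in> carrier (cgrp D) \<Longrightarrow> cact D v g \<in> cdom D"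
  and act_one [simp]: "v \<in> cdom D \<Longrightarrow> cact D v \<one>\<^bsub>cgrp D\<^esub> = v"
  and act_mult: "v \<in> cdom D \<Longrightarrow> g \<in> carrier (cgrp D) \<Longrightarrow> h \<in> carrier (cgrp D) \<Longrightarrow>
        cact D v (g \<otimes>\<^bsub>cgrp D\<^esub> h) = cact D (cact D v g) h"
  and effective: "g \<in> carrier (cgrp D) \<Longrightarrow> (\<And>v. v \<in> cdom D \<Longrightarrow> cact D v g = v) \<Longrightarrow> g = \<one>\<^bsub>cgrp D\<^esub>"
  and proj_eq_iff: "v \<in> cdom D \<Longrightarrow> w \<in> cdom D \<Longrightarrow>
        cproj D v = cproj D w \<longleftrightarrow> (\<exists>g\<in>carrier (cgrp D). w = cact D v g)"
  using chart by (simp_all add: orbifold_chart_def)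

sublocale G: group "cgrp D" by (rule grp)

lemma act_inv [simp]:
  assumes "v \<in> cdom D" "g \<in> carrier (cgrp D)"
  shows "cact D (cact D v g) (inv\<^bsub>cgrp D\<^esub> g) = v" "cact D (cact D v (inv\<^bsub>cgrp D\<^esub> g)) g = v"
  using assms by (simp_all flip: act_mult)

definition dact :: "'g \<Rightarrow> 'e \<Rightarrow> 'e \<Rightarrow> 'e" where
  "dact g v = frechet_derivative (\<lambda>v. cact D v g) (at v)"

lemma strict_act:
  "g \<in> carrier (cgrp D) \<Longrightarrow> v \<in> cdom D \<Longrightarrow> strict_deriv (\<lambda>v. cact D v g) (dact g v) v"
  unfolding dact_def by (rule smooth_imp_strict_deriv[OF fd smooth open_cdom])

text \<open>
  If \<open>k\<close> fixes \<open>e\<close> with trivial derivative there, then \<open>A u = \<Sum>\<^sub>i u \<cdot> k\<^sup>i\<close> has a multiple of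
  the identity as derivative, so \<open>A\<close> is injective near \<open>e\<close>; since \<open>A (u \<cdot> k) = A u\<close>, the
  element \<open>k\<close> acts trivially near \<open>e\<close>.
\<close>

lemma locally_trivial:
  assumes k: "k \<in> carrier (cgrp D)" and e: "e \<in> cdom D" "cact D e k = e"
    and sd: "strict_deriv (\<lambda>v. cact D v k) (\<lambda>v. v) e"
  obtains d where "d > 0" "ball e d \<subseteq> cdom D" "\<And>u. u \<in> ball e d \<Longrightarrow> cact D u k = u"
proof -
  have "\<not> inj (\<lambda>i::nat. k [^]\<^bsub>cgrp D\<^esub> i)"
    using k fin by (metis G.nat_pow_closed finite_subset image_subsetI infinite_UNIV_nat finite_imageD)
  then obtain i j :: nat where ij: "i < j" "k [^]\<^bsub>cgrp D\<^esub> i = k [^]\<^bsub>cgrp D\<^esub> j"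
    unfolding inj_on_def by (metis nat_neq_iff)
  define n where "n = j - i"
  have "k [^]\<^bsub>cgrp D\<^esub> i \<otimes>\<^bsub>cgrp D\<^esub> k [^]\<^bsub>cgrp D\<^esub> n = k [^]\<^bsub>cgrp D\<^esub> i"
    using ij(1) k by (simp add: G.nat_pow_mult n_def flip: ij(2))
  then have n: "n > 0" "k [^]\<^bsub>cgrp D\<^esub> n = \<one>\<^bsub>cgrp D\<^esub>"
    using ij k by (simp_all add: n_def)
  have fix_pow: "cact D e (k [^]\<^bsub>cgrp D\<^esub> i) = e" for i :: nat
    by (induction i) (use k e in \<open>simp_all add: act_mult\<close>)
  have sd_pow: "strict_deriv (\<lambda>v. cact D v (k [^]\<^bsub>cgrp D\<^esub> i)) (\<lambda>v. v) e" for i :: nat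
  proof (induction i)
    case 0
    show ?case
      by (rule strict_deriv_cong[OF strict_deriv_id open_cdom e(1)]) simp
  next
    case (Suc i)
    have "strict_deriv (\<lambda>v. cact D (cact D v (k [^]\<^bsub>cgrp D\<^esub> i)) k) (\<lambda>v. v) e"
      by (rule strict_deriv_chain[OF Suc]) (simp add: fix_pow sd)
    then show ?case
      by (rule strict_deriv_cong[OF _ open_cdom e(1)]) (use k in \<open>simp add: act_mult\<close>)
  qed
  define A where "A u = (\<Sum>i<n. cact D u (k [^]\<^bsub>cgrp D\<^esub> i))" for u
  have "strict_deriv A (\<lambda>v. \<Sum>i<n. v) e"
    unfolding A_def by (rule strict_deriv_sum) (auto intro: sd_pow)
  moreover have "(\<lambda>v::'e. \<Sum>i<n. v) = (\<lambda>v. real n *\<^sub>R v)" by (simp add: sum_constant_scaleR)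
  ultimately have "strict_deriv A (\<lambda>v. real n *\<^sub>R v) e" by simp
  with n(1) obtain d1 where d1: "d1 > 0" "inj_on A (ball e d1)"
    by (metis strict_deriv_scaleR_inj of_nat_0_less_iff)
  obtain d2 where d2: "d2 > 0" "ball e d2 \<subseteq> cdom D" using open_cdom e(1) open_contains_ball by blast
  \<comment> \<open>Injectivity of \<open>A\<close> is applied to \<open>u\<close> and its translate
    by \<open>k\<close>, so both must lie in the same small ball; this is possible because
    \<open>k\<close> fixes \<open>e\<close> and acts continuously there.\<close>
  obtain d3 where d3: "d3 > 0" "\<And>u. dist u e < d3 \<Longrightarrow> dist (cact D u k) e < d1"
    using strict_deriv_isCont[OF sd] d1(1) e(2) unfolding continuous_at_eps_delta by metis
  show thesis
  proof (rule that[of "min d1 (min d2 d3)"])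
    fix u assume u: "u \<in> ball e (min d1 (min d2 d3))"
    then have uV: "u \<in> cdom D" using d2 by auto
    have "A (cact D u k) = (\<Sum>i<n. cact D u (k [^]\<^bsub>cgrp D\<^esub> Suc i))"
      unfolding A_def by (rule sum.cong) (use uV k in \<open>simp_all add: G.nat_pow_Suc2 flip: act_mult del: nat_pow_Suc G.nat_pow_Suc\<close>)
    also have "\<dots> = A u"
    proof -
      have "cact D u (k [^]\<^bsub>cgrp D\<^esub> (0::nat)) + (\<Sum>i<n. cact D u (k [^]\<^bsub>cgrp D\<^esub> Suc i)) =
          (\<Sum>i<n. cact D u (k [^]\<^bsub>cgrp D\<^esub> i)) + cact D u (k [^]\<^bsub>cgrp D\<^esub> n)"
        using sum.lessThan_Suc_shift[of "\<lambda>i. cact D u (k [^]\<^bsub>cgrp D\<^esub> i)" n]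
        by (simp only: sum.lessThan_Suc)
      then show ?thesis using n(2) by (simp add: A_def)
    qed
    finally have "A (cact D u k) = A u" .
    moreover have "cact D u k \<in> ball e d1" "u \<in> ball e d1" using u d3(2)[of u] by (auto simp: dist_commute)
    ultimately show "cact D u k = u" using d1(2) by (auto dest: inj_onD)
  qed (use d1 d2 d3 in auto)
qed

text \<open>The interior of the fixed set of \<open>k\<close> is also closed in the chart: at a
  limit point in the chart, \<open>k\<close> agrees with the identity on open sets arbitrarily near,
  hence has the identity as derivative there, and \<open>locally_trivial\<close> applies. By
  connectedness \<open>k\<close> acts trivially, and the action is effective.\<close>

lemma rigid:
  assumes k: "k \<in> carrier (cgrp D)" and U: "open U" "U \<noteq> {}" "U \<subseteq> cdom D"
    and triv: "\<And>u. u \<in> U \<Longrightarrow> cact D u k = u"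
  shows "k = \<one>\<^bsub>cgrp D\<^esub>"
proof -
  define I where "I = interior {v \<in> cdom D. cact D v k = v}"
  have IU: "U \<subseteq> I" unfolding I_def using U(1,3) triv by (intro interior_maximal) auto
  have ID: "v \<in> cdom D \<and> cact D v k = v" if "v \<in> I" for v
    using that interior_subset unfolding I_def by blast
  have cl: "v \<in> I" if v: "v \<in> cdom D" "v \<in> closure I" for v
  proof -
    have ag: "\<exists>U. open U \<and> U \<noteq> {} \<and> U \<subseteq> ball v d \<and> (\<forall>y\<in>U. cact D y k = y)" if d: "d > 0" for d
    proof (intro exI[of _ "ball v d \<inter> I"] conjI)
      obtain y where "y \<in> I" "dist y v < d"
        using v(2) d unfolding closure_approachable by blast
      then have "y \<in> ball v d \<inter> I" by (simp add: dist_commute)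
      then show "ball v d \<inter> I \<noteq> {}" by blast
      show "open (ball v d \<inter> I)" by (simp add: I_def open_Int)
      show "\<forall>y\<in>ball v d \<inter> I. cact D y k = y" using ID by blast
    qed simp
    note * = strict_deriv_agree[OF strict_act[OF k v(1)] strict_deriv_id ag]
    have "strict_deriv (\<lambda>v. cact D v k) (\<lambda>v. v) v"
      using strict_act[OF k v(1)] *(2) by simp
    from locally_trivial[OF k v(1) *(1) this] obtain d where
      d: "d > 0" "ball v d \<subseteq> cdom D" "\<And>u. u \<in> ball v d \<Longrightarrow> cact D u k = u" by metis
    have "ball v d \<subseteq> I" unfolding I_def using d by (intro interior_maximal) auto
    then show ?thesis using d(1) by auto
  qed
  have "I \<inter> cdom D = {} \<or> - closure I \<inter> cdom D = {}"
  proof (rule connectedD[OF connected_cdom])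
    show "open I" "open (- closure I)" by (auto simp: I_def)
    show "I \<inter> - closure I \<inter> cdom D = {}" using closure_subset[of I] by auto
    show "cdom D \<subseteq> I \<union> - closure I" using cl by auto
  qed
  moreover have "I \<inter> cdom D \<noteq> {}" using IU U by auto
  ultimately have "cdom D \<subseteq> I" using cl by auto
  then show ?thesis using k ID by (intro effective) auto
qed

end

lemma chart_embeddingD:
  assumes "chart_embedding D E \<phi>"
  shows "\<phi> ` cdom D \<subseteq> cdom E" "open (\<phi> ` cdom D)" "inj_on \<phi> (cdom D)" "smooth_on (cdom D) \<phi>"
    "smooth_on (\<phi> ` cdom D) (inv_into (cdom D) \<phi>)"
    "\<And>v. v \<in> cdom D \<Longrightarrow> cproj E (\<phi> v) = cproj D v" "\<And>v. v \<in> cdom D \<Longrightarrow> \<phi> v \<in> cdom E"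
  using assms unfolding chart_embedding_def by auto

lemma chart_embedding_open_image:
  assumes "chart_embedding D E \<phi>" "open U" "U \<subseteq> cdom D"
  shows "open (\<phi> ` U)"
proof -
  note e = chart_embeddingD[OF assms(1)]
  have "open (\<phi> ` cdom D \<inter> inv_into (cdom D) \<phi> -` U)"
    using smooth_on_imp_continuous_on[OF e(5)] e(2) assms(2) by (simp add: continuous_on_open_vimage Int_commute)
  moreover have "\<phi> ` cdom D \<inter> inv_into (cdom D) \<phi> -` U = \<phi> ` U"
    using assms(3) e(3) by (auto simp: inv_into_f_f)
  ultimately show ?thesis by simp
qed

text \<open>The embedding has a smooth inverse on its open image, so the chain rule gives its
  derivative a right inverse.\<close>

lemma chart_embedding_deriv_surj:
  fixes D E :: "('x, 'e::real_normed_vector, 'g) ochart"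
  assumes fd: "fin_dim TYPE('e)" and D: "open (cdom D)" and emb: "chart_embedding D E \<phi>" and v: "v \<in> cdom D"
    and P: "strict_deriv \<phi> P v"
  shows "surj P"
proof -
  note e = chart_embeddingD[OF emb]
  let ?i = "inv_into (cdom D) \<phi>"
  have iv: "?i (\<phi> v) = v" using e(3) v by simp
  have Q: "strict_deriv ?i (frechet_derivative ?i (at (\<phi> v))) (\<phi> v)"
    by (rule smooth_imp_strict_deriv[OF fd e(5,2)]) (use v in auto)
  have "strict_deriv (\<lambda>y. \<phi> (?i y)) (\<lambda>w. P (frechet_derivative ?i (at (\<phi> v)) w)) (\<phi> v)"
    by (rule strict_deriv_chain[OF Q]) (simp add: iv P)
  moreover have "strict_deriv (\<lambda>y. \<phi> (?i y)) (\<lambda>w. w) (\<phi> v)"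
    by (rule strict_deriv_cong[OF strict_deriv_id e(2)]) (use v in \<open>auto simp: f_inv_into_f\<close>)
  ultimately have "(\<lambda>w. P (frechet_derivative ?i (at (\<phi> v)) w)) = (\<lambda>w. w)" by (rule strict_deriv_unique)
  then show ?thesis by (metis surjI)
qed

text \<open>
  Near a point of the closure of the interior of \<open>{\<psi> = \<phi> \<cdot> g}\<close> the domain is covered by the
  closed sets \<open>{\<psi> = \<phi> \<cdot> g k}\<close>; by comparison of derivatives only the one for \<open>k = 1\<close> has interior points.
\<close>

lemma chart_embeddings_differ_by_group:
  fixes D E :: "('x, 'e::real_normed_vector, 'g) ochart"
  assumes fd: "fin_dim TYPE('e)" and cD: "orbifold_chart X D" and cE: "orbifold_chart X E"
    and \<phi>: "chart_embedding D E \<phi>" and \<psi>: "chart_embedding D E \<psi>"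
  obtains g where "g \<in> carrier (cgrp E)" "\<And>v. v \<in> cdom D \<Longrightarrow> \<psi> v = cact E (\<phi> v) g"
proof -
  interpret D: chart X D by unfold_locales fact+
  interpret E: chart X E by unfold_locales fact+
  note \<phi>D = chart_embeddingD[OF \<phi>] and \<psi>D = chart_embeddingD[OF \<psi>]
  let ?W = "cdom D" and ?G = "carrier (cgrp E)"
  define T where "T g = {v \<in> ?W. \<psi> v = cact E (\<phi> v) g}" for g
  have closed: "closedin (top_of_set W') (W' \<inter> T g)" if "g \<in> ?G" "W' \<subseteq> ?W" for g W'
  proof -
    have "continuous_on W' (\<lambda>v. cact E (\<phi> v) g)"
      using that \<phi>D
      by (intro continuous_on_compose2[OF smooth_on_imp_continuous_on[OF E.smooth]]
          continuous_on_subset[OF smooth_on_imp_continuous_on[OF \<phi>D(4)]]) auto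
    moreover have "continuous_on W' \<psi>"
      using that by (intro continuous_on_subset[OF smooth_on_imp_continuous_on[OF \<psi>D(4)]])
    ultimately have "continuous_on W' (\<lambda>v. \<psi> v - cact E (\<phi> v) g)" by (intro continuous_intros)
    then have "closedin (top_of_set W') (W' \<inter> (\<lambda>v. \<psi> v - cact E (\<phi> v) g) -` {0})"
      by (rule continuous_closedin_preimage) simp
    moreover have "W' \<inter> (\<lambda>v. \<psi> v - cact E (\<phi> v) g) -` {0} = W' \<inter> T g" using that by (auto simp: T_def)
    ultimately show ?thesis by simp
  qed
  have cover: "\<exists>g\<in>?G. v \<in> T g" if "v \<in> ?W" for v
  proof -
    have "cproj E (\<phi> v) = cproj E (\<psi> v)" using that \<phi>D(6) \<psi>D(6) by simp
    then show ?thesis using that \<phi>D(7) \<psi>D(7) by (simp add: E.proj_eq_iff T_def)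
  qed
  have "\<exists>g\<in>?G. interior (?W \<inter> T g) \<noteq> {}"
    by (rule finite_closed_cover_interior[OF E.fin D.open_cdom D.cdom_ne]) (use closed cover in auto)
  then obtain g where g: "g \<in> ?G" "interior (T g) \<noteq> {}"
    by (metis Int_lower2 interior_mono subset_empty)
  define J where "J = interior (T g)"
  have JT: "J \<subseteq> T g" "T g \<subseteq> ?W" by (auto simp: J_def T_def interior_subset)
  have cl: "v \<in> J" if v: "v \<in> ?W" "v \<in> closure J" for v
  proof -
    define P where "P = frechet_derivative \<psi> (at v)"
    define Q where "Q = frechet_derivative \<phi> (at v)"
    have P: "strict_deriv \<psi> P v" and Q: "strict_deriv \<phi> Q v"
      unfolding P_def Q_def by (rule smooth_imp_strict_deriv[OF fd \<psi>D(4) D.open_cdom v(1)]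
        smooth_imp_strict_deriv[OF fd \<phi>D(4) D.open_cdom v(1)])+
    define B where "B = (\<lambda>w. E.dact g (\<phi> v) (Q w))"
    have B: "strict_deriv (\<lambda>u. cact E (\<phi> u) g) B v"
      unfolding B_def by (rule strict_deriv_chain[OF Q E.strict_act[OF g(1) \<phi>D(7)[OF v(1)]]])
    have ag: "\<exists>U. open U \<and> U \<noteq> {} \<and> U \<subseteq> ball v d \<and> (\<forall>y\<in>U. \<psi> y = cact E (\<phi> y) g)" if d: "d > 0" for d
    proof (intro exI[of _ "ball v d \<inter> J"] conjI)
      obtain y where "y \<in> J" "dist y v < d"
        using v(2) d unfolding closure_approachable by blast
      then have "y \<in> ball v d \<inter> J" by (simp add: dist_commute)
      then show "ball v d \<inter> J \<noteq> {}" by blast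
      show "open (ball v d \<inter> J)" by (simp add: J_def open_Int)
      show "\<forall>y\<in>ball v d \<inter> J. \<psi> y = cact E (\<phi> y) g" using JT(1) by (auto simp: T_def)
    qed simp
    note eq = strict_deriv_agree[OF P B ag]
    have \<psi>v: "\<psi> v \<in> cdom E" by (rule \<psi>D(7)[OF v(1)])
    \<comment> \<open>If \<open>\<psi> = \<phi> \<cdot> g k\<close> held on open sets accumulating
      at \<open>v\<close>, comparison with \<open>\<psi> = \<phi> \<cdot> g\<close> would show that
      \<open>k\<close> fixes \<open>\<psi> v\<close> and that its derivative is the identity on the
      range of the derivative of \<open>\<psi>\<close>, which is the whole space. Then
      \<open>k\<close> is trivial near \<open>\<psi> v\<close>, and \<open>rigid\<close> gives
      \<open>k = 1\<close>.\<close>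
    have thin: "\<exists>d>0. \<forall>U. open U \<longrightarrow> U \<noteq> {} \<longrightarrow> U \<subseteq> ball v d \<longrightarrow> \<not> (\<forall>y\<in>U. \<psi> y = cact E (cact E (\<phi> y) g) k)"
      if k: "k \<in> ?G" "k \<noteq> \<one>\<^bsub>cgrp E\<^esub>" for k
    proof (rule ccontr)
      assume "\<not> ?thesis"
      then have ag': "\<exists>U. open U \<and> U \<noteq> {} \<and> U \<subseteq> ball v d \<and> (\<forall>y\<in>U. \<psi> y = cact E (cact E (\<phi> y) g) k)"
        if "d > 0" for d using that by blast
      have sk: "strict_deriv (\<lambda>u. cact E (cact E (\<phi> u) g) k) (\<lambda>w. E.dact k (\<psi> v) (B w)) v"
        by (rule strict_deriv_chain[OF B]) (use E.strict_act[OF k(1) \<psi>v] eq(1) in simp)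
      note eq' = strict_deriv_agree[OF P sk ag']
      have fixv: "cact E (\<psi> v) k = \<psi> v" using eq'(1) eq(1) by simp
      have "E.dact k (\<psi> v) = (\<lambda>w. w)"
      proof
        fix w
        obtain w' where "w = P w'"
          using chart_embedding_deriv_surj[OF fd D.open_cdom \<psi> v(1) P] by (metis surjD)
        then show "E.dact k (\<psi> v) w = w" using eq'(2) eq(2) by metis
      qed
      then have "strict_deriv (\<lambda>u. cact E u k) (\<lambda>w. w) (\<psi> v)" using E.strict_act[OF k(1) \<psi>v] by simp
      from E.locally_trivial[OF k(1) \<psi>v fixv this] obtain d where
        "d > 0" "ball (\<psi> v) d \<subseteq> cdom E" "\<And>u. u \<in> ball (\<psi> v) d \<Longrightarrow> cact E u k = u" by metis
      then have "k = \<one>\<^bsub>cgrp E\<^esub>" by (intro E.rigid[OF k(1), of "ball (\<psi> v) d"]) auto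
      with k show False by simp
    qed
    then obtain r where r: "\<And>k. k \<in> ?G \<Longrightarrow> k \<noteq> \<one>\<^bsub>cgrp E\<^esub> \<Longrightarrow> r k > 0"
      "\<And>k U. k \<in> ?G \<Longrightarrow> k \<noteq> \<one>\<^bsub>cgrp E\<^esub> \<Longrightarrow> open U \<Longrightarrow> U \<noteq> {} \<Longrightarrow> U \<subseteq> ball v (r k) \<Longrightarrow>
          \<not> (\<forall>y\<in>U. \<psi> y = cact E (cact E (\<phi> y) g) k)"
      by metis
    obtain d0 where d0: "d0 > 0" "ball v d0 \<subseteq> ?W" using D.open_cdom v(1) open_contains_ball by blast
    \<comment> \<open>The group is finite, so one radius serves all its non-trivial elements. On
      this ball only the closed set belonging to \<open>k = 1\<close> can have interior points,
      hence it fills the ball.\<close>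
    define d where "d = Min (insert d0 (r ` (?G - {\<one>\<^bsub>cgrp E\<^esub>})))"
    have fin': "finite (insert d0 (r ` (?G - {\<one>\<^bsub>cgrp E\<^esub>})))" using E.fin by simp
    have d: "d > 0" "d \<le> d0" "\<And>k. k \<in> ?G \<Longrightarrow> k \<noteq> \<one>\<^bsub>cgrp E\<^esub> \<Longrightarrow> d \<le> r k"
      unfolding d_def using fin' d0(1) r(1) by (simp_all add: Min_gr_iff)
    have bW: "ball v d \<subseteq> ?W" using d0 d by auto
    have "ball v d \<subseteq> ball v d \<inter> T (g \<otimes>\<^bsub>cgrp E\<^esub> \<one>\<^bsub>cgrp E\<^esub>)"
    proof (rule closed_cover_only_thick_member[where I = ?G and j = "\<one>\<^bsub>cgrp E\<^esub>"
          and T = "\<lambda>k. ball v d \<inter> T (g \<otimes>\<^bsub>cgrp E\<^esub> k)"])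
      show "closedin (top_of_set (ball v d)) (ball v d \<inter> T (g \<otimes>\<^bsub>cgrp E\<^esub> k))" if "k \<in> ?G" for k
        using closed[of "g \<otimes>\<^bsub>cgrp E\<^esub> k" "ball v d"] that g(1) bW by simp
      show "ball v d \<subseteq> (\<Union>k\<in>?G. ball v d \<inter> T (g \<otimes>\<^bsub>cgrp E\<^esub> k))"
      proof
        fix u assume u: "u \<in> ball v d"
        then have "u \<in> ?W" using bW by auto
        from cover[OF this] obtain h where h: "h \<in> ?G" "u \<in> T h" by auto
        have "g \<otimes>\<^bsub>cgrp E\<^esub> (inv\<^bsub>cgrp E\<^esub> g \<otimes>\<^bsub>cgrp E\<^esub> h) = h"
          using g(1) h(1) by (metis E.G.inv_closed E.G.l_one E.G.m_assoc E.G.r_inv)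
        then show "u \<in> (\<Union>k\<in>?G. ball v d \<inter> T (g \<otimes>\<^bsub>cgrp E\<^esub> k))"
          using u h g(1) by (intro UN_I[of "inv\<^bsub>cgrp E\<^esub> g \<otimes>\<^bsub>cgrp E\<^esub> h"]) simp_all
      qed
      show "interior (ball v d \<inter> T (g \<otimes>\<^bsub>cgrp E\<^esub> k)) = {}" if k: "k \<in> ?G" "k \<noteq> \<one>\<^bsub>cgrp E\<^esub>" for k
      proof (rule ccontr)
        let ?U = "interior (ball v d \<inter> T (g \<otimes>\<^bsub>cgrp E\<^esub> k))"
        assume ne: "?U \<noteq> {}"
        have sub: "?U \<subseteq> ball v d \<inter> T (g \<otimes>\<^bsub>cgrp E\<^esub> k)" by (rule interior_subset)
        then have "?U \<subseteq> ball v (r k)" using d(3)[OF k] by auto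
        moreover have "\<forall>y\<in>?U. \<psi> y = cact E (cact E (\<phi> y) g) k"
        proof
          fix y assume "y \<in> ?U"
          then have y: "y \<in> ?W" "\<psi> y = cact E (\<phi> y) (g \<otimes>\<^bsub>cgrp E\<^esub> k)" using sub by (auto simp: T_def)
          then show "\<psi> y = cact E (cact E (\<phi> y) g) k" using E.act_mult[OF \<phi>D(7)[OF y(1)] g(1) k(1)] by simp
        qed
        ultimately show False using r(2)[OF k open_interior ne] by blast
      qed
    qed (use E.fin in auto)
    then have "ball v d \<subseteq> J" unfolding J_def using g(1) by (intro interior_maximal) auto
    then show ?thesis using d(1) by auto
  qed
  have "J \<inter> ?W = {} \<or> - closure J \<inter> ?W = {}"
  proof (rule connectedD[OF D.connected_cdom])
    show "open J" "open (- closure J)" by (auto simp: J_def)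
    show "J \<inter> - closure J \<inter> ?W = {}" using closure_subset[of J] by auto
    show "?W \<subseteq> J \<union> - closure J" using cl by auto
  qed
  moreover have "J \<inter> ?W \<noteq> {}" using JT g(2) by (auto simp: J_def)
  ultimately have "?W \<subseteq> J" using cl by auto
  then show thesis using that[OF g(1)] JT(1) by (auto simp: T_def)
qed

context chart
begin

text \<open>For a right action, \<open>v \<cdot> h g = (v \<cdot> g) \<cdot> (inv g h g)\<close>, so
  translation by \<open>g\<close> is equivariant with respect to conjugation by
  \<open>g\<close>.\<close>

lemma act_embedding:
  assumes g: "g \<in> carrier (cgrp D)"
  shows "chart_embedding D D (\<lambda>v. cact D v g)"
  unfolding chart_embedding_def
proof (intro conjI)
  have im: "(\<lambda>v. cact D v g) ` cdom D = cdom D"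
  proof
    show "cdom D \<subseteq> (\<lambda>v. cact D v g) ` cdom D"
    proof
      fix v assume "v \<in> cdom D"
      then show "v \<in> (\<lambda>v. cact D v g) ` cdom D"
        using g by (intro image_eqI[of _ _ "cact D v (inv\<^bsub>cgrp D\<^esub> g)"]) auto
    qed
  qed (use g in auto)
  show inj: "inj_on (\<lambda>v. cact D v g) (cdom D)"
    by (rule inj_on_inverseI[where g = "\<lambda>v. cact D v (inv\<^bsub>cgrp D\<^esub> g)"]) (use g in simp)
  show "(\<lambda>v. cact D v g) ` cdom D \<subseteq> cdom D" "open ((\<lambda>v. cact D v g) ` cdom D)"
    using open_cdom by (simp_all add: im)
  show "smooth_on (cdom D) (\<lambda>v. cact D v g)" by (rule smooth[OF g])
  have "smooth_on (cdom D) (inv_into (cdom D) (\<lambda>v. cact D v g))"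
  proof (rule smooth_on_cong[OF open_cdom _ smooth[of "inv\<^bsub>cgrp D\<^esub> g"]])
    show "cact D v (inv\<^bsub>cgrp D\<^esub> g) = inv_into (cdom D) (\<lambda>v. cact D v g) v" if "v \<in> cdom D" for v
      using inv_into_f_f[OF inj, of "cact D v (inv\<^bsub>cgrp D\<^esub> g)"] that g by simp
  qed (use g in simp)
  then show "smooth_on ((\<lambda>v. cact D v g) ` cdom D) (inv_into (cdom D) (\<lambda>v. cact D v g))" by (simp add: im)
  show "\<forall>v\<in>cdom D. cproj D (cact D v g) = cproj D v"
    using g proj_eq_iff by (metis act_closed)
  show "\<exists>\<eta>\<in>hom (cgrp D) (cgrp D). inj_on \<eta> (carrier (cgrp D)) \<and>
      (\<forall>v\<in>cdom D. \<forall>h\<in>carrier (cgrp D). cact D (cact D v h) g = cact D (cact D v g) (\<eta> h))"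
  proof (intro bexI[of _ "\<lambda>h. inv\<^bsub>cgrp D\<^esub> g \<otimes>\<^bsub>cgrp D\<^esub> h \<otimes>\<^bsub>cgrp D\<^esub> g"] conjI ballI)
    show "inj_on (\<lambda>h. inv\<^bsub>cgrp D\<^esub> g \<otimes>\<^bsub>cgrp D\<^esub> h \<otimes>\<^bsub>cgrp D\<^esub> g) (carrier (cgrp D))"
      by (rule inj_onI) (use g in simp)
    show "(\<lambda>h. inv\<^bsub>cgrp D\<^esub> g \<otimes>\<^bsub>cgrp D\<^esub> h \<otimes>\<^bsub>cgrp D\<^esub> g) \<in> hom (cgrp D) (cgrp D)"
    proof (rule homI)
      fix h k assume hk: "h \<in> carrier (cgrp D)" "k \<in> carrier (cgrp D)"
      have "g \<otimes>\<^bsub>cgrp D\<^esub> (inv\<^bsub>cgrp D\<^esub> g \<otimes>\<^bsub>cgrp D\<^esub> (k \<otimes>\<^bsub>cgrp D\<^esub> g)) = k \<otimes>\<^bsub>cgrp D\<^esub> g"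
        using g hk by (simp flip: G.m_assoc)
      then show "inv\<^bsub>cgrp D\<^esub> g \<otimes>\<^bsub>cgrp D\<^esub> (h \<otimes>\<^bsub>cgrp D\<^esub> k) \<otimes>\<^bsub>cgrp D\<^esub> g =
          inv\<^bsub>cgrp D\<^esub> g \<otimes>\<^bsub>cgrp D\<^esub> h \<otimes>\<^bsub>cgrp D\<^esub> g \<otimes>\<^bsub>cgrp D\<^esub> (inv\<^bsub>cgrp D\<^esub> g \<otimes>\<^bsub>cgrp D\<^esub> k \<otimes>\<^bsub>cgrp D\<^esub> g)"
        using g hk by (simp add: G.m_assoc)
    qed (use g in simp)
    fix v h assume v: "v \<in> cdom D" "h \<in> carrier (cgrp D)"
    have "cact D (cact D v g) (inv\<^bsub>cgrp D\<^esub> g \<otimes>\<^bsub>cgrp D\<^esub> h \<otimes>\<^bsub>cgrp D\<^esub> g) =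
        cact D v (g \<otimes>\<^bsub>cgrp D\<^esub> (inv\<^bsub>cgrp D\<^esub> g \<otimes>\<^bsub>cgrp D\<^esub> h \<otimes>\<^bsub>cgrp D\<^esub> g))"
      using v g by (intro act_mult[symmetric]) auto
    also have "g \<otimes>\<^bsub>cgrp D\<^esub> (inv\<^bsub>cgrp D\<^esub> g \<otimes>\<^bsub>cgrp D\<^esub> h \<otimes>\<^bsub>cgrp D\<^esub> g) = h \<otimes>\<^bsub>cgrp D\<^esub> g"
      using v g by (simp flip: G.m_assoc)
    finally show "cact D (cact D v h) g = cact D (cact D v g) (inv\<^bsub>cgrp D\<^esub> g \<otimes>\<^bsub>cgrp D\<^esub> h \<otimes>\<^bsub>cgrp D\<^esub> g)"
      using v g by (simp add: act_mult)
  qed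
qed

lemma id_embedding: "chart_embedding D D id"
proof -
  have *: "chart_embedding D D (\<lambda>v. cact D v \<one>\<^bsub>cgrp D\<^esub>)" by (rule act_embedding) simp
  have im: "(\<lambda>v. cact D v \<one>\<^bsub>cgrp D\<^esub>) ` cdom D = cdom D" by simp
  have "smooth_on (cdom D) id"
    by (rule smooth_on_cong[OF open_cdom _ smooth[of "\<one>\<^bsub>cgrp D\<^esub>"]]) auto
  moreover have "smooth_on (cdom D) (inv_into (cdom D) id)"
    by (rule smooth_on_cong[OF open_cdom _ smooth[of "\<one>\<^bsub>cgrp D\<^esub>"]])
      (auto simp: inv_into_f_f[of id, simplified])
  moreover have "(\<lambda>h. h) \<in> hom (cgrp D) (cgrp D)" by (rule homI) auto
  ultimately show ?thesis
    unfolding chart_embedding_def using open_cdom by (auto intro!: bexI[of _ "\<lambda>h. h"])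
qed

end

section \<open>The orbifold groupoid and its twisted sectors as part of its inertia groupoid\<close>

section \<open>The orbifold groupoid\<close>

text \<open>That the orbifold groupoid satisfies the groupoid axioms is part of the hypothesis of
  Morita equivalence, from which this assumption will be discharged.\<close>

locale orbifold_gpd =
  fixes X :: "'x topology" and C :: "'x \<Rightarrow> ('x, 'e::real_normed_vector, 'g) ochart"
  assumes orb: "orbifold X C" and gpd: "topological_groupoid (orbifold_groupoid X C)"
begin

abbreviation "XX \<equiv> orbifold_groupoid X C"
abbreviation "cls \<equiv> orb_class X C"
abbreviation "rel \<equiv> roof_rel X C"

sublocale XX: topgpd XX by unfold_locales (rule gpd)

definition germs :: "(('x, 'e, 'g) roof \<times> 'e) topology" where
  "germs = sum_topology (\<lambda>\<rho>. top_of_set (cdom (fst (snd (snd \<rho>))))) (roofs X C)"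

lemma arr_eq: "garr XX = quotient_top germs cls"
  by (simp add: orbifold_groupoid_def germs_def case_prod_unfold)

lemma obj_eq: "gobj XX = sum_topology (\<lambda>p. top_of_set (cdom (C p))) (topspace X)"
  by (simp add: orbifold_groupoid_def)

lemma topspace_germs: "topspace germs = {(\<rho>, w). \<rho> \<in> roofs X C \<and> w \<in> cdom (fst (snd (snd \<rho>)))}"
  by (auto simp: germs_def)

lemma chart_C: "p \<in> topspace X \<Longrightarrow> chart X (C p)"
  using orb by unfold_locales (auto simp: orbifold_def)

lemma fin_dim: "fin_dim TYPE('e)"
  using orb by (simp add: orbifold_def)

lemma roofsD:
  assumes "\<rho> \<in> roofs X C"
  shows "fst \<rho> \<in> topspace X" "snd (snd (snd (snd \<rho>))) \<in> topspace X"
    "orbifold_chart X (fst (snd (snd \<rho>)))"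
    "chart_embedding (fst (snd (snd \<rho>))) (C (fst \<rho>)) (fst (snd \<rho>))"
    "chart_embedding (fst (snd (snd \<rho>))) (C (snd (snd (snd (snd \<rho>))))) (fst (snd (snd (snd \<rho>))))"
  using assms by (auto simp: roofs_def)

lemma relD:
  assumes "rel t' t"
  obtains \<gamma> where "fst (fst t') = fst (fst t)" "snd (snd (snd (snd (fst t')))) = snd (snd (snd (snd (fst t))))"
    "t' \<in> topspace germs" "t \<in> topspace germs"
    "chart_embedding (fst (snd (snd (fst t')))) (fst (snd (snd (fst t)))) \<gamma>" "\<gamma> (snd t') = snd t"
    "\<And>v. v \<in> cdom (fst (snd (snd (fst t')))) \<Longrightarrow> fst (snd (fst t')) v = fst (snd (fst t)) (\<gamma> v) \<and>
        fst (snd (snd (snd (fst t')))) v = fst (snd (snd (snd (fst t)))) (\<gamma> v)"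
  using assms by (auto simp: roof_rel_def case_prod_unfold topspace_germs)

lemma relI:
  assumes "fst \<rho>' = fst \<rho>" "snd (snd (snd (snd \<rho>'))) = snd (snd (snd (snd \<rho>)))"
    "(\<rho>', w') \<in> topspace germs" "(\<rho>, w) \<in> topspace germs"
    "chart_embedding (fst (snd (snd \<rho>'))) (fst (snd (snd \<rho>))) \<gamma>" "\<gamma> w' = w"
    "\<And>v. v \<in> cdom (fst (snd (snd \<rho>'))) \<Longrightarrow> fst (snd \<rho>') v = fst (snd \<rho>) (\<gamma> v) \<and>
        fst (snd (snd (snd \<rho>'))) v = fst (snd (snd (snd \<rho>))) (\<gamma> v)"
  shows "rel (\<rho>', w') (\<rho>, w)"
  using assms by (auto simp: roof_rel_def case_prod_unfold topspace_germs)

definition gsource :: "('x, 'e, 'g) roof \<times> 'e \<Rightarrow> 'x \<times> 'e" where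
  "gsource t = (fst (fst t), fst (snd (fst t)) (snd t))"

definition gtarget :: "('x, 'e, 'g) roof \<times> 'e \<Rightarrow> 'x \<times> 'e" where
  "gtarget t = (snd (snd (snd (snd (fst t)))), fst (snd (snd (snd (fst t)))) (snd t))"

lemma equiv_source_target:
  assumes "equivclp rel t t'"
  shows "gsource t' = gsource t \<and> gtarget t' = gtarget t"
  using assms
proof (induction rule: equivclp_induct)
  case (step y z)
  have "gsource y = gsource z \<and> gtarget y = gtarget z" if "rel y z" for y z
    using that by (elim relD) (auto simp: gsource_def gtarget_def topspace_germs case_prod_unfold)
  with step show ?case by metis
qed simp

lemma cls_eq_iff: "cls t = cls t' \<longleftrightarrow> equivclp rel t t'"
proof
  assume "cls t = cls t'"
  moreover have "t' \<in> cls t'" by (simp add: orb_class_def)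
  ultimately have "t' \<in> cls t" by simp
  then show "equivclp rel t t'" by (simp add: orb_class_def)
next
  assume *: "equivclp rel t t'"
  show "cls t = cls t'"
    unfolding orb_class_def
    by (intro Collect_cong iffI) (rule equivclp_trans[OF equivclp_sym[OF *]] equivclp_trans[OF *], assumption)+
qed

lemma src_cls: "gsrc XX (cls t) = gsource t"
proof -
  have "gsrc XX (cls t) = (THE y. \<exists>t'\<in>cls t. y = gsource t')"
    by (simp add: orbifold_groupoid_def case_prod_unfold gsource_def)
  also have "\<dots> = gsource t"
  proof (rule the_equality)
    show "\<exists>t'\<in>cls t. gsource t = gsource t'"
      by (rule bexI[of _ t]) (simp_all add: orb_class_def)
  qed (auto simp: orb_class_def dest: equiv_source_target)
  finally show ?thesis .
qed

lemma tgt_cls: "gtgt XX (cls t) = gtarget t"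
proof -
  have "gtgt XX (cls t) = (THE y. \<exists>t'\<in>cls t. y = gtarget t')"
    by (simp add: orbifold_groupoid_def case_prod_unfold gtarget_def)
  also have "\<dots> = gtarget t"
  proof (rule the_equality)
    show "\<exists>t'\<in>cls t. gtarget t = gtarget t'"
      by (rule bexI[of _ t]) (simp_all add: orb_class_def)
  qed (auto simp: orb_class_def dest: equiv_source_target)
  finally show ?thesis .
qed

lemma arr_cases:
  assumes "a \<in> topspace (garr XX)"
  obtains t where "t \<in> topspace germs" "a = cls t"
  using assms by (auto simp: arr_eq)

lemma cls_closed: "t \<in> topspace germs \<Longrightarrow> cls t \<in> topspace (garr XX)"
  by (simp add: arr_eq)

lemma openin_germs_slice:
  assumes "\<rho> \<in> roofs X C" "open U" "U \<subseteq> cdom (fst (snd (snd \<rho>)))"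
  shows "openin germs ({\<rho>} \<times> U)"
  unfolding germs_def openin_sum_topology
proof (intro conjI ballI)
  fix i assume "i \<in> roofs X C"
  show "openin (top_of_set (cdom (fst (snd (snd i))))) {x. (i, x) \<in> {\<rho>} \<times> U}"
    using assms by (cases "i = \<rho>") (auto simp: openin_open)
qed (use assms in auto)

lemma openin_germsD:
  assumes "openin germs U" "\<rho> \<in> roofs X C"
  shows "open {w. (\<rho>, w) \<in> U}" "{w. (\<rho>, w) \<in> U} \<subseteq> cdom (fst (snd (snd \<rho>)))"
proof -
  interpret chart X "fst (snd (snd \<rho>))"
    using roofsD[OF assms(2)] fin_dim by unfold_locales
  have "openin (top_of_set (cdom (fst (snd (snd \<rho>))))) {w. (\<rho>, w) \<in> U}"
    using assms unfolding germs_def openin_sum_topology by blast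
  then show "open {w. (\<rho>, w) \<in> U}" "{w. (\<rho>, w) \<in> U} \<subseteq> cdom (fst (snd (snd \<rho>)))"
    using open_cdom by (simp_all add: openin_open_eq)
qed

text \<open>Each generating relation is induced by an embedding \<open>\<gamma>\<close>. It carries
  neighbourhoods forward because its images of open sets are open, and backward because it is
  continuous. Therefore saturations of open sets are open, and the quotient map to the arrow space
  is an open map.\<close>

lemma equiv_local:
  assumes "equivclp rel u t" "u \<in> U" "openin germs U"
  shows "\<exists>V. openin germs V \<and> t \<in> V \<and> (\<forall>t'\<in>V. \<exists>u'\<in>U. equivclp rel u' t')"
  using assms(1)
proof (induction rule: equivclp_induct)
  case base
  show ?case using assms(2,3) equivclp_refl by (intro exI[of _ U] conjI ballI bexI) assumption+
next
  case (step y z)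
  then obtain V where V: "openin germs V" "y \<in> V" "\<And>t'. t' \<in> V \<Longrightarrow> \<exists>u'\<in>U. equivclp rel u' t'" by blast
  from step(2) show ?case
  proof
    assume yz: "rel y z"
    from yz obtain \<gamma> where e: "fst (fst y) = fst (fst z)" "snd (snd (snd (snd (fst y)))) = snd (snd (snd (snd (fst z))))"
      "y \<in> topspace germs" "z \<in> topspace germs"
      "chart_embedding (fst (snd (snd (fst y)))) (fst (snd (snd (fst z)))) \<gamma>" "\<gamma> (snd y) = snd z"
      "\<And>v. v \<in> cdom (fst (snd (snd (fst y)))) \<Longrightarrow> fst (snd (fst y)) v = fst (snd (fst z)) (\<gamma> v) \<and>
          fst (snd (snd (snd (fst y)))) v = fst (snd (snd (snd (fst z)))) (\<gamma> v)"
      by (rule relD) blast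
    have yr: "fst y \<in> roofs X C" and zr: "fst z \<in> roofs X C" using e(3,4) by (auto simp: topspace_germs)
    let ?N = "{w. (fst y, w) \<in> V}"
    note N = openin_germsD[OF V(1) yr]
    have "openin germs ({fst z} \<times> \<gamma> ` ?N)"
      by (rule openin_germs_slice[OF zr chart_embedding_open_image[OF e(5) N]])
        (use N(2) chart_embeddingD(7)[OF e(5)] in auto)
    moreover have "z \<in> {fst z} \<times> \<gamma> ` ?N"
      using V(2) e(6) by (cases z) (auto intro!: image_eqI[of _ _ "snd y"])
    moreover have "\<exists>u'\<in>U. equivclp rel u' t'" if t': "t' \<in> {fst z} \<times> \<gamma> ` ?N" for t'
    proof -
      obtain w where w: "t' = (fst z, \<gamma> w)" "(fst y, w) \<in> V" using t' by auto
      have wd: "w \<in> cdom (fst (snd (snd (fst y))))" using w(2) N(2) by auto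
      have r: "rel (fst y, w) (fst z, \<gamma> w)"
        by (rule relI[where \<gamma> = \<gamma>])
          (use e yr zr wd chart_embeddingD(7)[OF e(5) wd] in \<open>simp_all add: topspace_germs\<close>)
      obtain u' where u': "u' \<in> U" "equivclp rel u' (fst y, w)" using V(3)[OF w(2)] by blast
      show ?thesis
        unfolding w(1) by (rule bexI[of _ u'], rule equivclp_trans[OF u'(2) r_into_equivclp[of rel, OF r]], rule u'(1))
    qed
    ultimately show ?thesis by (intro exI[of _ "{fst z} \<times> \<gamma> ` ?N"] conjI ballI) simp_all
  next
    assume zy: "rel z y"
    from zy obtain \<gamma> where e: "fst (fst z) = fst (fst y)" "snd (snd (snd (snd (fst z)))) = snd (snd (snd (snd (fst y))))"
      "z \<in> topspace germs" "y \<in> topspace germs"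
      "chart_embedding (fst (snd (snd (fst z)))) (fst (snd (snd (fst y)))) \<gamma>" "\<gamma> (snd z) = snd y"
      "\<And>v. v \<in> cdom (fst (snd (snd (fst z)))) \<Longrightarrow> fst (snd (fst z)) v = fst (snd (fst y)) (\<gamma> v) \<and>
          fst (snd (snd (snd (fst z)))) v = fst (snd (snd (snd (fst y)))) (\<gamma> v)"
      by (rule relD) blast
    have yr: "fst y \<in> roofs X C" and zr: "fst z \<in> roofs X C" using e(3,4) by (auto simp: topspace_germs)
    let ?W = "cdom (fst (snd (snd (fst z))))"
    let ?N = "?W \<inter> \<gamma> -` {w. (fst y, w) \<in> V}"
    interpret Dz: chart X "fst (snd (snd (fst z)))"
      using roofsD[OF zr] fin_dim by unfold_locales
    have "open ?N"
      by (rule continuous_open_preimage[OF smooth_on_imp_continuous_on[OF chart_embeddingD(4)[OF e(5)]]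
            Dz.open_cdom openin_germsD(1)[OF V(1) yr]])
    then have "openin germs ({fst z} \<times> ?N)" by (intro openin_germs_slice zr) auto
    moreover have "z \<in> {fst z} \<times> ?N"
      using V(2) e(3,6) by (cases z) (auto simp: topspace_germs)
    moreover have "\<exists>u'\<in>U. equivclp rel u' t'" if t': "t' \<in> {fst z} \<times> ?N" for t'
    proof -
      obtain w where w: "t' = (fst z, w)" "(fst y, \<gamma> w) \<in> V" "w \<in> ?W" using t' by auto
      have r: "rel (fst z, w) (fst y, \<gamma> w)"
        by (rule relI[where \<gamma> = \<gamma>])
          (use e yr zr w(3) chart_embeddingD(7)[OF e(5) w(3)] in \<open>simp_all add: topspace_germs\<close>)
      obtain u' where u': "u' \<in> U" "equivclp rel u' (fst y, \<gamma> w)" using V(3)[OF w(2)] by blast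
      show ?thesis
        unfolding w(1)
        by (rule bexI[of _ u'], rule equivclp_trans[OF u'(2) equivclp_sym[OF r_into_equivclp[of rel, OF r]]], rule u'(1))
    qed
    ultimately show ?thesis by (intro exI[of _ "{fst z} \<times> ?N"] conjI ballI) simp_all
  qed
qed

lemma cls_open: "open_map germs (garr XX) cls"
  unfolding open_map_def
proof (intro allI impI)
  fix U assume U: "openin germs U"
  have "openin germs {t \<in> topspace germs. cls t \<in> cls ` U}"
  proof (subst openin_subopen, intro ballI)
    fix t assume "t \<in> {t \<in> topspace germs. cls t \<in> cls ` U}"
    then have "cls t \<in> cls ` U" by simp
    then obtain u where u: "u \<in> U" "equivclp rel u t" by (metis (no_types, lifting) cls_eq_iff imageE)
    from equiv_local[OF u(2,1) U] obtain V where
      V: "openin germs V" "t \<in> V" "\<And>t'. t' \<in> V \<Longrightarrow> \<exists>u'\<in>U. equivclp rel u' t'" by blast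
    have "V \<subseteq> {t \<in> topspace germs. cls t \<in> cls ` U}"
    proof
      fix t' assume t': "t' \<in> V"
      from V(3)[OF t'] obtain u' where u': "u' \<in> U" "equivclp rel u' t'" by blast
      from u'(2) have "cls u' = cls t'" by (simp only: cls_eq_iff)
      then have "cls t' \<in> cls ` U" by (rule image_eqI[OF sym u'(1)])
      then show "t' \<in> {t \<in> topspace germs. cls t \<in> cls ` U}" using t' openin_subset[OF V(1)] by auto
    qed
    then show "\<exists>T. openin germs T \<and> t \<in> T \<and> T \<subseteq> {t \<in> topspace germs. cls t \<in> cls ` U}"
      using V(1,2) by blast
  qed
  then show "openin (garr XX) (cls ` U)"
    using openin_subset[OF U] by (auto simp: arr_eq openin_quotient_top)
qed

lemma gsource_open: "open_map germs (gobj XX) gsource"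
  unfolding open_map_def
proof (intro allI impI)
  fix U assume U: "openin germs U"
  show "openin (gobj XX) (gsource ` U)"
    unfolding obj_eq openin_sum_topology
  proof (intro conjI ballI)
    show "gsource ` U \<subseteq> Sigma (topspace X) (topspace \<circ> (\<lambda>p. top_of_set (cdom (C p))))"
      using openin_subset[OF U] chart_embeddingD(7)[OF roofsD(4)] roofsD(1)
      by (auto simp: topspace_germs gsource_def)
    fix p assume p: "p \<in> topspace X"
    have eq: "{x. (p, x) \<in> gsource ` U} = (\<Union>\<rho>\<in>{\<rho> \<in> roofs X C. fst \<rho> = p}. fst (snd \<rho>) ` {w. (\<rho>, w) \<in> U})"
      using openin_subset[OF U] by (force simp: topspace_germs gsource_def)
    have "open (fst (snd \<rho>) ` {w. (\<rho>, w) \<in> U})" if "\<rho> \<in> roofs X C" for \<rho>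
      by (rule chart_embedding_open_image[OF roofsD(4)[OF that] openin_germsD[OF U that]])
    then have "open {x. (p, x) \<in> gsource ` U}" unfolding eq by (intro open_UN) auto
    moreover have "{x. (p, x) \<in> gsource ` U} \<subseteq> cdom (C p)"
      using openin_subset[OF U] chart_embeddingD(7)[OF roofsD(4)]
      by (auto simp: topspace_germs gsource_def)
    ultimately show "openin (top_of_set (cdom (C p))) {x. (p, x) \<in> gsource ` U}"
      by (auto simp: openin_open)
  qed
qed

lemma src_open: "open_map (garr XX) (gobj XX) (gsrc XX)"
proof (rule open_map_factor[OF gsource_open])
  show "continuous_map germs (garr XX) cls"
    unfolding arr_eq by (rule continuous_map_quotient_top)
  show "\<exists>t\<in>topspace germs. cls t = a" if "a \<in> topspace (garr XX)" for a
    using that by (rule arr_cases) auto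
  show "gsource t = gsrc XX (cls t)" for t by (rule src_cls[symmetric])
qed


subsection \<open>Group elements as arrows\<close>

abbreviation "ga \<equiv> group_arrow X C"

definition groof :: "'x \<Rightarrow> 'g \<Rightarrow> ('x, 'e, 'g) roof" where
  "groof p g = (p, id, C p, \<lambda>v. cact (C p) v g, p)"

lemma ga_eq: "ga (p, x) g = cls (groof p g, x)"
  by (simp add: group_arrow_def groof_def)

lemma groof_in: 
  assumes "p \<in> topspace X" "g \<in> carrier (cgrp (C p))"
  shows "groof p g \<in> roofs X C"
proof -
  interpret chart X "C p" by (rule chart_C[OF assms(1)])
  show ?thesis using assms act_embedding[OF assms(2)] id_embedding chart by (simp add: groof_def roofs_def)
qed

lemma groof_germ:
  "p \<in> topspace X \<Longrightarrow> g \<in> carrier (cgrp (C p)) \<Longrightarrow> x \<in> cdom (C p) \<Longrightarrow> (groof p g, x) \<in> topspace germs"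
  by (simp add: topspace_germs groof_in) (simp add: groof_def)

lemma
  assumes "p \<in> topspace X" "g \<in> carrier (cgrp (C p))" "x \<in> cdom (C p)"
  shows ga_closed [simp]: "ga (p, x) g \<in> topspace (garr XX)"
    and src_ga [simp]: "gsrc XX (ga (p, x) g) = (p, x)"
    and tgt_ga [simp]: "gtgt XX (ga (p, x) g) = (p, cact (C p) x g)"
proof -
  show "ga (p, x) g \<in> topspace (garr XX)" unfolding ga_eq by (intro cls_closed groof_germ assms)
  show "gsrc XX (ga (p, x) g) = (p, x)" "gtgt XX (ga (p, x) g) = (p, cact (C p) x g)"
    unfolding ga_eq src_cls tgt_cls gsource_def gtarget_def by (simp_all add: groof_def)
qed

text \<open>The embedding \<open>\<phi>1\<close> itself relates the given representative to the
  standard one on the chart at \<open>p\<close>.\<close>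

lemma cls_eq_ga:
  assumes "(p, \<phi>1, D, \<phi>2, p) \<in> roofs X C" "w \<in> cdom D" "g \<in> carrier (cgrp (C p))"
    "\<And>v. v \<in> cdom D \<Longrightarrow> \<phi>2 v = cact (C p) (\<phi>1 v) g"
  shows "cls ((p, \<phi>1, D, \<phi>2, p), w) = ga (p, \<phi>1 w) g"
proof -
  have \<phi>1: "chart_embedding D (C p) \<phi>1" and p: "p \<in> topspace X" using roofsD[OF assms(1)] by simp_all
  have "rel ((p, \<phi>1, D, \<phi>2, p), w) (groof p g, \<phi>1 w)"
    by (rule relI[where \<gamma> = \<phi>1])
      (use assms \<phi>1 groof_germ[OF p assms(3) chart_embeddingD(7)[OF \<phi>1 assms(2)]]
        in \<open>simp_all add: groof_def topspace_germs\<close>)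
  then show ?thesis unfolding ga_eq cls_eq_iff by (rule r_into_equivclp)
qed

text \<open>Both legs of a representative embed its chart into the same chart at \<open>p\<close>,
  so they differ by one group element.\<close>

lemma loop_eq_ga:
  assumes "a \<in> topspace (garr XX)" "gsrc XX a = (p, x)" "gtgt XX a = (p, y)"
  obtains g where "g \<in> carrier (cgrp (C p))" "a = ga (p, x) g" "p \<in> topspace X" "x \<in> cdom (C p)" "y = cact (C p) x g"
proof -
  obtain t where t: "t \<in> topspace germs" "a = cls t" using assms(1) by (rule arr_cases)
  obtain p' \<phi>1 D \<phi>2 q' w where t': "t = ((p', \<phi>1, D, \<phi>2, q'), w)" by (cases t) auto
  have *: "p' = p" "q' = p" "x = \<phi>1 w" "y = \<phi>2 w"
    using assms(2,3) by (auto simp: t(2) src_cls tgt_cls gsource_def gtarget_def t')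
  have r: "(p, \<phi>1, D, \<phi>2, p) \<in> roofs X C" "w \<in> cdom D" using t(1) by (auto simp: topspace_germs t' *)
  note rD = roofsD[OF r(1), simplified]
  have Cp: "orbifold_chart X (C p)" using chart_C[OF rD(1)] by (simp add: chart_def)
  obtain g where g: "g \<in> carrier (cgrp (C p))" "\<And>v. v \<in> cdom D \<Longrightarrow> \<phi>2 v = cact (C p) (\<phi>1 v) g"
    using chart_embeddings_differ_by_group[OF fin_dim rD(3) Cp rD(4,5)] by metis
  show thesis
  proof (rule that[OF g(1)])
    show "a = ga (p, x) g" unfolding t(2) t' * by (rule cls_eq_ga[OF r g])
    show "p \<in> topspace X" by (rule rD(1))
    show "x \<in> cdom (C p)" "y = cact (C p) x g" using * g(2)[OF r(2)] chart_embeddingD(7)[OF rD(4) r(2)] by auto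
  qed
qed

text \<open>
  By rigidity of embeddings, the relation between the two legs of a representative at one point
  holds on the whole chart.
\<close>

lemma ga_representative:
  assumes p: "p \<in> topspace X" and g: "g \<in> carrier (cgrp (C p))" and x: "x \<in> cdom (C p)"
    and t: "t \<in> ga (p, x) g"
  shows "fst t \<in> roofs X C \<and> snd t \<in> cdom (fst (snd (snd (fst t)))) \<and> gsource t = (p, x) \<and>
    snd (snd (snd (snd (fst t)))) = p \<and>
    (\<forall>v\<in>cdom (fst (snd (snd (fst t)))). fst (snd (snd (snd (fst t)))) v = cact (C p) (fst (snd (fst t)) v) g)"
proof -
  interpret Cp: chart X "C p" by (rule chart_C[OF p])
  have "equivclp rel (groof p g, x) t" using t by (simp add: ga_eq orb_class_def)
  then show ?thesis
  proof (induction rule: equivclp_induct)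
    case base
    show ?case using groof_germ[OF p g x] by (simp add: topspace_germs gsource_def) (simp add: groof_def)
  next
    case (step y z)
    from step(2) show ?case
    proof
      \<comment> \<open>Here the chart of \<open>z\<close> is the larger one, and the relation is
        known only on the image of \<open>\<gamma>\<close>. The legs of \<open>z\<close> differ by
        some \<open>h\<close> on the whole chart; \<open>h\<close> and \<open>g\<close> act alike on
        a non-empty open set, so \<open>rigid\<close> gives \<open>h = g\<close>. In the opposite
        case the relation is merely restricted.\<close>
      assume yz: "rel y z"
      from yz obtain \<gamma> where e: "fst (fst y) = fst (fst z)" "snd (snd (snd (snd (fst y)))) = snd (snd (snd (snd (fst z))))"
        "y \<in> topspace germs" "z \<in> topspace germs"
        "chart_embedding (fst (snd (snd (fst y)))) (fst (snd (snd (fst z)))) \<gamma>" "\<gamma> (snd y) = snd z"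
        "\<And>v. v \<in> cdom (fst (snd (snd (fst y)))) \<Longrightarrow> fst (snd (fst y)) v = fst (snd (fst z)) (\<gamma> v) \<and>
            fst (snd (snd (snd (fst y)))) v = fst (snd (snd (snd (fst z)))) (\<gamma> v)"
        by (rule relD) blast
      have zr: "fst z \<in> roofs X C" "snd z \<in> cdom (fst (snd (snd (fst z))))"
        and yr: "fst y \<in> roofs X C" "snd y \<in> cdom (fst (snd (snd (fst y))))"
        using e(3,4) by (auto simp: topspace_germs)
      define D where "D = fst (snd (snd (fst z)))"
      define D' where "D' = fst (snd (snd (fst y)))"
      define \<phi>1 where "\<phi>1 = fst (snd (fst z))"
      define \<phi>2 where "\<phi>2 = fst (snd (snd (snd (fst z))))"
      have src: "gsource z = (p, x)" using step(3) equiv_source_target[of y z] yz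
        by (metis r_into_equivclp)
      have pq: "fst (fst z) = p" "snd (snd (snd (snd (fst z)))) = p"
        using src step(3) e(2) by (auto simp: gsource_def)
      have emb: "chart_embedding D (C p) \<phi>1" "chart_embedding D (C p) \<phi>2" and oc: "orbifold_chart X D"
        using roofsD(3-5)[OF zr(1)] unfolding pq by (simp_all add: D_def \<phi>1_def \<phi>2_def)
      have emb': "chart_embedding D' D \<gamma>" using e(5) by (simp add: D_def D'_def)
      obtain h where h: "h \<in> carrier (cgrp (C p))" "\<And>v. v \<in> cdom D \<Longrightarrow> \<phi>2 v = cact (C p) (\<phi>1 v) h"
        using chart_embeddings_differ_by_group[OF fin_dim oc Cp.chart emb] by metis
      interpret D': chart X D' unfolding D'_def using roofsD(3)[OF yr(1)] fin_dim by unfold_locales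
      have opn: "open (\<phi>1 ` \<gamma> ` cdom D')"
        by (rule chart_embedding_open_image[OF emb(1) chart_embeddingD(2,1)[OF emb']])
      have "g \<otimes>\<^bsub>cgrp (C p)\<^esub> inv\<^bsub>cgrp (C p)\<^esub> h = \<one>\<^bsub>cgrp (C p)\<^esub>"
      proof (rule Cp.rigid[OF _ opn])
        show "\<phi>1 ` \<gamma> ` cdom D' \<noteq> {}" using D'.cdom_ne by simp
        show "\<phi>1 ` \<gamma> ` cdom D' \<subseteq> cdom (C p)"
          using chart_embeddingD(7)[OF emb(1)] chart_embeddingD(7)[OF emb'] by auto
        fix u assume "u \<in> \<phi>1 ` \<gamma> ` cdom D'"
        then obtain v where v: "v \<in> cdom D'" "u = \<phi>1 (\<gamma> v)" by auto
        have \<gamma>v: "\<gamma> v \<in> cdom D" by (rule chart_embeddingD(7)[OF emb' v(1)])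
        have uC: "u \<in> cdom (C p)" unfolding v(2) by (rule chart_embeddingD(7)[OF emb(1) \<gamma>v])
        have v': "v \<in> cdom (fst (snd (snd (fst y))))" using v(1) by (simp add: D'_def)
        have "\<phi>2 (\<gamma> v) = cact (C p) (\<phi>1 (\<gamma> v)) g"
        proof -
          have "fst (snd (snd (snd (fst y)))) v = cact (C p) (fst (snd (fst y)) v) g"
            using step(3) v' by blast
          then show ?thesis
            unfolding conjunct1[OF e(7)[OF v']] conjunct2[OF e(7)[OF v']] \<phi>1_def \<phi>2_def .
        qed
        then have "cact (C p) u h = cact (C p) u g" using h(2)[OF \<gamma>v] v(2) by simp
        then show "cact (C p) u (g \<otimes>\<^bsub>cgrp (C p)\<^esub> inv\<^bsub>cgrp (C p)\<^esub> h) = u"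
          using Cp.act_mult[OF uC g, of "inv\<^bsub>cgrp (C p)\<^esub> h"] Cp.act_inv(1)[OF uC h(1)] h(1) by simp
      qed (use g h in simp)
      then have "g = h" using g h(1) by (metis Cp.G.inv_closed Cp.G.inv_equality Cp.G.inv_inv)
      then show ?thesis using zr src pq h(2) by (simp add: D_def \<phi>1_def \<phi>2_def)
    next
      assume zy: "rel z y"
      from zy obtain \<gamma> where e: "fst (fst z) = fst (fst y)" "snd (snd (snd (snd (fst z)))) = snd (snd (snd (snd (fst y))))"
        "z \<in> topspace germs" "y \<in> topspace germs"
        "chart_embedding (fst (snd (snd (fst z)))) (fst (snd (snd (fst y)))) \<gamma>" "\<gamma> (snd z) = snd y"
        "\<And>v. v \<in> cdom (fst (snd (snd (fst z)))) \<Longrightarrow> fst (snd (fst z)) v = fst (snd (fst y)) (\<gamma> v) \<and>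
            fst (snd (snd (snd (fst z)))) v = fst (snd (snd (snd (fst y)))) (\<gamma> v)"
        by (rule relD) blast
      have src: "gsource z = (p, x)" using step(3) equiv_source_target[of z y] zy
        by (metis r_into_equivclp)
      have "\<forall>v\<in>cdom (fst (snd (snd (fst z)))). fst (snd (snd (snd (fst z)))) v = cact (C p) (fst (snd (fst z)) v) g"
        using step(3) e(7) chart_embeddingD(7)[OF e(5)] by auto
      then show ?thesis using e(2,3) src step(3) by (auto simp: topspace_germs)
    qed
  qed
qed

text \<open>Composition ranges over pairs of representatives that share their chart and middle leg.
  Such a pair exists on the chart at \<open>p\<close>, with legs the identity, \<open>g\<close> and
  \<open>g h\<close>. In any other pair \<open>ga_representative\<close> makes the outer legs differ
  by \<open>g h\<close> on the whole chart, so the value is the same.\<close>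

lemma ga_mul:
  assumes p: "p \<in> topspace X" and g: "g \<in> carrier (cgrp (C p))" and h: "h \<in> carrier (cgrp (C p))"
    and x: "x \<in> cdom (C p)"
  shows "gmul XX (ga (p, x) g) (ga (p, cact (C p) x g) h) = ga (p, x) (g \<otimes>\<^bsub>cgrp (C p)\<^esub> h)"
proof -
  interpret Cp: chart X "C p" by (rule chart_C[OF p])
  have xg: "cact (C p) x g \<in> cdom (C p)" using x g by simp
  have "gmul XX (ga (p, x) g) (ga (p, cact (C p) x g) h) =
    (THE c. \<exists>p' \<phi>1 q \<phi>2 r \<phi>3 D w. ((p', \<phi>1, D, \<phi>2, q), w) \<in> ga (p, x) g \<and>
       ((q, \<phi>2, D, \<phi>3, r), w) \<in> ga (p, cact (C p) x g) h \<and> c = cls ((p', \<phi>1, D, \<phi>3, r), w))"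
    by (simp add: orbifold_groupoid_def)
  also have "\<dots> = ga (p, x) (g \<otimes>\<^bsub>cgrp (C p)\<^esub> h)"
  proof (rule the_equality)
    let ?g = "\<lambda>v. cact (C p) v g"
    let ?gh = "\<lambda>v. cact (C p) v (g \<otimes>\<^bsub>cgrp (C p)\<^esub> h)"
    have gh: "chart_embedding (C p) (C p) ?gh" "chart_embedding (C p) (C p) ?g"
      by (rule Cp.act_embedding; use g h in simp)+
    have "rel ((p, ?g, C p, ?gh, p), x) (groof p h, cact (C p) x g)"
      by (rule relI[where \<gamma> = ?g])
        (use groof_germ[OF p h xg] gh x p g h Cp.chart
          in \<open>simp_all add: topspace_germs groof_def Cp.act_mult roofs_def\<close>)
    then have "((p, ?g, C p, ?gh, p), x) \<in> ga (p, cact (C p) x g) h"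
      unfolding ga_eq orb_class_def by (auto intro: equivclp_sym r_into_equivclp)
    moreover have "((p, id, C p, ?g, p), x) \<in> ga (p, x) g" by (simp add: group_arrow_def orb_class_def)
    ultimately show "\<exists>p' \<phi>1 q \<phi>2 r \<phi>3 D w. ((p', \<phi>1, D, \<phi>2, q), w) \<in> ga (p, x) g \<and>
       ((q, \<phi>2, D, \<phi>3, r), w) \<in> ga (p, cact (C p) x g) h \<and>
       ga (p, x) (g \<otimes>\<^bsub>cgrp (C p)\<^esub> h) = cls ((p', \<phi>1, D, \<phi>3, r), w)"
      by (intro exI[of _ p] exI[of _ id] exI[of _ ?g] exI[of _ ?gh] exI[of _ "C p"] exI[of _ x])
        (simp add: group_arrow_def)
  next
    fix c assume "\<exists>p' \<phi>1 q \<phi>2 r \<phi>3 D w. ((p', \<phi>1, D, \<phi>2, q), w) \<in> ga (p, x) g \<and>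
       ((q, \<phi>2, D, \<phi>3, r), w) \<in> ga (p, cact (C p) x g) h \<and> c = cls ((p', \<phi>1, D, \<phi>3, r), w)"
    then obtain p' \<phi>1 q \<phi>2 r \<phi>3 D w where *: "((p', \<phi>1, D, \<phi>2, q), w) \<in> ga (p, x) g"
       "((q, \<phi>2, D, \<phi>3, r), w) \<in> ga (p, cact (C p) x g) h" "c = cls ((p', \<phi>1, D, \<phi>3, r), w)" by blast
    note 1 = ga_representative[OF p g x *(1), unfolded gsource_def, simplified]
    note 2 = ga_representative[OF p h xg *(2), unfolded gsource_def, simplified]
    have pp: "p' = p" "q = p" "r = p" "\<phi>1 w = x" "w \<in> cdom D" using 1 2 by auto
    have e1: "chart_embedding D (C p) \<phi>1" and e3: "chart_embedding D (C p) \<phi>3" and oc: "orbifold_chart X D"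
      using 1 2 pp roofsD(3-5)[of "(p', \<phi>1, D, \<phi>2, q)"] roofsD(5)[of "(q, \<phi>2, D, \<phi>3, r)"] by auto
    have roof: "(p, \<phi>1, D, \<phi>3, p) \<in> roofs X C" using p oc e1 e3 by (simp add: roofs_def)
    have "cls ((p, \<phi>1, D, \<phi>3, p), w) = ga (p, \<phi>1 w) (g \<otimes>\<^bsub>cgrp (C p)\<^esub> h)"
    proof (rule cls_eq_ga[OF roof pp(5)])
      fix v assume v: "v \<in> cdom D"
      have "\<phi>3 v = cact (C p) (cact (C p) (\<phi>1 v) g) h" using 1 2 v by simp
      then show "\<phi>3 v = cact (C p) (\<phi>1 v) (g \<otimes>\<^bsub>cgrp (C p)\<^esub> h)"
        using Cp.act_mult[OF chart_embeddingD(7)[OF e1 v] g h] by simp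
    qed (use g h in simp)
    then show "c = ga (p, x) (g \<otimes>\<^bsub>cgrp (C p)\<^esub> h)" using *(3) pp by simp
  qed
  finally show ?thesis .
qed

end

section \<open>Twisted sectors\<close>

locale sectors = orbifold_gpd X C
  for X :: "'x topology" and C :: "'x \<Rightarrow> ('x, 'e::real_normed_vector, 'g) ochart" +
  fixes R :: "'x \<Rightarrow> 'g set"
  assumes reps: "\<And>p. p \<in> topspace X \<Longrightarrow> conj_reps (cgrp (C p)) (R p)"
begin

abbreviation "SS \<equiv> sector_groupoid X C R"
abbreviation "OS \<equiv> sector_obj_space X C R"

definition base :: "('x, 'e, 'g) sector_obj \<Rightarrow> 'x \<times> 'e" where
  "base u = (fst (fst u), snd u)"

definition sobj :: "'x \<times> 'e \<Rightarrow> 'g \<Rightarrow> ('x, 'e, 'g) sector_obj" where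
  "sobj y g = ((fst y, g), snd y)"

text \<open>The object map of the comparison functor to the inertia groupoid: a point of a sector
  becomes the automorphism that its label defines.\<close>

definition auto_arr :: "('x, 'e, 'g) sector_obj \<Rightarrow> ('x, 'e, 'g) orb_arr" where
  "auto_arr u = ga (base u) (snd (fst u))"

lemma base_sobj [simp]: "base (sobj y g) = y"
  and label_sobj [simp]: "snd (fst (sobj y g)) = g"
  and sobj_base [simp]: "sobj (base u) (snd (fst u)) = u"
  by (simp_all add: base_def sobj_def)

lemma topspace_OS:
  "u \<in> topspace OS \<longleftrightarrow> fst (fst u) \<in> topspace X \<and> snd (fst u) \<in> R (fst (fst u)) \<and>
     snd u \<in> cdom (C (fst (fst u))) \<and> cact (C (fst (fst u))) (snd u) (snd (fst u)) = snd u"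
  by (cases u) (auto simp: sector_obj_space_def)

lemma rep_carrier: "p \<in> topspace X \<Longrightarrow> g \<in> R p \<Longrightarrow> g \<in> carrier (cgrp (C p))"
  using reps by (auto simp: conj_reps_def)

lemma
  assumes "u \<in> topspace OS"
  shows auto_arr_closed [simp]: "auto_arr u \<in> topspace (garr XX)"
    and src_auto_arr [simp]: "gsrc XX (auto_arr u) = base u"
    and tgt_auto_arr [simp]: "gtgt XX (auto_arr u) = base u"
  using assms rep_carrier[of "fst (fst u)" "snd (fst u)"]
  by (simp_all add: auto_arr_def base_def topspace_OS)

lemma sector_simps [simp]:
  "gobj SS = OS"
  "garr SS = subtopology (prod_topology (discrete_topology UNIV) (prod_topology (garr XX) (discrete_topology UNIV)))
     {a. fst (snd a) \<in> topspace (garr XX) \<and> sobj (gsrc XX (fst (snd a))) (fst a) \<in> topspace OS \<and>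
         sobj (gtgt XX (fst (snd a))) (snd (snd a)) \<in> topspace OS \<and>
         gmul XX (auto_arr (sobj (gsrc XX (fst (snd a))) (fst a))) (fst (snd a)) =
         gmul XX (fst (snd a)) (auto_arr (sobj (gtgt XX (fst (snd a))) (snd (snd a))))}"
  "gsrc SS = (\<lambda>a. sobj (gsrc XX (fst (snd a))) (fst a))"
  "gtgt SS = (\<lambda>a. sobj (gtgt XX (fst (snd a))) (snd (snd a)))"
  "gmul SS = (\<lambda>a b. (fst a, gmul XX (fst (snd a)) (fst (snd b)), snd (snd b)))"
  "ginv SS = (\<lambda>a. (snd (snd a), ginv XX (fst (snd a)), fst a))"
  "gid SS = (\<lambda>u. (snd (fst u), gid XX (base u), snd (fst u)))"
  unfolding sector_groupoid_def Let_def auto_arr_def base_sobj label_sobj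
  by (simp_all add: case_prod_unfold sobj_def base_def)

text \<open>Extending open subsets of a fixed set to open sets of the ambient space lets
  \<open>cm_sobj\<close> and \<open>auto_arr_open\<close> compare them with open sets of objects and
  arrows of the orbifold groupoid.\<close>

lemma openin_OS_slices:
  assumes "openin OS U"
  shows "\<exists>V. (\<forall>i. open (V i)) \<and> (\<forall>i. fst i \<in> topspace X \<longrightarrow> snd i \<in> R (fst i) \<longrightarrow>
      {x. (i, x) \<in> U} = {x \<in> cdom (C (fst i)). cact (C (fst i)) x (snd i) = x} \<inter> V i)"
proof -
  let ?P = "\<lambda>i T. open T \<and> (fst i \<in> topspace X \<longrightarrow> snd i \<in> R (fst i) \<longrightarrow>
      {x. (i, x) \<in> U} = {x \<in> cdom (C (fst i)). cact (C (fst i)) x (snd i) = x} \<inter> T)"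
  have "\<exists>T. ?P i T" for i
  proof (cases "fst i \<in> topspace X \<and> snd i \<in> R (fst i)")
    case True
    then have i: "i \<in> {(p, g). p \<in> topspace X \<and> g \<in> R p}" by (simp add: case_prod_unfold)
    have "\<forall>i\<in>{(p, g). p \<in> topspace X \<and> g \<in> R p}.
        openin ((\<lambda>(p, g). top_of_set {x \<in> cdom (C p). cact (C p) x g = x}) i) {x. (i, x) \<in> U}"
      using assms unfolding sector_obj_space_def openin_sum_topology by (rule conjunct2)
    from bspec[OF this i]
    have "openin (top_of_set {x \<in> cdom (C (fst i)). cact (C (fst i)) x (snd i) = x}) {x. (i, x) \<in> U}"
      by (simp add: case_prod_unfold)
    then obtain T where "open T" "{x. (i, x) \<in> U} = {x \<in> cdom (C (fst i)). cact (C (fst i)) x (snd i) = x} \<inter> T"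
      unfolding openin_open by (elim exE conjE)
    then show ?thesis by (intro exI[of _ T]) simp
  next
    case False
    then show ?thesis by (intro exI[of _ UNIV]) simp
  qed
  then have "?P i (SOME T. ?P i T)" for i by (rule someI_ex)
  then show ?thesis by (intro exI[of _ "\<lambda>i. SOME T. ?P i T"] conjI allI) simp_all
qed

text \<open>The label varies in a discrete space, so the preimage of an open set splits into pieces
  with constant label. On each piece the condition concerns only \<open>y\<close>, and it is cut out
  by an open set of the ambient charts.\<close>

lemma cm_sobj:
  assumes "continuous_map Z (gobj XX) y" "continuous_map Z (discrete_topology UNIV) g"
    "\<And>z. z \<in> topspace Z \<Longrightarrow> sobj (y z) (g z) \<in> topspace OS"
  shows "continuous_map Z OS (\<lambda>z. sobj (y z) (g z))"
  unfolding continuous_map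
proof (intro conjI allI impI)
  show "(\<lambda>z. sobj (y z) (g z)) ` topspace Z \<subseteq> topspace OS" using assms(3) by auto
  fix U assume U: "openin OS U"
  from openin_OS_slices[OF U] obtain V' where V': "\<And>i. open (V' i)"
    "\<And>i. fst i \<in> topspace X \<Longrightarrow> snd i \<in> R (fst i) \<Longrightarrow>
       {x. (i, x) \<in> U} = {x \<in> cdom (C (fst i)). cact (C (fst i)) x (snd i) = x} \<inter> V' i" by blast
  define V where "V p h = V' (p, h)" for p h
  have V: "open (V p h)" "p \<in> topspace X \<Longrightarrow> h \<in> R p \<Longrightarrow>
      {x. ((p, h), x) \<in> U} = {x \<in> cdom (C p). cact (C p) x h = x} \<inter> V p h" for p h
    using V'(1) V'(2)[of "(p, h)"] by (simp_all add: V_def)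
  define N where "N h = {y \<in> topspace (gobj XX). snd y \<in> V (fst y) h}" for h
  have N: "openin (gobj XX) (N h)" for h
    unfolding obj_eq openin_sum_topology
  proof (intro conjI ballI)
    fix p assume "p \<in> topspace X"
    then have "{x. (p, x) \<in> N h} = cdom (C p) \<inter> V p h" by (auto simp: N_def obj_eq)
    then show "openin (top_of_set (cdom (C p))) {x. (p, x) \<in> N h}"
      using V(1) by (auto simp: openin_open)
  qed (auto simp: N_def obj_eq)
  have iff: "sobj y' h \<in> U \<longleftrightarrow> y' \<in> N h" if "sobj y' h \<in> topspace OS" for y' h
  proof -
    have *: "fst y' \<in> topspace X" "h \<in> R (fst y')" "snd y' \<in> cdom (C (fst y'))" "cact (C (fst y')) (snd y') h = snd y'"
      using that by (simp_all add: topspace_OS sobj_def)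
    have "sobj y' h \<in> U \<longleftrightarrow> snd y' \<in> {x. ((fst y', h), x) \<in> U}" by (simp add: sobj_def)
    also have "\<dots> \<longleftrightarrow> snd y' \<in> V (fst y') h" unfolding V(2)[OF *(1,2)] using * by simp
    also have "\<dots> \<longleftrightarrow> y' \<in> N h" using * by (cases y') (simp add: N_def obj_eq)
    finally show ?thesis .
  qed
  have "{z \<in> topspace Z. sobj (y z) (g z) \<in> U} =
      (\<Union>h. {z \<in> topspace Z. g z \<in> {h}} \<inter> {z \<in> topspace Z. y z \<in> N h})"
    using iff[OF assms(3)] by auto
  also have "openin Z \<dots>"
  proof (intro openin_Union)
    fix T assume "T \<in> range (\<lambda>h. {z \<in> topspace Z. g z \<in> {h}} \<inter> {z \<in> topspace Z. y z \<in> N h})"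
    then obtain h where "T = {z \<in> topspace Z. g z \<in> {h}} \<inter> {z \<in> topspace Z. y z \<in> N h}" by (rule rangeE)
    moreover have "openin Z {z \<in> topspace Z. g z \<in> {h}}"
      by (rule openin_continuous_map_preimage[OF assms(2)]) simp
    ultimately show "openin Z T"
      using openin_continuous_map_preimage[OF assms(1) N] by (simp only: openin_Int)
  qed
  finally show "openin Z {z \<in> topspace Z. sobj (y z) (g z) \<in> U}" .
qed

lemma cm_base: "continuous_map Z OS f \<Longrightarrow> continuous_map Z (gobj XX) (\<lambda>z. base (f z))"
proof (rule cm_comp[of OS])
  show "continuous_map OS (gobj XX) base"
    unfolding sector_obj_space_def
  proof (rule continuous_map_from_sum_topology)
    fix i assume i: "i \<in> {(p, g). p \<in> topspace X \<and> g \<in> R p}"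
    have "continuous_map (top_of_set (cdom (C (fst i)))) (gobj XX) (\<lambda>x. (fst i, x))"
      unfolding obj_eq using i by (intro continuous_map_component_injection) auto
    then have "continuous_map (subtopology (top_of_set (cdom (C (fst i)))) {x. cact (C (fst i)) x (snd i) = x})
        (gobj XX) (\<lambda>x. (fst i, x))"
      by (rule continuous_map_from_subtopology)
    then show "continuous_map (case i of (p, g) \<Rightarrow> top_of_set {x \<in> cdom (C p). cact (C p) x g = x})
        (gobj XX) (\<lambda>x. base (i, x))"
      by (simp add: case_prod_unfold base_def subtopology_subtopology Collect_conj_eq)
  qed
qed

lemma cm_label: "continuous_map Z OS f \<Longrightarrow> continuous_map Z (discrete_topology UNIV) (\<lambda>z. snd (fst (f z)))"
proof (rule cm_comp[of OS])
  show "continuous_map OS (discrete_topology UNIV) (\<lambda>u. snd (fst u))"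
    unfolding sector_obj_space_def
    by (rule continuous_map_from_sum_topology) simp
qed

lemma cm_auto_arr: "continuous_map Z OS f \<Longrightarrow> continuous_map Z (garr XX) (\<lambda>z. auto_arr (f z))"
proof (rule cm_comp[of OS])
  show "continuous_map OS (garr XX) auto_arr"
    unfolding sector_obj_space_def
  proof (rule continuous_map_from_sum_topology)
    fix i assume i: "i \<in> {(p, g). p \<in> topspace X \<and> g \<in> R p}"
    then have r: "groof (fst i) (snd i) \<in> roofs X C" using rep_carrier by (auto intro: groof_in)
    have "continuous_map (top_of_set (cdom (fst (snd (snd (groof (fst i) (snd i))))))) germs
        (\<lambda>x. (groof (fst i) (snd i), x))"
      unfolding germs_def by (rule continuous_map_component_injection[OF r])
    then have "continuous_map (top_of_set (cdom (C (fst i)))) (garr XX) (\<lambda>x. cls (groof (fst i) (snd i), x))"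
      unfolding arr_eq by (intro cm_comp[OF continuous_map_quotient_top]) (simp add: groof_def)
    then have "continuous_map (subtopology (top_of_set (cdom (C (fst i)))) {x. cact (C (fst i)) x (snd i) = x})
        (garr XX) (\<lambda>x. cls (groof (fst i) (snd i), x))"
      by (rule continuous_map_from_subtopology)
    then show "continuous_map (case i of (p, g) \<Rightarrow> top_of_set {x \<in> cdom (C p). cact (C p) x g = x})
        (garr XX) (\<lambda>x. auto_arr (i, x))"
      by (simp add: case_prod_unfold auto_arr_def base_def ga_eq subtopology_subtopology Collect_conj_eq)
  qed
qed

lemma OS_baseD: "u \<in> topspace OS \<Longrightarrow> base u \<in> topspace (gobj XX)"
  using cm_base[OF cm_id(2)] continuous_map_image_subset_topspace by fastforce

lemma sector_arrD:
  assumes "a \<in> topspace (garr SS)"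
  shows "fst (snd a) \<in> topspace (garr XX)" "sobj (gsrc XX (fst (snd a))) (fst a) \<in> topspace OS"
    "sobj (gtgt XX (fst (snd a))) (snd (snd a)) \<in> topspace OS"
    "gmul XX (auto_arr (sobj (gsrc XX (fst (snd a))) (fst a))) (fst (snd a)) =
         gmul XX (fst (snd a)) (auto_arr (sobj (gtgt XX (fst (snd a))) (snd (snd a))))"
  using assms by (simp_all only: sector_simps topspace_subtopology) auto

lemma sector_arrI:
  assumes "r \<in> topspace (garr XX)" "sobj (gsrc XX r) g \<in> topspace OS" "sobj (gtgt XX r) h \<in> topspace OS"
    "gmul XX (auto_arr (sobj (gsrc XX r) g)) r = gmul XX r (auto_arr (sobj (gtgt XX r) h))"
  shows "(g, r, h) \<in> topspace (garr SS)"
  using assms by simp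

lemma sector_mul_closed:
  assumes a: "a \<in> topspace (garr SS)" and b: "b \<in> topspace (garr SS)" and c: "gtgt SS a = gsrc SS b"
  shows "gmul SS a b \<in> topspace (garr SS)"
proof -
  note A = sector_arrD[OF a] and B = sector_arrD[OF b]
  let ?r = "fst (snd a)" and ?r' = "fst (snd b)"
  have eq: "sobj (gtgt XX ?r) (snd (snd a)) = sobj (gsrc XX ?r') (fst b)" using c by simp
  then have t: "gtgt XX ?r = gsrc XX ?r'" by (metis base_sobj)
  define u where "u = auto_arr (sobj (gsrc XX ?r) (fst a))"
  define v where "v = auto_arr (sobj (gsrc XX ?r') (fst b))"
  define w where "w = auto_arr (sobj (gtgt XX ?r') (snd (snd b)))"
  have uvw: "u \<in> topspace (garr XX)" "v \<in> topspace (garr XX)" "w \<in> topspace (garr XX)"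
    "gsrc XX u = gsrc XX ?r" "gtgt XX u = gsrc XX ?r" "gsrc XX v = gsrc XX ?r'" "gtgt XX v = gsrc XX ?r'"
    "gsrc XX w = gtgt XX ?r'" "gtgt XX w = gtgt XX ?r'"
    using A B by (simp_all add: u_def v_def w_def)
  have 1: "gmul XX u ?r = gmul XX ?r v" using A(4) unfolding u_def v_def eq .
  have 2: "gmul XX v ?r' = gmul XX ?r' w" using B(4) unfolding w_def v_def .
  have "gmul XX u (gmul XX ?r ?r') = gmul XX (gmul XX u ?r) ?r'"
    by (rule XX.mul_assoc[symmetric]) (use A(1) B(1) t uvw in simp_all)
  also have "\<dots> = gmul XX ?r (gmul XX v ?r')"
    unfolding 1 by (rule XX.mul_assoc) (use A(1) B(1) t uvw in simp_all)
  also have "\<dots> = gmul XX (gmul XX ?r ?r') w"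
    unfolding 2 by (rule XX.mul_assoc[symmetric]) (use A(1) B(1) t uvw in simp_all)
  finally have 3: "gmul XX u (gmul XX ?r ?r') = gmul XX (gmul XX ?r ?r') w" .
  have "(fst a, gmul XX ?r ?r', snd (snd b)) \<in> topspace (garr SS)"
    by (rule sector_arrI) (use A(1-3) B(1-3) t 3 in \<open>simp_all add: u_def w_def\<close>)
  then show ?thesis by simp
qed

lemma sector_inv_closed:
  assumes a: "a \<in> topspace (garr SS)"
  shows "ginv SS a \<in> topspace (garr SS)"
proof -
  note A = sector_arrD[OF a]
  let ?r = "fst (snd a)"
  define u where "u = auto_arr (sobj (gsrc XX ?r) (fst a))"
  define w where "w = auto_arr (sobj (gtgt XX ?r) (snd (snd a)))"
  have uw: "u \<in> topspace (garr XX)" "w \<in> topspace (garr XX)"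
    "gsrc XX u = gsrc XX ?r" "gtgt XX u = gsrc XX ?r" "gsrc XX w = gtgt XX ?r" "gtgt XX w = gtgt XX ?r"
    using A by (simp_all add: u_def w_def)
  have 1: "gmul XX u ?r = gmul XX ?r w" using A(4) by (simp add: u_def w_def)
  have "w = gmul XX (ginv XX ?r) (gmul XX ?r w)" using A(1) uw by simp
  also have "\<dots> = gmul XX (ginv XX ?r) (gmul XX u ?r)" by (simp only: 1)
  finally have w: "w = gmul XX (ginv XX ?r) (gmul XX u ?r)" .
  have 2: "gmul XX w (ginv XX ?r) = gmul XX (ginv XX ?r) u"
    unfolding w using A(1) uw by simp
  have "(snd (snd a), ginv XX ?r, fst a) \<in> topspace (garr SS)"
    by (rule sector_arrI) (use A(1-3) 2 in \<open>simp_all add: u_def w_def\<close>)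
  then show ?thesis by simp
qed

lemma sector_id_closed: "u \<in> topspace OS \<Longrightarrow> gid SS u \<in> topspace (garr SS)"
proof -
  assume u: "u \<in> topspace OS"
  have "(snd (fst u), gid XX (base u), snd (fst u)) \<in> topspace (garr SS)"
    by (rule sector_arrI) (use u OS_baseD[OF u] in simp_all)
  then show ?thesis by simp
qed

lemma sector_arr_sub: "garr SS = subtopology (prod_topology (discrete_topology UNIV) (prod_topology (garr XX) (discrete_topology UNIV)))
     (topspace (garr SS))"
  by (simp add: subtopology_subtopology) (rule subtopology_eq, auto)

lemma cm_arr:
  assumes "continuous_map Z (garr SS) f"
  shows "continuous_map Z (garr XX) (\<lambda>z. fst (snd (f z)))"
    "continuous_map Z (discrete_topology UNIV) (\<lambda>z. fst (f z))"
    "continuous_map Z (discrete_topology UNIV) (\<lambda>z. snd (snd (f z)))"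
proof -
  have *: "continuous_map Z (prod_topology (discrete_topology UNIV) (prod_topology (garr XX) (discrete_topology UNIV))) f"
    using assms by (simp add: continuous_map_in_subtopology)
  show "continuous_map Z (garr XX) (\<lambda>z. fst (snd (f z)))" by (rule cm_fst[OF cm_snd[OF *]])
  show "continuous_map Z (discrete_topology UNIV) (\<lambda>z. fst (f z))" by (rule cm_fst[OF *])
  show "continuous_map Z (discrete_topology UNIV) (\<lambda>z. snd (snd (f z)))" by (rule cm_snd[OF cm_snd[OF *]])
qed

lemma cm_into_arr:
  assumes "continuous_map Z (discrete_topology UNIV) g" "continuous_map Z (garr XX) r"
    "continuous_map Z (discrete_topology UNIV) h" "\<And>z. z \<in> topspace Z \<Longrightarrow> (g z, r z, h z) \<in> topspace (garr SS)"
  shows "continuous_map Z (garr SS) (\<lambda>z. (g z, r z, h z))"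
  by (subst sector_arr_sub, intro cm_into_sub cm_pair assms)

lemma sector_groupoid: "topological_groupoid SS"
proof (rule topological_groupoidI)
  note id = cm_id(2)[of "garr SS"]
  have "continuous_map (garr SS) OS (\<lambda>a. sobj (gsrc XX (fst (snd a))) (fst a))"
    by (rule cm_sobj[OF XX.cm_src[OF cm_arr(1)[OF id]] cm_arr(2)[OF id] sector_arrD(2)])
  then show "continuous_map (garr SS) (gobj SS) (gsrc SS)" by (simp only: sector_simps)
  have "continuous_map (garr SS) OS (\<lambda>a. sobj (gtgt XX (fst (snd a))) (snd (snd a)))"
    by (rule cm_sobj[OF XX.cm_tgt[OF cm_arr(1)[OF id]] cm_arr(3)[OF id] sector_arrD(3)])
  then show "continuous_map (garr SS) (gobj SS) (gtgt SS)" by (simp only: sector_simps)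
  have "continuous_map OS (garr SS) (\<lambda>u. (snd (fst u), gid XX (base u), snd (fst u)))"
    by (rule cm_into_arr[OF cm_label[OF cm_id(2)] XX.cm_gid[OF cm_base[OF cm_id(2)]] cm_label[OF cm_id(2)]])
      (use sector_id_closed in \<open>simp only: sector_simps(7)\<close>)
  then show "continuous_map (gobj SS) (garr SS) (gid SS)" by (simp only: sector_simps(1,7))
  have "continuous_map (garr SS) (garr SS) (\<lambda>a. (snd (snd a), ginv XX (fst (snd a)), fst a))"
    by (rule cm_into_arr[OF cm_arr(3)[OF id] XX.cm_inv[OF cm_arr(1)[OF id]] cm_arr(2)[OF id]])
      (use sector_inv_closed in \<open>simp only: sector_simps(6)\<close>)
  then show "continuous_map (garr SS) (garr SS) (ginv SS)" by (simp only: sector_simps(6))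
  let ?Z = "subtopology (prod_topology (garr SS) (garr SS)) {z. gtgt SS (fst z) = gsrc SS (snd z)}"
  have f: "continuous_map ?Z (garr SS) fst" "continuous_map ?Z (garr SS) snd"
    by (intro continuous_map_from_subtopology continuous_map_fst continuous_map_snd)+
  have zz: "fst z \<in> topspace (garr SS)" "snd z \<in> topspace (garr SS)" "gtgt SS (fst z) = gsrc SS (snd z)"
    if "z \<in> topspace ?Z" for z
    using that by (simp_all only: topspace_subtopology topspace_prod_topology) auto
  have "continuous_map ?Z (garr SS)
      (\<lambda>z. (fst (fst z), gmul XX (fst (snd (fst z))) (fst (snd (snd z))), snd (snd (snd z))))"
  proof (rule cm_into_arr[OF cm_arr(2)[OF f(1)] XX.cm_mul[OF cm_arr(1)[OF f(1)] cm_arr(1)[OF f(2)]] cm_arr(3)[OF f(2)]])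
    fix z assume z: "z \<in> topspace ?Z"
    have "sobj (gtgt XX (fst (snd (fst z)))) (snd (snd (fst z))) = sobj (gsrc XX (fst (snd (snd z)))) (fst (snd z))"
      using zz(3)[OF z] by (simp only: sector_simps(3,4))
    then show "gtgt XX (fst (snd (fst z))) = gsrc XX (fst (snd (snd z)))" by (metis base_sobj)
    show "(fst (fst z), gmul XX (fst (snd (fst z))) (fst (snd (snd z))), snd (snd (snd z))) \<in> topspace (garr SS)"
      using sector_mul_closed[OF zz[OF z]] by (simp only: sector_simps(5))
  qed
  then show "continuous_map ?Z (garr SS) (\<lambda>z. gmul SS (fst z) (snd z))" by (simp only: sector_simps(5))
next
  fix u assume "u \<in> topspace (gobj SS)"
  then have u: "u \<in> topspace OS" by simp
  then show "gsrc SS (gid SS u) = u \<and> gtgt SS (gid SS u) = u"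
    using OS_baseD[OF u] by simp
next
  fix a b assume a: "a \<in> topspace (garr SS)" and b: "b \<in> topspace (garr SS)" and c: "gtgt SS a = gsrc SS b"
  then have "gtgt XX (fst (snd a)) = gsrc XX (fst (snd b))" by (simp only: sector_simps(3,4)) (metis base_sobj)
  then show "gsrc SS (gmul SS a b) = gsrc SS a \<and> gtgt SS (gmul SS a b) = gtgt SS b"
    using sector_arrD(1)[OF a] sector_arrD(1)[OF b] by simp
next
  fix a b c assume a: "a \<in> topspace (garr SS)" and b: "b \<in> topspace (garr SS)" and c: "c \<in> topspace (garr SS)"
    and ab: "gtgt SS a = gsrc SS b" and bc: "gtgt SS b = gsrc SS c"
  from ab have 1: "gtgt XX (fst (snd a)) = gsrc XX (fst (snd b))" by (simp only: sector_simps(3,4)) (metis base_sobj)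
  from bc have 2: "gtgt XX (fst (snd b)) = gsrc XX (fst (snd c))" by (simp only: sector_simps(3,4)) (metis base_sobj)
  show "gmul SS (gmul SS a b) c = gmul SS a (gmul SS b c)"
    using sector_arrD(1)[OF a] sector_arrD(1)[OF b] sector_arrD(1)[OF c] 1 2 by simp
next
  fix a assume a: "a \<in> topspace (garr SS)"
  show "gmul SS (gid SS (gsrc SS a)) a = a \<and> gmul SS a (gid SS (gtgt SS a)) = a \<and>
        gsrc SS (ginv SS a) = gtgt SS a \<and> gtgt SS (ginv SS a) = gsrc SS a \<and>
        gmul SS a (ginv SS a) = gid SS (gsrc SS a) \<and> gmul SS (ginv SS a) a = gid SS (gtgt SS a)"
    using sector_arrD(1)[OF a] by simp
qed

text \<open>Extended to an open set of the chart, an open piece of a sector yields representatives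
  of the arrow \<open>g\<close> whose classes form an open set, as \<open>cls\<close> is open. Among
  these arrows the automorphisms are exactly those based at fixed points of
  \<open>g\<close>.\<close>

lemma auto_arr_open: "open_map OS (gobj (inertia XX)) auto_arr"
  unfolding open_map_def
proof (intro allI impI)
  fix U assume U: "openin OS U"
  from openin_OS_slices[OF U] obtain V where V': "\<And>i. open (V i)"
    "\<And>i. fst i \<in> topspace X \<Longrightarrow> snd i \<in> R (fst i) \<Longrightarrow>
       {x. (i, x) \<in> U} = {x \<in> cdom (C (fst i)). cact (C (fst i)) x (snd i) = x} \<inter> V i" by blast
  have V: "open (V i)" "p \<in> topspace X \<Longrightarrow> h \<in> R p \<Longrightarrow>
      {x. ((p, h), x) \<in> U} = {x \<in> cdom (C p). cact (C p) x h = x} \<inter> V (p, h)" for i p h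
    using V'(1) V'(2)[of "(p, h)"] by simp_all
  define I where "I = {(p, h). p \<in> topspace X \<and> h \<in> R p}"
  define N where "N = (\<Union>i\<in>I. {groof (fst i) (snd i)} \<times> (cdom (C (fst i)) \<inter> V i))"
  have "openin germs N"
    unfolding N_def
  proof (intro openin_Union ballI)
    fix W assume "W \<in> (\<lambda>i. {groof (fst i) (snd i)} \<times> (cdom (C (fst i)) \<inter> V i)) ` I"
    then obtain i where i: "i \<in> I" "W = {groof (fst i) (snd i)} \<times> (cdom (C (fst i)) \<inter> V i)" by auto
    then have p: "fst i \<in> topspace X" "snd i \<in> carrier (cgrp (C (fst i)))"
      using rep_carrier by (auto simp: I_def)
    interpret chart X "C (fst i)" by (rule chart_C[OF p(1)])
    show "openin germs W"
      unfolding i(2) using open_cdom V(1)[of i]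
      by (intro openin_germs_slice groof_in p) (auto simp: groof_def)
  qed
  then have "openin (garr XX) (cls ` N)" using cls_open by (simp add: open_map_def)
  moreover have "auto_arr ` U = cls ` N \<inter> {h. gsrc XX h = gtgt XX h}"
  proof
    show "auto_arr ` U \<subseteq> cls ` N \<inter> {h. gsrc XX h = gtgt XX h}"
    proof
      fix a assume "a \<in> auto_arr ` U"
      then obtain u where u: "u \<in> U" "a = auto_arr u" by auto
      obtain p h x where u': "u = ((p, h), x)" by (cases u) auto
      have uO: "u \<in> topspace OS" using u openin_subset[OF U] by auto
      then have ph: "p \<in> topspace X" "h \<in> R p" by (simp_all add: topspace_OS u')
      have "x \<in> {x. ((p, h), x) \<in> U}" using u u' by simp
      then have "x \<in> cdom (C p) \<inter> V (p, h)" unfolding V(2)[OF ph] by simp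
      then have "(groof p h, x) \<in> N" unfolding N_def using ph by (intro UN_I[of "(p, h)"]) (auto simp: I_def)
      moreover have "a = cls (groof p h, x)" by (simp add: u(2) u' auto_arr_def base_def ga_eq)
      ultimately have "a \<in> cls ` N" by simp
      then show "a \<in> cls ` N \<inter> {h. gsrc XX h = gtgt XX h}" using uO u(2) by simp
    qed
    show "cls ` N \<inter> {h. gsrc XX h = gtgt XX h} \<subseteq> auto_arr ` U"
    proof
      fix a assume a: "a \<in> cls ` N \<inter> {h. gsrc XX h = gtgt XX h}"
      then obtain p h x where *: "a = cls (groof p h, x)" "(p, h) \<in> I" "x \<in> cdom (C p)" "x \<in> V (p, h)"
        by (auto simp: N_def)
      then have ph: "p \<in> topspace X" "h \<in> R p" "h \<in> carrier (cgrp (C p))" by (auto simp: I_def rep_carrier)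
      have ag: "a = ga (p, x) h" by (simp add: *(1) ga_eq)
      have "gsrc XX a = gtgt XX a" using a by simp
      then have "cact (C p) x h = x" using *(3) ph by (simp add: ag)
      then have "x \<in> {x. ((p, h), x) \<in> U}" unfolding V(2)[OF ph(1,2)] using *(3,4) by simp
      then show "a \<in> auto_arr ` U" by (intro image_eqI[of _ _ "((p, h), x)"]) (simp_all add: ag auto_arr_def base_def)
    qed
  qed
  ultimately show "openin (gobj (inertia XX)) (auto_arr ` U)"
    by (auto simp: openin_subtopology)
qed

text \<open>An arrow conjugating the automorphism of \<open>u\<close> to that of \<open>v\<close>
  satisfies the defining equation of a sector arrow, which gives full faithfulness. For essential
  surjectivity, an automorphism is some group element \<open>g\<close> at \<open>x\<close>, and an
  element \<open>k\<close> conjugates \<open>g\<close> to the chosen representative \<open>h\<close>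
  of its class.\<close>

lemma sector_to_inertia_morita:
  "morita_hom SS (inertia XX) auto_arr (\<lambda>a. (auto_arr (gsrc SS a), fst (snd a)))"
proof -
  have conj: "gmul XX (ginv XX (fst (snd a))) (gmul XX (auto_arr (gsrc SS a)) (fst (snd a))) = auto_arr (gtgt SS a)"
    if a: "a \<in> topspace (garr SS)" for a
  proof -
    note A = sector_arrD[OF a]
    have "gmul XX (auto_arr (gsrc SS a)) (fst (snd a)) = gmul XX (fst (snd a)) (auto_arr (gtgt SS a))"
      using A(4) by (simp only: sector_simps(3,4))
    then show ?thesis using A(1-3) by simp
  qed
  have src_in: "gsrc SS a \<in> topspace OS" and tgt_in: "gtgt SS a \<in> topspace OS"
    and arr_in: "fst (snd a) \<in> topspace (garr XX)"
    and bs: "base (gsrc SS a) = gsrc XX (fst (snd a))" "base (gtgt SS a) = gtgt XX (fst (snd a))"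
    if "a \<in> topspace (garr SS)" for a
    using sector_arrD[OF that] by simp_all
  have hom: "groupoid_morphism SS (inertia XX) auto_arr (\<lambda>a. (auto_arr (gsrc SS a), fst (snd a)))"
  proof (rule groupoid_morphismI)
    show "continuous_map (gobj SS) (gobj (inertia XX)) auto_arr"
      unfolding inertia_simps sector_simps(1)
      by (rule cm_into_sub[OF cm_auto_arr[OF cm_id(2)]]) simp
    have "continuous_map (garr SS) OS (gsrc SS)"
      using sector_groupoid by (simp only: topological_groupoid_def sector_simps(1))
    then show "continuous_map (garr SS) (garr (inertia XX)) (\<lambda>a. (auto_arr (gsrc SS a), fst (snd a)))"
      unfolding inertia_simps
      by (intro cm_into_sub cm_pair cm_auto_arr cm_arr(1)[OF cm_id(2)]) (use src_in bs in simp_all)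
    fix a assume a: "a \<in> topspace (garr SS)"
    have "auto_arr (gsrc SS (ginv SS a)) = auto_arr (gtgt SS a)"
      using arr_in[OF a] by simp
    then show "gsrc (inertia XX) (auto_arr (gsrc SS a), fst (snd a)) = auto_arr (gsrc SS a) \<and>
        gtgt (inertia XX) (auto_arr (gsrc SS a), fst (snd a)) = auto_arr (gtgt SS a) \<and>
        (auto_arr (gsrc SS (ginv SS a)), fst (snd (ginv SS a))) = ginv (inertia XX) (auto_arr (gsrc SS a), fst (snd a))"
      unfolding inertia_simps fst_conv snd_conv conj[OF a] by (simp only: sector_simps(6) fst_conv snd_conv)
  next
    fix u assume u: "u \<in> topspace (gobj SS)"
    then have "gsrc SS (gid SS u) = u" using OS_baseD[of u] by simp
    then show "(auto_arr (gsrc SS (gid SS u)), fst (snd (gid SS u))) = gid (inertia XX) (auto_arr u)"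
      using u by simp
  next
    fix a b assume a: "a \<in> topspace (garr SS)" and b: "b \<in> topspace (garr SS)" and c: "gtgt SS a = gsrc SS b"
    have "gsrc SS (gmul SS a b) = gsrc SS a"
      using topgpd.src_mul[of SS, OF _ a b c] sector_groupoid by (simp add: topgpd_def)
    then show "(auto_arr (gsrc SS (gmul SS a b)), fst (snd (gmul SS a b))) =
       gmul (inertia XX) (auto_arr (gsrc SS a), fst (snd a)) (auto_arr (gsrc SS b), fst (snd b))"
      unfolding inertia_simps by (simp only: sector_simps(5) fst_conv snd_conv)
  qed
  have key: "(snd (fst u), r, snd (fst v)) \<in> topspace (garr SS) \<and>
      gsrc SS (snd (fst u), r, snd (fst v)) = u \<and> gtgt SS (snd (fst u), r, snd (fst v)) = v"
    if uv: "u \<in> topspace OS" "v \<in> topspace OS" and r: "r \<in> topspace (garr XX)"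
      and s: "gsrc XX r = base u" and e: "gmul XX (ginv XX r) (gmul XX (auto_arr u) r) = auto_arr v" for u v r
  proof -
    have "gsrc XX (gmul XX (ginv XX r) (gmul XX (auto_arr u) r)) = gtgt XX r"
      using uv r s by simp
    then have t: "gtgt XX r = base v" unfolding e using uv by simp
    have "gmul XX r (auto_arr v) = gmul XX r (gmul XX (ginv XX r) (gmul XX (auto_arr u) r))" by (simp only: e)
    also have "\<dots> = gmul XX (auto_arr u) r"
      by (rule XX.mul_inv_cancel) (use uv r s in simp_all)
    finally have "gmul XX (auto_arr u) r = gmul XX r (auto_arr v)" ..
    then have "(snd (fst u), r, snd (fst v)) \<in> topspace (garr SS)"
      by (intro sector_arrI) (use uv r s t in simp_all)
    then show ?thesis using s t by simp
  qed
  have "fully_faithful SS (inertia XX) auto_arr (\<lambda>a. (auto_arr (gsrc SS a), fst (snd a)))"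
  proof (rule fully_faithfulI[of _ _ _ _ "\<lambda>z. (snd (fst (fst (fst z))), snd (snd z), snd (fst (snd (fst z))))"])
    let ?Z = "subtopology (prod_topology (prod_topology (gobj SS) (gobj SS)) (garr (inertia XX)))
          {((x, y), g). gsrc (inertia XX) g = auto_arr x \<and> gtgt (inertia XX) g = auto_arr y}"
    have z: "fst (fst z) \<in> topspace OS" "snd (fst z) \<in> topspace OS" "snd (snd z) \<in> topspace (garr XX)"
      "gsrc XX (snd (snd z)) = base (fst (fst z))"
      "gmul XX (ginv XX (snd (snd z))) (gmul XX (auto_arr (fst (fst z))) (snd (snd z))) = auto_arr (snd (fst z))"
      if "z \<in> topspace ?Z" for z
      using that by (auto simp del: sector_simps(2-7))
    have "continuous_map ?Z (prod_topology (prod_topology OS OS) (prod_topology (garr XX) (garr XX))) (\<lambda>z. z)"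
      unfolding sector_simps(1) inertia_simps prod_topology_subtopology subtopology_subtopology by (rule cm_id)
    note c = cm_fst[OF cm_fst[OF this]] cm_snd[OF cm_fst[OF this]] cm_snd[OF cm_snd[OF this]]
    show "continuous_map ?Z (garr SS) (\<lambda>z. (snd (fst (fst (fst z))), snd (snd z), snd (fst (snd (fst z)))))"
    proof (rule cm_into_arr[OF cm_label[OF c(1)] c(3) cm_label[OF c(2)]])
      fix w assume w: "w \<in> topspace ?Z"
      show "(snd (fst (fst (fst w))), snd (snd w), snd (fst (snd (fst w)))) \<in> topspace (garr SS)"
        using key[OF z[OF w]] by (rule conjunct1)
    qed
    fix u v g assume "u \<in> topspace (gobj SS)" "v \<in> topspace (gobj SS)" "g \<in> topspace (garr (inertia XX))"
      and g: "gsrc (inertia XX) g = auto_arr u" "gtgt (inertia XX) g = auto_arr v"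
    then have "((u, v), g) \<in> topspace ?Z" by (simp del: sector_simps(2-7) inertia_simps)
    from key[OF z[OF this]] have k: "gsrc SS (snd (fst u), snd g, snd (fst v)) = u"
      "gtgt SS (snd (fst u), snd g, snd (fst v)) = v" by (simp_all only: fst_conv snd_conv)
    show "gsrc SS (snd (fst (fst (fst ((u, v), g)))), snd (snd ((u, v), g)), snd (fst (snd (fst ((u, v), g))))) = u \<and>
      gtgt SS (snd (fst (fst (fst ((u, v), g)))), snd (snd ((u, v), g)), snd (fst (snd (fst ((u, v), g))))) = v \<and>
      (auto_arr (gsrc SS (snd (fst (fst (fst ((u, v), g)))), snd (snd ((u, v), g)), snd (fst (snd (fst ((u, v), g)))))),
       fst (snd (snd (fst (fst (fst ((u, v), g)))), snd (snd ((u, v), g)), snd (fst (snd (fst ((u, v), g))))))) = g"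
      unfolding fst_conv snd_conv k using g(1) by (cases g) simp
  next
    fix a assume "a \<in> topspace (garr SS)"
    show "(snd (fst (fst (fst ((gsrc SS a, gtgt SS a), (auto_arr (gsrc SS a), fst (snd a)))))),
        snd (snd ((gsrc SS a, gtgt SS a), (auto_arr (gsrc SS a), fst (snd a)))),
        snd (fst (snd (fst ((gsrc SS a, gtgt SS a), (auto_arr (gsrc SS a), fst (snd a))))))) = a"
      by (simp add: prod_eq_iff)
  qed (rule hom sector_groupoid XX.inertia_groupoid)+
  then have "ff_hom SS (inertia XX) auto_arr (\<lambda>a. (auto_arr (gsrc SS a), fst (snd a)))"
    by (intro ff_homI sector_groupoid XX.inertia_groupoid)
  then show ?thesis
  proof (rule ff_hom.morita_homI_open)
    show "open_map (gobj SS) (gobj (inertia XX)) auto_arr" using auto_arr_open by simp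
    show "open_map (garr (inertia XX)) (gobj (inertia XX)) (gsrc (inertia XX))"
      by (rule XX.inertia_src_open[OF src_open])
    fix a assume "a \<in> topspace (gobj (inertia XX))"
    then have a: "a \<in> topspace (garr XX)" "gsrc XX a = gtgt XX a" by auto
    obtain p x where px: "gsrc XX a = (p, x)" by (cases "gsrc XX a") auto
    have "gtgt XX a = (p, x)" using a(2) px by simp
    then obtain g where g: "g \<in> carrier (cgrp (C p))" "a = ga (p, x) g" "p \<in> topspace X" "x \<in> cdom (C p)"
      "x = cact (C p) x g"
      by (rule loop_eq_ga[OF a(1) px])
    interpret Cp: chart X "C p" by (rule chart_C[OF g(3)])
    obtain h k where hk: "h \<in> R p" "k \<in> carrier (cgrp (C p))"
      "h = inv\<^bsub>cgrp (C p)\<^esub> k \<otimes>\<^bsub>cgrp (C p)\<^esub> g \<otimes>\<^bsub>cgrp (C p)\<^esub> k"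
    proof -
      have "\<forall>g\<in>carrier (cgrp (C p)). \<exists>!h. h \<in> R p \<and>
          (\<exists>k\<in>carrier (cgrp (C p)). h = inv\<^bsub>cgrp (C p)\<^esub> k \<otimes>\<^bsub>cgrp (C p)\<^esub> g \<otimes>\<^bsub>cgrp (C p)\<^esub> k)"
        using reps[OF g(3)] unfolding conj_reps_def by (rule conjunct2)
      from ex1_implies_ex[OF bspec[OF this g(1)]] show thesis using that by (elim exE conjE bexE)
    qed
    have h: "h \<in> carrier (cgrp (C p))" by (rule rep_carrier[OF g(3) hk(1)])
    have kh: "k \<otimes>\<^bsub>cgrp (C p)\<^esub> h = g \<otimes>\<^bsub>cgrp (C p)\<^esub> k"
      unfolding hk(3) using hk(2) g(1) by (simp add: Cp.G.m_assoc[symmetric])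
    note g5 = g(5)[symmetric]
    have fixed: "cact (C p) (cact (C p) x k) h = cact (C p) x k"
    proof -
      have "cact (C p) (cact (C p) x k) h = cact (C p) x (k \<otimes>\<^bsub>cgrp (C p)\<^esub> h)"
        by (rule Cp.act_mult[OF g(4) hk(2) h, symmetric])
      also have "\<dots> = cact (C p) (cact (C p) x g) k"
        unfolding kh by (rule Cp.act_mult[OF g(4,1) hk(2)])
      also have "\<dots> = cact (C p) x k" by (simp only: g5)
      finally show ?thesis .
    qed
    \<comment> \<open>As \<open>g\<close> fixes \<open>x\<close>, its conjugate \<open>h\<close>
      fixes the translate of \<open>x\<close> by \<open>k\<close>. The arrow \<open>k\<close> then
      joins the given automorphism to this sector point.\<close>
    let ?u = "((p, h), cact (C p) x k)" and ?r = "ga (p, x) k"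
    have u: "?u \<in> topspace OS" using g(3,4) hk(1,2) fixed by (simp add: topspace_OS)
    have r: "?r \<in> topspace (garr XX)" "gsrc XX ?r = (p, x)" "gtgt XX ?r = (p, cact (C p) x k)"
      using g(3,4) hk(2) by simp_all
    have 1: "gmul XX a ?r = ga (p, x) (g \<otimes>\<^bsub>cgrp (C p)\<^esub> k)"
      using ga_mul[OF g(3,1) hk(2) g(4)] unfolding g5 g(2) .
    have 2: "gmul XX ?r (auto_arr ?u) = ga (p, x) (k \<otimes>\<^bsub>cgrp (C p)\<^esub> h)"
      using ga_mul[OF g(3) hk(2) h g(4)] by (simp add: auto_arr_def base_def)
    have "gmul XX (ginv XX ?r) (gmul XX a ?r) = gmul XX (ginv XX ?r) (gmul XX ?r (auto_arr ?u))"
      unfolding 1 2 kh ..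
    also have "\<dots> = auto_arr ?u"
      by (rule XX.inv_mul_cancel) (use r(1,3) u in \<open>simp_all add: base_def\<close>)
    finally have "auto_arr ?u = gtgt (inertia XX) (a, ?r)" by (simp only: inertia_simps fst_conv snd_conv)
    moreover have "(a, ?r) \<in> topspace (garr (inertia XX))" using a r px by simp
    ultimately show "\<exists>u\<in>topspace (gobj SS). \<exists>b\<in>topspace (garr (inertia XX)).
        auto_arr u = gtgt (inertia XX) b \<and> gsrc (inertia XX) b = a"
      using u by (intro bexI[of _ ?u] bexI[of _ "(a, ?r)"] conjI) (simp_all only: sector_simps(1) inertia_simps(3) fst_conv)
  qed
qed

end

section \<open>Covers of the circle, seen on the real line, and translation invariance\<close>

section \<open>Covers of the circle\<close>

lemma circle_map_eq_iff: "circle_map x = circle_map y \<longleftrightarrow> (\<exists>k::int. x = y + of_int k)"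
proof -
  have "circle_map x = circle_map y \<longleftrightarrow> sin (2 * pi * x) = sin (2 * pi * y) \<and> cos (2 * pi * x) = cos (2 * pi * y)"
    by (auto simp: circle_map_def complex_eq_iff)
  also have "\<dots> \<longleftrightarrow> (\<exists>k::int. 2 * pi * x = 2 * pi * y + 2 * pi * of_int k)"
    by (simp add: sin_cos_eq_iff)
  also have "\<dots> \<longleftrightarrow> (\<exists>k::int. x = y + of_int k)"
    by (simp flip: distrib_left)
  finally show ?thesis .
qed

definition proper_cover :: "cover \<Rightarrow> bool" where
  "proper_cover W \<longleftrightarrow> finite (fst W) \<and> fst W \<noteq> {} \<and> fst W \<subseteq> {0<..1} \<and> 0 < snd W"

lemma circle_covers_proper: "W \<in> circle_covers \<Longrightarrow> proper_cover W"
  by (auto simp: circle_covers_def proper_cover_def)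

lemma cover_pts_shift: "x \<in> cover_pts W \<Longrightarrow> x + of_int k \<in> cover_pts W"
  unfolding cover_pts_def by (auto intro!: exI[of _ "_ + k"])

lemma cover_pts_shift_iff [simp]: "x + of_int k \<in> cover_pts W \<longleftrightarrow> x \<in> cover_pts W"
  using cover_pts_shift[of x W k] cover_pts_shift[of "x + of_int k" W "- k"] by auto

lemma cover_pts_shift_iff' [simp]: "x - of_int k \<in> cover_pts W \<longleftrightarrow> x \<in> cover_pts W"
  using cover_pts_shift_iff[of x "- k"] by simp

lemma unit_interval_int_diff:
  fixes x y :: real
  assumes "x \<in> {0<..1}" "y \<in> {0<..1}" "x = y + of_int k"
  shows "x = y"
proof -
  have "-1 < real_of_int k" "real_of_int k < 1" using assms by auto
  then have "k = 0" by linarith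
  then show ?thesis using assms by simp
qed

lemma cover_pts_unit: "fst W \<subseteq> {0<..1} \<Longrightarrow> cover_pts W \<inter> {0<..1} = fst W"
proof (intro subset_antisym subsetI)
  fix x assume W: "fst W \<subseteq> {0<..1}" and x: "x \<in> cover_pts W \<inter> {0<..1}"
  then obtain q k where "q \<in> fst W" "x = q + of_int k" by (auto simp: cover_pts_def)
  moreover from this W x have "x = q" by (intro unit_interval_int_diff[of x q k]) auto
  ultimately show "x \<in> fst W" by simp
next
  fix x assume "fst W \<subseteq> {0<..1}" "x \<in> fst W"
  moreover have "x = x + of_int 0" by simp
  ultimately show "x \<in> cover_pts W \<inter> {0<..1}" unfolding cover_pts_def by blast
qed

text \<open>Representatives in \<open>(0, 1]\<close> differ by less than 1, so differences of points
  with integer shift outside \<open>-1, 0, 1\<close> are at least 1 in size. Only finitely many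
  smaller candidates remain, and the value 1 is put into the minimum to cover the other
  shifts.\<close>

lemma cover_gap:
  assumes "proper_cover W"
  obtains m where "m > 0" "\<And>x y. x \<in> cover_pts W \<Longrightarrow> y \<in> cover_pts W \<Longrightarrow> x < y \<Longrightarrow> m \<le> y - x"
proof -
  let ?Q = "fst W"
  define F where "F = (\<lambda>(a, b, k). \<bar>a - b + of_int k\<bar>) ` (?Q \<times> ?Q \<times> {-1, 0, 1::int}) - {0}"
  have fin: "finite F" using assms by (simp add: F_def proper_cover_def)
  define m where "m = Min (insert 1 F)"
  have pos: "m > 0" unfolding m_def using fin by (auto simp: F_def)
  have "m \<le> y - x" if xy: "x \<in> cover_pts W" "y \<in> cover_pts W" "x < y" for x y
  proof -
    obtain a i b j where *: "a \<in> ?Q" "x = a + of_int i" "b \<in> ?Q" "y = b + of_int j"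
      using xy by (auto simp: cover_pts_def)
    have ab: "\<bar>b - a\<bar> < 1" using * assms by (auto simp: proper_cover_def subset_iff) (smt (verit))
    show ?thesis
    proof (cases "j - i \<in> {-1, 0, 1}")
      case True
      have "y - x = b - a + of_int (j - i)" using * by simp
      then have "y - x = \<bar>b - a + of_int (j - i)\<bar>" using xy(3) by simp
      then have "y - x \<in> F" unfolding F_def using * True xy(3) by (auto intro!: image_eqI[of _ _ "(b, a, j - i)"])
      then show ?thesis unfolding m_def using fin by simp
    next
      case False
      then have "\<bar>real_of_int (j - i)\<bar> \<ge> 2" by auto
      then have "y - x \<ge> 1" using ab * xy(3) by (auto simp: abs_if split: if_splits)
      then show ?thesis unfolding m_def using fin by (meson Min_le finite_insert insertI1 order_trans)
    qed
  qed
  with pos that show thesis by blast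
qed

lemma cover_pts_unbounded:
  assumes "proper_cover W"
  shows "\<exists>y\<in>cover_pts W. y \<le> x" "\<exists>y\<in>cover_pts W. x < y"
proof -
  obtain q where q: "q \<in> cover_pts W" using assms cover_pts_unit[of W] by (auto simp: proper_cover_def)
  have "q + of_int (- \<lceil>q - x\<rceil>) \<in> cover_pts W" "q + of_int (\<lfloor>x - q\<rfloor> + 1) \<in> cover_pts W"
    using q by (simp_all only: cover_pts_shift_iff)
  moreover have "q + of_int (- \<lceil>q - x\<rceil>) \<le> x" "x < q + of_int (\<lfloor>x - q\<rfloor> + 1)" by linarith+
  ultimately show "\<exists>y\<in>cover_pts W. y \<le> x" "\<exists>y\<in>cover_pts W. x < y" by blast+
qed

text \<open>The supremum is attained because of the gap \<open>m\<close> between points: an element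
  closer than \<open>m\<close> to the supremum has no larger element beside it.\<close>

lemma
  assumes W: "proper_cover W"
  shows cover_floor_pts: "cover_floor W x \<in> cover_pts W"
    and cover_floor_le: "cover_floor W x \<le> x"
    and cover_floor_greatest: "y \<in> cover_pts W \<Longrightarrow> y \<le> x \<Longrightarrow> y \<le> cover_floor W x"
proof -
  let ?S = "{y \<in> cover_pts W. y \<le> x}"
  obtain m where m: "m > 0" "\<And>x y. x \<in> cover_pts W \<Longrightarrow> y \<in> cover_pts W \<Longrightarrow> x < y \<Longrightarrow> m \<le> y - x"
    using cover_gap[OF W] by metis
  have ne: "?S \<noteq> {}" using cover_pts_unbounded[OF W] by blast
  have bd: "bdd_above ?S" by (rule bdd_aboveI[of _ x]) simp
  obtain s where s: "s \<in> ?S" "Sup ?S - m < s"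
    using less_cSup_iff[OF ne bd, of "Sup ?S - m"] m(1) by auto
  have le: "y \<le> s" if "y \<in> ?S" for y
  proof (rule ccontr)
    assume "\<not> y \<le> s"
    then have "m \<le> y - s" using m(2)[of s y] s that by auto
    moreover have "y \<le> Sup ?S" by (rule cSup_upper[OF that bd])
    ultimately show False using s(2) by linarith
  qed
  have "cover_floor W x = s" unfolding cover_floor_def by (rule cSup_eq_maximum[OF s(1) le])
  then show "cover_floor W x \<in> cover_pts W" "cover_floor W x \<le> x"
    "y \<in> cover_pts W \<Longrightarrow> y \<le> x \<Longrightarrow> y \<le> cover_floor W x"
    using s(1) le by auto
qed

lemma cover_floor_eqI:
  assumes "b \<in> cover_pts W" "b \<le> x" "\<And>c. c \<in> cover_pts W \<Longrightarrow> c \<le> x \<Longrightarrow> c \<le> b"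
  shows "cover_floor W x = b"
  unfolding cover_floor_def by (rule cSup_eq_maximum) (use assms in auto)

lemma
  assumes W: "proper_cover W"
  shows cover_next_pts: "cover_next W x \<in> cover_pts W"
    and cover_next_gt: "x < cover_next W x"
    and cover_next_least: "y \<in> cover_pts W \<Longrightarrow> x < y \<Longrightarrow> cover_next W x \<le> y"
proof -
  let ?S = "{y \<in> cover_pts W. x < y}"
  obtain m where m: "m > 0" "\<And>x y. x \<in> cover_pts W \<Longrightarrow> y \<in> cover_pts W \<Longrightarrow> x < y \<Longrightarrow> m \<le> y - x"
    using cover_gap[OF W] by metis
  have ne: "?S \<noteq> {}" using cover_pts_unbounded[OF W] by blast
  have bd: "bdd_below ?S" by (rule bdd_belowI[of _ x]) simp
  obtain s where s: "s \<in> ?S" "s < Inf ?S + m"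
    using cInf_less_iff[OF ne bd, of "Inf ?S + m"] m(1) by auto
  have le: "s \<le> y" if "y \<in> ?S" for y
  proof (rule ccontr)
    assume "\<not> s \<le> y"
    then have "m \<le> s - y" using m(2)[of y s] s that by auto
    moreover have "Inf ?S \<le> y" by (rule cInf_lower[OF that bd])
    ultimately show False using s(2) by linarith
  qed
  have "cover_next W x = s" unfolding cover_next_def by (rule cInf_eq_minimum[OF s(1) le])
  then show "cover_next W x \<in> cover_pts W" "x < cover_next W x"
    "y \<in> cover_pts W \<Longrightarrow> x < y \<Longrightarrow> cover_next W x \<le> y"
    using s(1) le by auto
qed

lemma cover_next_eqI:
  assumes "b \<in> cover_pts W" "x < b" "\<And>c. c \<in> cover_pts W \<Longrightarrow> x < c \<Longrightarrow> b \<le> c"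
  shows "cover_next W x = b"
  unfolding cover_next_def by (rule cInf_eq_minimum) (use assms in auto)

lemma cover_floor_add_int:
  assumes "proper_cover W"
  shows "cover_floor W (x + of_int k) = cover_floor W x + of_int k"
proof (rule cover_floor_eqI)
  fix c assume c: "c \<in> cover_pts W" "c \<le> x + of_int k"
  then have "c - of_int k \<le> cover_floor W x" by (intro cover_floor_greatest[OF assms]) auto
  then show "c \<le> cover_floor W x + of_int k" by simp
qed (use cover_floor_pts[OF assms] cover_floor_le[OF assms] in auto)

lemma cover_next_add_int:
  assumes "proper_cover W"
  shows "cover_next W (x + of_int k) = cover_next W x + of_int k"
proof (rule cover_next_eqI)
  fix c assume c: "c \<in> cover_pts W" "x + of_int k < c"
  then have "cover_next W x \<le> c - of_int k" by (intro cover_next_least[OF assms]) auto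
  then show "cover_next W x + of_int k \<le> c" by simp
qed (use cover_next_pts[OF assms] cover_next_gt[OF assms] in auto)

lemma cover_int_add_int:
  "proper_cover W \<Longrightarrow> x + of_int k \<in> cover_int W (\<beta> + of_int k) \<longleftrightarrow> x \<in> cover_int W \<beta>"
  by (auto simp: cover_int_def cover_next_add_int)

lemma floor_in_cover_int: "proper_cover W \<Longrightarrow> x \<in> cover_int W (cover_floor W x)"
proof -
  assume W: "proper_cover W"
  have "x < cover_next W (cover_floor W x)"
  proof (rule ccontr)
    assume "\<not> ?thesis"
    then have "cover_next W (cover_floor W x) \<le> cover_floor W x"
      by (intro cover_floor_greatest[OF W] cover_next_pts[OF W]) simp
    then show False using cover_next_gt[OF W, of "cover_floor W x"] by simp
  qed
  then show ?thesis using W cover_floor_le[OF W, of x] by (auto simp: cover_int_def proper_cover_def)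
qed

text \<open>On the real line, admissibility means that three intervals which meet are not pairwise incongruent.\<close>

definition triple_free :: "cover \<Rightarrow> bool" where
  "triple_free W \<longleftrightarrow> (\<forall>x. \<forall>a\<in>cover_pts W. \<forall>b\<in>cover_pts W. \<forall>c\<in>cover_pts W.
     x \<in> cover_int W a \<longrightarrow> x \<in> cover_int W b \<longrightarrow> x \<in> cover_int W c \<longrightarrow>
     a - b \<in> \<int> \<or> b - c \<in> \<int> \<or> a - c \<in> \<int>)"

text \<open>Points of the line with equal image on the circle differ by an integer, and the family
  of intervals is invariant under integers, so a meeting point on the circle lifts to a common point
  of suitably shifted intervals. The form on the line is the one in which translation invariance is
  immediate.\<close>

lemma circle_covers_iff: "W \<in> circle_covers \<longleftrightarrow> proper_cover W \<and> triple_free W"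
proof (intro iffI conjI)
  assume W: "W \<in> circle_covers"
  then show P: "proper_cover W" by (rule circle_covers_proper)
  have tri: "circle_map ` cover_int W a \<inter> circle_map ` cover_int W b \<inter> circle_map ` cover_int W c = {}"
    if "a \<in> fst W" "b \<in> fst W" "c \<in> fst W" "a \<noteq> b" "b \<noteq> c" "a \<noteq> c" for a b c
    using W that by (cases W) (auto simp: circle_covers_def)
  show "triple_free W"
    unfolding triple_free_def
  proof (intro allI ballI impI)
    fix x a b c assume abc: "a \<in> cover_pts W" "b \<in> cover_pts W" "c \<in> cover_pts W"
      "x \<in> cover_int W a" "x \<in> cover_int W b" "x \<in> cover_int W c"
    have *: "\<exists>q k. q \<in> fst W \<and> a = q + of_int k \<and> circle_map x \<in> circle_map ` cover_int W q"
      if a: "a \<in> cover_pts W" "x \<in> cover_int W a" for a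
    proof -
      obtain q k where q: "q \<in> fst W" "a = q + of_int k" using a by (auto simp: cover_pts_def)
      have "x - of_int k \<in> cover_int W q"
        using a(2) cover_int_add_int[OF P, of "x - of_int k" k q] q(2) by simp
      moreover have "circle_map x = circle_map (x - of_int k)" by (auto simp: circle_map_eq_iff)
      ultimately show ?thesis using q by blast
    qed
    obtain qa ka where a: "qa \<in> fst W" "a = qa + of_int ka" "circle_map x \<in> circle_map ` cover_int W qa"
      using *[OF abc(1,4)] by blast
    obtain qb kb where b: "qb \<in> fst W" "b = qb + of_int kb" "circle_map x \<in> circle_map ` cover_int W qb"
      using *[OF abc(2,5)] by blast
    obtain qc kc where c: "qc \<in> fst W" "c = qc + of_int kc" "circle_map x \<in> circle_map ` cover_int W qc"
      using *[OF abc(3,6)] by blast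
    have "qa = qb \<or> qb = qc \<or> qa = qc" using tri[OF a(1) b(1) c(1)] a(3) b(3) c(3) by blast
    then show "a - b \<in> \<int> \<or> b - c \<in> \<int> \<or> a - c \<in> \<int>"
      using a(2) b(2) c(2) by auto
  qed
next
  assume "proper_cover W \<and> triple_free W"
  then have P: "proper_cover W" and T: "triple_free W" by auto
  obtain Q e where W: "W = (Q, e)" by (cases W)
  have Q: "finite Q" "Q \<noteq> {}" "Q \<subseteq> {0<..1}" "0 < e" using P by (auto simp: W proper_cover_def)
  have "circle_map ` cover_int W a \<inter> circle_map ` cover_int W b \<inter> circle_map ` cover_int W c = {}"
    if q: "a \<in> Q" "b \<in> Q" "c \<in> Q" "a \<noteq> b" "b \<noteq> c" "a \<noteq> c" for a b c
  proof (rule ccontr)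
    assume "\<not> ?thesis"
    then obtain x y z where xyz: "x \<in> cover_int W a" "y \<in> cover_int W b" "z \<in> cover_int W c"
      "circle_map x = circle_map y" "circle_map x = circle_map z"
    proof -
      assume *: "\<And>x y z. x \<in> cover_int W a \<Longrightarrow> y \<in> cover_int W b \<Longrightarrow> z \<in> cover_int W c \<Longrightarrow>
        circle_map x = circle_map y \<Longrightarrow> circle_map x = circle_map z \<Longrightarrow> thesis"
      assume "circle_map ` cover_int W a \<inter> circle_map ` cover_int W b \<inter> circle_map ` cover_int W c \<noteq> {}"
      then obtain p where "p \<in> circle_map ` cover_int W a" "p \<in> circle_map ` cover_int W b" "p \<in> circle_map ` cover_int W c"
        by blast
      then show thesis by (elim imageE) (rule *, assumption+, simp_all)
    qed
    obtain i where i: "x = y + of_int i" using xyz(4) unfolding circle_map_eq_iff by blast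
    obtain j where j: "x = z + of_int j" using xyz(5) unfolding circle_map_eq_iff by blast
    have pts: "a \<in> cover_pts W" "b \<in> cover_pts W" "c \<in> cover_pts W"
      using cover_pts_unit[of W] Q q by (auto simp: W)
    have "x \<in> cover_int W (b + of_int i)"
      using xyz(2) unfolding i cover_int_add_int[OF P] .
    moreover have "x \<in> cover_int W (c + of_int j)"
      using xyz(3) unfolding j cover_int_add_int[OF P] .
    moreover have "b + of_int i \<in> cover_pts W" "c + of_int j \<in> cover_pts W" using pts by auto
    ultimately have "a - (b + of_int i) \<in> \<int> \<or> (b + of_int i) - (c + of_int j) \<in> \<int> \<or> a - (c + of_int j) \<in> \<int>"
      using T pts(1) xyz(1) unfolding triple_free_def by meson
    then obtain n :: int where "a - (b + of_int i) = of_int n \<or> (b + of_int i) - (c + of_int j) = of_int n \<or> a - (c + of_int j) = of_int n"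
      by (auto elim!: Ints_cases)
    then have "a = b + of_int (n + i) \<or> b = c + of_int (n + j - i) \<or> a = c + of_int (n + j)" by auto
    moreover have "a \<in> {0<..1}" "b \<in> {0<..1}" "c \<in> {0<..1}" using q(1-3) Q(3) by blast+
    ultimately have "a = b \<or> b = c \<or> a = c"
      using unit_interval_int_diff[of a b "n + i"] unit_interval_int_diff[of b c "n + j - i"]
        unit_interval_int_diff[of a c "n + j"] by blast
    then show False using q by simp
  qed
  then show "W \<in> circle_covers" using Q by (auto simp: W circle_covers_def)
qed

text \<open>If the intervals of \<open>a < b < c\<close> share a point, then those of
  \<open>a\<close> and \<open>c\<close> give \<open>c - e < b + e\<close>, whereas the gap gives
  \<open>c - b \<ge> m\<close>. This is excluded when \<open>e \<le> m / 2\<close>.\<close>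

lemma small_cover_admissible:
  assumes "finite Q" "Q \<noteq> {}" "Q \<subseteq> {0<..1}"
  obtains e0 where "e0 > 0" "\<And>e. 0 < e \<Longrightarrow> e \<le> e0 \<Longrightarrow> (Q, e) \<in> circle_covers"
proof -
  have pts: "cover_pts (Q, e) = cover_pts (Q, 1)" for e by (simp add: cover_pts_def)
  have P: "proper_cover (Q, e)" if "0 < e" for e using assms that by (simp add: proper_cover_def)
  obtain m where m: "m > 0" "\<And>x y. x \<in> cover_pts (Q, 1) \<Longrightarrow> y \<in> cover_pts (Q, 1) \<Longrightarrow> x < y \<Longrightarrow> m \<le> y - x"
    using cover_gap[OF P[of 1]] by auto
  have "(Q, e) \<in> circle_covers" if e: "0 < e" "e \<le> m / 2" for e
  proof -
    let ?W = "(Q, e)"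
    have no: False if abc: "a \<in> cover_pts ?W" "b \<in> cover_pts ?W" "c \<in> cover_pts ?W" "a < b" "b < c"
      "x \<in> cover_int ?W a" "x \<in> cover_int ?W c" for a b c x
    proof -
      have "x < b + e" using abc(6) cover_next_least[OF P[OF e(1)] abc(2,4)] by (auto simp: cover_int_def)
      moreover have "c - e < x" using abc(7) by (simp add: cover_int_def)
      moreover have "m \<le> c - b" using m(2)[of b c] abc(2,3,5) unfolding pts[of e] by blast
      ultimately show False using e by linarith
    qed
    have "triple_free ?W"
      unfolding triple_free_def
    proof (intro allI ballI impI, rule ccontr)
      fix x a b c assume abc: "a \<in> cover_pts ?W" "b \<in> cover_pts ?W" "c \<in> cover_pts ?W"
        "x \<in> cover_int ?W a" "x \<in> cover_int ?W b" "x \<in> cover_int ?W c"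
        "\<not> (a - b \<in> \<int> \<or> b - c \<in> \<int> \<or> a - c \<in> \<int>)"
      then have "a \<noteq> b" "b \<noteq> c" "a \<noteq> c" by auto
      then consider "a < b" "b < c" | "a < c" "c < b" | "b < a" "a < c" | "b < c" "c < a" | "c < a" "a < b" | "c < b" "b < a"
        by linarith
      then show False
        using no[OF abc(1,2,3)] no[OF abc(1,3,2)] no[OF abc(2,1,3)] no[OF abc(2,3,1)] no[OF abc(3,1,2)]
          no[OF abc(3,2,1)] abc(4-6) by cases blast+
    qed
    then show ?thesis using P[OF e(1)] by (simp add: circle_covers_iff)
  qed
  with m(1) that[of "m / 2"] show thesis by auto
qed

lemma refines_refl: "refines W W" by (simp add: refines_def)
lemma refines_trans: "refines U V \<Longrightarrow> refines V W \<Longrightarrow> refines U W" by (auto simp: refines_def)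

lemma common_refinement:
  assumes "V \<in> circle_covers" "W \<in> circle_covers"
  obtains U where "U \<in> circle_covers" "refines U V" "refines U W"
proof -
  note P = assms[THEN circle_covers_proper, unfolded proper_cover_def]
  obtain e0 where e0: "e0 > 0" "\<And>e. 0 < e \<Longrightarrow> e \<le> e0 \<Longrightarrow> (fst V \<union> fst W, e) \<in> circle_covers"
    using small_cover_admissible[of "fst V \<union> fst W"] P by auto
  show thesis
    by (rule that[of "(fst V \<union> fst W, min e0 (min (snd V) (snd W)))"])
      (use P e0 in \<open>auto simp: refines_def\<close>)
qed

lemma refines_pts: "refines W' W \<Longrightarrow> cover_pts W \<subseteq> cover_pts W'"
  by (auto simp: refines_def cover_pts_def)

lemma cover_floor_floor:
  assumes "proper_cover W'" "proper_cover W" "refines W' W"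
  shows "cover_floor W (cover_floor W' x) = cover_floor W x"
proof (rule cover_floor_eqI)
  show "cover_floor W x \<in> cover_pts W" by (rule cover_floor_pts[OF assms(2)])
  show "cover_floor W x \<le> cover_floor W' x"
    using refines_pts[OF assms(3)] cover_floor_pts[OF assms(2)] cover_floor_le[OF assms(2)]
    by (intro cover_floor_greatest[OF assms(1)]) auto
  show "c \<le> cover_floor W x" if "c \<in> cover_pts W" "c \<le> cover_floor W' x" for c
    using cover_floor_greatest[OF assms(2) that(1), of x] that(2) cover_floor_le[OF assms(1), of x] by linarith
qed

lemma cover_int_refine:
  assumes "proper_cover W'" "proper_cover W" "refines W' W" "x \<in> cover_int W' \<beta>"
  shows "x \<in> cover_int W (cover_floor W \<beta>)"
proof -
  let ?n = "cover_next W (cover_floor W \<beta>)"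
  have "\<beta> < ?n"
    using cover_floor_greatest[OF assms(2) cover_next_pts[OF assms(2)], of "cover_floor W \<beta>" \<beta>]
      cover_next_gt[OF assms(2), of "cover_floor W \<beta>"] by force
  then have "cover_next W' \<beta> \<le> ?n"
    using refines_pts[OF assms(3)] cover_next_pts[OF assms(2)] by (intro cover_next_least[OF assms(1)]) auto
  moreover have "snd W' \<le> snd W" using assms(3) by (simp add: refines_def)
  moreover have "cover_floor W \<beta> \<le> \<beta>" by (rule cover_floor_le[OF assms(2)])
  ultimately show ?thesis using assms(4) by (auto simp: cover_int_def)
qed

lemma shift_cover_pts: "x \<in> cover_pts (shift_cover z W) \<longleftrightarrow> x - z \<in> cover_pts W"
proof
  assume "x \<in> cover_pts (shift_cover z W)"
  then obtain q and k :: int where "q - z \<in> cover_pts W" "x = q + of_int k"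
    unfolding cover_pts_def[of "shift_cover z W"] by (auto simp: shift_cover_def)
  then show "x - z \<in> cover_pts W" using cover_pts_shift[of "q - z" W k] by (simp add: algebra_simps)
next
  assume x: "x - z \<in> cover_pts W"
  let ?k = "\<lceil>x\<rceil> - 1"
  have "x - of_int ?k - z \<in> cover_pts W"
    using x cover_pts_shift_iff'[of "x - z" ?k W] by (simp add: algebra_simps)
  moreover have "x - of_int ?k \<in> {0<..1}" by (auto; linarith)
  ultimately have "x - of_int ?k \<in> fst (shift_cover z W)" by (simp only: shift_cover_def fst_conv mem_Collect_eq simp_thms)
  moreover have "x = (x - of_int ?k) + of_int ?k" by simp
  ultimately show "x \<in> cover_pts (shift_cover z W)" unfolding cover_pts_def by blast
qed

lemma snd_shift_cover [simp]: "snd (shift_cover z W) = snd W"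
  by (simp add: shift_cover_def)

lemma shift_cover_proper:
  assumes W: "proper_cover W"
  shows "proper_cover (shift_cover z W)"
proof -
  \<comment> \<open>The integer \<open>1 - \<lceil>q + z\<rceil>\<close> is the only one that moves
    \<open>q + z\<close> into \<open>(0, 1]\<close>.\<close>
  have "fst (shift_cover z W) \<subseteq> (\<lambda>q. q + z + of_int (1 - \<lceil>q + z\<rceil>)) ` fst W"
  proof
    fix x assume "x \<in> fst (shift_cover z W)"
    then obtain q k where q: "q \<in> fst W" "x - z = q + of_int k" "0 < x" "x \<le> 1"
      by (auto simp: shift_cover_def cover_pts_def)
    then have "k = 1 - \<lceil>q + z\<rceil>" by linarith
    with q show "x \<in> (\<lambda>q. q + z + of_int (1 - \<lceil>q + z\<rceil>)) ` fst W"
      by (intro image_eqI[of _ _ q]) (auto simp: algebra_simps)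
  qed
  then have fin: "finite (fst (shift_cover z W))" using W by (auto simp: proper_cover_def intro: finite_subset)
  obtain y where "y \<in> cover_pts W" using cover_pts_unbounded(1)[OF W] by blast
  then have "y + z \<in> cover_pts (shift_cover z W)" by (simp add: shift_cover_pts)
  then have "cover_pts (shift_cover z W) \<noteq> {}" by blast
  then have "fst (shift_cover z W) \<noteq> {}" by (auto simp: cover_pts_def)
  with fin show ?thesis using W by (auto simp: proper_cover_def shift_cover_def)
qed

lemma cover_floor_shift:
  assumes W: "proper_cover W"
  shows "cover_floor (shift_cover z W) x = cover_floor W (x - z) + z"
proof (rule cover_floor_eqI)
  fix c assume "c \<in> cover_pts (shift_cover z W)" "c \<le> x"
  then have "c - z \<le> cover_floor W (x - z)" by (intro cover_floor_greatest[OF W]) (auto simp: shift_cover_pts)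
  then show "c \<le> cover_floor W (x - z) + z" by simp
qed (use cover_floor_pts[OF W] cover_floor_le[OF W, of "x - z"] in \<open>auto simp: shift_cover_pts\<close>)

lemma cover_next_shift:
  assumes W: "proper_cover W"
  shows "cover_next (shift_cover z W) x = cover_next W (x - z) + z"
proof (rule cover_next_eqI)
  fix c assume "c \<in> cover_pts (shift_cover z W)" "x < c"
  then have "cover_next W (x - z) \<le> c - z" by (intro cover_next_least[OF W]) (auto simp: shift_cover_pts)
  then show "cover_next W (x - z) + z \<le> c" by simp
qed (use cover_next_pts[OF W] cover_next_gt[OF W, of "x - z"] in \<open>auto simp: shift_cover_pts\<close>)

lemma cover_int_shift:
  "proper_cover W \<Longrightarrow> x \<in> cover_int (shift_cover z W) \<beta> \<longleftrightarrow> x - z \<in> cover_int W (\<beta> - z)"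
  by (auto simp: cover_int_def cover_next_shift)

lemma shift_cover_closed:
  assumes "W \<in> circle_covers"
  shows "shift_cover z W \<in> circle_covers"
proof -
  have W: "proper_cover W" and T: "triple_free W" using assms by (auto simp: circle_covers_iff)
  have "triple_free (shift_cover z W)"
    unfolding triple_free_def
  proof (intro allI ballI impI)
    fix x a b c assume "a \<in> cover_pts (shift_cover z W)" "b \<in> cover_pts (shift_cover z W)"
      "c \<in> cover_pts (shift_cover z W)" "x \<in> cover_int (shift_cover z W) a"
      "x \<in> cover_int (shift_cover z W) b" "x \<in> cover_int (shift_cover z W) c"
    then have "(a - z) - (b - z) \<in> \<int> \<or> (b - z) - (c - z) \<in> \<int> \<or> (a - z) - (c - z) \<in> \<int>"
      using T unfolding triple_free_def shift_cover_pts cover_int_shift[OF W] by meson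
    then show "a - b \<in> \<int> \<or> b - c \<in> \<int> \<or> a - c \<in> \<int>" by simp
  qed
  then show ?thesis using shift_cover_proper[OF W] by (simp add: circle_covers_iff)
qed

lemma shift_shift_cover:
  assumes "W \<in> circle_covers"
  shows "shift_cover z (shift_cover (- z) W) = W"
proof (rule prod_eqI)
  have "fst (shift_cover z (shift_cover (- z) W)) = cover_pts W \<inter> {0<..1}"
    unfolding shift_cover_def[of z] fst_conv shift_cover_pts by auto
  then show "fst (shift_cover z (shift_cover (- z) W)) = fst W"
    using cover_pts_unit[of W] circle_covers_proper[OF assms] by (simp add: proper_cover_def)
qed simp

lemma shift_cover_refines: "refines V W \<Longrightarrow> refines (shift_cover z V) (shift_cover z W)"
  using refines_pts[of V W] by (auto simp: refines_def shift_cover_def)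

lemma cover_floor_constant:
  assumes W: "proper_cover W" and none: "\<And>c. c \<in> cover_pts W \<Longrightarrow> c \<le> lo \<or> hi < c"
    and a: "lo < a" "a \<le> hi" and b: "lo < b" "b \<le> hi"
  shows "cover_floor W a = cover_floor W b"
proof (rule cover_floor_eqI)
  show "cover_floor W b \<in> cover_pts W" by (rule cover_floor_pts[OF W])
  show "cover_floor W b \<le> a"
    using none[OF cover_floor_pts[OF W], of b] cover_floor_le[OF W, of b] a b by linarith
  show "c \<le> cover_floor W b" if "c \<in> cover_pts W" "c \<le> a" for c
    using none[OF that(1)] that(2) a b by (intro cover_floor_greatest[OF W that(1)]) linarith
qed

text \<open>Adding all multiples of \<open>1 / N\<close> to the points makes the gaps smaller than
  \<open>\<eta>\<close>, and the enlargement is cut down to \<open>\<eta>\<close>. This accounts for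
  one \<open>\<eta>\<close> below the index and two above it.\<close>

lemma fine_refinement:
  assumes W: "W \<in> circle_covers" and e: "\<eta> > 0"
  obtains U where "U \<in> circle_covers" "refines U W"
    "\<And>\<beta> x. x \<in> cover_int U \<beta> \<Longrightarrow> \<beta> - \<eta> < x \<and> x < \<beta> + 2 * \<eta>"
proof -
  note P = circle_covers_proper[OF W, unfolded proper_cover_def]
  obtain N :: nat where N: "N > 0" "1 / real N < \<eta>"
    using real_arch_inverse[of \<eta>] e by (metis inverse_eq_divide not_gr_zero)
  define Q where "Q = fst W \<union> (\<lambda>i. real i / real N) ` {1..N}"
  have Q: "finite Q" "Q \<noteq> {}" "Q \<subseteq> {0<..1}" using P N(1) by (auto simp: Q_def field_simps)
  obtain e0 where e0: "e0 > 0" "\<And>e. 0 < e \<Longrightarrow> e \<le> e0 \<Longrightarrow> (Q, e) \<in> circle_covers"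
    using small_cover_admissible[OF Q] by metis
  define U where "U = (Q, min e0 (min (snd W) \<eta>))"
  have U: "U \<in> circle_covers" unfolding U_def using e0 P e by auto
  have PU: "proper_cover U" by (rule circle_covers_proper[OF U])
  have grid: "of_int i / real N \<in> cover_pts U" for i :: int
  proof -
    \<comment> \<open>The residue is taken in \<open>{1..N}\<close> and not in
      \<open>{0..<N}\<close>, because the points of a cover are normalised to
      \<open>(0, 1]\<close>.\<close>
    define j where "j = (i - 1) mod int N + 1"
    have j: "1 \<le> j" "j \<le> int N" using N(1) by (auto simp: j_def pos_mod_bound add1_zle_eq)
    have i: "i = j + int N * ((i - 1) div int N)" by (simp add: j_def)
    have "of_int i / real N = of_int j / real N + of_int ((i - 1) div int N)"
      using N(1) by (subst i) (simp add: field_simps)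
    moreover have "of_int j / real N \<in> Q"
      unfolding Q_def using j by (intro UnI2 image_eqI[of _ _ "nat j"]) auto
    ultimately show ?thesis unfolding cover_pts_def U_def by auto
  qed
  show thesis
  proof (rule that[OF U])
    show "refines U W" by (auto simp: refines_def U_def Q_def)
    fix \<beta> x assume x: "x \<in> cover_int U \<beta>"
    define i where "i = \<lfloor>\<beta> * real N\<rfloor> + 1"
    have "\<beta> * real N < of_int i" "of_int i \<le> \<beta> * real N + 1" unfolding i_def by linarith+
    then have "\<beta> < of_int i / real N" "of_int i / real N \<le> \<beta> + 1 / real N"
      using N(1) by (simp_all add: field_simps)
    then have "cover_next U \<beta> \<le> \<beta> + 1 / real N"
      using cover_next_least[OF PU grid, of \<beta> i] by linarith
    moreover have "snd U \<le> \<eta>" by (simp add: U_def)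
    ultimately show "\<beta> - \<eta> < x \<and> x < \<beta> + 2 * \<eta>" using x N(2) by (auto simp: cover_int_def)
  qed
qed

lemma circle_covers_nonempty: "({1}, 1) \<in> circle_covers"
  by (auto simp: circle_covers_def)


section \<open>The circle groupoids\<close>

lemma mem_circle_obj [simp]:
  "(\<beta>, x) \<in> topspace (gobj (circle_groupoid W)) \<longleftrightarrow> \<beta> \<in> cover_pts W \<and> x \<in> cover_int W \<beta>"
  by (simp add: circle_groupoid_def)

lemma mem_circle_arr [simp]:
  "(((\<beta>, \<gamma>), x), l) \<in> topspace (garr (circle_groupoid W)) \<longleftrightarrow>
     \<beta> \<in> cover_pts W \<and> \<gamma> \<in> cover_pts W \<and> x \<in> cover_int W \<beta> \<and> x \<in> cover_int W \<gamma>"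
  by (auto simp: circle_groupoid_def)

lemma circle_structure [simp]:
  "gsrc (circle_groupoid W) (((\<beta>, \<gamma>), x), l) = (\<beta>, x)"
  "gtgt (circle_groupoid W) (((\<beta>, \<gamma>), x), l) = (\<gamma> + of_int l, x + of_int l)"
  "gmul (circle_groupoid W) (((\<beta>, \<gamma>), x), l) (((\<gamma>', \<sigma>), x'), k) = (((\<beta>, \<sigma> - of_int l), x), l + k)"
  "ginv (circle_groupoid W) (((\<beta>, \<gamma>), x), l) = (((\<gamma> + of_int l, \<beta> + of_int l), x + of_int l), - l)"
  "gid (circle_groupoid W) (\<beta>, x) = (((\<beta>, \<beta>), x), 0)"
  by (simp_all add: circle_groupoid_def)

lemma refine_obj_closed:
  assumes "proper_cover W'" "proper_cover W" "refines W' W" "y \<in> topspace (gobj (circle_groupoid W'))"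
  shows "refine_obj W y \<in> topspace (gobj (circle_groupoid W))"
  using assms(4) cover_int_refine[OF assms(1-3)] cover_floor_pts[OF assms(2)]
  by (cases y) (auto simp: refine_obj_def)

lemma refine_arr_closed:
  assumes "proper_cover W'" "proper_cover W" "refines W' W" "r \<in> topspace (garr (circle_groupoid W'))"
  shows "refine_arr W r \<in> topspace (garr (circle_groupoid W))"
  using assms(4) cover_int_refine[OF assms(1-3)] cover_floor_pts[OF assms(2)]
  by (cases r) (auto simp: refine_arr_def case_prod_unfold)

lemma refine_obj_refine_obj:
  "proper_cover W' \<Longrightarrow> proper_cover W \<Longrightarrow> refines W' W \<Longrightarrow> refine_obj W (refine_obj W' y) = refine_obj W y"
  by (cases y) (simp add: refine_obj_def cover_floor_floor)

lemma refine_arr_refine_arr: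
  "proper_cover W' \<Longrightarrow> proper_cover W \<Longrightarrow> refines W' W \<Longrightarrow> refine_arr W (refine_arr W' r) = refine_arr W r"
  by (simp add: refine_arr_def cover_floor_floor case_prod_unfold)

lemma unshift_obj_closed:
  "proper_cover W \<Longrightarrow> y \<in> topspace (gobj (circle_groupoid (shift_cover z W))) \<Longrightarrow>
     unshift_obj z y \<in> topspace (gobj (circle_groupoid W))"
  by (cases y) (auto simp: unshift_obj_def shift_cover_pts cover_int_shift)

lemma unshift_arr_closed:
  "proper_cover W \<Longrightarrow> r \<in> topspace (garr (circle_groupoid (shift_cover z W))) \<Longrightarrow>
     unshift_arr z r \<in> topspace (garr (circle_groupoid W))"
  by (cases r) (auto simp: unshift_arr_def shift_cover_pts cover_int_shift case_prod_unfold)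

lemma unshift_refine_obj:
  "proper_cover W \<Longrightarrow> unshift_obj z (refine_obj (shift_cover z W) y) = refine_obj W (unshift_obj z y)"
  by (cases y) (simp add: unshift_obj_def refine_obj_def cover_floor_shift)

lemma unshift_refine_arr:
  "proper_cover W \<Longrightarrow> unshift_arr z (refine_arr (shift_cover z W) r) = refine_arr W (unshift_arr z r)"
  by (simp add: unshift_arr_def refine_arr_def cover_floor_shift case_prod_unfold)

lemma unshift_hom:
  assumes W: "proper_cover W"
  shows "groupoid_morphism (circle_groupoid (shift_cover z W)) (circle_groupoid W) (unshift_obj z) (unshift_arr z)"
proof (rule groupoid_morphismI)
  have trans: "continuous_map (top_of_set S) (top_of_set T) (\<lambda>x. x - z)"
    if "\<And>x. x \<in> S \<Longrightarrow> x - z \<in> T" for S T :: "real set"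
    using that by (auto intro!: continuous_intros)
  show "continuous_map (gobj (circle_groupoid (shift_cover z W))) (gobj (circle_groupoid W)) (unshift_obj z)"
    unfolding circle_groupoid_def tgroupoid.select_convs
  proof (rule continuous_map_from_sum_topology)
    fix \<beta> assume b: "\<beta> \<in> cover_pts (shift_cover z W)"
    have "continuous_map (top_of_set (cover_int (shift_cover z W) \<beta>)) (top_of_set (cover_int W (\<beta> - z))) (\<lambda>x. x - z)"
      by (rule trans) (simp add: cover_int_shift[OF W])
    moreover have "continuous_map (top_of_set (cover_int W (\<beta> - z)))
        (sum_topology (\<lambda>\<beta>. top_of_set (cover_int W \<beta>)) (cover_pts W)) (Pair (\<beta> - z))"
      using b by (intro continuous_map_component_injection) (simp add: shift_cover_pts)
    ultimately have "continuous_map (top_of_set (cover_int (shift_cover z W) \<beta>))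
       (sum_topology (\<lambda>\<beta>. top_of_set (cover_int W \<beta>)) (cover_pts W)) (\<lambda>x. Pair (\<beta> - z) (x - z))"
      by (rule cm_comp[rotated])
    then show "continuous_map (top_of_set (cover_int (shift_cover z W) \<beta>))
       (sum_topology (\<lambda>\<beta>. top_of_set (cover_int W \<beta>)) (cover_pts W)) (\<lambda>x. unshift_obj z (\<beta>, x))"
      by (simp add: unshift_obj_def)
  qed
  let ?X = "\<lambda>W. sum_topology (\<lambda>i. top_of_set (cover_int W (fst i) \<inter> cover_int W (snd i))) (cover_pts W \<times> cover_pts W)"
  have "continuous_map (?X (shift_cover z W)) (?X W) (\<lambda>r. ((fst (fst r) - z, snd (fst r) - z), snd r - z))"
  proof (rule continuous_map_from_sum_topology)
    fix i assume b: "i \<in> cover_pts (shift_cover z W) \<times> cover_pts (shift_cover z W)"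
    let ?j = "(fst i - z, snd i - z)"
    have "continuous_map (top_of_set (cover_int (shift_cover z W) (fst i) \<inter> cover_int (shift_cover z W) (snd i)))
        (top_of_set (cover_int W (fst ?j) \<inter> cover_int W (snd ?j))) (\<lambda>x. x - z)"
      by (rule trans) (simp add: cover_int_shift[OF W])
    moreover have "continuous_map (top_of_set (cover_int W (fst ?j) \<inter> cover_int W (snd ?j))) (?X W) (Pair ?j)"
      using b by (intro continuous_map_component_injection) (auto simp: shift_cover_pts)
    ultimately have "continuous_map (top_of_set (cover_int (shift_cover z W) (fst i) \<inter> cover_int (shift_cover z W) (snd i)))
       (?X W) (\<lambda>x. Pair ?j (x - z))"
      by (rule cm_comp[rotated])
    then show "continuous_map (top_of_set (cover_int (shift_cover z W) (fst i) \<inter> cover_int (shift_cover z W) (snd i)))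
       (?X W) (\<lambda>x. ((fst (fst (i, x)) - z, snd (fst (i, x)) - z), snd (i, x) - z))"
      by simp
  qed
  from cm_pair[OF cm_comp[OF this continuous_map_fst] continuous_map_snd]
  have "continuous_map (prod_topology (?X (shift_cover z W)) (discrete_topology UNIV))
      (prod_topology (?X W) (discrete_topology UNIV))
      (\<lambda>r. (((fst (fst (fst r)) - z, snd (fst (fst r)) - z), snd (fst r) - z), snd r))" .
  then show "continuous_map (garr (circle_groupoid (shift_cover z W))) (garr (circle_groupoid W)) (unshift_arr z)"
    by (simp add: circle_groupoid_def unshift_arr_def case_prod_unfold)
next
  fix r assume "r \<in> topspace (garr (circle_groupoid (shift_cover z W)))"
  show "gsrc (circle_groupoid W) (unshift_arr z r) = unshift_obj z (gsrc (circle_groupoid (shift_cover z W)) r) \<and>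
      gtgt (circle_groupoid W) (unshift_arr z r) = unshift_obj z (gtgt (circle_groupoid (shift_cover z W)) r) \<and>
      unshift_arr z (ginv (circle_groupoid (shift_cover z W)) r) = ginv (circle_groupoid W) (unshift_arr z r)"
    by (simp add: circle_groupoid_def unshift_obj_def unshift_arr_def case_prod_unfold)
next
  fix y
  show "unshift_arr z (gid (circle_groupoid (shift_cover z W)) y) = gid (circle_groupoid W) (unshift_obj z y)"
    by (simp add: circle_groupoid_def unshift_obj_def unshift_arr_def case_prod_unfold)
next
  fix r r'
  show "unshift_arr z (gmul (circle_groupoid (shift_cover z W)) r r') =
      gmul (circle_groupoid W) (unshift_arr z r) (unshift_arr z r')"
    by (simp add: circle_groupoid_def unshift_arr_def case_prod_unfold)
qed

abbreviation "Sob W \<equiv> topspace (gobj (circle_groupoid W))"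
abbreviation "Sar W \<equiv> topspace (garr (circle_groupoid W))"

lemma circ_arr_cases:
  fixes r :: circ_arr
  obtains \<beta> \<gamma> x l where "r = (((\<beta>, \<gamma>), x), l)"
proof -
  have "r = (((fst (fst (fst r)), snd (fst (fst r))), snd (fst r)), snd r)" by simp
  then show thesis by (rule that)
qed

lemma circle_closed:
  assumes W: "proper_cover W"
  shows "r \<in> Sar W \<Longrightarrow> gsrc (circle_groupoid W) r \<in> Sob W"
    "r \<in> Sar W \<Longrightarrow> gtgt (circle_groupoid W) r \<in> Sob W"
    "r \<in> Sar W \<Longrightarrow> ginv (circle_groupoid W) r \<in> Sar W"
    "y \<in> Sob W \<Longrightarrow> gid (circle_groupoid W) y \<in> Sar W"
    "(r, r') \<in> composable (circle_groupoid W) \<Longrightarrow> gmul (circle_groupoid W) r r' \<in> Sar W"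
proof -
  obtain \<beta> \<gamma> x l where r: "r = (((\<beta>, \<gamma>), x), l)" by (rule circ_arr_cases)
  obtain \<beta>' \<sigma> x' k where r': "r' = (((\<beta>', \<sigma>), x'), k)" by (rule circ_arr_cases)
  show "r \<in> Sar W \<Longrightarrow> gsrc (circle_groupoid W) r \<in> Sob W"
    "r \<in> Sar W \<Longrightarrow> gtgt (circle_groupoid W) r \<in> Sob W"
    "r \<in> Sar W \<Longrightarrow> ginv (circle_groupoid W) r \<in> Sar W"
    by (simp_all add: r cover_int_add_int[OF W])
  show "y \<in> Sob W \<Longrightarrow> gid (circle_groupoid W) y \<in> Sar W" by (cases y) simp
  assume "(r, r') \<in> composable (circle_groupoid W)"
  then have c: "\<beta> \<in> cover_pts W" "x \<in> cover_int W \<beta>" "\<sigma> \<in> cover_pts W" "x' \<in> cover_int W \<sigma>" "x' = x + of_int l"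
    by (simp_all add: composable_def r r')
  have "x \<in> cover_int W (\<sigma> - of_int l)"
    using c(4) cover_int_add_int[OF W, of x l "\<sigma> - of_int l"] by (simp add: c(5))
  then show "gmul (circle_groupoid W) r r' \<in> Sar W" using c by (simp add: r r')
qed

lemma circle_snd [simp]:
  "snd (ginv (circle_groupoid W) r) = - snd r"
  "snd (gid (circle_groupoid W) y) = 0"
  "snd (gmul (circle_groupoid W) r r') = snd r + snd r'"
  by (simp_all add: circle_groupoid_def case_prod_unfold)

lemma snd_refine_arr [simp]: "snd (refine_arr W r) = snd r"
  by (simp add: refine_arr_def case_prod_unfold)

lemma snd_unshift_arr [simp]: "snd (unshift_arr z r) = snd r"
  by (simp add: unshift_arr_def case_prod_unfold)

lemma refine_gsrc: "gsrc (circle_groupoid W) (refine_arr W r) = refine_obj W (gsrc (circle_groupoid W') r)"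
  by (simp add: circle_groupoid_def refine_arr_def refine_obj_def case_prod_unfold)

lemma refine_gid: "gid (circle_groupoid W) (refine_obj W y) = refine_arr W (gid (circle_groupoid W') y)"
  by (simp add: circle_groupoid_def refine_arr_def refine_obj_def case_prod_unfold)

lemma circle_gid_continuous:
  "continuous_map (gobj (circle_groupoid W)) (garr (circle_groupoid W)) (gid (circle_groupoid W))"
proof -
  let ?Y = "sum_topology (\<lambda>(\<beta>, \<gamma>). top_of_set (cover_int W \<beta> \<inter> cover_int W \<gamma>)) (cover_pts W \<times> cover_pts W)"
  have "continuous_map (sum_topology (\<lambda>\<beta>. top_of_set (cover_int W \<beta>)) (cover_pts W))
      (prod_topology ?Y (discrete_topology UNIV)) (\<lambda>y. (((fst y, fst y), snd y), 0::int))"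
  proof (rule continuous_map_from_sum_topology, rule cm_pair)
    fix \<beta> assume "\<beta> \<in> cover_pts W"
    then have "(\<beta>, \<beta>) \<in> cover_pts W \<times> cover_pts W" by simp
    from continuous_map_component_injection[OF this, of "\<lambda>(\<beta>, \<gamma>). top_of_set (cover_int W \<beta> \<inter> cover_int W \<gamma>)"]
    show "continuous_map (top_of_set (cover_int W \<beta>)) ?Y (\<lambda>x. ((fst (\<beta>, x), fst (\<beta>, x)), snd (\<beta>, x)))"
      by (simp only: prod.case Int_absorb fst_conv snd_conv)
  qed simp
  then show ?thesis by (simp add: circle_groupoid_def case_prod_unfold)
qed

text \<open>Arrows over the point 0 with canonical index. Refinements carry origins to origins, so
  values there can be compared across the levels of the colimit; they serve as the reference values
  of a translation-invariant function.\<close>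

definition origin :: "cover \<Rightarrow> int \<Rightarrow> circ_arr" where
  "origin W l = (((cover_floor W 0, cover_floor W 0), 0), l)"

lemma origin_closed: "proper_cover W \<Longrightarrow> origin W l \<in> Sar W"
  by (simp add: origin_def cover_floor_pts floor_in_cover_int)

lemma snd_origin [simp]: "snd (origin W l) = l" by (simp add: origin_def)

lemma refine_origin:
  "proper_cover W' \<Longrightarrow> proper_cover W \<Longrightarrow> refines W' W \<Longrightarrow> refine_arr W (origin W' l) = origin W l"
  by (simp add: origin_def refine_arr_def cover_floor_floor)

lemma gid_origin: "gid (circle_groupoid W) (gsrc (circle_groupoid W) (origin W l)) = origin W 0"
  by (simp add: origin_def)

text \<open>
  A function of the arrows which is invariant under all translations depends only on the integer
  component: away from the points of \<open>W\<close> all the indices have the same floor, and a translation by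
  half the gap between the points moves the remaining small triples \<open>(\<beta>, \<gamma>, x)\<close> away from them.
\<close>

lemma translation_invariant_constant:
  assumes W: "W \<in> circle_covers"
    and inv: "\<And>z. \<exists>k\<in>circle_covers. refines k W \<and> refines k (shift_cover z W) \<and>
      (\<forall>r\<in>Sar k. F (refine_arr W r) = F (refine_arr W (unshift_arr z r)))"
  shows "\<exists>k\<in>circle_covers. refines k W \<and> (\<forall>r\<in>Sar k. F (refine_arr W r) = F (origin W (snd r)))"
proof -
  note PW = circle_covers_proper[OF W]
  let ?E = "\<lambda>x l. F (((cover_floor W x, cover_floor W x), x), l)"
  \<comment> \<open>Translation by the point \<open>x\<close> itself moves the arrow over
    \<open>x\<close> with canonical indices to the origin. The refinement depends on
    \<open>x\<close>, which does no harm as only this one arrow is compared.\<close>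
  have E: "?E x l = F (origin W l)" for x l
  proof -
    obtain k where k: "k \<in> circle_covers" "refines k W" "refines k (shift_cover x W)"
      "\<And>r. r \<in> Sar k \<Longrightarrow> F (refine_arr W r) = F (refine_arr W (unshift_arr x r))" using inv[of x] by blast
    note Pk = circle_covers_proper[OF k(1)]
    have r: "(((cover_floor k x, cover_floor k x), x), l) \<in> Sar k"
      by (simp add: cover_floor_pts[OF Pk] floor_in_cover_int[OF Pk])
    have "cover_floor (shift_cover x W) (cover_floor k x) = cover_floor (shift_cover x W) x"
      by (rule cover_floor_floor[OF Pk shift_cover_proper[OF PW] k(3)])
    then have "cover_floor W (cover_floor k x - x) = cover_floor W 0"
      by (simp add: cover_floor_shift[OF PW])
    with k(4)[OF r] show ?thesis
      by (simp add: refine_arr_def unshift_arr_def origin_def cover_floor_floor[OF Pk PW k(2)])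
  qed
  obtain m where m: "m > 0" "\<And>x y. x \<in> cover_pts W \<Longrightarrow> y \<in> cover_pts W \<Longrightarrow> x < y \<Longrightarrow> m \<le> y - x"
    using cover_gap[OF PW] by metis
  \<comment> \<open>The indices at \<open>x\<close> lie in a window of length
    \<open>3 \<eta>\<close>, and half a gap is \<open>4 \<eta>\<close>. A point of \<open>W\<close>
    in the window and another in the window moved down by half a gap would be less than
    \<open>7 \<eta>\<close> apart, although distinct points are at least \<open>8 \<eta>\<close>
    apart. So one of the two windows is free of points.\<close>
  define \<eta> where "\<eta> = m / 8"
  have \<eta>: "\<eta> > 0" using m(1) by (simp add: \<eta>_def)
  obtain k where k: "k \<in> circle_covers" "refines k W"
    "\<And>r. r \<in> Sar k \<Longrightarrow> F (refine_arr W r) = F (refine_arr W (unshift_arr (m / 2) r))"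
    "refines k (shift_cover (m / 2) W)" using inv[of "m / 2"] by blast
  note Pk = circle_covers_proper[OF k(1)]
  have flk: "cover_floor W (cover_floor k a - m / 2) = cover_floor W (a - m / 2)" for a
    using cover_floor_floor[OF Pk shift_cover_proper[OF PW] k(4), of a] by (simp add: cover_floor_shift[OF PW])
  obtain k' where k': "k' \<in> circle_covers" "refines k' k"
    "\<And>\<beta> x. x \<in> cover_int k' \<beta> \<Longrightarrow> \<beta> - \<eta> < x \<and> x < \<beta> + 2 * \<eta>"
    using fine_refinement[OF k(1) \<eta>] by metis
  note Pk' = circle_covers_proper[OF k'(1)]
  have ref: "refines k' W" by (rule refines_trans[OF k'(2) k(2)])
  have "F (refine_arr W r) = F (origin W (snd r))" if r: "r \<in> Sar k'" for r
  proof -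
    obtain \<beta> \<gamma> x l where req: "r = (((\<beta>, \<gamma>), x), l)" by (cases r) auto
    have near: "x - 2 * \<eta> < \<beta>" "\<beta> < x + \<eta>" "x - 2 * \<eta> < \<gamma>" "\<gamma> < x + \<eta>"
      using k'(3)[of x \<beta>] k'(3)[of x \<gamma>] r by (auto simp: req)
    show ?thesis
    proof (cases "\<exists>c\<in>cover_pts W. x - 2 * \<eta> < c \<and> c \<le> x + \<eta>")
      case False
      have fl: "cover_floor W a = cover_floor W x" if "x - 2 * \<eta> < a" "a < x + \<eta>" for a
      proof (rule cover_floor_constant[OF PW, of "x - 2 * \<eta>" "x + \<eta>"])
        show "c \<le> x - 2 * \<eta> \<or> x + \<eta> < c" if "c \<in> cover_pts W" for c using False that by force
      qed (use that \<eta> in auto)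
      have "F (refine_arr W r) = ?E x l"
        unfolding req refine_arr_def prod.case fl[OF near(1,2)] fl[OF near(3,4)] ..
      then show ?thesis using E by (simp add: req)
    next
      case True
      then obtain c where c: "c \<in> cover_pts W" "x - 2 * \<eta> < c" "c \<le> x + \<eta>" by blast
      have fl: "cover_floor W (a - m / 2) = cover_floor W (x - m / 2)" if "x - 2 * \<eta> < a" "a < x + \<eta>" for a
      proof (rule cover_floor_constant[OF PW, of "x - 2 * \<eta> - m / 2" "x + \<eta> - m / 2"])
        fix c' assume c': "c' \<in> cover_pts W"
        show "c' \<le> x - 2 * \<eta> - m / 2 \<or> x + \<eta> - m / 2 < c'"
        proof (rule ccontr)
          assume *: "\<not> ?thesis"
          then have "c' < c" using c(2) m(1) by (auto simp: \<eta>_def)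
          then have "m \<le> c - c'" by (rule m(2)[OF c' c(1)])
          then show False using * c(3) m(1) by (auto simp: \<eta>_def)
        qed
      qed (use that \<eta> in auto)
      have "F (refine_arr W (refine_arr k r)) = F (refine_arr W (unshift_arr (m / 2) (refine_arr k r)))"
        by (rule k(3)[OF refine_arr_closed[OF Pk' Pk k'(2) r]])
      then have "F (refine_arr W r) = F (refine_arr W (unshift_arr (m / 2) (refine_arr k r)))"
        by (simp add: refine_arr_refine_arr[OF Pk PW k(2)])
      also have "\<dots> = F (((cover_floor W (cover_floor k \<beta> - m / 2), cover_floor W (cover_floor k \<gamma> - m / 2)), x - m / 2), l)"
        by (simp add: req refine_arr_def unshift_arr_def)
      also have "\<dots> = ?E (x - m / 2) l" 
        unfolding flk fl[OF near(1,2)] fl[OF near(3,4)] ..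
      finally show ?thesis using E by (simp add: req)
    qed
  qed
  then show ?thesis by (intro bexI[OF _ k'(1)] conjI ref) blast
qed


section \<open>Colimit classes of eventually equal elements\<close>

text \<open>The elements \<open>c k\<close> form a compatible family, and \<open>x\<close> meets it
  at the level \<open>m\<close>. By directedness, having the same image as \<open>x\<close>
  somewhere is then the same as meeting \<open>c\<close> somewhere. The class is thus described
  without reference to \<open>x\<close>.\<close>

lemma dirlim_class_eventually:
  assumes directed: "\<And>i j. i \<in> I \<Longrightarrow> j \<in> I \<Longrightarrow> \<exists>k\<in>I. prec k i \<and> prec k j"
    and trans: "\<And>i j k. prec i j \<Longrightarrow> prec j k \<Longrightarrow> prec i k"
    and comp: "\<And>i k l y. i \<in> I \<Longrightarrow> k \<in> I \<Longrightarrow> l \<in> I \<Longrightarrow> prec k i \<Longrightarrow> prec l k \<Longrightarrow> \<tau> k l (\<tau> i k y) = \<tau> i l y"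
    and const: "\<And>i k. i \<in> I \<Longrightarrow> k \<in> I \<Longrightarrow> prec k i \<Longrightarrow> \<tau> i k (c i) = c k"
    and x: "i \<in> I" "m \<in> I" "prec m i" "\<tau> i m x = c m"
  shows "dirlim_class I prec \<tau> X (i, x) =
    {(j, y). j \<in> I \<and> y \<in> topspace (X j) \<and> (\<exists>k\<in>I. prec k j \<and> \<tau> j k y = c k)}"
proof -
  have "(\<exists>k\<in>I. prec k i \<and> prec k j \<and> \<tau> i k x = \<tau> j k y) \<longleftrightarrow> (\<exists>k\<in>I. prec k j \<and> \<tau> j k y = c k)"
    if j: "j \<in> I" for j y
  proof
    assume "\<exists>k\<in>I. prec k i \<and> prec k j \<and> \<tau> i k x = \<tau> j k y"
    then obtain k where k: "k \<in> I" "prec k i" "prec k j" "\<tau> i k x = \<tau> j k y" by blast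
    obtain l where l: "l \<in> I" "prec l k" "prec l m" using directed[OF k(1) x(2)] by blast
    have "\<tau> j l y = \<tau> k l (\<tau> j k y)" by (rule comp[OF j k(1) l(1) k(3) l(2), symmetric])
    also have "\<dots> = \<tau> i l x" unfolding k(4)[symmetric] by (rule comp[OF x(1) k(1) l(1) k(2) l(2)])
    also have "\<dots> = \<tau> m l (\<tau> i m x)" by (rule comp[OF x(1,2) l(1) x(3) l(3), symmetric])
    also have "\<dots> = c l" unfolding x(4) by (rule const[OF x(2) l(1,3)])
    finally have "\<tau> j l y = c l" .
    with trans[OF l(2) k(3)] show "\<exists>k\<in>I. prec k j \<and> \<tau> j k y = c k"
      by (intro bexI[of _ l] conjI l(1))
  next
    assume "\<exists>k\<in>I. prec k j \<and> \<tau> j k y = c k"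
    then obtain k where k: "k \<in> I" "prec k j" "\<tau> j k y = c k" by blast
    obtain l where l: "l \<in> I" "prec l k" "prec l m" using directed[OF k(1) x(2)] by blast
    have "\<tau> j l y = c l"
      using comp[OF j k(1) l(1) k(2) l(2), of y] unfolding k(3) const[OF k(1) l(1,2)] ..
    moreover have "\<tau> i l x = c l"
      using comp[OF x(1,2) l(1) x(3) l(3), of x] unfolding x(4) const[OF x(2) l(1,3)] ..
    ultimately have "\<tau> i l x = \<tau> j l y" by simp
    with trans[OF l(3) x(3)] trans[OF l(2) k(2)]
    show "\<exists>k\<in>I. prec k i \<and> prec k j \<and> \<tau> i k x = \<tau> j k y"
      by (intro bexI[of _ l] conjI l(1))
  qed
  then show ?thesis unfolding dirlim_class_def prod.case by (intro Collect_cong) (simp add: case_prod_unfold cong: conj_cong)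
qed


section \<open>Constant loops, the compact-open topology and the fixed loop groupoid\<close>

section \<open>Restriction and translation of loops\<close>

lemma loop_arrs_iff:
  "(\<Psi>, \<Lambda>, \<Phi>) \<in> loop_arrs G W \<longleftrightarrow>
     \<Psi> \<in> loop_objs G W \<and> \<Phi> \<in> loop_objs G W \<and> \<Lambda> \<in> cmaps (garr (circle_groupoid W)) (garr G) \<and>
     (\<forall>r\<in>Sar W. gsrc G (\<Lambda> r) = fst \<Psi> (gsrc (circle_groupoid W) r) \<and>
        gtgt G (\<Lambda> r) = fst \<Phi> (gtgt (circle_groupoid W) r) \<and>
        \<Lambda> r = gmul G (snd \<Psi> r) (\<Lambda> (gid (circle_groupoid W) (gtgt (circle_groupoid W) r))) \<and>
        \<Lambda> r = gmul G (\<Lambda> (gid (circle_groupoid W) (gsrc (circle_groupoid W) r))) (snd \<Phi> r))"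
  by (simp only: loop_arrs_def Let_def mem_Collect_eq prod.case)

lemma restrict_loop_comp:
  assumes "i \<in> circle_covers" "k \<in> circle_covers" "l \<in> circle_covers" "refines k i" "refines l k"
  shows "restrict_loop k l (restrict_loop i k (y :: ('p, 'b) loop)) = restrict_loop i l y"
    "restrict_loop_arr k l (restrict_loop_arr i k (a :: ('p, 'b) loop_arr)) = restrict_loop_arr i l a"
proof -
  note P = assms(1-3)[THEN circle_covers_proper]
  have *: "restrict_loop k l (restrict_loop i k y) = restrict_loop i l y" for y :: "('p, 'b) loop"
    using refine_obj_closed[OF P(3,2) assms(5)] refine_arr_closed[OF P(3,2) assms(5)]
    by (auto simp: restrict_loop_def case_prod_unfold refine_obj_refine_obj[OF P(2,1) assms(4)]
        refine_arr_refine_arr[OF P(2,1) assms(4)] intro!: restrict_ext)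
  show "restrict_loop k l (restrict_loop i k y) = restrict_loop i l y" by (rule *)
  show "restrict_loop_arr k l (restrict_loop_arr i k a) = restrict_loop_arr i l a"
    using refine_arr_closed[OF P(3,2) assms(5)]
    by (auto simp: restrict_loop_arr_def case_prod_unfold refine_arr_refine_arr[OF P(2,1) assms(4)] *
        intro!: restrict_ext)
qed

lemma restrict_shift_loop:
  assumes "j \<in> circle_covers" "k \<in> circle_covers" "refines k j"
  shows "restrict_loop (shift_cover z j) (shift_cover z k) (shift_loop z j (y :: ('p, 'b) loop)) = shift_loop z k (restrict_loop j k y)"
    "restrict_loop_arr (shift_cover z j) (shift_cover z k) (shift_loop_arr z j (a :: ('p, 'b) loop_arr)) =
       shift_loop_arr z k (restrict_loop_arr j k a)"
proof -
  note P = assms(1,2)[THEN circle_covers_proper]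
  note Q = P[THEN shift_cover_proper[of _ z]] shift_cover_refines[OF assms(3), of z]
  have *: "restrict_loop (shift_cover z j) (shift_cover z k) (shift_loop z j y) = shift_loop z k (restrict_loop j k y)"
    for y :: "('p, 'b) loop"
    using refine_obj_closed[OF Q(2,1,3)] refine_arr_closed[OF Q(2,1,3)]
      unshift_obj_closed[OF P(2)] unshift_arr_closed[OF P(2)]
    by (auto simp: restrict_loop_def shift_loop_def case_prod_unfold unshift_refine_obj[OF P(1)]
        unshift_refine_arr[OF P(1)] intro!: restrict_ext)
  show "restrict_loop (shift_cover z j) (shift_cover z k) (shift_loop z j y) = shift_loop z k (restrict_loop j k y)"
    by (rule *)
  show "restrict_loop_arr (shift_cover z j) (shift_cover z k) (shift_loop_arr z j a) =
       shift_loop_arr z k (restrict_loop_arr j k a)"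
    using refine_arr_closed[OF Q(2,1,3)] unshift_arr_closed[OF P(2)]
    by (auto simp: restrict_loop_arr_def shift_loop_arr_def case_prod_unfold unshift_refine_arr[OF P(1)] *
        intro!: restrict_ext)
qed

lemma unshift_unshift [simp]:
  "unshift_obj (- z) (unshift_obj z y) = y" "unshift_arr (- z) (unshift_arr z r) = r"
  by (simp_all add: unshift_obj_def unshift_arr_def case_prod_unfold)

lemma shift_shift_loop:
  assumes j: "j \<in> circle_covers" and y: "y \<in> loop_objs G j"
  shows "shift_loop z (shift_cover (- z) j) (shift_loop (- z) j y) = y"
proof -
  note P = circle_covers_proper[OF j]
  have 1: "unshift_obj z u \<in> Sob (shift_cover (- z) j)" if "u \<in> Sob j" for u
    using unshift_obj_closed[OF shift_cover_proper[OF P], of u z "- z"] that by (simp add: shift_shift_cover[OF j])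
  have 2: "unshift_arr z r \<in> Sar (shift_cover (- z) j)" if "r \<in> Sar j" for r
    using unshift_arr_closed[OF shift_cover_proper[OF P], of r z "- z"] that by (simp add: shift_shift_cover[OF j])
  have ext: "fst y \<in> extensional (Sob j)" "snd y \<in> extensional (Sar j)"
    using y by (auto simp: loop_objs_def)
  show ?thesis
    unfolding shift_loop_def case_prod_unfold fst_conv snd_conv shift_shift_cover[OF j]
    using ext 1 2 by (intro prod_eqI) (auto simp: extensional_def restrict_def)
qed

lemma shift_shift_loop_arr:
  assumes j: "j \<in> circle_covers" and a: "a \<in> loop_arrs G j"
  shows "shift_loop_arr z (shift_cover (- z) j) (shift_loop_arr (- z) j a) = a"
proof -
  note P = circle_covers_proper[OF j]
  have 2: "unshift_arr z r \<in> Sar (shift_cover (- z) j)" if "r \<in> Sar j" for r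
    using unshift_arr_closed[OF shift_cover_proper[OF P], of r z "- z"] that by (simp add: shift_shift_cover[OF j])
  have a': "fst a \<in> loop_objs G j" "snd (snd a) \<in> loop_objs G j" "fst (snd a) \<in> extensional (Sar j)"
  proof -
    have "(fst a, fst (snd a), snd (snd a)) \<in> loop_arrs G j" using a by simp
    note A = this[unfolded loop_arrs_iff cmaps_def mem_Collect_eq]
    show "fst a \<in> loop_objs G j" "snd (snd a) \<in> loop_objs G j" "fst (snd a) \<in> extensional (Sar j)"
      using A by (simp_all only:)
  qed
  have "restrict (restrict (fst (snd a) \<circ> unshift_arr (- z)) (Sar (shift_cover (- z) j)) \<circ> unshift_arr z) (Sar j) = fst (snd a)"
    using a'(3) 2 by (auto simp: extensional_def restrict_def)
  then show ?thesis
    unfolding shift_loop_arr_def case_prod_unfold fst_conv snd_conv shift_shift_cover[OF j]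
      shift_shift_loop[OF j a'(1)] shift_shift_loop[OF j a'(2)] by simp
qed

lemma shift_loop_closed:
  assumes "topological_groupoid G" "j \<in> circle_covers" "y \<in> loop_objs G j"
  shows "shift_loop z j y \<in> loop_objs G (shift_cover z j)"
proof -
  interpret topgpd G by unfold_locales fact
  note P = circle_covers_proper[OF assms(2)] and Q = shift_cover_proper[OF circle_covers_proper[OF assms(2)], of z]
  have h: "groupoid_morphism (circle_groupoid j) G (fst y) (snd y)" using assms(3) by (auto simp: loop_objs_def)
  note u = unshift_hom[OF P, of z]
  have hc: "continuous_map (gobj (circle_groupoid j)) (gobj G) (fst y)"
      "continuous_map (garr (circle_groupoid j)) (garr G) (snd y)"
    using h by (simp_all only: groupoid_morphism_def)
  have uc: "continuous_map (gobj (circle_groupoid (shift_cover z j))) (gobj (circle_groupoid j)) (unshift_obj z)"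
      "continuous_map (garr (circle_groupoid (shift_cover z j))) (garr (circle_groupoid j)) (unshift_arr z)"
    using u by (simp_all only: groupoid_morphism_def)
  have "groupoid_morphism (circle_groupoid (shift_cover z j)) G
     (restrict (fst y \<circ> unshift_obj z) (Sob (shift_cover z j))) (restrict (snd y \<circ> unshift_arr z) (Sar (shift_cover z j)))"
  proof (rule groupoid_morphismI)
    have "continuous_map (gobj (circle_groupoid (shift_cover z j))) (gobj G) (fst y \<circ> unshift_obj z)"
      by (rule continuous_map_compose[OF uc(1) hc(1)])
    then show "continuous_map (gobj (circle_groupoid (shift_cover z j))) (gobj G)
        (restrict (fst y \<circ> unshift_obj z) (Sob (shift_cover z j)))"
      by (rule continuous_map_eq) simp
    have "continuous_map (garr (circle_groupoid (shift_cover z j))) (garr G) (snd y \<circ> unshift_arr z)"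
      by (rule continuous_map_compose[OF uc(2) hc(2)])
    then show "continuous_map (garr (circle_groupoid (shift_cover z j))) (garr G)
        (restrict (snd y \<circ> unshift_arr z) (Sar (shift_cover z j)))"
      by (rule continuous_map_eq) simp
  next
    fix r assume r: "r \<in> Sar (shift_cover z j)"
    note ur = unshift_arr_closed[OF P r]
    show "gsrc G (restrict (snd y \<circ> unshift_arr z) (Sar (shift_cover z j)) r) =
        restrict (fst y \<circ> unshift_obj z) (Sob (shift_cover z j)) (gsrc (circle_groupoid (shift_cover z j)) r) \<and>
      gtgt G (restrict (snd y \<circ> unshift_arr z) (Sar (shift_cover z j)) r) =
        restrict (fst y \<circ> unshift_obj z) (Sob (shift_cover z j)) (gtgt (circle_groupoid (shift_cover z j)) r) \<and>
      restrict (snd y \<circ> unshift_arr z) (Sar (shift_cover z j)) (ginv (circle_groupoid (shift_cover z j)) r) =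
        ginv G (restrict (snd y \<circ> unshift_arr z) (Sar (shift_cover z j)) r)"
      using h u r ur circle_closed[OF Q] by (simp add: groupoid_morphism_def)
  next
    fix v assume v: "v \<in> Sob (shift_cover z j)"
    note uv = unshift_obj_closed[OF P v]
    show "restrict (snd y \<circ> unshift_arr z) (Sar (shift_cover z j)) (gid (circle_groupoid (shift_cover z j)) v) =
        gid G (restrict (fst y \<circ> unshift_obj z) (Sob (shift_cover z j)) v)"
      using h u v uv circle_closed[OF Q] by (simp add: groupoid_morphism_def)
  next
    fix r r' assume r: "r \<in> Sar (shift_cover z j)" "r' \<in> Sar (shift_cover z j)"
      and c: "gtgt (circle_groupoid (shift_cover z j)) r = gsrc (circle_groupoid (shift_cover z j)) r'"
    have c': "(r, r') \<in> composable (circle_groupoid (shift_cover z j))" using r c by (simp add: composable_def)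
    then have 1: "unshift_arr z (gmul (circle_groupoid (shift_cover z j)) r r') =
        gmul (circle_groupoid j) (unshift_arr z r) (unshift_arr z r')"
      using u unfolding groupoid_morphism_def by blast
    have "(unshift_arr z r, unshift_arr z r') \<in> composable (circle_groupoid j)"
      using u r c unshift_arr_closed[OF P] by (simp add: groupoid_morphism_def composable_def)
    then have "snd y (gmul (circle_groupoid j) (unshift_arr z r) (unshift_arr z r')) =
        gmul G (snd y (unshift_arr z r)) (snd y (unshift_arr z r'))"
      using h unfolding groupoid_morphism_def by blast
    then show "restrict (snd y \<circ> unshift_arr z) (Sar (shift_cover z j)) (gmul (circle_groupoid (shift_cover z j)) r r') =
        gmul G (restrict (snd y \<circ> unshift_arr z) (Sar (shift_cover z j)) r)
          (restrict (snd y \<circ> unshift_arr z) (Sar (shift_cover z j)) r')"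
      using r circle_closed(5)[OF Q c'] by (simp add: 1)
  qed
  then show ?thesis by (simp add: shift_loop_def loop_objs_def case_prod_unfold)
qed

lemma shift_loop_arr_closed:
  assumes "topological_groupoid G" "j \<in> circle_covers" "a \<in> loop_arrs G j"
  shows "shift_loop_arr z j a \<in> loop_arrs G (shift_cover z j)"
proof -
  note P = circle_covers_proper[OF assms(2)] and Q = shift_cover_proper[OF circle_covers_proper[OF assms(2)], of z]
  note u = unshift_hom[OF P, of z]
  obtain \<Psi> \<Lambda> \<Phi> where a: "a = (\<Psi>, \<Lambda>, \<Phi>)" by (cases a)
  note A = assms(3)[unfolded a loop_arrs_iff]
  have *: "\<Psi> \<in> loop_objs G j" "\<Phi> \<in> loop_objs G j" "continuous_map (garr (circle_groupoid j)) (garr G) \<Lambda>"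
    using A by (simp_all only: cmaps_def mem_Collect_eq)
  note eq = bspec[OF conjunct2[OF conjunct2[OF conjunct2[OF A]]]]
  have "continuous_map (garr (circle_groupoid (shift_cover z j))) (garr G) (\<Lambda> \<circ> unshift_arr z)"
    by (rule continuous_map_compose[OF _ *(3)]) (use u in \<open>simp only: groupoid_morphism_def\<close>)
  then have c: "continuous_map (garr (circle_groupoid (shift_cover z j))) (garr G) (restrict (\<Lambda> \<circ> unshift_arr z) (Sar (shift_cover z j)))"
    by (rule continuous_map_eq) simp
  have st: "gsrc (circle_groupoid j) (unshift_arr z r) = unshift_obj z (gsrc (circle_groupoid (shift_cover z j)) r)"
      "gtgt (circle_groupoid j) (unshift_arr z r) = unshift_obj z (gtgt (circle_groupoid (shift_cover z j)) r)" for r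
    by (simp_all add: circle_groupoid_def unshift_obj_def unshift_arr_def case_prod_unfold)
  have idt: "gid (circle_groupoid j) (unshift_obj z v) = unshift_arr z (gid (circle_groupoid (shift_cover z j)) v)" for v
    by (simp add: circle_groupoid_def unshift_obj_def unshift_arr_def case_prod_unfold)
  let ?S = "circle_groupoid (shift_cover z j)"
  let ?L = "restrict (\<Lambda> \<circ> unshift_arr z) (Sar (shift_cover z j))"
  have K: "gsrc G (?L r) = fst (shift_loop z j \<Psi>) (gsrc ?S r) \<and> gtgt G (?L r) = fst (shift_loop z j \<Phi>) (gtgt ?S r) \<and>
      ?L r = gmul G (snd (shift_loop z j \<Psi>) r) (?L (gid ?S (gtgt ?S r))) \<and>
      ?L r = gmul G (?L (gid ?S (gsrc ?S r))) (snd (shift_loop z j \<Phi>) r)"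
    if r: "r \<in> Sar (shift_cover z j)" for r
  proof -
    have "gsrc ?S r \<in> Sob (shift_cover z j)" "gtgt ?S r \<in> Sob (shift_cover z j)"
      "gid ?S (gsrc ?S r) \<in> Sar (shift_cover z j)" "gid ?S (gtgt ?S r) \<in> Sar (shift_cover z j)"
      using circle_closed[OF Q] r by blast+
    then have L: "?L r = \<Lambda> (unshift_arr z r)"
      "?L (gid ?S (gtgt ?S r)) = \<Lambda> (unshift_arr z (gid ?S (gtgt ?S r)))"
      "?L (gid ?S (gsrc ?S r)) = \<Lambda> (unshift_arr z (gid ?S (gsrc ?S r)))"
      "fst (shift_loop z j \<Psi>) (gsrc ?S r) = fst \<Psi> (unshift_obj z (gsrc ?S r))"
      "fst (shift_loop z j \<Phi>) (gtgt ?S r) = fst \<Phi> (unshift_obj z (gtgt ?S r))"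
      "snd (shift_loop z j \<Psi>) r = snd \<Psi> (unshift_arr z r)"
      "snd (shift_loop z j \<Phi>) r = snd \<Phi> (unshift_arr z r)"
      using r by (simp_all add: shift_loop_def case_prod_unfold)
    show ?thesis unfolding L by (rule eq[OF unshift_arr_closed[OF P r], unfolded st idt])
  qed
  then show ?thesis
    using shift_loop_closed[OF assms(1,2) *(1), of z] shift_loop_closed[OF assms(1,2) *(2), of z] c
    unfolding a shift_loop_arr_def prod.case loop_arrs_iff cmaps_def
    using ballI[of "Sar (shift_cover z j)", OF K]
    by (intro conjI CollectI restrict_extensional) assumption+
qed

section \<open>Powers of automorphisms\<close>

context topgpd
begin

text \<open>Packaging the automorphisms of \<open>x\<close> as an abstract group gives access to
  integer powers, which define \<open>gpow\<close>.\<close>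

definition isotropy :: "'o \<Rightarrow> 'a monoid" where
  "isotropy x = \<lparr>carrier = {a \<in> topspace (garr G). gsrc G a = x \<and> gtgt G a = x}, mult = gmul G, one = gid G x\<rparr>"

lemma isotropy_simps [simp]:
  "a \<in> carrier (isotropy x) \<longleftrightarrow> a \<in> topspace (garr G) \<and> gsrc G a = x \<and> gtgt G a = x"
  "mult (isotropy x) = gmul G" "one (isotropy x) = gid G x"
  by (simp_all add: isotropy_def)

lemma isotropy_group: "x \<in> topspace (gobj G) \<Longrightarrow> group (isotropy x)"
proof (rule groupI)
  show "\<exists>b\<in>carrier (isotropy x). b \<otimes>\<^bsub>isotropy x\<^esub> a = \<one>\<^bsub>isotropy x\<^esub>" if "a \<in> carrier (isotropy x)" for a
    using that by (intro bexI[of _ "ginv G a"]) auto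
qed auto

definition loops :: "'a set" where
  "loops = {h \<in> topspace (garr G). gsrc G h = gtgt G h}"

definition gpow :: "'a \<Rightarrow> int \<Rightarrow> 'a" where
  "gpow h l = h [^]\<^bsub>isotropy (gsrc G h)\<^esub> l"

lemma
  assumes h: "h \<in> loops"
  shows gpow_closed [simp]: "gpow h l \<in> topspace (garr G)"
    and src_gpow [simp]: "gsrc G (gpow h l) = gsrc G h"
    and tgt_gpow [simp]: "gtgt G (gpow h l) = gsrc G h"
    and gpow_0 [simp]: "gpow h 0 = gid G (gsrc G h)"
    and gpow_1 [simp]: "gpow h 1 = h"
    and gpow_add: "gpow h (l + k) = gmul G (gpow h l) (gpow h k)"
proof -
  have h': "h \<in> topspace (garr G)" "gtgt G h = gsrc G h" using h by (simp_all add: loops_def)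
  interpret I: group "isotropy (gsrc G h)" by (rule isotropy_group) (use h' in simp)
  have hc: "h \<in> carrier (isotropy (gsrc G h))" using h' by simp
  have "gpow h l \<in> carrier (isotropy (gsrc G h))" unfolding gpow_def by (rule I.int_pow_closed[OF hc])
  then show "gpow h l \<in> topspace (garr G)" "gsrc G (gpow h l) = gsrc G h" "gtgt G (gpow h l) = gsrc G h"
    by simp_all
  show "gpow h 0 = gid G (gsrc G h)" by (simp add: gpow_def int_pow_def nat_pow_def)
  show "gpow h 1 = h" unfolding gpow_def by (rule I.int_pow_1[OF hc])
  show "gpow h (l + k) = gmul G (gpow h l) (gpow h k)"
    unfolding gpow_def using I.int_pow_mult[OF hc, of l k] by simp
qed

lemma gpow_neg:
  assumes h: "h \<in> loops"
  shows "gpow h (- l) = ginv G (gpow h l)"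
proof (rule inv_unique)
  show "gmul G (gpow h l) (gpow h (- l)) = gid G (gsrc G (gpow h l))"
    using gpow_add[OF h, of l "- l"] h by simp
qed (use h in simp_all)

text \<open>Additivity makes \<open>E 0\<close> idempotent and hence an identity. The values at
  natural numbers follow by induction from \<open>E 1\<close>, the negative ones as
  inverses.\<close>

lemma int_hom_eq_gpow:
  assumes E: "\<And>l. E l \<in> topspace (garr G)" "\<And>l. gsrc G (E l) = x" "\<And>l. gtgt G (E l) = x"
    and add: "\<And>l k. E (l + k) = gmul G (E l) (E k)"
  shows "E 1 \<in> loops" "E l = gpow (E 1) l"
proof -
  show h: "E 1 \<in> loops" using E by (simp add: loops_def)
  have "gmul G (E 0) (E 0) = gmul G (E 0) (gid G x)"
    using add[of 0 0] mul_id_right'[OF E(1)[of 0] E(3)[of 0]] by simp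
  moreover have x: "x \<in> topspace (gobj G)" using src_closed[OF E(1)[of 0]] E(2)[of 0] by simp
  ultimately have E0: "E 0 = gid G x"
    by (intro mul_left_imp_eq[OF E(1)[of 0] E(1)[of 0]]) (simp_all add: E)
  have nat: "E (int n) = gpow (E 1) (int n)" for n
  proof (induction n)
    case 0
    show ?case using E0 E(2)[of 1] gpow_0[OF h] by simp
  next
    case (Suc n)
    have "E (int n + 1) = gpow (E 1) (int n + 1)"
      unfolding add gpow_add[OF h] gpow_1[OF h] Suc.IH ..
    then show ?case by (simp add: add.commute)
  qed
  have neg: "E (- k) = ginv G (E k)" for k
  proof (rule inv_unique)
    show "gmul G (E k) (E (- k)) = gid G (gsrc G (E k))"
      using add[of k "- k"] E0 E(2)[of k] by simp
  qed (simp_all add: E)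
  show "E l = gpow (E 1) l"
  proof (cases "l \<ge> 0")
    case True
    then show ?thesis using nat[of "nat l"] by simp
  next
    case False
    then have l: "l = - int (nat (- l))" by simp
    show ?thesis by (subst (1 2) l) (simp only: neg nat gpow_neg[OF h])
  qed
qed

definition conjug :: "'a \<Rightarrow> 'a \<Rightarrow> 'a" where
  "conjug h m = gmul G (ginv G m) (gmul G h m)"

lemma conjug_loop:
  assumes "h \<in> loops" "m \<in> topspace (garr G)" "gsrc G m = gsrc G h"
  shows "conjug h m \<in> loops" "gsrc G (conjug h m) = gtgt G m"
  using assms by (simp_all add: loops_def conjug_def)

text \<open>The map \<open>l \<mapsto> inv m \<cdot> h^l \<cdot> m\<close> is additive in
  \<open>l\<close> with value \<open>conjug h m\<close> at 1, so it consists of the powers of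
  \<open>conjug h m\<close>.\<close>

lemma gpow_conjug:
  assumes h: "h \<in> loops" and m: "m \<in> topspace (garr G)" "gsrc G m = gsrc G h"
  shows "gmul G m (gpow (conjug h m) l) = gmul G (gpow h l) m"
proof -
  define E where "E l = gmul G (ginv G m) (gmul G (gpow h l) m)" for l
  have hm: "gmul G (gpow h l) m \<in> topspace (garr G)" "gsrc G (gmul G (gpow h l) m) = gsrc G m"
    "gtgt G (gmul G (gpow h l) m) = gtgt G m" for l using h m by simp_all
  have mE: "gmul G m (E l) = gmul G (gpow h l) m" for l
    unfolding E_def by (rule mul_inv_cancel) (simp_all add: hm m)
  have E: "E l \<in> topspace (garr G)" "gsrc G (E l) = gtgt G m" "gtgt G (E l) = gtgt G m" for l
    unfolding E_def using m hm[of l] by simp_all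
  have add: "E (l + k) = gmul G (E l) (E k)" for l k
  proof (rule mul_left_imp_eq[OF m(1)])
    have "gmul G m (gmul G (E l) (E k)) = gmul G (gmul G m (E l)) (E k)"
      by (rule mul_assoc[symmetric]) (simp_all add: E m(1))
    also have "\<dots> = gmul G (gmul G (gpow h l) m) (E k)" by (simp only: mE)
    also have "\<dots> = gmul G (gpow h l) (gmul G m (E k))"
      by (rule mul_assoc) (use h m E in simp_all)
    also have "\<dots> = gmul G (gpow h l) (gmul G (gpow h k) m)" by (simp only: mE)
    also have "\<dots> = gmul G (gmul G (gpow h l) (gpow h k)) m"
      by (rule mul_assoc[symmetric]) (use h m in simp_all)
    also have "\<dots> = gmul G m (E (l + k))" unfolding mE gpow_add[OF h] ..
    finally show "gmul G m (E (l + k)) = gmul G m (gmul G (E l) (E k))" ..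
  qed (simp_all add: E)
  have "E l = gpow (E 1) l" by (rule int_hom_eq_gpow(2)[of E, OF E add])
  moreover have "E 1 = conjug h m" by (simp add: E_def conjug_def gpow_1[OF h])
  ultimately show ?thesis using mE[of l] by simp
qed

lemma conjug_conjug_inv:
  assumes "h \<in> loops" "m \<in> topspace (garr G)" "gsrc G m = gsrc G h"
  shows "conjug (conjug h m) (ginv G m) = h"
  using assms by (simp add: conjug_def loops_def)

lemma conjug_id: "h \<in> loops \<Longrightarrow> conjug h (gid G (gsrc G h)) = h"
  by (simp add: conjug_def loops_def)

lemma conjug_mul:
  assumes "h \<in> loops" "m \<in> topspace (garr G)" "gsrc G m = gsrc G h" "n \<in> topspace (garr G)" "gsrc G n = gtgt G m"
  shows "conjug (conjug h m) n = conjug h (gmul G m n)"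
  using assms by (simp add: conjug_def loops_def)

text \<open>The powers live in isotropy groups that vary with \<open>z\<close>. Continuity is
  therefore derived from products and inverses in the whole arrow space.\<close>

lemma cm_gpow:
  assumes f: "continuous_map Z (garr G) f" "\<And>z. z \<in> topspace Z \<Longrightarrow> f z \<in> loops"
  shows "continuous_map Z (garr G) (\<lambda>z. gpow (f z) l)"
proof -
  have nat: "continuous_map Z (garr G) (\<lambda>z. gpow (f z) (int n))" for n
  proof (induction n)
    case 0
    have "continuous_map Z (garr G) (\<lambda>z. gid G (gsrc G (f z)))" by (intro cm_gid cm_src f(1))
    then show ?case by (rule continuous_map_eq) (simp add: f(2))
  next
    case (Suc n)
    have "continuous_map Z (garr G) (\<lambda>z. gmul G (gpow (f z) (int n)) (f z))"
      by (rule cm_mul[OF Suc.IH f(1)]) (simp add: f(2))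
    then show ?case
    proof (rule continuous_map_eq)
      fix z assume "z \<in> topspace Z"
      then show "gmul G (gpow (f z) (int n)) (f z) = gpow (f z) (int (Suc n))"
        using gpow_add[OF f(2), of z "int n" 1] gpow_1[OF f(2)] by (simp add: add.commute)
    qed
  qed
  show ?thesis
  proof (cases "l \<ge> 0")
    case True
    then show ?thesis using nat[of "nat l"] by simp
  next
    case False
    have "continuous_map Z (garr G) (\<lambda>z. ginv G (gpow (f z) (int (nat (- l)))))"
      by (rule cm_inv[OF nat])
    then show ?thesis
    proof (rule continuous_map_eq)
      fix z assume "z \<in> topspace Z"
      then show "ginv G (gpow (f z) (int (nat (- l)))) = gpow (f z) l"
        using gpow_neg[OF f(2), of z "int (nat (- l))"] False by simp
    qed
  qed
qed


section \<open>Constant loops\<close>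

definition const_loop :: "cover \<Rightarrow> 'a \<Rightarrow> ('o, 'a) loop" where
  "const_loop W h = (restrict (\<lambda>y. gsrc G h) (Sob W), restrict (\<lambda>r. gpow h (snd r)) (Sar W))"

text \<open>On identities the arrow has the constant value \<open>m = snd a\<close>. The value
  \<open>h^l \<cdot> m\<close> on the other arrows, with \<open>h = fst a\<close>, is forced by the
  compatibility with the source loop, and compatibility with the target loop forces its holonomy to
  be the conjugate.\<close>

definition const_loop_arr :: "cover \<Rightarrow> 'a \<times> 'a \<Rightarrow> ('o, 'a) loop_arr" where
  "const_loop_arr W a = (const_loop W (fst a), restrict (\<lambda>r. gmul G (gpow (fst a) (snd r)) (snd a)) (Sar W), const_loop W (conjug (fst a) (snd a)))"

lemma cm_of_snd:
  assumes "\<And>l. f l \<in> topspace Y"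
  shows "continuous_map (garr (circle_groupoid W)) Y (\<lambda>r. f (snd r))"
proof -
  have "continuous_map (discrete_topology UNIV) Y f" using assms by (auto simp: continuous_map)
  moreover have "continuous_map (garr (circle_groupoid W)) (discrete_topology UNIV) snd"
    unfolding circle_groupoid_def tgroupoid.select_convs by (rule continuous_map_snd)
  ultimately show ?thesis by (rule cm_comp)
qed

lemma const_loop_in:
  assumes h: "h \<in> loops" and W: "proper_cover W"
  shows "const_loop W h \<in> loop_objs G W"
proof -
  have x: "gsrc G h \<in> topspace (gobj G)" using h by (simp add: loops_def)
  have "groupoid_morphism (circle_groupoid W) G (fst (const_loop W h)) (snd (const_loop W h))"
    unfolding const_loop_def fst_conv snd_conv
  proof (rule groupoid_morphismI)
    have "continuous_map (gobj (circle_groupoid W)) (gobj G) (\<lambda>y. gsrc G h)" using x by simp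
    then show "continuous_map (gobj (circle_groupoid W)) (gobj G) (restrict (\<lambda>y. gsrc G h) (Sob W))"
      by (rule continuous_map_eq) simp
    have "continuous_map (garr (circle_groupoid W)) (garr G) (\<lambda>r. gpow h (snd r))"
      by (rule cm_of_snd) (simp add: h)
    then show "continuous_map (garr (circle_groupoid W)) (garr G) (restrict (\<lambda>r. gpow h (snd r)) (Sar W))"
      by (rule continuous_map_eq) simp
  next
    fix r assume r: "r \<in> Sar W"
    note c = circle_closed(1-3)[OF W r]
    show "gsrc G (restrict (\<lambda>r. gpow h (snd r)) (Sar W) r) =
        restrict (\<lambda>y. gsrc G h) (Sob W) (gsrc (circle_groupoid W) r) \<and>
      gtgt G (restrict (\<lambda>r. gpow h (snd r)) (Sar W) r) =
        restrict (\<lambda>y. gsrc G h) (Sob W) (gtgt (circle_groupoid W) r) \<and>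
      restrict (\<lambda>r. gpow h (snd r)) (Sar W) (ginv (circle_groupoid W) r) =
        ginv G (restrict (\<lambda>r. gpow h (snd r)) (Sar W) r)"
      unfolding restrict_apply'[OF r] restrict_apply'[OF c(1)] restrict_apply'[OF c(2)] restrict_apply'[OF c(3)]
      by (simp add: h gpow_neg)
  next
    fix y assume y: "y \<in> Sob W"
    show "restrict (\<lambda>r. gpow h (snd r)) (Sar W) (gid (circle_groupoid W) y) =
        gid G (restrict (\<lambda>y. gsrc G h) (Sob W) y)"
      unfolding restrict_apply'[OF y] restrict_apply'[OF circle_closed(4)[OF W y]] by (simp add: h)
  next
    fix r r' assume r: "r \<in> Sar W" "r' \<in> Sar W" "gtgt (circle_groupoid W) r = gsrc (circle_groupoid W) r'"
    then have c: "(r, r') \<in> composable (circle_groupoid W)" by (simp only: composable_def mem_Collect_eq prod.case simp_thms)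
    show "restrict (\<lambda>r. gpow h (snd r)) (Sar W) (gmul (circle_groupoid W) r r') =
        gmul G (restrict (\<lambda>r. gpow h (snd r)) (Sar W) r) (restrict (\<lambda>r. gpow h (snd r)) (Sar W) r')"
      unfolding restrict_apply'[OF r(1)] restrict_apply'[OF r(2)] restrict_apply'[OF circle_closed(5)[OF W c]]
      by (simp add: h gpow_add)
  qed
  then show ?thesis by (simp add: loop_objs_def const_loop_def)
qed

lemma const_loop_arr_in:
  assumes h: "h \<in> loops" and m: "m \<in> topspace (garr G)" "gsrc G m = gsrc G h" and W: "proper_cover W"
  shows "const_loop_arr W (h, m) \<in> loop_arrs G W"
  unfolding const_loop_arr_def fst_conv snd_conv loop_arrs_iff
proof (intro conjI ballI)
  let ?h' = "conjug h m"
  note h' = conjug_loop[OF h m]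
  show "const_loop W h \<in> loop_objs G W" "const_loop W ?h' \<in> loop_objs G W" by (rule const_loop_in[OF h W] const_loop_in[OF h'(1) W])+
  let ?L = "restrict (\<lambda>r. gmul G (gpow h (snd r)) m) (Sar W)"
  have "continuous_map (garr (circle_groupoid W)) (garr G) (\<lambda>r. gmul G (gpow h (snd r)) m)"
    by (rule cm_of_snd) (simp add: h m)
  then have "continuous_map (garr (circle_groupoid W)) (garr G) ?L" by (rule continuous_map_eq) simp
  then show "?L \<in> cmaps (garr (circle_groupoid W)) (garr G)" by (simp add: cmaps_def)
  fix r assume r: "r \<in> Sar W"
  note c = circle_closed(1-2)[OF W r]
  note d = circle_closed(4)[OF W c(1)] circle_closed(4)[OF W c(2)]
  note ra = restrict_apply'[OF r] restrict_apply'[OF c(1)] restrict_apply'[OF c(2)] restrict_apply'[OF d(1)] restrict_apply'[OF d(2)]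
  have im: "gmul G (gid G (gsrc G h)) m = m" using m by simp
  show "gsrc G (?L r) = fst (const_loop W h) (gsrc (circle_groupoid W) r)"
    unfolding const_loop_def fst_conv ra using h m by simp
  show "gtgt G (?L r) = fst (const_loop W ?h') (gtgt (circle_groupoid W) r)"
    unfolding const_loop_def fst_conv ra using h m h' by simp
  show "?L r = gmul G (snd (const_loop W h) r) (?L (gid (circle_groupoid W) (gtgt (circle_groupoid W) r)))"
    unfolding const_loop_def snd_conv ra circle_snd gpow_0[OF h] im ..
  show "?L r = gmul G (?L (gid (circle_groupoid W) (gsrc (circle_groupoid W) r))) (snd (const_loop W ?h') r)"
    unfolding const_loop_def snd_conv ra circle_snd gpow_0[OF h] im gpow_conjug[OF h m] ..
qed

lemma restrict_const_loop:
  assumes "proper_cover W'" "proper_cover W" "refines W' W"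
  shows "restrict_loop W W' (const_loop W h) = const_loop W' h" "restrict_loop_arr W W' (const_loop_arr W a) = const_loop_arr W' a"
proof -
  have *: "restrict_loop W W' (const_loop W h) = const_loop W' h" for h
    unfolding restrict_loop_def const_loop_def prod.case
    using refine_obj_closed[OF assms] refine_arr_closed[OF assms] by (auto intro!: restrict_ext)
  then show "restrict_loop W W' (const_loop W h) = const_loop W' h" .
  show "restrict_loop_arr W W' (const_loop_arr W a) = const_loop_arr W' a"
    unfolding restrict_loop_arr_def const_loop_arr_def prod.case *
    using refine_arr_closed[OF assms] by (auto intro!: restrict_ext)
qed

lemma shift_const_loop:
  assumes "proper_cover W"
  shows "shift_loop z W (const_loop W h) = const_loop (shift_cover z W) h" "shift_loop_arr z W (const_loop_arr W a) = const_loop_arr (shift_cover z W) a"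
proof -
  have *: "shift_loop z W (const_loop W h) = const_loop (shift_cover z W) h" for h
    unfolding shift_loop_def const_loop_def prod.case
    using unshift_obj_closed[OF assms] unshift_arr_closed[OF assms] by (auto intro!: restrict_ext)
  then show "shift_loop z W (const_loop W h) = const_loop (shift_cover z W) h" .
  show "shift_loop_arr z W (const_loop_arr W a) = const_loop_arr (shift_cover z W) a"
    unfolding shift_loop_arr_def const_loop_arr_def prod.case *
    using unshift_arr_closed[OF assms] by (auto intro!: restrict_ext)
qed

lemma loop_objsD:
  assumes y: "y \<in> loop_objs G W"
  shows "continuous_map (gobj (circle_groupoid W)) (gobj G) (fst y)"
    "continuous_map (garr (circle_groupoid W)) (garr G) (snd y)"
    "r \<in> Sar W \<Longrightarrow> snd y r \<in> topspace (garr G)"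
    "r \<in> Sar W \<Longrightarrow> gsrc G (snd y r) = fst y (gsrc (circle_groupoid W) r)"
    "r \<in> Sar W \<Longrightarrow> gtgt G (snd y r) = fst y (gtgt (circle_groupoid W) r)"
    "v \<in> Sob W \<Longrightarrow> snd y (gid (circle_groupoid W) v) = gid G (fst y v)"
    "v \<in> Sob W \<Longrightarrow> fst y v \<in> topspace (gobj G)"
    "(r, r') \<in> composable (circle_groupoid W) \<Longrightarrow> snd y (gmul (circle_groupoid W) r r') = gmul G (snd y r) (snd y r')"
    "fst y \<in> extensional (Sob W)" "snd y \<in> extensional (Sar W)"
proof -
  have g: "groupoid_morphism (circle_groupoid W) G (fst y) (snd y)"
    and e: "fst y \<in> extensional (Sob W)" "snd y \<in> extensional (Sar W)"
    using y by (simp_all only: loop_objs_def mem_Collect_eq case_prod_unfold)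
  show "fst y \<in> extensional (Sob W)" "snd y \<in> extensional (Sar W)" by fact+
  note G = g[unfolded groupoid_morphism_def]
  show c: "continuous_map (gobj (circle_groupoid W)) (gobj G) (fst y)"
    "continuous_map (garr (circle_groupoid W)) (garr G) (snd y)" using G by (simp_all only:)
  show "r \<in> Sar W \<Longrightarrow> snd y r \<in> topspace (garr G)" "v \<in> Sob W \<Longrightarrow> fst y v \<in> topspace (gobj G)"
    using c[THEN continuous_map_image_subset_topspace] by auto
  note A = conjunct1[OF conjunct2[OF conjunct2[OF G]]]
    and B = conjunct1[OF conjunct2[OF conjunct2[OF conjunct2[OF G]]]]
    and C = conjunct2[OF conjunct2[OF conjunct2[OF conjunct2[OF G]]]]
  show "r \<in> Sar W \<Longrightarrow> gsrc G (snd y r) = fst y (gsrc (circle_groupoid W) r)"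
    "r \<in> Sar W \<Longrightarrow> gtgt G (snd y r) = fst y (gtgt (circle_groupoid W) r)"
    using bspec[OF A, of r] by (simp_all only: simp_thms)
  show "v \<in> Sob W \<Longrightarrow> snd y (gid (circle_groupoid W) v) = gid G (fst y v)" by (rule bspec[OF B])
  show "(r, r') \<in> composable (circle_groupoid W) \<Longrightarrow> snd y (gmul (circle_groupoid W) r r') = gmul G (snd y r) (snd y r')"
    using bspec[OF C, of "(r, r')"] by (simp only: prod.case)
qed

text \<open>Constancy on identity arrows makes the object map constant after refinement, so the
  values \<open>E l\<close> at the origins are automorphisms of one object. Functoriality makes them
  additive in \<open>l\<close>, hence they are the powers of \<open>h = E 1\<close>.\<close>

lemma loop_const_core:
  assumes W: "W \<in> circle_covers" and y: "y \<in> loop_objs G W" and k: "k \<in> circle_covers" "refines k W"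
    and const: "\<And>r. r \<in> Sar k \<Longrightarrow> snd y (refine_arr W r) = snd y (origin W (snd r))"
  defines "h \<equiv> snd y (origin W 1)"
  shows "h \<in> loops" "snd y (origin W l) = gpow h l" "restrict_loop W k y = const_loop k h"
    "fst y (gsrc (circle_groupoid W) (origin W 0)) = gsrc G h"
proof -
  note PW = circle_covers_proper[OF W] and Pk = circle_covers_proper[OF k(1)]
  note Y = loop_objsD[OF y]
  define E where "E l = snd y (origin W l)" for l
  define x where "x = gsrc G (E 0)"
  have obj: "fst y (refine_obj W v) = x" if v: "v \<in> Sob k" for v
  proof -
    note rv = refine_obj_closed[OF Pk PW k(2) v]
    have "snd y (gid (circle_groupoid W) (refine_obj W v)) = E 0"
      unfolding refine_gid[of W v k] E_def using const[OF circle_closed(4)[OF Pk v]] by simp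
    then have "gid G (fst y (refine_obj W v)) = E 0" using Y(6)[OF rv] by simp
    then have "gsrc G (gid G (fst y (refine_obj W v))) = x" by (simp add: x_def)
    then show ?thesis using Y(7)[OF rv] by simp
  qed
  have E: "E l \<in> topspace (garr G)" "gsrc G (E l) = x" "gtgt G (E l) = x" for l
  proof -
    note o = origin_closed[OF PW, of l] and ok = origin_closed[OF Pk, of l]
    show "E l \<in> topspace (garr G)" unfolding E_def by (rule Y(3)[OF o])
    have s: "gsrc (circle_groupoid W) (origin W l) = refine_obj W (gsrc (circle_groupoid k) (origin k l))"
      "gtgt (circle_groupoid W) (origin W l) = refine_obj W (gtgt (circle_groupoid k) (origin k l))"
      using cover_floor_add_int[OF PW, of "cover_floor k 0" l]
      by (simp_all add: origin_def refine_obj_def cover_floor_floor[OF Pk PW k(2)])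
    show "gsrc G (E l) = x" unfolding E_def Y(4)[OF o] s by (rule obj[OF circle_closed(1)[OF Pk ok]])
    show "gtgt G (E l) = x" unfolding E_def Y(5)[OF o] s by (rule obj[OF circle_closed(2)[OF Pk ok]])
  qed
  have add: "E (l + n) = gmul G (E l) (E n)" for l n
  proof -
    \<comment> \<open>An arrow that starts where \<open>origin W l\<close> ends after refinement. It
      is not an origin, but as it comes from \<open>k\<close> the loop takes there the value of the
      origin with integer component \<open>n\<close>.\<close>
    let ?r = "(((cover_floor k 0 + of_int l, cover_floor k 0 + of_int l), of_int l), n) :: circ_arr"
    have r: "?r \<in> Sar k"
      using cover_int_add_int[OF Pk, of 0 l "cover_floor k 0"] floor_in_cover_int[OF Pk, of 0]
      by (simp add: cover_floor_pts[OF Pk])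
    have eq: "refine_arr W ?r = (((cover_floor W 0 + of_int l, cover_floor W 0 + of_int l), of_int l), n)"
      using cover_floor_add_int[OF PW, of "cover_floor k 0" l]
      by (simp add: refine_arr_def cover_floor_floor[OF Pk PW k(2)])
    have "(origin W l, refine_arr W ?r) \<in> composable (circle_groupoid W)"
      using origin_closed[OF PW, of l] refine_arr_closed[OF Pk PW k(2) r]
      unfolding composable_def eq origin_def by simp
    from Y(8)[OF this] have "snd y (gmul (circle_groupoid W) (origin W l) (refine_arr W ?r)) = gmul G (E l) (E n)"
      using const[OF r] by (simp add: E_def)
    moreover have "gmul (circle_groupoid W) (origin W l) (refine_arr W ?r) = origin W (l + n)"
      unfolding eq by (simp add: origin_def)
    ultimately show ?thesis by (simp add: E_def)
  qed
  have h: "h = E 1" by (simp add: h_def E_def)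
  show hl: "h \<in> loops" unfolding h by (rule int_hom_eq_gpow(1)[of E, OF E add])
  have pw: "E l = gpow h l" for l unfolding h by (rule int_hom_eq_gpow(2)[of E, OF E add])
  then show "snd y (origin W l) = gpow h l" by (simp add: E_def)
  have xh: "x = gsrc G h" using E(2)[of 1] h by simp
  show "restrict_loop W k y = const_loop k h"
  proof (rule prod_eqI)
    show "fst (restrict_loop W k y) = fst (const_loop k h)"
      unfolding restrict_loop_def const_loop_def case_prod_unfold fst_conv
      by (rule restrict_ext) (simp add: obj xh)
    show "snd (restrict_loop W k y) = snd (const_loop k h)"
      unfolding restrict_loop_def const_loop_def case_prod_unfold snd_conv
      by (rule restrict_ext) (simp add: const pw[unfolded E_def])
  qed
  have "gsrc G (E 0) = fst y (gsrc (circle_groupoid W) (origin W 0))"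
    unfolding E_def by (rule Y(4)[OF origin_closed[OF PW]])
  then show "fst y (gsrc (circle_groupoid W) (origin W 0)) = gsrc G h" using xh by (simp add: x_def)
qed

text \<open>At the origin with integer component \<open>l\<close> the compatibility with
  \<open>\<Psi>\<close> gives the value \<open>h^l \<cdot> m\<close>. For \<open>l = 1\<close> the
  compatibility with \<open>\<Phi>\<close> gives \<open>m \<cdot> h'\<close>, so
  \<open>h \<cdot> m = m \<cdot> h'\<close> and the target holonomy \<open>h'\<close> is the
  conjugate of \<open>h\<close> by \<open>m\<close>.\<close>

lemma loop_arr_const_core:
  assumes W: "W \<in> circle_covers" and a: "(\<Psi>, \<Lambda>, \<Phi>) \<in> loop_arrs G W" and k: "k \<in> circle_covers" "refines k W"
    and c\<Psi>: "\<And>r. r \<in> Sar k \<Longrightarrow> snd \<Psi> (refine_arr W r) = snd \<Psi> (origin W (snd r))"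
    and c\<Lambda>: "\<And>r. r \<in> Sar k \<Longrightarrow> \<Lambda> (refine_arr W r) = \<Lambda> (origin W (snd r))"
    and c\<Phi>: "\<And>r. r \<in> Sar k \<Longrightarrow> snd \<Phi> (refine_arr W r) = snd \<Phi> (origin W (snd r))"
  defines "h \<equiv> snd \<Psi> (origin W 1)" and "m \<equiv> \<Lambda> (origin W 0)"
  shows "h \<in> loops" "m \<in> topspace (garr G)" "gsrc G m = gsrc G h" "restrict_loop_arr W k (\<Psi>, \<Lambda>, \<Phi>) = const_loop_arr k (h, m)"
proof -
  note PW = circle_covers_proper[OF W] and Pk = circle_covers_proper[OF k(1)]
  note A = a[unfolded loop_arrs_iff]
  have \<Psi>: "\<Psi> \<in> loop_objs G W" and \<Phi>: "\<Phi> \<in> loop_objs G W" and cm: "continuous_map (garr (circle_groupoid W)) (garr G) \<Lambda>"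
    using A by (simp_all only: cmaps_def mem_Collect_eq)
  note eq = bspec[OF conjunct2[OF conjunct2[OF conjunct2[OF A]]]]
  note P = loop_const_core[OF W \<Psi> k c\<Psi>, folded h_def]
  define h' where "h' = snd \<Phi> (origin W 1)"
  note Q = loop_const_core[OF W \<Phi> k c\<Phi>, folded h'_def]
  show h: "h \<in> loops" by (rule P(1))
  note o = origin_closed[OF PW]
  show m: "m \<in> topspace (garr G)"
    unfolding m_def using continuous_map_image_subset_topspace[OF cm] o by blast
  note e0 = eq[OF o[of 0], folded m_def]
  show sm: "gsrc G m = gsrc G h" using conjunct1[OF e0] P(4) by simp
  have tg: "gtgt (circle_groupoid W) (origin W 0) = gsrc (circle_groupoid W) (origin W 0)" by (simp add: origin_def)
  have tm: "gtgt G m = gsrc G h'" using conjunct1[OF conjunct2[OF e0]] Q(4) by (simp add: tg)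
  have L: "\<Lambda> (origin W l) = gmul G (gpow h l) m" for l
  proof -
    let ?v = "gtgt (circle_groupoid k) (origin k l)"
    have "gtgt (circle_groupoid W) (origin W l) = refine_obj W ?v"
      using cover_floor_add_int[OF PW, of "cover_floor k 0" l]
      by (simp add: origin_def refine_obj_def cover_floor_floor[OF Pk PW k(2)])
    then have "\<Lambda> (gid (circle_groupoid W) (gtgt (circle_groupoid W) (origin W l))) = \<Lambda> (refine_arr W (gid (circle_groupoid k) ?v))"
      by (simp only: refine_gid[of W _ k])
    also have "\<dots> = m"
      using c\<Lambda>[OF circle_closed(4)[OF Pk circle_closed(2)[OF Pk origin_closed[OF Pk]]]] by (simp add: m_def)
    finally have *: "\<Lambda> (gid (circle_groupoid W) (gtgt (circle_groupoid W) (origin W l))) = m" .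
    have "snd \<Psi> (origin W l) = gpow h l" by (rule P(2))
    then show ?thesis
      using conjunct1[OF conjunct2[OF conjunct2[OF eq[OF o[of l]]]]] unfolding * by simp
  qed
  have "\<Lambda> (origin W 1) = gmul G m h'"
    using conjunct2[OF conjunct2[OF conjunct2[OF eq[OF o[of 1]]]]] unfolding gid_origin m_def[symmetric] h'_def[symmetric] .
  then have hm: "gmul G h m = gmul G m h'" using L[of 1] gpow_1[OF h] by simp
  have h'l: "h' \<in> topspace (garr G)" using Q(1) by (simp add: loops_def)
  have h': "conjug h m = h'"
    unfolding conjug_def hm by (rule inv_mul_cancel[OF m h'l tm])
  have "restrict (\<Lambda> \<circ> refine_arr W) (Sar k) = restrict (\<lambda>r. gmul G (gpow h (snd r)) m) (Sar k)"
    by (rule restrict_ext) (simp add: c\<Lambda> L)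
  moreover have "restrict_loop W k \<Psi> = const_loop k h" by (rule P(3))
  moreover have "restrict_loop W k \<Phi> = const_loop k h'" by (rule Q(3))
  ultimately show "restrict_loop_arr W k (\<Psi>, \<Lambda>, \<Phi>) = const_loop_arr k (h, m)"
    unfolding restrict_loop_arr_def const_loop_arr_def prod.case fst_conv snd_conv h' by simp
qed

end

section \<open>The compact-open topology\<close>

lemma topspace_compact_open [simp]: "topspace (compact_open_topology X Y) = cmaps X Y"
proof -
  have "cmaps X Y \<in> {{f \<in> cmaps X Y. f ` K \<subseteq> U} | K U. compactin X K \<and> openin Y U}"
    by (rule CollectI, rule exI[of _ "{}"], rule exI[of _ "{}"]) auto
  then show ?thesis
    unfolding compact_open_topology_def topology_generated_by_topspace by blast
qed

lemma compact_open_eval: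
  assumes "r \<in> topspace X"
  shows "continuous_map (compact_open_topology X Y) Y (\<lambda>f. f r)"
  unfolding continuous_map
proof (intro conjI allI impI)
  show "(\<lambda>f. f r) ` topspace (compact_open_topology X Y) \<subseteq> topspace Y"
    using assms by (auto simp: cmaps_def dest!: continuous_map_image_subset_topspace)
  fix U assume U: "openin Y U"
  have "{f \<in> topspace (compact_open_topology X Y). f r \<in> U} = {f \<in> cmaps X Y. f ` {r} \<subseteq> U}" by auto
  moreover have "openin (compact_open_topology X Y) {f \<in> cmaps X Y. f ` {r} \<subseteq> U}"
    unfolding compact_open_topology_def
    by (rule topology_generated_by_Basis) (use assms U in \<open>auto intro!: exI[of _ "{r}"] exI[of _ U]\<close>)
  ultimately show "openin (compact_open_topology X Y) {f \<in> topspace (compact_open_topology X Y). f r \<in> U}" by simp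
qed

lemma continuous_map_into_compact_open:
  assumes "\<And>z. z \<in> topspace Z \<Longrightarrow> f z \<in> cmaps X Y"
    and "\<And>K U. compactin X K \<Longrightarrow> openin Y U \<Longrightarrow> openin Z {z \<in> topspace Z. f z ` K \<subseteq> U}"
  shows "continuous_map Z (compact_open_topology X Y) f"
  unfolding compact_open_topology_def continuous_on_generated_topo_iff
proof (intro conjI allI impI)
  fix V assume "V \<in> {{f \<in> cmaps X Y. f ` K \<subseteq> U} | K U. compactin X K \<and> openin Y U}"
  then obtain K U where V: "V = {f \<in> cmaps X Y. f ` K \<subseteq> U}" "compactin X K" "openin Y U" by auto
  have "f -` V \<inter> topspace Z = {z \<in> topspace Z. f z ` K \<subseteq> U}" using assms(1) by (auto simp: V(1))
  then show "openin Z (f -` V \<inter> topspace Z)" using assms(2)[OF V(2,3)] by simp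
next
  have "f ` topspace Z \<subseteq> topspace (compact_open_topology X Y)" using assms(1) by auto
  then show "f ` topspace Z \<subseteq> \<Union> {{f \<in> cmaps X Y. f ` K \<subseteq> U} | K U. compactin X K \<and> openin Y U}"
    unfolding compact_open_topology_def topology_generated_by_topspace .
qed

lemma openin_finite_ball:
  assumes "finite F" "\<And>l. l \<in> F \<Longrightarrow> openin Z {z \<in> topspace Z. P l z}"
  shows "openin Z {z \<in> topspace Z. \<forall>l\<in>F. P l z}"
  using assms
proof (induction F rule: finite_induct)
  case (insert l F)
  have "openin Z ({z \<in> topspace Z. P l z} \<inter> {z \<in> topspace Z. \<forall>l\<in>F. P l z})"
    using insert by (intro openin_Int) auto
  moreover have "{z \<in> topspace Z. P l z} \<inter> {z \<in> topspace Z. \<forall>l\<in>F. P l z} = {z \<in> topspace Z. \<forall>l\<in>insert l F. P l z}"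
    by auto
  ultimately show ?case by simp
qed simp

text \<open>The integer component is continuous into a discrete space, so a compact set of arrows
  meets only finitely many levels. Consequently only finitely many powers of an automorphism enter a
  single subbasic condition.\<close>

lemma finite_levels:
  assumes "compactin (garr (circle_groupoid W)) K"
  shows "finite (snd ` K)"
proof -
  have "continuous_map (garr (circle_groupoid W)) (discrete_topology UNIV) snd"
    unfolding circle_groupoid_def tgroupoid.select_convs by (rule continuous_map_snd)
  from image_compactin[OF assms this] show ?thesis by (simp add: compactin_discrete_topology)
qed


section \<open>Constant classes in the loop groupoid\<close>

context topgpd
begin

abbreviation "LL \<equiv> loop_level G"
abbreviation "FL \<equiv> fixed_loop_groupoid G"

definition "obj_class = dirlim_class circle_covers refines restrict_loop (\<lambda>i. gobj (LL i))"
definition "arr_class = dirlim_class circle_covers refines restrict_loop_arr (\<lambda>i. garr (LL i))"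

text \<open>The class of the constant loops of \<open>h\<close>, described intrinsically: the loops
  that become constant with holonomy \<open>h\<close> on some refinement. It agrees with the class
  of each of its members by \<open>obj_class_eq\<close>.\<close>

definition const0 :: "'a \<Rightarrow> (cover \<times> ('o, 'a) loop) set" where
  "const0 h = {(j, y). j \<in> circle_covers \<and> y \<in> loop_objs G j \<and>
     (\<exists>k\<in>circle_covers. refines k j \<and> restrict_loop j k y = const_loop k h)}"

definition const1 :: "'a \<times> 'a \<Rightarrow> (cover \<times> ('o, 'a) loop_arr) set" where
  "const1 a = {(j, y). j \<in> circle_covers \<and> y \<in> loop_arrs G j \<and>
     (\<exists>k\<in>circle_covers. refines k j \<and> restrict_loop_arr j k y = const_loop_arr k a)}"

lemma level_structure:
  "gsrc (LL W) x = fst x"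
  "gtgt (LL W) x = snd (snd x)"
  "gmul (LL W) x y = (fst x, restrict (\<lambda>r. gmul G
     (gmul G (fst (snd x) (gid (circle_groupoid W) (gsrc (circle_groupoid W) r)))
        (fst (snd y) (gid (circle_groupoid W) (gsrc (circle_groupoid W) r)))) (snd (snd (snd y)) r)) (Sar W), snd (snd y))"
  "ginv (LL W) x = (snd (snd x), restrict (\<lambda>r. gmul G
     (ginv G (fst (snd x) (gid (circle_groupoid W) (gsrc (circle_groupoid W) r)))) (snd (fst x) r)) (Sar W), fst x)"
  "gid (LL W) \<psi> = (\<psi>, snd \<psi>, \<psi>)"
  by (simp_all add: loop_level_def Let_def case_prod_unfold)

lemma level_obj: "gobj (LL W) = subtopology
    (prod_topology (compact_open_topology (gobj (circle_groupoid W)) (gobj G))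
       (compact_open_topology (garr (circle_groupoid W)) (garr G))) (loop_objs G W)"
  by (simp add: loop_level_def Let_def)

lemma level_arr: "garr (LL W) = pullback_topology (loop_arrs G W)
    (\<lambda>x. (snd (fst x), restrict (fst (snd x) \<circ> gid (circle_groupoid W)) (Sob W)))
    (prod_topology (compact_open_topology (garr (circle_groupoid W)) (garr G))
       (compact_open_topology (gobj (circle_groupoid W)) (garr G)))"
  by (simp add: loop_level_def Let_def case_prod_unfold)

lemma topspace_level_obj [simp]: "topspace (gobj (LL W)) = loop_objs G W"
proof -
  have "y \<in> cmaps (gobj (circle_groupoid W)) (gobj G) \<times> cmaps (garr (circle_groupoid W)) (garr G)"
    if "y \<in> loop_objs G W" for y
    using loop_objsD(1,2,9,10)[OF that] by (cases y) (simp add: cmaps_def)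
  then show ?thesis unfolding level_obj topspace_subtopology topspace_prod_topology topspace_compact_open by blast
qed

lemma loop_arrsD:
  assumes "x \<in> loop_arrs G W"
  shows "fst x \<in> loop_objs G W" "snd (snd x) \<in> loop_objs G W"
    "continuous_map (garr (circle_groupoid W)) (garr G) (fst (snd x))"
    "fst (snd x) \<in> extensional (Sar W)"
proof -
  have "(fst x, fst (snd x), snd (snd x)) \<in> loop_arrs G W" using assms by simp
  note A = this[unfolded loop_arrs_iff cmaps_def mem_Collect_eq]
  show "fst x \<in> loop_objs G W" "snd (snd x) \<in> loop_objs G W"
    "continuous_map (garr (circle_groupoid W)) (garr G) (fst (snd x))"
    "fst (snd x) \<in> extensional (Sar W)"
    using A by (simp_all only:)
qed

lemma topspace_level_arr [simp]: "topspace (garr (LL W)) = loop_arrs G W"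
proof -
  have "(snd (fst x), restrict (fst (snd x) \<circ> gid (circle_groupoid W)) (Sob W))
     \<in> cmaps (garr (circle_groupoid W)) (garr G) \<times> cmaps (gobj (circle_groupoid W)) (garr G)"
    if x: "x \<in> loop_arrs G W" for x
  proof -
    have "continuous_map (gobj (circle_groupoid W)) (garr G) (fst (snd x) \<circ> gid (circle_groupoid W))"
      by (rule continuous_map_compose[OF circle_gid_continuous loop_arrsD(3)[OF x]])
    then have "continuous_map (gobj (circle_groupoid W)) (garr G) (restrict (fst (snd x) \<circ> gid (circle_groupoid W)) (Sob W))"
      by (rule continuous_map_eq) simp
    then show ?thesis using loop_objsD(2,10)[OF loop_arrsD(1)[OF x]] by (simp add: cmaps_def)
  qed
  then show ?thesis
    unfolding level_arr topspace_pullback_topology topspace_prod_topology topspace_compact_open by blast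
qed

lemma covers_directed: "i \<in> circle_covers \<Longrightarrow> j \<in> circle_covers \<Longrightarrow> \<exists>k\<in>circle_covers. refines k i \<and> refines k j"
  by (meson common_refinement)

lemma obj_class_eq:
  assumes "i \<in> circle_covers" "k \<in> circle_covers" "refines k i" "restrict_loop i k x = const_loop k h"
  shows "obj_class (i, x) = const0 h"
proof -
  have "obj_class (i, x) = {(j, y). j \<in> circle_covers \<and> y \<in> topspace (gobj (LL j)) \<and>
      (\<exists>k\<in>circle_covers. refines k j \<and> restrict_loop j k y = const_loop k h)}"
    unfolding obj_class_def
  proof (rule dirlim_class_eventually[where c = "\<lambda>k. const_loop k h" and m = k])
    show "restrict_loop i k x = const_loop k h" by (rule assms(4))
    show "restrict_loop j l (const_loop j h) = const_loop l h" if "j \<in> circle_covers" "l \<in> circle_covers" "refines l j" for j l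
      using that by (simp add: restrict_const_loop circle_covers_proper)
  qed (use assms in \<open>auto intro: covers_directed refines_trans restrict_loop_comp\<close>)
  then show ?thesis by (simp add: const0_def)
qed

lemma arr_class_eq:
  assumes "i \<in> circle_covers" "k \<in> circle_covers" "refines k i" "restrict_loop_arr i k x = const_loop_arr k a"
  shows "arr_class (i, x) = const1 a"
proof -
  have "arr_class (i, x) = {(j, y). j \<in> circle_covers \<and> y \<in> topspace (garr (LL j)) \<and>
      (\<exists>k\<in>circle_covers. refines k j \<and> restrict_loop_arr j k y = const_loop_arr k a)}"
    unfolding arr_class_def
  proof (rule dirlim_class_eventually[where c = "\<lambda>k. const_loop_arr k a" and m = k])
    show "restrict_loop_arr i k x = const_loop_arr k a" by (rule assms(4))
    show "restrict_loop_arr j l (const_loop_arr j a) = const_loop_arr l a" if "j \<in> circle_covers" "l \<in> circle_covers" "refines l j" for j l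
      using that by (simp add: restrict_const_loop circle_covers_proper)
  qed (use assms in \<open>auto intro: covers_directed refines_trans restrict_loop_comp\<close>)
  then show ?thesis by (simp add: const1_def)
qed

text \<open>One fixed admissible cover. Every constant loop has a representative on it, so the maps
  from the inertia groupoid into the colimit factor through a single level, where continuity can be
  checked.\<close>

definition W0 :: cover where "W0 = ({1}, 1)"

lemma W0: "W0 \<in> circle_covers" "proper_cover W0"
  using circle_covers_nonempty circle_covers_proper by (simp_all add: W0_def)

lemma obj_class_const_loop: "W \<in> circle_covers \<Longrightarrow> obj_class (W, const_loop W h) = const0 h"
  by (rule obj_class_eq[of W W]) (simp_all add: refines_refl restrict_const_loop circle_covers_proper)

lemma arr_class_const_loop_arr: "W \<in> circle_covers \<Longrightarrow> arr_class (W, const_loop_arr W a) = const1 a"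
  by (rule arr_class_eq[of W W]) (simp_all add: refines_refl restrict_const_loop circle_covers_proper)

lemma const_loop_in_const0: "h \<in> loops \<Longrightarrow> W \<in> circle_covers \<Longrightarrow> (W, const_loop W h) \<in> const0 h"
  unfolding const0_def using const_loop_in[OF _ circle_covers_proper] refines_refl[of W] restrict_const_loop(1)[of W W h] circle_covers_proper
  by auto

definition inertia_arr :: "'a \<times> 'a \<Rightarrow> bool" where
  "inertia_arr a \<longleftrightarrow> fst a \<in> loops \<and> snd a \<in> topspace (garr G) \<and> gsrc G (snd a) = gsrc G (fst a)"

lemma topspace_inertia: "topspace (gobj (inertia G)) = loops" "a \<in> topspace (garr (inertia G)) \<longleftrightarrow> inertia_arr a"
proof -
  show "topspace (gobj (inertia G)) = loops" by (auto simp: loops_def)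
  show "a \<in> topspace (garr (inertia G)) \<longleftrightarrow> inertia_arr a" by (cases a) (auto simp: loops_def inertia_arr_def)
qed

lemma const_loop_arr_closed: "inertia_arr a \<Longrightarrow> proper_cover W \<Longrightarrow> const_loop_arr W a \<in> loop_arrs G W"
  using const_loop_arr_in[of "fst a" "snd a" W] by (simp add: inertia_arr_def)

lemma const_loop_arr_in_const1: "inertia_arr a \<Longrightarrow> W \<in> circle_covers \<Longrightarrow> (W, const_loop_arr W a) \<in> const1 a"
  unfolding const1_def using const_loop_arr_closed[OF _ circle_covers_proper] refines_refl[of W] restrict_const_loop(2)[of W W a] circle_covers_proper
  by auto

lemma FL_obj: "gobj FL = subtopology (quotient_top (sum_topology (\<lambda>i. gobj (LL i)) circle_covers) obj_class) {u. \<forall>z. act_obj z u = u}"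
  by (simp add: fixed_loop_groupoid_def subgroupoid_def loop_groupoid_def dirlim_groupoid_def Let_def dirlim_top_def obj_class_def)

lemma FL_arr: "garr FL = subtopology (quotient_top (sum_topology (\<lambda>i. garr (LL i)) circle_covers) arr_class) {a. \<forall>z. act_arr z a = a}"
  by (simp add: fixed_loop_groupoid_def subgroupoid_def loop_groupoid_def dirlim_groupoid_def Let_def dirlim_top_def arr_class_def)

lemma FL_structure:
  "gsrc FL a = (THE c. \<exists>e\<in>a. c = obj_class (fst e, fst (snd e)))"
  "gtgt FL a = (THE c. \<exists>e\<in>a. c = obj_class (fst e, snd (snd (snd e))))"
  "gmul FL a b = (THE c. \<exists>i x y. (i, x) \<in> a \<and> (i, y) \<in> b \<and> snd (snd x) = fst y \<and> c = arr_class (i, gmul (LL i) x y))"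
  "ginv FL a = (THE c. \<exists>e\<in>a. c = arr_class (fst e, ginv (LL (fst e)) (snd e)))"
  "gid FL u = (THE c. \<exists>e\<in>u. c = arr_class (fst e, (snd e, snd (snd e), snd e)))"
  by (simp_all add: fixed_loop_groupoid_def subgroupoid_def loop_groupoid_def dirlim_groupoid_def Let_def
      obj_class_def arr_class_def case_prod_unfold level_structure(1,2,5))

lemma restrict_loop_pointwise:
  assumes "restrict_loop W k y = restrict_loop W' k y'" "r \<in> Sar k"
  shows "snd y (refine_arr W r) = snd y' (refine_arr W' r)"
  using arg_cong[OF assms(1), of "\<lambda>y. snd y r"] assms(2) by (simp add: restrict_loop_def case_prod_unfold)

lemma restrict_loop_arr_pointwise:
  assumes "restrict_loop_arr W k x = restrict_loop_arr W' k x'"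
  shows "restrict_loop W k (fst x) = restrict_loop W' k (fst x')"
    "restrict_loop W k (snd (snd x)) = restrict_loop W' k (snd (snd x'))"
    "r \<in> Sar k \<Longrightarrow> fst (snd x) (refine_arr W r) = fst (snd x') (refine_arr W' r)"
  using arg_cong[OF assms, of fst] arg_cong[OF assms, of "\<lambda>x. snd (snd x)"] arg_cong[OF assms, of "\<lambda>x. fst (snd x) r"]
  by (simp_all add: restrict_loop_arr_def case_prod_unfold)

lemma unshift_pointwise:
  assumes "proper_cover k" "proper_cover W" "refines k (shift_cover z W)" "r \<in> Sar k"
  shows "restrict (f \<circ> unshift_arr z) (Sar (shift_cover z W)) (refine_arr (shift_cover z W) r) = f (refine_arr W (unshift_arr z r))"
  using refine_arr_closed[OF assms(1) shift_cover_proper[OF assms(2)] assms(3,4)]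
  by (simp add: unshift_refine_arr[OF assms(2)])

lemma mem_obj_class: "W \<in> circle_covers \<Longrightarrow> y \<in> loop_objs G W \<Longrightarrow> (W, y) \<in> obj_class (W, y)"
  unfolding obj_class_def dirlim_class_def using refines_refl[of W] by auto

lemma mem_arr_class: "W \<in> circle_covers \<Longrightarrow> x \<in> loop_arrs G W \<Longrightarrow> (W, x) \<in> arr_class (W, x)"
  unfolding arr_class_def dirlim_class_def using refines_refl[of W] by auto

lemma cl0D:
  assumes "(j, y') \<in> obj_class (W, y)"
  obtains k where "k \<in> circle_covers" "refines k W" "refines k j" "restrict_loop W k y = restrict_loop j k y'"
    "j \<in> circle_covers" "y' \<in> loop_objs G j"
  using assms unfolding obj_class_def dirlim_class_def by auto

lemma cl1D:
  assumes "(j, x') \<in> arr_class (W, x)"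
  obtains k where "k \<in> circle_covers" "refines k W" "refines k j" "restrict_loop_arr W k x = restrict_loop_arr j k x'"
    "j \<in> circle_covers" "x' \<in> loop_arrs G j"
  using assms unfolding arr_class_def dirlim_class_def by auto

text \<open>For each \<open>z\<close> the translated loop lies in the class of the original one, so
  the two agree on a common refinement depending on \<open>z\<close>. This is the hypothesis of
  \<open>translation_invariant_constant\<close> for the arrow component of the loop.\<close>

lemma fixed_obj_constant:
  assumes W: "W \<in> circle_covers" and y: "y \<in> loop_objs G W" and fixed: "\<And>z. act_obj z (obj_class (W, y)) = obj_class (W, y)"
  obtains h where "h \<in> loops" "obj_class (W, y) = const0 h"
proof -
  note PW = circle_covers_proper[OF W]
  have "\<exists>k\<in>circle_covers. refines k W \<and> (\<forall>r\<in>Sar k. snd y (refine_arr W r) = snd y (origin W (snd r)))"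
  proof (rule translation_invariant_constant[OF W])
    fix z
    have "(shift_cover z W, shift_loop z W y) \<in> act_obj z (obj_class (W, y))"
      unfolding act_obj_def using mem_obj_class[OF W y] by (rule rev_image_eqI) simp
    then have "(shift_cover z W, shift_loop z W y) \<in> obj_class (W, y)" by (simp only: fixed)
    then obtain k where k: "k \<in> circle_covers" "refines k W" "refines k (shift_cover z W)"
      "restrict_loop W k y = restrict_loop (shift_cover z W) k (shift_loop z W y)" by (rule cl0D)
    have "snd y (refine_arr W r) = snd y (refine_arr W (unshift_arr z r))" if r: "r \<in> Sar k" for r
      using restrict_loop_pointwise[OF k(4) r] unshift_pointwise[OF circle_covers_proper[OF k(1)] PW k(3) r, of "snd y"]
      by (simp add: shift_loop_def case_prod_unfold)
    with k(1-3) show "\<exists>k\<in>circle_covers. refines k W \<and> refines k (shift_cover z W) \<and>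
        (\<forall>r\<in>Sar k. snd y (refine_arr W r) = snd y (refine_arr W (unshift_arr z r)))"
      by (intro bexI[OF _ k(1)] conjI ballI)
  qed
  then obtain k where k: "k \<in> circle_covers" "refines k W"
    "\<And>r. r \<in> Sar k \<Longrightarrow> snd y (refine_arr W r) = snd y (origin W (snd r))" by blast
  note c = loop_const_core[OF W y k]
  show thesis by (rule that[OF c(1) obj_class_eq[OF W k(1,2) c(3)]])
qed

lemma fixed_arr_constant:
  assumes W: "W \<in> circle_covers" and x: "x \<in> loop_arrs G W" and fixed: "\<And>z. act_arr z (arr_class (W, x)) = arr_class (W, x)"
  obtains a where "inertia_arr a" "arr_class (W, x) = const1 a"
proof -
  note PW = circle_covers_proper[OF W]
  have inv: "\<exists>k\<in>circle_covers. refines k W \<and> refines k (shift_cover z W) \<and>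
      (\<forall>r\<in>Sar k. snd (fst x) (refine_arr W r) = snd (fst x) (refine_arr W (unshift_arr z r)) \<and>
         fst (snd x) (refine_arr W r) = fst (snd x) (refine_arr W (unshift_arr z r)) \<and>
         snd (snd (snd x)) (refine_arr W r) = snd (snd (snd x)) (refine_arr W (unshift_arr z r)))" for z
  proof -
    have "(shift_cover z W, shift_loop_arr z W x) \<in> act_arr z (arr_class (W, x))"
      unfolding act_arr_def using mem_arr_class[OF W x] by (rule rev_image_eqI) simp
    then have "(shift_cover z W, shift_loop_arr z W x) \<in> arr_class (W, x)" by (simp only: fixed)
    then obtain k where k: "k \<in> circle_covers" "refines k W" "refines k (shift_cover z W)"
      "restrict_loop_arr W k x = restrict_loop_arr (shift_cover z W) k (shift_loop_arr z W x)" by (rule cl1D)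
    note P = restrict_loop_arr_pointwise[OF k(4)]
    note u = unshift_pointwise[OF circle_covers_proper[OF k(1)] PW k(3)]
    have "snd (fst x) (refine_arr W r) = snd (fst x) (refine_arr W (unshift_arr z r)) \<and>
         fst (snd x) (refine_arr W r) = fst (snd x) (refine_arr W (unshift_arr z r)) \<and>
         snd (snd (snd x)) (refine_arr W r) = snd (snd (snd x)) (refine_arr W (unshift_arr z r))" if r: "r \<in> Sar k" for r
      using restrict_loop_pointwise[OF P(1) r] restrict_loop_pointwise[OF P(2) r] P(3)[OF r]
        u[OF r, of "snd (fst x)"] u[OF r, of "fst (snd x)"] u[OF r, of "snd (snd (snd x))"]
      by (simp add: shift_loop_arr_def shift_loop_def case_prod_unfold)
    then show ?thesis by (intro bexI[OF _ k(1)] conjI ballI k(2,3)) blast+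
  qed
  \<comment> \<open>The source loop, the arrow and the target loop are bundled into one function, so
    that a single refinement makes all three constant.\<close>
  define F where "F r = (snd (fst x) r, fst (snd x) r, snd (snd (snd x)) r)" for r
  have "\<exists>k\<in>circle_covers. refines k W \<and> (\<forall>r\<in>Sar k. F (refine_arr W r) = F (origin W (snd r)))"
    by (rule translation_invariant_constant[OF W]) (use inv in \<open>simp only: F_def prod.inject\<close>)
  then obtain k where k: "k \<in> circle_covers" "refines k W"
    and F: "\<And>r. r \<in> Sar k \<Longrightarrow> F (refine_arr W r) = F (origin W (snd r))"
    by blast
  note k = k F[unfolded F_def prod.inject]
  have x': "(fst x, fst (snd x), snd (snd x)) \<in> loop_arrs G W" using x by simp
  note c = loop_arr_const_core[OF W x' k(1,2) conjunct1[OF k(3)] conjunct1[OF conjunct2[OF k(3)]] conjunct2[OF conjunct2[OF k(3)]]]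
  have "restrict_loop_arr W k x = const_loop_arr k (snd (fst x) (origin W 1), fst (snd x) (origin W 0))"
    using c(4) by simp
  then show thesis
    by (intro that[OF _ arr_class_eq[OF W k(1,2)]]) (simp_all add: inertia_arr_def c(1-3))
qed

text \<open>Translation maps constant loops to constant loops with the same holonomy, which gives
  one inclusion for every \<open>z\<close>. The reverse inclusion uses the translation by
  \<open>- z\<close>, whose composite with the one by \<open>z\<close> is the identity on
  representatives.\<close>

lemma act_const0:
  assumes h: "h \<in> loops"
  shows "act_obj z (const0 h) = const0 h"
proof -
  have sub: "(shift_cover z j, shift_loop z j y) \<in> const0 h" if jy: "(j, y) \<in> const0 h" for z j y
  proof -
    obtain k where k: "k \<in> circle_covers" "refines k j" "restrict_loop j k y = const_loop k h" "j \<in> circle_covers" "y \<in> loop_objs G j"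
      using jy by (auto simp: const0_def)
    have "restrict_loop (shift_cover z j) (shift_cover z k) (shift_loop z j y) = const_loop (shift_cover z k) h"
      unfolding restrict_shift_loop(1)[OF k(4,1,2)] k(3) by (rule shift_const_loop(1)[OF circle_covers_proper[OF k(1)]])
    then show ?thesis
      unfolding const0_def
      using shift_cover_closed[OF k(4)] shift_cover_closed[OF k(1)] shift_cover_refines[OF k(2)] shift_loop_closed[OF tg k(4,5)]
      by blast
  qed
  show ?thesis
  proof
    show "act_obj z (const0 h) \<subseteq> const0 h" unfolding act_obj_def using sub by auto
    show "const0 h \<subseteq> act_obj z (const0 h)"
    proof
      fix e assume e: "e \<in> const0 h"
      obtain j y where jy: "e = (j, y)" by (cases e)
      have "j \<in> circle_covers" "y \<in> loop_objs G j" using e by (auto simp: const0_def jy)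
      then have "e = (shift_cover z (shift_cover (- z) j), shift_loop z (shift_cover (- z) j) (shift_loop (- z) j y))"
        by (simp add: jy shift_shift_cover shift_shift_loop)
      moreover have "(shift_cover (- z) j, shift_loop (- z) j y) \<in> const0 h" using sub e jy by blast
      ultimately show "e \<in> act_obj z (const0 h)" unfolding act_obj_def by (intro image_eqI) auto
    qed
  qed
qed

lemma act_const1:
  assumes a: "inertia_arr a"
  shows "act_arr z (const1 a) = const1 a"
proof -
  have sub: "(shift_cover z j, shift_loop_arr z j y) \<in> const1 a" if jy: "(j, y) \<in> const1 a" for z j y
  proof -
    obtain k where k: "k \<in> circle_covers" "refines k j" "restrict_loop_arr j k y = const_loop_arr k a" "j \<in> circle_covers" "y \<in> loop_arrs G j"
      using jy by (auto simp: const1_def)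
    have "restrict_loop_arr (shift_cover z j) (shift_cover z k) (shift_loop_arr z j y) = const_loop_arr (shift_cover z k) a"
      unfolding restrict_shift_loop(2)[OF k(4,1,2)] k(3) by (rule shift_const_loop(2)[OF circle_covers_proper[OF k(1)]])
    then show ?thesis
      unfolding const1_def
      using shift_cover_closed[OF k(4)] shift_cover_closed[OF k(1)] shift_cover_refines[OF k(2)] shift_loop_arr_closed[OF tg k(4,5)]
      by blast
  qed
  show ?thesis
  proof
    show "act_arr z (const1 a) \<subseteq> const1 a" unfolding act_arr_def using sub by auto
    show "const1 a \<subseteq> act_arr z (const1 a)"
    proof
      fix e assume e: "e \<in> const1 a"
      obtain j y where jy: "e = (j, y)" by (cases e)
      have "j \<in> circle_covers" "y \<in> loop_arrs G j" using e by (auto simp: const1_def jy)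
      then have "e = (shift_cover z (shift_cover (- z) j), shift_loop_arr z (shift_cover (- z) j) (shift_loop_arr (- z) j y))"
        by (simp add: jy shift_shift_cover shift_shift_loop_arr)
      moreover have "(shift_cover (- z) j, shift_loop_arr (- z) j y) \<in> const1 a" using sub e jy by blast
      ultimately show "e \<in> act_arr z (const1 a)" unfolding act_arr_def by (intro image_eqI) auto
    qed
  qed
qed

lemma topspace_FL_obj: "topspace (gobj FL) = const0 ` loops"
proof
  show "topspace (gobj FL) \<subseteq> const0 ` loops"
  proof
    fix u assume "u \<in> topspace (gobj FL)"
    then obtain W y where u: "u = obj_class (W, y)" "W \<in> circle_covers" "y \<in> loop_objs G W" "\<And>z. act_obj z u = u"
      unfolding FL_obj by auto
    then show "u \<in> const0 ` loops" by (metis fixed_obj_constant imageI)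
  qed
  show "const0 ` loops \<subseteq> topspace (gobj FL)"
  proof
    fix u assume "u \<in> const0 ` loops"
    then obtain h where h: "h \<in> loops" "u = const0 h" by auto
    have "obj_class (W0, const_loop W0 h) \<in> obj_class ` topspace (sum_topology (\<lambda>i. gobj (LL i)) circle_covers)"
      using W0 const_loop_in[OF h(1) W0(2)] by (intro imageI) simp
    then show "u \<in> topspace (gobj FL)"
      using act_const0[OF h(1)] by (simp add: FL_obj obj_class_const_loop[OF W0(1)] h(2))
  qed
qed

lemma topspace_FL_arr: "topspace (garr FL) = const1 ` {a. inertia_arr a}"
proof
  show "topspace (garr FL) \<subseteq> const1 ` {a. inertia_arr a}"
  proof
    fix u assume "u \<in> topspace (garr FL)"
    then obtain W y where u: "u = arr_class (W, y)" "W \<in> circle_covers" "y \<in> loop_arrs G W" "\<And>z. act_arr z u = u"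
      unfolding FL_arr by auto
    then show "u \<in> const1 ` {a. inertia_arr a}" by (metis fixed_arr_constant imageI mem_Collect_eq)
  qed
  show "const1 ` {a. inertia_arr a} \<subseteq> topspace (garr FL)"
  proof
    fix u assume "u \<in> const1 ` {a. inertia_arr a}"
    then obtain a where a: "inertia_arr a" "u = const1 a" by auto
    have "arr_class (W0, const_loop_arr W0 a) \<in> arr_class ` topspace (sum_topology (\<lambda>i. garr (LL i)) circle_covers)"
      using W0 const_loop_arr_closed[OF a(1) W0(2)] by (intro imageI) simp
    then show "u \<in> topspace (garr FL)"
      using act_const1[OF a(1)] by (simp add: FL_arr arr_class_const_loop_arr[OF W0(1)] a(2))
  qed
qed

end

section \<open>The fixed loop groupoid is the inertia groupoid\<close>

lemma compact_open_constant:
  assumes "continuous_map Z Y g"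
  shows "continuous_map Z (compact_open_topology X Y) (\<lambda>z. restrict (\<lambda>_. g z) (topspace X))"
proof (rule continuous_map_into_compact_open)
  fix z assume z: "z \<in> topspace Z"
  have "continuous_map X Y (\<lambda>_. g z)" using continuous_map_image_subset_topspace[OF assms] z by auto
  then have "continuous_map X Y (restrict (\<lambda>_. g z) (topspace X))" by (rule continuous_map_eq) simp
  then show "restrict (\<lambda>_. g z) (topspace X) \<in> cmaps X Y" by (simp add: cmaps_def)
next
  fix K U assume K: "compactin X K" and U: "openin Y U"
  show "openin Z {z \<in> topspace Z. restrict (\<lambda>_. g z) (topspace X) ` K \<subseteq> U}"
  proof (cases "K = {}")
    case False
    have "K \<subseteq> topspace X" by (rule compactin_subset_topspace[OF K])
    with False have "{z \<in> topspace Z. restrict (\<lambda>_. g z) (topspace X) ` K \<subseteq> U} = {z \<in> topspace Z. g z \<in> U}"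
      by auto
    then show ?thesis using openin_continuous_map_preimage[OF assms U] by simp
  qed simp
qed

text \<open>By \<open>finite_levels\<close>, the subbasic condition for a compact \<open>K\<close>
  restricts \<open>E z l\<close> for finitely many \<open>l\<close> only, so it is a finite
  intersection of open conditions on \<open>z\<close>.\<close>

lemma compact_open_levels:
  assumes E: "\<And>l. continuous_map Z Y (\<lambda>z. E z l)"
  shows "continuous_map Z (compact_open_topology (garr (circle_groupoid W)) Y) (\<lambda>z. restrict (\<lambda>r. E z (snd r)) (Sar W))"
proof (rule continuous_map_into_compact_open)
  fix z assume z: "z \<in> topspace Z"
  have "continuous_map (discrete_topology UNIV) Y (E z)"
    using continuous_map_image_subset_topspace[OF E] z by (auto simp: continuous_map)
  moreover have "continuous_map (garr (circle_groupoid W)) (discrete_topology UNIV) snd"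
    unfolding circle_groupoid_def tgroupoid.select_convs by (rule continuous_map_snd)
  ultimately have "continuous_map (garr (circle_groupoid W)) Y (\<lambda>r. E z (snd r))" by (rule cm_comp)
  then have "continuous_map (garr (circle_groupoid W)) Y (restrict (\<lambda>r. E z (snd r)) (Sar W))"
    by (rule continuous_map_eq) simp
  then show "restrict (\<lambda>r. E z (snd r)) (Sar W) \<in> cmaps (garr (circle_groupoid W)) Y" by (simp add: cmaps_def)
next
  fix K U assume K: "compactin (garr (circle_groupoid W)) K" and U: "openin Y U"
  have "K \<subseteq> Sar W" by (rule compactin_subset_topspace[OF K])
  then have "restrict (\<lambda>r. E z (snd r)) (Sar W) ` K = (\<lambda>r. E z (snd r)) ` K" for z
    by (intro image_cong refl) (simp only: restrict_apply' subsetD)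
  then have "restrict (\<lambda>r. E z (snd r)) (Sar W) ` K \<subseteq> U \<longleftrightarrow> (\<forall>l\<in>snd ` K. E z l \<in> U)" for z
    by (simp only: image_subset_iff ball_simps)
  then have "{z \<in> topspace Z. restrict (\<lambda>r. E z (snd r)) (Sar W) ` K \<subseteq> U} = {z \<in> topspace Z. \<forall>l\<in>snd ` K. E z l \<in> U}"
    by (simp only:)
  moreover have "openin Z {z \<in> topspace Z. \<forall>l\<in>snd ` K. E z l \<in> U}"
    by (rule openin_finite_ball[OF finite_levels[OF K]]) (rule openin_continuous_map_preimage[OF E U])
  ultimately show "openin Z {z \<in> topspace Z. restrict (\<lambda>r. E z (snd r)) (Sar W) ` K \<subseteq> U}" by (simp only:)
qed

text \<open>The operations of the colimit are definite descriptions over all representatives of a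
  class. One representative, together with independence of the choice, evaluates them.\<close>

lemma the_common_value:
  "e \<in> A \<Longrightarrow> (\<And>e. e \<in> A \<Longrightarrow> F e = c) \<Longrightarrow> (THE c. \<exists>e\<in>A. c = F e) = c"
  by (rule the_equality) auto

context topgpd
begin

text \<open>\<open>loop_holonomy\<close> is the holonomy of a loop along one period.\<close>

definition loop_holonomy :: "(cover \<times> ('o, 'a) loop) set \<Rightarrow> 'a" where
  "loop_holonomy u = (let e = SOME e. e \<in> u in snd (snd e) (origin (fst e) 1))"

definition arr_holonomy :: "(cover \<times> ('o, 'a) loop_arr) set \<Rightarrow> 'a \<times> 'a" where
  "arr_holonomy a = (let e = SOME e. e \<in> a
     in (snd (fst (snd e)) (origin (fst e) 1), fst (snd (snd e)) (origin (fst e) 0)))"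

text \<open>The chosen representative agrees with \<open>y\<close> on a common refinement, and the
  origin of the refinement is sent to the origins of both covers.\<close>

lemma loop_holonomy_obj_class:
  assumes W: "W \<in> circle_covers" and y: "y \<in> loop_objs G W"
  shows "loop_holonomy (obj_class (W, y)) = snd y (origin W 1)"
proof -
  define e where "e = (SOME e. e \<in> obj_class (W, y))"
  have "e \<in> obj_class (W, y)" unfolding e_def by (rule someI[of _ "(W, y)"]) (rule mem_obj_class[OF W y])
  then have "(fst e, snd e) \<in> obj_class (W, y)" by simp
  then obtain k where k: "k \<in> circle_covers" "refines k W" "refines k (fst e)"
    "restrict_loop W k y = restrict_loop (fst e) k (snd e)" "fst e \<in> circle_covers" "snd e \<in> loop_objs G (fst e)"
    by (rule cl0D)
  note P = circle_covers_proper[OF k(1)] circle_covers_proper[OF W] circle_covers_proper[OF k(5)]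
  have "snd y (origin W 1) = snd (snd e) (origin (fst e) 1)"
    using restrict_loop_pointwise[OF k(4) origin_closed[OF P(1), of 1]]
    unfolding refine_origin[OF P(1,2) k(2)] refine_origin[OF P(1,3) k(3)] .
  then show ?thesis by (simp add: loop_holonomy_def Let_def flip: e_def)
qed

lemma arr_holonomy_arr_class:
  assumes W: "W \<in> circle_covers" and x: "x \<in> loop_arrs G W"
  shows "arr_holonomy (arr_class (W, x)) = (snd (fst x) (origin W 1), fst (snd x) (origin W 0))"
proof -
  define e where "e = (SOME e. e \<in> arr_class (W, x))"
  have "e \<in> arr_class (W, x)" unfolding e_def by (rule someI[of _ "(W, x)"]) (rule mem_arr_class[OF W x])
  then have "(fst e, snd e) \<in> arr_class (W, x)" by simp
  then obtain k where k: "k \<in> circle_covers" "refines k W" "refines k (fst e)"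
    "restrict_loop_arr W k x = restrict_loop_arr (fst e) k (snd e)" "fst e \<in> circle_covers" "snd e \<in> loop_arrs G (fst e)"
    by (rule cl1D)
  note P = circle_covers_proper[OF k(1)] circle_covers_proper[OF W] circle_covers_proper[OF k(5)]
  note R = restrict_loop_arr_pointwise[OF k(4)]
  have "snd (fst x) (origin W 1) = snd (fst (snd e)) (origin (fst e) 1)"
    using restrict_loop_pointwise[OF R(1) origin_closed[OF P(1), of 1]]
    unfolding refine_origin[OF P(1,2) k(2)] refine_origin[OF P(1,3) k(3)] .
  moreover have "fst (snd x) (origin W 0) = fst (snd (snd e)) (origin (fst e) 0)"
    using R(3)[OF origin_closed[OF P(1), of 0]]
    unfolding refine_origin[OF P(1,2) k(2)] refine_origin[OF P(1,3) k(3)] .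
  ultimately show ?thesis by (simp add: arr_holonomy_def Let_def flip: e_def)
qed

lemma loop_holonomy_const0:
  assumes h: "h \<in> loops"
  shows "loop_holonomy (const0 h) = h"
proof -
  have "snd (const_loop W0 h) (origin W0 1) = h"
    unfolding const_loop_def snd_conv restrict_apply'[OF origin_closed[OF W0(2)]] using h by simp
  then show ?thesis using loop_holonomy_obj_class[OF W0(1) const_loop_in[OF h W0(2)]] by (simp only: obj_class_const_loop[OF W0(1)])
qed

lemma arr_holonomy_const1:
  assumes a: "inertia_arr a"
  shows "arr_holonomy (const1 a) = a"
proof -
  have "snd (fst (const_loop_arr W0 a)) (origin W0 1) = fst a" "fst (snd (const_loop_arr W0 a)) (origin W0 0) = snd a"
    unfolding const_loop_arr_def const_loop_def fst_conv snd_conv restrict_apply'[OF origin_closed[OF W0(2)]]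
    using a by (simp_all add: inertia_arr_def)
  then show ?thesis using arr_holonomy_arr_class[OF W0(1) const_loop_arr_closed[OF a W0(2)]] by (simp only: arr_class_const_loop_arr[OF W0(1)] prod.collapse)
qed

text \<open>On each level this is evaluation at an origin, which is continuous for the compact-open
  topology; continuity passes to the colimit by the universal properties of sums and
  quotients.\<close>

lemma continuous_loop_holonomy: "continuous_map (gobj FL) (gobj (inertia G)) loop_holonomy"
  unfolding inertia_simps
proof (rule cm_into_sub)
  have "continuous_map (quotient_top (sum_topology (\<lambda>i. gobj (LL i)) circle_covers) obj_class) (garr G) loop_holonomy"
  proof (intro continuous_map_from_quotient_top continuous_map_from_sum_topology)
    fix i assume i: "i \<in> circle_covers"
    have "continuous_map (gobj (LL i)) (garr G) (\<lambda>y. snd y (origin i 1))"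
      by (rule cm_comp[OF compact_open_eval[OF origin_closed[OF circle_covers_proper[OF i]]], where f = snd])
        (unfold level_obj, rule continuous_map_from_subtopology[OF continuous_map_snd])
    then show "continuous_map (gobj (LL i)) (garr G) (\<lambda>y. loop_holonomy (obj_class (i, y)))"
      by (rule continuous_map_eq) (simp add: loop_holonomy_obj_class i)
  qed
  then show "continuous_map (gobj FL) (garr G) loop_holonomy" unfolding FL_obj by (rule continuous_map_from_subtopology)
  show "loop_holonomy u \<in> {h. gsrc G h = gtgt G h}" if "u \<in> topspace (gobj FL)" for u
    using that unfolding topspace_FL_obj by (auto simp: loop_holonomy_const0) (simp add: loops_def)
qed

lemma continuous_arr_holonomy: "continuous_map (garr FL) (garr (inertia G)) arr_holonomy"
  unfolding inertia_simps
proof (rule cm_into_sub)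
  have "continuous_map (quotient_top (sum_topology (\<lambda>i. garr (LL i)) circle_covers) arr_class) (prod_topology (garr G) (garr G)) arr_holonomy"
  proof (intro continuous_map_from_quotient_top continuous_map_from_sum_topology)
    fix i assume i: "i \<in> circle_covers"
    note o = origin_closed[OF circle_covers_proper[OF i]]
    note s = circle_closed(1)[OF circle_covers_proper[OF i] o[of 0]]
    let ?g = "\<lambda>p. (fst p (origin i 1), snd p (gsrc (circle_groupoid i) (origin i 0)))"
    let ?f = "\<lambda>x :: ('o, 'a) loop_arr. (snd (fst x), restrict (fst (snd x) \<circ> gid (circle_groupoid i)) (Sob i))"
    have "continuous_map (prod_topology (compact_open_topology (garr (circle_groupoid i)) (garr G))
       (compact_open_topology (gobj (circle_groupoid i)) (garr G))) (prod_topology (garr G) (garr G)) ?g"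
      by (intro cm_pair cm_comp[OF compact_open_eval[OF o], where f = fst] continuous_map_fst
          cm_comp[OF compact_open_eval[OF s], where f = snd] continuous_map_snd)
    then have "continuous_map (garr (LL i)) (prod_topology (garr G) (garr G)) (?g \<circ> ?f)"
      unfolding level_arr by (rule continuous_map_pullback)
    then show "continuous_map (garr (LL i)) (prod_topology (garr G) (garr G)) (\<lambda>y. arr_holonomy (arr_class (i, y)))"
      by (rule continuous_map_eq) (simp add: arr_holonomy_arr_class i s gid_origin)
  qed
  then show "continuous_map (garr FL) (prod_topology (garr G) (garr G)) arr_holonomy"
    unfolding FL_arr by (rule continuous_map_from_subtopology)
  show "arr_holonomy u \<in> {(h, l). gsrc G h = gtgt G h \<and> gsrc G l = gsrc G h}" if "u \<in> topspace (garr FL)" for u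
    using that unfolding topspace_FL_arr by (auto simp: arr_holonomy_const1) (auto simp: inertia_arr_def loops_def)
qed

lemma continuous_const0: "continuous_map (gobj (inertia G)) (gobj FL) const0"
  unfolding FL_obj
proof (rule cm_into_sub)
  let ?Z = "gobj (inertia G)"
  have id: "continuous_map ?Z (garr G) (\<lambda>h. h)" unfolding inertia_simps by (rule cm_id)
  have Z: "h \<in> loops" if "h \<in> topspace ?Z" for h using that by (simp only: topspace_inertia)
  have "continuous_map ?Z (gobj (LL W0)) (const_loop W0)"
    unfolding level_obj
  proof (rule cm_into_sub)
    show "continuous_map ?Z (prod_topology (compact_open_topology (gobj (circle_groupoid W0)) (gobj G))
       (compact_open_topology (garr (circle_groupoid W0)) (garr G))) (const_loop W0)"
      unfolding const_loop_def[abs_def]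
      by (intro cm_pair compact_open_constant compact_open_levels cm_src cm_gpow id Z)
  qed (rule const_loop_in[OF Z W0(2)])
  then have "continuous_map ?Z (quotient_top (sum_topology (\<lambda>i. gobj (LL i)) circle_covers) obj_class) (\<lambda>h. obj_class (W0, const_loop W0 h))"
    by (intro cm_comp[OF continuous_map_quotient_top] cm_comp[OF continuous_map_component_injection[OF W0(1)]])
  then show "continuous_map ?Z (quotient_top (sum_topology (\<lambda>i. gobj (LL i)) circle_covers) obj_class) const0"
    by (rule continuous_map_eq) (rule obj_class_const_loop[OF W0(1)])
  show "const0 h \<in> {u. \<forall>z. act_obj z u = u}" if "h \<in> topspace ?Z" for h using act_const0[OF Z[OF that]] by simp
qed

lemma continuous_const1: "continuous_map (garr (inertia G)) (garr FL) const1"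
  unfolding FL_arr
proof (rule cm_into_sub)
  let ?Z = "garr (inertia G)"
  have id: "continuous_map ?Z (garr G) fst" "continuous_map ?Z (garr G) snd"
    unfolding inertia_simps by (intro continuous_map_from_subtopology continuous_map_fst continuous_map_snd)+
  have Z: "inertia_arr a" if "a \<in> topspace ?Z" for a using that by (simp only: topspace_inertia)
  have Zl: "fst a \<in> loops" if "a \<in> topspace ?Z" for a using Z[OF that] by (simp add: inertia_arr_def)
  have "continuous_map ?Z (garr (LL W0)) (const_loop_arr W0)"
    unfolding level_arr
  proof (rule continuous_map_pullback')
    have "continuous_map ?Z (prod_topology (compact_open_topology (garr (circle_groupoid W0)) (garr G))
       (compact_open_topology (gobj (circle_groupoid W0)) (garr G)))
       (\<lambda>a. (restrict (\<lambda>r. gpow (fst a) (snd r)) (Sar W0), restrict (\<lambda>y. snd a) (Sob W0)))"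
      by (intro cm_pair compact_open_constant compact_open_levels cm_gpow id Zl)
    then show "continuous_map ?Z (prod_topology (compact_open_topology (garr (circle_groupoid W0)) (garr G))
       (compact_open_topology (gobj (circle_groupoid W0)) (garr G)))
       ((\<lambda>x. (snd (fst x), restrict (fst (snd x) \<circ> gid (circle_groupoid W0)) (Sob W0))) \<circ> const_loop_arr W0)"
    proof (rule continuous_map_eq)
      fix a assume "a \<in> topspace ?Z"
      then have a: "fst a \<in> loops" "snd a \<in> topspace (garr G)" "gsrc G (snd a) = gsrc G (fst a)"
        using Z[of a] by (simp_all add: inertia_arr_def)
      show "(restrict (\<lambda>r. gpow (fst a) (snd r)) (Sar W0), restrict (\<lambda>y. snd a) (Sob W0)) =
        ((\<lambda>x. (snd (fst x), restrict (fst (snd x) \<circ> gid (circle_groupoid W0)) (Sob W0))) \<circ> const_loop_arr W0) a"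
        unfolding const_loop_arr_def const_loop_def o_def fst_conv snd_conv prod.inject
        by (intro conjI refl restrict_ext) (simp add: a circle_closed(4)[OF W0(2)])
    qed
    show "topspace ?Z \<subseteq> const_loop_arr W0 -` loop_arrs G W0" using const_loop_arr_closed[OF Z W0(2)] by blast
  qed
  then have "continuous_map ?Z (quotient_top (sum_topology (\<lambda>i. garr (LL i)) circle_covers) arr_class) (\<lambda>h. arr_class (W0, const_loop_arr W0 h))"
    by (intro cm_comp[OF continuous_map_quotient_top] cm_comp[OF continuous_map_component_injection[OF W0(1)]])
  then show "continuous_map ?Z (quotient_top (sum_topology (\<lambda>i. garr (LL i)) circle_covers) arr_class) const1"
    by (rule continuous_map_eq) (rule arr_class_const_loop_arr[OF W0(1)])
  show "const1 h \<in> {u. \<forall>z. act_arr z u = u}" if "h \<in> topspace ?Z" for h using act_const1[OF Z[OF that]] by simp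
qed

lemma const1D:
  assumes "e \<in> const1 a"
  obtains k where "k \<in> circle_covers" "refines k (fst e)" "restrict_loop_arr (fst e) k (snd e) = const_loop_arr k a" "fst e \<in> circle_covers"
  using assms unfolding const1_def by auto

lemma const_loop_arr_pointwise:
  assumes a: "h \<in> loops" "m \<in> topspace (garr G)" "gsrc G m = gsrc G h"
    and k: "k \<in> circle_covers" and eq: "restrict_loop_arr j k x = const_loop_arr k (h, m)"
  shows "restrict_loop j k (fst x) = const_loop k h" "restrict_loop j k (snd (snd x)) = const_loop k (conjug h m)"
    "r \<in> Sar k \<Longrightarrow> snd (fst x) (refine_arr j r) = gpow h (snd r)"
    "r \<in> Sar k \<Longrightarrow> snd (snd (snd x)) (refine_arr j r) = gpow (conjug h m) (snd r)"
    "r \<in> Sar k \<Longrightarrow> fst (snd x) (gid (circle_groupoid j) (gsrc (circle_groupoid j) (refine_arr j r))) = m"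
proof -
  show s: "restrict_loop j k (fst x) = const_loop k h" and t: "restrict_loop j k (snd (snd x)) = const_loop k (conjug h m)"
    using arg_cong[OF eq, of fst] arg_cong[OF eq, of "\<lambda>x. snd (snd x)"]
    by (simp_all add: restrict_loop_arr_def const_loop_arr_def case_prod_unfold)
  show "r \<in> Sar k \<Longrightarrow> snd (fst x) (refine_arr j r) = gpow h (snd r)"
    using arg_cong[OF s, of "\<lambda>y. snd y r"] by (simp add: restrict_loop_def const_loop_def case_prod_unfold)
  show "r \<in> Sar k \<Longrightarrow> snd (snd (snd x)) (refine_arr j r) = gpow (conjug h m) (snd r)"
    using arg_cong[OF t, of "\<lambda>y. snd y r"] by (simp add: restrict_loop_def const_loop_def case_prod_unfold)
  assume r: "r \<in> Sar k"
  note P = circle_covers_proper[OF k]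
  let ?r = "gid (circle_groupoid k) (gsrc (circle_groupoid k) r)"
  have r': "?r \<in> Sar k" by (rule circle_closed(4)[OF P circle_closed(1)[OF P r]])
  have "fst (snd x) (refine_arr j ?r) = m"
    using arg_cong[OF eq, of "\<lambda>x. fst (snd x) ?r"] r' a
    by (simp add: restrict_loop_arr_def const_loop_arr_def case_prod_unfold)
  then show "fst (snd x) (gid (circle_groupoid j) (gsrc (circle_groupoid j) (refine_arr j r))) = m"
    by (simp only: refine_gsrc[of j r k] refine_gid[of j _ k])
qed

lemma restrict_loop_arr_eqI:
  assumes "k \<in> circle_covers" "j \<in> circle_covers" "refines k j"
    and "restrict_loop j k \<Psi> = const_loop k h" "restrict_loop j k \<Phi> = const_loop k (conjug h m)"
    and "\<And>r. r \<in> Sar k \<Longrightarrow> N (refine_arr j r) = gmul G (gpow h (snd r)) m"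
  shows "restrict_loop_arr j k (\<Psi>, restrict N (Sar j), \<Phi>) = const_loop_arr k (h, m)"
proof -
  have "restrict (restrict N (Sar j) \<circ> refine_arr j) (Sar k) = restrict (\<lambda>r. gmul G (gpow h (snd r)) m) (Sar k)"
    by (rule restrict_ext)
      (simp add: assms(6) refine_arr_closed[OF circle_covers_proper[OF assms(1)] circle_covers_proper[OF assms(2)] assms(3)])
  then show ?thesis by (simp only: restrict_loop_arr_def const_loop_arr_def prod.case fst_conv snd_conv assms(4,5))
qed

text \<open>Every representative becomes a constant arrow on some refinement, and the operations are
  computed there. For the inverse, \<open>gpow_conjug\<close> applied to \<open>ginv G m\<close>
  turns \<open>inv m \<cdot> h^l\<close> into the required form, a power of the conjugate followed
  by \<open>inv m\<close>.\<close>

lemma FL_src_const1: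
  assumes a: "h \<in> loops" "m \<in> topspace (garr G)" "gsrc G m = gsrc G h"
  shows "gsrc FL (const1 (h, m)) = const0 h" "gtgt FL (const1 (h, m)) = const0 (conjug h m)"
    "ginv FL (const1 (h, m)) = const1 (conjug h m, ginv G m)"
proof -
  have i: "inertia_arr (h, m)" using a by (simp add: inertia_arr_def)
  note mem = const_loop_arr_in_const1[OF i W0(1)]
  show "gsrc FL (const1 (h, m)) = const0 h"
    unfolding FL_structure
  proof (rule the_common_value[OF mem])
    fix e assume "e \<in> const1 (h, m)"
    then obtain k where k: "k \<in> circle_covers" "refines k (fst e)" "restrict_loop_arr (fst e) k (snd e) = const_loop_arr k (h, m)"
      "fst e \<in> circle_covers" by (rule const1D)
    show "obj_class (fst e, fst (snd e)) = const0 h"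
      by (rule obj_class_eq[OF k(4,1,2) const_loop_arr_pointwise(1)[OF a k(1,3)]])
  qed
  show "gtgt FL (const1 (h, m)) = const0 (conjug h m)"
    unfolding FL_structure
  proof (rule the_common_value[OF mem])
    fix e assume "e \<in> const1 (h, m)"
    then obtain k where k: "k \<in> circle_covers" "refines k (fst e)" "restrict_loop_arr (fst e) k (snd e) = const_loop_arr k (h, m)"
      "fst e \<in> circle_covers" by (rule const1D)
    show "obj_class (fst e, snd (snd (snd e))) = const0 (conjug h m)"
      by (rule obj_class_eq[OF k(4,1,2) const_loop_arr_pointwise(2)[OF a k(1,3)]])
  qed
  note h' = conjug_loop[OF a]
  have m': "ginv G m \<in> topspace (garr G)" "gsrc G (ginv G m) = gsrc G (conjug h m)" using a h' by simp_all
  show "ginv FL (const1 (h, m)) = const1 (conjug h m, ginv G m)"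
    unfolding FL_structure
  proof (rule the_common_value[OF mem])
    fix e assume "e \<in> const1 (h, m)"
    then obtain k where k: "k \<in> circle_covers" "refines k (fst e)" "restrict_loop_arr (fst e) k (snd e) = const_loop_arr k (h, m)"
      "fst e \<in> circle_covers" by (rule const1D)
    note P = const_loop_arr_pointwise[OF a k(1,3)]
    show "arr_class (fst e, ginv (LL (fst e)) (snd e)) = const1 (conjug h m, ginv G m)"
      unfolding level_structure
    proof (rule arr_class_eq[OF k(4,1,2)], rule restrict_loop_arr_eqI[OF k(1,4,2) P(2)])
      show "restrict_loop (fst e) k (fst (snd e)) = const_loop k (conjug (conjug h m) (ginv G m))"
        unfolding P(1) conjug_conjug_inv[OF a] ..
      fix r assume r: "r \<in> Sar k"
      have "gmul G (ginv G m) (gpow h (snd r)) = gmul G (gpow (conjug h m) (snd r)) (ginv G m)"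
        using gpow_conjug[OF h'(1) m', of "snd r"] unfolding conjug_conjug_inv[OF a] .
      then show "gmul G (ginv G (fst (snd (snd e)) (gid (circle_groupoid (fst e)) (gsrc (circle_groupoid (fst e)) (refine_arr (fst e) r)))))
          (snd (fst (snd e)) (refine_arr (fst e) r)) = gmul G (gpow (conjug h m) (snd r)) (ginv G m)"
        by (simp only: P(3)[OF r] P(5)[OF r])
    qed
  qed
qed

lemma FL_id_const0:
  assumes h: "h \<in> loops"
  shows "gid FL (const0 h) = const1 (h, gid G (gsrc G h))"
  unfolding FL_structure
proof (rule the_common_value[OF const_loop_in_const0[OF h W0(1)]])
  fix e assume "e \<in> const0 h"
  then obtain k where k: "k \<in> circle_covers" "refines k (fst e)" "restrict_loop (fst e) k (snd e) = const_loop k h"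
    "fst e \<in> circle_covers" unfolding const0_def by auto
  have "restrict (\<lambda>r. gmul G (gpow h (snd r)) (gid G (gsrc G h))) (Sar k) = snd (const_loop k h)"
    unfolding const_loop_def snd_conv by (rule restrict_ext) (use h in simp)
  moreover have "restrict (snd (snd e) \<circ> refine_arr (fst e)) (Sar k) = snd (restrict_loop (fst e) k (snd e))"
    by (simp add: restrict_loop_def case_prod_unfold)
  ultimately have "restrict_loop_arr (fst e) k (snd e, snd (snd e), snd e) = const_loop_arr k (h, gid G (gsrc G h))"
    by (simp only: restrict_loop_arr_def const_loop_arr_def prod.case fst_conv snd_conv k(3) conjug_id[OF h])
  then show "arr_class (fst e, (snd e, snd (snd e), snd e)) = const1 (h, gid G (gsrc G h))"
    by (rule arr_class_eq[OF k(4,1,2)])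
qed

text \<open>The two factors live on the same cover but become constant on different refinements, so
  a common refinement is taken. There the product has value \<open>m \<cdot> n\<close> on
  identities, and \<open>gpow_conjug\<close> moves the powers of the holonomy from the right to the
  left of \<open>m \<cdot> n\<close>.\<close>

lemma FL_mul_const1:
  assumes a: "h \<in> loops" "m \<in> topspace (garr G)" "gsrc G m = gsrc G h"
    and n: "n \<in> topspace (garr G)" "gsrc G n = gtgt G m"
  shows "gmul FL (const1 (h, m)) (const1 (conjug h m, n)) = const1 (h, gmul G m n)"
proof -
  note h' = conjug_loop[OF a]
  have n': "gsrc G n = gsrc G (conjug h m)" using n h' by simp
  have mn: "gmul G m n \<in> topspace (garr G)" "gsrc G (gmul G m n) = gsrc G h" using a n by simp_all
  have cm: "conjug (conjug h m) n = conjug h (gmul G m n)" by (rule conjug_mul[OF a n])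
  have val: "arr_class (i, gmul (LL i) x y) = const1 (h, gmul G m n)"
    if x: "(i, x) \<in> const1 (h, m)" and y: "(i, y) \<in> const1 (conjug h m, n)" for i x y
  proof -
    obtain k1 where k1: "k1 \<in> circle_covers" "refines k1 i" "restrict_loop_arr i k1 x = const_loop_arr k1 (h, m)"
      "i \<in> circle_covers" by (rule const1D[OF x, unfolded fst_conv snd_conv])
    obtain k2 where k2: "k2 \<in> circle_covers" "refines k2 i" "restrict_loop_arr i k2 y = const_loop_arr k2 (conjug h m, n)"
      "i \<in> circle_covers" by (rule const1D[OF y, unfolded fst_conv snd_conv])
    obtain k where k: "k \<in> circle_covers" "refines k k1" "refines k k2"
      using common_refinement[OF k1(1) k2(1)] by blast
    have ki: "refines k i" by (rule refines_trans[OF k(2) k1(2)])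
    note pk = circle_covers_proper[OF k(1)] circle_covers_proper[OF k1(1)] circle_covers_proper[OF k2(1)]
    have "restrict_loop_arr i k x = const_loop_arr k (h, m)"
      using restrict_loop_comp(2)[OF k1(4,1) k(1) k1(2) k(2), of x] restrict_const_loop(2)[OF pk(1,2) k(2), of "(h, m)"]
      unfolding k1(3) by simp
    note P = const_loop_arr_pointwise[OF a k(1) this]
    have "restrict_loop_arr i k y = const_loop_arr k (conjug h m, n)"
      using restrict_loop_comp(2)[OF k1(4) k2(1) k(1) k2(2) k(3), of y] restrict_const_loop(2)[OF pk(1,3) k(3), of "(conjug h m, n)"]
      unfolding k2(3) by simp
    note Q = const_loop_arr_pointwise[OF h'(1) n(1) n' k(1) this]
    show ?thesis
      unfolding level_structure
    proof (rule arr_class_eq[OF k1(4) k(1) ki], rule restrict_loop_arr_eqI[OF k(1) k1(4) ki P(1)])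
      show "restrict_loop i k (snd (snd y)) = const_loop k (conjug h (gmul G m n))" unfolding Q(2) cm ..
      fix r assume r: "r \<in> Sar k"
      have "gmul G (gmul G m n) (gpow (conjug h (gmul G m n)) (snd r)) = gmul G (gpow h (snd r)) (gmul G m n)"
        by (rule gpow_conjug[OF a(1) mn])
      then show "gmul G (gmul G (fst (snd x) (gid (circle_groupoid i) (gsrc (circle_groupoid i) (refine_arr i r))))
          (fst (snd y) (gid (circle_groupoid i) (gsrc (circle_groupoid i) (refine_arr i r)))))
          (snd (snd (snd y)) (refine_arr i r)) = gmul G (gpow h (snd r)) (gmul G m n)"
        by (simp only: P(5)[OF r] Q(5)[OF r] Q(4)[OF r] cm)
    qed
  qed
  have i: "inertia_arr (h, m)" "inertia_arr (conjug h m, n)" using a n n' h' by (simp_all add: inertia_arr_def)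
  note x0 = const_loop_arr_in_const1[OF i(1) W0(1)] and y0 = const_loop_arr_in_const1[OF i(2) W0(1)]
  show ?thesis
    unfolding FL_structure
  proof (rule the_equality)
    have "snd (snd (const_loop_arr W0 (h, m))) = fst (const_loop_arr W0 (conjug h m, n))" by (simp add: const_loop_arr_def)
    then show "\<exists>i x y. (i, x) \<in> const1 (h, m) \<and> (i, y) \<in> const1 (conjug h m, n) \<and> snd (snd x) = fst y \<and>
        const1 (h, gmul G m n) = arr_class (i, gmul (LL i) x y)"
      using x0 y0 val[OF x0 y0, symmetric] by (intro exI conjI)
  qed (use val in blast)
qed

lemma inertia_iso_fixed_loops: "gpd_iso (inertia G) FL const0 const1 loop_holonomy arr_holonomy"
proof (rule gpd_iso.intro)
  show "topgpd (inertia G)" using inertia_groupoid by (rule topgpd.intro)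
  show "gpd_iso_axioms (inertia G) FL const0 const1 loop_holonomy arr_holonomy"
  proof
    show "homeomorphic_maps (gobj (inertia G)) (gobj FL) const0 loop_holonomy"
      unfolding homeomorphic_maps_def topspace_inertia topspace_FL_obj
      using continuous_const0 continuous_loop_holonomy by (auto simp: loop_holonomy_const0)
    show "homeomorphic_maps (garr (inertia G)) (garr FL) const1 arr_holonomy"
      unfolding homeomorphic_maps_def topspace_FL_arr
      using continuous_const1 continuous_arr_holonomy by (auto simp only: topspace_inertia arr_holonomy_const1 mem_Collect_eq)
  next
    fix a assume "a \<in> topspace (garr (inertia G))"
    then have "inertia_arr a" by (simp only: topspace_inertia)
    moreover obtain h m where a: "a = (h, m)" by (cases a)
    ultimately have hm: "h \<in> loops" "m \<in> topspace (garr G)" "gsrc G m = gsrc G h" by (simp_all add: inertia_arr_def)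
    show "gsrc FL (const1 a) = const0 (gsrc (inertia G) a)" by (simp add: a FL_src_const1[OF hm])
    show "gtgt FL (const1 a) = const0 (gtgt (inertia G) a)" by (simp add: a FL_src_const1[OF hm] conjug_def)
    show "ginv FL (const1 a) = const1 (ginv (inertia G) a)" by (simp add: a FL_src_const1[OF hm] conjug_def)
    fix b assume "b \<in> topspace (garr (inertia G))" and c: "gtgt (inertia G) a = gsrc (inertia G) b"
    then have "inertia_arr b" by (simp only: topspace_inertia)
    moreover obtain h' n where b: "b = (h', n)" by (cases b)
    ultimately have n: "h' \<in> loops" "n \<in> topspace (garr G)" "gsrc G n = gsrc G h'" by (simp_all add: inertia_arr_def)
    have h': "h' = conjug h m" using c by (simp add: a b conjug_def)
    have "gsrc G n = gtgt G m" using n(3) conjug_loop(2)[OF hm] by (simp add: h')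
    from FL_mul_const1[OF hm n(2) this] show "gmul FL (const1 a) (const1 b) = const1 (gmul (inertia G) a b)"
      by (simp add: a b h')
  next
    fix x assume "x \<in> topspace (gobj (inertia G))"
    then have "x \<in> loops" by (simp only: topspace_inertia)
    from FL_id_const0[OF this] show "gid FL (const0 x) = const1 (gid (inertia G) x)" by simp
  qed
qed

end

theorem corollary3p6p7:
  fixes G :: "('o, 'a) tgroupoid"
    and A0 :: "('o, 'm::real_normed_vector) atlas" and A1 :: "('a, 'm) atlas"
    and X :: "'x topology" and C :: "'x \<Rightarrow> ('x, 'e::real_normed_vector, 'g) ochart"
    and R :: "'x \<Rightarrow> 'g set"
  assumes "smooth_etale_groupoid G A0 A1"
    and "proper_groupoid G"
    and "orbifold X C"
    and "morita_equivalent TYPE('k0) TYPE('k1) G (orbifold_groupoid X C)"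
    and "\<And>p. p \<in> topspace X \<Longrightarrow> conj_reps (cgrp (C p)) (R p)"
  shows "morita_equivalent
           TYPE('k1 \<times> (('x, 'e, 'g) orb_arr \<times> ('x, 'e, 'g) orb_arr) \<times> ('x, 'e, 'g) sector_obj)
           TYPE(('k1 \<times> 'k1) \<times> (('x, 'e, 'g) orb_arr \<times> ('x, 'e, 'g) orb_arr) \<times> ('x, 'e, 'g) sector_arr)
           (fixed_loop_groupoid G) (sector_groupoid X C R)"
proof -
  from assms(4) obtain K :: "('k0, 'k1) tgroupoid" and \<Phi>0 \<Phi>1 \<Psi>0 \<Psi>1
    where G: "topological_groupoid G" and XX: "topological_groupoid (orbifold_groupoid X C)"
      and K: "topological_groupoid K" and \<Phi>: "morita_morphism K G \<Phi>0 \<Phi>1"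
      and \<Psi>: "morita_morphism K (orbifold_groupoid X C) \<Psi>0 \<Psi>1"
    unfolding morita_equivalent_def by blast
  interpret S: sectors X C R
    using assms(3,5) XX by (auto intro!: sectors.intro orbifold_gpd.intro sectors_axioms.intro)
  interpret T: topgpd G by (rule topgpd.intro[OF G])
  note iso = T.inertia_iso_fixed_loops
  note kg = inertia_morita[OF morita_homI[OF K G \<Phi>]]
  note kx = inertia_morita[OF morita_homI[OF K XX \<Psi>]]
  \<comment> \<open>The left projection continues through \<open>inertia K\<close> and
    \<open>inertia G\<close> to the fixed loop groupoid, and the right projection ends at the
    twisted sectors. An object consists of an automorphism in \<open>K\<close>, an arrow of the
    inertia groupoid of the orbifold groupoid and a sector point, which accounts for the types in
    the conclusion.\<close>
  interpret P: weak_pullback "inertia K" "inertia (orbifold_groupoid X C)" "sector_groupoid X C R"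
    \<Psi>1 "\<lambda>a. (\<Psi>1 (fst a), \<Psi>1 (snd a))" S.auto_arr "\<lambda>a. (S.auto_arr (gsrc (sector_groupoid X C R) a), fst (snd a))"
    by (rule weak_pullback.intro[OF kx S.sector_to_inertia_morita])
  note l = morita_compose_iso[OF morita_compose[OF P.wpb_left kg] iso]
  show ?thesis
    unfolding morita_equivalent_def
    using morita_homD[OF l] morita_homD[OF P.wpb_right] by blast
qed

end
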